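(* Let $n\ge 3$ and $m=\frac{n-2}{n+2}$. There is a universal constant $\kappa=\kappa(n)\in\mathbb{R}$, depending only on $n$, such that the following holds. Let $\beta>0$, $\gamma=\frac{2\beta}{1-m}$ and $K\in\mathbb{R}$. Assume that $g(t)=u(\cdot,t)^{1-m}\,\delta_{ij}$ is a solution of the Yamabe flow $\frac{\partial g}{\partial t}=-R\,g$ on $\mathbb{R}^n$, $t\ge 0$, with nonnegative initial data $u_0\in L^1_{loc}(\mathbb{R}^n)$ which has a decomposition $u_0=\phi+\psi$ with $\psi\in L^1(\mathbb{R}^n)$ and $$\phi^{1-m}(x)=\frac{1}{r^2}\,\frac{(n-2)(n-1)}{\beta}\bigl(\ln r+K+o(1)\bigr),\qquad r=|x|\to\infty.$$ Then the rescaled solution $\bar u(x,t):=e^{\gamma t}u(e^{\beta t}x,t)$ converges, as $t\to+\infty$, to $u_{\beta,\lambda}$ in $L^1_{loc}(\mathbb{R}^n)$ for some $\lambda>0$. Moreover, the number $\lambda$ is uniquely determined by $K$ through $$K=\frac{2\ln\lambda}{n+2}+\frac{\ln\beta}{2}+\kappa(n).$$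
   Context: Here $\delta_{ij}$ is the Euclidean metric on $\mathbb{R}^n$, $1-m=\frac{4}{n+2}$, and $R$ is the scalar curvature of $g$. For the conformally flat metric $g=u^{1-m}\delta_{ij}$ the Yamabe flow is equivalent to the fast diffusion equation $u_t=\frac{n-1}{m}\Delta u^m$ on $\mathbb{R}^n$; for $L^1_{loc}$ initial data, "solution of the Yamabe flow with initial data $u_0$" means that $u\ge 0$ solves this equation with $u(\cdot,0)=u_0$, in the standard sense of the theory of the Cauchy problem for the fast diffusion equation. For $\beta>0$, $\lambda>0$, $u_{\beta,\lambda}$ (a Yamabe steady soliton) denotes the unique smooth positive radially symmetric solution on $\mathbb{R}^n$ of the elliptic equation $\frac{n-1}{m}\Delta u^m+\beta\,x\cdot\nabla u+\gamma u=0$, with $\gamma=\frac{2\beta}{1-m}$, satisfying $u_{\beta,\lambda}(0)=\lambda$. *)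

theory Defs
  imports "HOL-Analysis.Analysis"
begin

definition locally_integrable_on :: "('a::euclidean_space \<Rightarrow> real) \<Rightarrow> 'a set \<Rightarrow> bool"
    (infixr "locally'_integrable'_on" 46) where
  "f locally_integrable_on S \<longleftrightarrow>
     (\<forall>C. compact C \<and> C \<subseteq> S \<longrightarrow> f absolutely_integrable_on C)"

text \<open>Convergence in \<open>L\<^sup>1\<^sub>l\<^sub>o\<^sub>c\<close>. Local integrability is part of the notion because a
  Bochner integral of a non-integrable function is \<open>0\<close> by convention.\<close>

definition L1loc_tendsto ::
    "('b \<Rightarrow> 'a::euclidean_space \<Rightarrow> real) \<Rightarrow> ('a \<Rightarrow> real) \<Rightarrow> 'b filter \<Rightarrow> bool" where
  "L1loc_tendsto f l F \<longleftrightarrow>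
     l locally_integrable_on UNIV \<and>
     (\<forall>\<^sub>F s in F. f s locally_integrable_on UNIV) \<and>
     (\<forall>C. compact C \<longrightarrow> ((\<lambda>s. LINT x:C|lebesgue. \<bar>f s x - l x\<bar>) \<longlongrightarrow> 0) F)"

definition partial_deriv :: "'a::euclidean_space \<Rightarrow> ('a \<Rightarrow> real) \<Rightarrow> 'a \<Rightarrow> real" where
  "partial_deriv b f x = frechet_derivative f (at x) b"

primrec Ck :: "nat \<Rightarrow> ('a::euclidean_space \<Rightarrow> real) \<Rightarrow> bool" where
  "Ck 0 f \<longleftrightarrow> continuous_on UNIV f"
| "Ck (Suc k) f \<longleftrightarrow> (\<forall>x. f differentiable (at x)) \<and> (\<forall>b\<in>Basis. Ck k (partial_deriv b f))"

definition smooth :: "('a::euclidean_space \<Rightarrow> real) \<Rightarrow> bool" where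
  "smooth f \<longleftrightarrow> (\<forall>k. Ck k f)"

definition laplacian :: "('a::euclidean_space \<Rightarrow> real) \<Rightarrow> 'a \<Rightarrow> real" where
  "laplacian f x = (\<Sum>b\<in>Basis. partial_deriv b (partial_deriv b f) x)"

definition test_function :: "'a::euclidean_space set \<Rightarrow> ('a \<Rightarrow> real) \<Rightarrow> bool" where
  "test_function S \<eta> \<longleftrightarrow>
     smooth \<eta> \<and> compact (closure {p. \<eta> p \<noteq> 0}) \<and> closure {p. \<eta> p \<noteq> 0} \<subseteq> S"

abbreviation space_time :: "((real^'n) \<times> real) set" where
  "space_time \<equiv> UNIV \<times> {0<..}"

definition weak_time_deriv ::
    "(real^'n \<Rightarrow> real \<Rightarrow> real) \<Rightarrow> (real^'n \<Rightarrow> real \<Rightarrow> real) \<Rightarrow> bool" where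
  "weak_time_deriv u w \<longleftrightarrow>
     (\<forall>\<eta>. test_function space_time \<eta> \<longrightarrow>
        integral\<^sup>L lebesgue (\<lambda>(x, t). u x t * deriv (\<lambda>s. \<eta> (x, s)) t) =
        - integral\<^sup>L lebesgue (\<lambda>(x, t). w x t * \<eta> (x, t)))"

text \<open>Solutions \<open>u \<ge> 0\<close> of \<open>u\<^sub>t = (n - 1)/m \<Delta>u\<^sup>m\<close> on \<open>\<real>\<^sup>n \<times> (0,\<infinity>)\<close> with
  \<open>u(\<cdot>,0) = u\<^sub>0 \<in> L\<^sup>1\<^sub>l\<^sub>o\<^sub>c\<close>, in the sense of the Herrero--Pierre theory:
  \<open>u \<in> C([0,\<infinity>); L\<^sup>1\<^sub>l\<^sub>o\<^sub>c)\<close> satisfies the equation in the sense of distributions and is a strong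
  solution, \<open>u\<^sub>t \<in> L\<^sup>1\<^sub>l\<^sub>o\<^sub>c(\<real>\<^sup>n \<times> (0,\<infinity>))\<close>. The last condition is the one under which that theory
  proves uniqueness and comparison; it is satisfied by classical solutions and by the solutions
  constructed there for arbitrary nonnegative \<open>L\<^sup>1\<^sub>l\<^sub>o\<^sub>c\<close> data.\<close>

definition fast_diffusion_solution ::
    "real \<Rightarrow> (real^'n \<Rightarrow> real \<Rightarrow> real) \<Rightarrow> (real^'n \<Rightarrow> real) \<Rightarrow> bool" where
  "fast_diffusion_solution m u u\<^sub>0 \<longleftrightarrow>
     (\<forall>t\<ge>0. AE x in lebesgue. 0 \<le> u x t) \<and>
     (\<forall>t\<ge>0. L1loc_tendsto (\<lambda>s x. u x s) (\<lambda>x. u x t) (at t within {0..})) \<and>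
     (AE x in lebesgue. u x 0 = u\<^sub>0 x) \<and>
     (\<lambda>(x, t). u x t) locally_integrable_on space_time \<and>
     (\<forall>\<eta>. test_function space_time \<eta> \<longrightarrow>
        integral\<^sup>L lebesgue (\<lambda>(x, t). u x t * deriv (\<lambda>s. \<eta> (x, s)) t
          + (real CARD('n) - 1) / m * (u x t powr m) * laplacian (\<lambda>y. \<eta> (y, t)) x) = 0) \<and>
     (\<exists>w. (\<lambda>(x, t). w x t) locally_integrable_on space_time \<and> weak_time_deriv u w)"

text \<open>For \<open>m = (n - 2)/(n + 2)\<close> the metric \<open>g(t) = u(\<cdot>,t)\<^bsup>1-m\<^esup> \<delta>\<^sub>i\<^sub>j\<close> solves
  \<open>\<partial>g/\<partial>t = -R g\<close> iff \<open>u\<close> solves the fast diffusion equation; for \<open>L\<^sup>1\<^sub>l\<^sub>o\<^sub>c\<close> initial data the flow is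
  understood through this equation.\<close>

abbreviation yamabe_exponent :: "nat \<Rightarrow> real" where
  "yamabe_exponent n \<equiv> (real n - 2) / (real n + 2)"

definition yamabe_flow_solution ::
    "(real^'n \<Rightarrow> real \<Rightarrow> real) \<Rightarrow> (real^'n \<Rightarrow> real) \<Rightarrow> bool" where
  "yamabe_flow_solution u u\<^sub>0 \<longleftrightarrow> fast_diffusion_solution (yamabe_exponent CARD('n)) u u\<^sub>0"

definition steady_soliton_profile :: "real \<Rightarrow> real \<Rightarrow> (real^'n \<Rightarrow> real) \<Rightarrow> bool" where
  "steady_soliton_profile \<beta> lam U \<longleftrightarrow>
     (let n = real CARD('n); m = yamabe_exponent CARD('n); \<gamma> = 2 * \<beta> / (1 - m) in
       smooth U \<and> (\<forall>x. U x > 0) \<and> (\<forall>x y. norm x = norm y \<longrightarrow> U x = U y) \<and>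
       (\<forall>x. (n - 1) / m * laplacian (\<lambda>y. U y powr m) x
              + \<beta> * (\<Sum>b\<in>Basis. (x \<bullet> b) * partial_deriv b U x) + \<gamma> * U x = 0) \<and>
       U 0 = lam)"

text \<open>The Yamabe steady soliton \<open>u\<^sub>\<beta>\<^sub>,\<^sub>\<lambda>\<close>; meaningful for \<open>n \<ge> 3\<close> and \<open>\<beta>, \<lambda> > 0\<close>, where exactly
  one profile exists.\<close>

definition steady_soliton :: "real \<Rightarrow> real \<Rightarrow> real^'n \<Rightarrow> real" where
  "steady_soliton \<beta> lam = (THE U. steady_soliton_profile \<beta> lam U)"

end

theory Submission
  imports Defs
begin

text \<open>For the soliton \<open>U\<^sub>\<mu>\<close> the travelling wave \<open>v\<^sub>\<mu>(x, t) = e\<^sup>-\<^sup>\<gamma>\<^sup>t U\<^sub>\<mu>(e\<^sup>-\<^sup>\<beta>\<^sup>t x)\<close> is a classical solution of the fast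
  diffusion equation, and \<open>U\<^sub>\<mu>\<^bsup>1-m\<^esup>\<close> has the expansion required of \<open>\<phi>\<^bsup>1-m\<^esup>\<close>, with a constant that increases strictly
  in \<open>\<mu>\<close>. If \<open>\<lambda>\<close> has the constant \<open>K\<close> and \<open>\<mu>\<^sub>1 < \<lambda> < \<mu>\<^sub>2\<close>, then \<open>U\<^bsub>\<mu>\<^sub>1\<^esub> \<le> \<phi> \<le> U\<^bsub>\<mu>\<^sub>2\<^esub>\<close> near infinity, so that
  \<open>(u\<^sub>0 - U\<^bsub>\<mu>\<^sub>2\<^esub>)\<^sub>+\<close> and \<open>(U\<^bsub>\<mu>\<^sub>1\<^esub> - u\<^sub>0)\<^sub>+\<close> are integrable. Up to a factor depending only on \<open>n\<close>, the \<open>L\<^sup>1\<close> norm of the positive part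
  of the difference of two solutions does not grow. The rescaling multiplies it by \<open>e\<^bsup>(\<gamma> - n \<beta>) t\<^esup>\<close>, which decays since
  \<open>\<gamma> - n \<beta> = - \<beta> (n - 2) / 2\<close>. In the limit the rescaled solution lies between \<open>U\<^bsub>\<mu>\<^sub>1\<^esub>\<close> and \<open>U\<^bsub>\<mu>\<^sub>2\<^esub>\<close>, and
  \<open>\<mu>\<^sub>1, \<mu>\<^sub>2\<close> are arbitrarily close to \<open>\<lambda>\<close>.

  The contraction estimate needs Kato's inequality for strong solutions. It is tested first with a power cut-off
  (Herrero--Pierre), which gives growth like \<open>R\<^sup>n\<^sup>-\<^sup>2\<close> for the mass in a ball, and then with the superharmonic function
  \<open>(\<bar>x\<bar>\<^sup>2 + a)\<^bsup>-(n-2)/2\<^esup>\<close>, whose decay absorbs this growth.\<close>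

section \<open>Functions of class \<open>C\<^sup>k\<close>\<close>

text \<open>The solitons decay like the power (n+2)/4 of ln r / r^2, too slowly to be integrable, so
  only positive parts of differences can be measured in L^1. As m < (n-2)/n, the error bound of an
  ordinary cut-off of radius R grows with R, which forces the second, weighted test. The weight is
  tuned to the ball in question so that the resulting constant does not depend on its radius; this
  is indispensable, because the rescaling evaluates the estimate on balls of radius e^(\<beta> t) r.
  All solitons are scalings \<lambda> F(\<beta> \<lambda>^(1-m) |x|^2) of a single profile. In
  Emden-Fowler variables this profile gives w(s) = (n-1)(n-2) s + l + o(1), where exp(2 s) is the
  argument of F; hence the terms ln \<beta> / 2 and 2 ln \<lambda> / (n+2), and \<kappa> = l /
  ((n-1)(n-2)). The existence of l comes from a monotone quantity. The radial equation is singular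
  at the origin; written in |x|^2 and integrated once over balls it becomes an integral equation
  with a bounded averaging operator, solved globally by a contraction.\<close>

text \<open>One-sided derivatives at boundary points of \<open>S\<close> are allowed; this makes
  \<open>x \<mapsto> f \<bar>x\<bar>\<^sup>2\<close> smooth at the origin for \<open>f\<close> given only on \<open>[0, \<infinity>)\<close>.\<close>

primrec Ck_on :: "nat \<Rightarrow> real set \<Rightarrow> (real \<Rightarrow> real) \<Rightarrow> bool" where
  "Ck_on 0 S f \<longleftrightarrow> continuous_on S f"
| "Ck_on (Suc k) S f \<longleftrightarrow>
     (\<exists>f'. (\<forall>x\<in>S. (f has_real_derivative f' x) (at x within S)) \<and> Ck_on k S f')"

lemma Ck_on_SucI:
  "(\<And>x. x \<in> S \<Longrightarrow> (f has_real_derivative f' x) (at x within S)) \<Longrightarrow> Ck_on k S f' \<Longrightarrow> Ck_on (Suc k) S f"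
  by auto

lemma Ck_on_Suc_imp: "Ck_on (Suc k) S f \<Longrightarrow> Ck_on k S f"
proof (induction k arbitrary: f)
  case 0
  then obtain f' where "\<forall>x\<in>S. (f has_real_derivative f' x) (at x within S)" by auto
  then show ?case by (auto intro!: DERIV_continuous_on)
next
  case (Suc k)
  then obtain f' where f': "\<forall>x\<in>S. (f has_real_derivative f' x) (at x within S)"
    "Ck_on (Suc k) S f'" by auto
  from Suc.IH[OF f'(2)] f'(1) show ?case by auto
qed

lemma Ck_on_cong: "Ck_on k S f \<Longrightarrow> (\<And>x. x \<in> S \<Longrightarrow> f x = g x) \<Longrightarrow> Ck_on k S g"
proof (cases k)
  case 0
  assume "Ck_on k S f" "\<And>x. x \<in> S \<Longrightarrow> f x = g x"
  then show ?thesis using 0 by (simp cong: continuous_on_cong)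
next
  case (Suc l)
  assume "Ck_on k S f" and eq: "\<And>x. x \<in> S \<Longrightarrow> f x = g x"
  then obtain f' where f': "\<forall>x\<in>S. (f has_real_derivative f' x) (at x within S)" "Ck_on l S f'"
    using Suc by auto
  have "(g has_real_derivative f' x) (at x within S)" if "x \<in> S" for x
    by (rule has_field_derivative_transform_within[where d = 1 and f = f]) (use f'(1) that eq in auto)
  then show ?thesis using f'(2) Suc by auto
qed

lemma Ck_on_const [simp]: "Ck_on k S (\<lambda>x. c)"
proof (induction k arbitrary: c)
  case (Suc k)
  show ?case by (rule Ck_on_SucI[OF _ Suc[of 0]]) simp
qed simp

lemma Ck_on_ident [simp]: "Ck_on k S (\<lambda>x. x)"
proof (cases k)
  case (Suc l)
  show ?thesis unfolding Suc by (rule Ck_on_SucI[OF _ Ck_on_const[of _ _ 1]]) simp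
qed simp

lemma Ck_on_add: "Ck_on k S f \<Longrightarrow> Ck_on k S g \<Longrightarrow> Ck_on k S (\<lambda>x. f x + g x)"
proof (induction k arbitrary: f g)
  case 0
  then show ?case by (auto intro: continuous_on_add)
next
  case (Suc k)
  then obtain f' g' where "\<forall>x\<in>S. (f has_real_derivative f' x) (at x within S)" "Ck_on k S f'"
    "\<forall>x\<in>S. (g has_real_derivative g' x) (at x within S)" "Ck_on k S g'" by auto
  then show ?case using Suc.IH
    by (auto intro!: exI[of _ "\<lambda>x. f' x + g' x"] DERIV_add)
qed

lemma Ck_on_mult: "Ck_on k S f \<Longrightarrow> Ck_on k S g \<Longrightarrow> Ck_on k S (\<lambda>x. f x * g x)"
proof (induction k arbitrary: f g)
  case 0
  then show ?case by (auto intro: continuous_on_mult)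
next
  case (Suc k)
  then obtain f' g' where *: "\<forall>x\<in>S. (f has_real_derivative f' x) (at x within S)" "Ck_on k S f'"
    "\<forall>x\<in>S. (g has_real_derivative g' x) (at x within S)" "Ck_on k S g'" by auto
  have "Ck_on k S (\<lambda>x. f' x * g x + g' x * f x)"
    using Suc.IH * Ck_on_Suc_imp[OF Suc.prems(1)] Ck_on_Suc_imp[OF Suc.prems(2)]
    by (intro Ck_on_add) auto
  then show ?case using * by (auto intro!: exI[of _ "\<lambda>x. f' x * g x + g' x * f x"] DERIV_mult)
qed

lemma Ck_on_cmult: "Ck_on k S f \<Longrightarrow> Ck_on k S (\<lambda>x. c * f x)"
  by (rule Ck_on_mult) auto

lemma Ck_on_diff: "Ck_on k S f \<Longrightarrow> Ck_on k S g \<Longrightarrow> Ck_on k S (\<lambda>x. f x - g x)"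
  using Ck_on_add[of k S f "\<lambda>x. (-1) * g x"] Ck_on_cmult[of k S g "-1"] by simp

lemma Ck_on_compose:
  "Ck_on k T F \<Longrightarrow> Ck_on k S f \<Longrightarrow> f ` S \<subseteq> T \<Longrightarrow> Ck_on k S (\<lambda>x. F (f x))"
proof (induction k arbitrary: F f)
  case 0
  then show ?case by (auto intro: continuous_on_compose2)
next
  case (Suc k)
  then obtain F' f' where *: "\<forall>x\<in>T. (F has_real_derivative F' x) (at x within T)" "Ck_on k T F'"
    "\<forall>x\<in>S. (f has_real_derivative f' x) (at x within S)" "Ck_on k S f'" by auto
  have d: "((\<lambda>x. F (f x)) has_real_derivative F' (f x) * f' x) (at x within S)" if "x \<in> S" for x
  proof -
    have "(F has_real_derivative F' (f x)) (at (f x) within f ` S)"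
      using * that Suc.prems(3) by (meson DERIV_subset image_subset_iff)
    from DERIV_image_chain[OF this] * that show ?thesis by (auto simp: o_def)
  qed
  have "Ck_on k S (\<lambda>x. F' (f x))"
    using Suc.IH[OF *(2) Ck_on_Suc_imp[OF Suc.prems(2)] Suc.prems(3)] .
  then have "Ck_on k S (\<lambda>x. F' (f x) * f' x)" using * by (intro Ck_on_mult)
  with d show ?case by (rule Ck_on_SucI)
qed

lemma Ck_on_exp: "Ck_on k S exp"
proof (induction k)
  case (Suc k)
  then show ?case by (auto intro!: exI[of _ exp] DERIV_exp intro: DERIV_subset)
qed (auto intro: continuous_on_exp continuous_on_id)

lemma Ck_on_powr: "Ck_on k {0<..} (\<lambda>x. x powr a)"
proof (induction k arbitrary: a)
  case 0
  show ?case by (auto intro!: continuous_intros)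
next
  case (Suc k)
  have "\<forall>x\<in>{0<..}. ((\<lambda>x. x powr a) has_real_derivative a * x powr (a - 1)) (at x within {0<..})"
    by (auto intro!: has_real_derivative_powr DERIV_subset[OF has_real_derivative_powr])
  then show ?case using Suc[of "a - 1"] Ck_on_cmult by (auto intro!: exI[of _ "\<lambda>x. a * x powr (a - 1)"])
qed

section \<open>Partial derivatives and class C^k in several variables\<close>

lemma partial_deriv_eq: "(f has_derivative D) (at x) \<Longrightarrow> partial_deriv b f x = D b"
  by (metis frechet_derivative_at partial_deriv_def)

lemma partial_deriv_has_derivative:
  "f differentiable (at x) \<Longrightarrow> (f has_derivative (\<lambda>b. partial_deriv b f x)) (at x)"
  unfolding partial_deriv_def by (simp add: frechet_derivative_works)

lemma Ck_Suc_imp: "Ck (Suc k) f \<Longrightarrow> Ck k f"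
proof (induction k arbitrary: f)
  case 0
  then show ?case
    by (auto simp: continuous_on_eq_continuous_at intro: differentiable_imp_continuous_within)
qed simp

lemma Ck_le: "Ck k f \<Longrightarrow> l \<le> k \<Longrightarrow> Ck l f"
  by (induction k) (auto simp del: Ck.simps dest: Ck_Suc_imp simp: le_Suc_eq)

lemma Ck_imp_continuous: "Ck k f \<Longrightarrow> continuous_on UNIV f"
  using Ck_le[of k f 0] by simp

lemma Ck_const [simp]: "Ck k (\<lambda>x. c)"
proof (induction k arbitrary: c)
  case (Suc k)
  have "partial_deriv b (\<lambda>x::'a. c) = (\<lambda>x. 0)" for b
    using partial_deriv_eq[OF has_derivative_const[of c]] by blast
  with Suc show ?case by simp
qed simp

lemma Ck_bounded_linear: "bounded_linear f \<Longrightarrow> Ck k f"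
proof (cases k)
  case 0
  assume "bounded_linear f" then show ?thesis using 0
    by (simp add: linear_continuous_on)
next
  case (Suc l)
  assume *: "bounded_linear f"
  then have d: "(f has_derivative f) (at x)" for x by (simp add: bounded_linear_imp_has_derivative)
  then have "partial_deriv b f = (\<lambda>x. f b)" for b using partial_deriv_eq[OF d] by blast
  with d show ?thesis using Suc by (auto simp: differentiable_def)
qed

lemma Ck_add: "Ck k f \<Longrightarrow> Ck k g \<Longrightarrow> Ck k (\<lambda>x. f x + g x)"
proof (induction k arbitrary: f g)
  case 0
  then show ?case by (auto intro: continuous_on_add)
next
  case (Suc k)
  have "partial_deriv b (\<lambda>x. f x + g x) = (\<lambda>x. partial_deriv b f x + partial_deriv b g x)" for b
    using Suc.prems partial_deriv_eq[OF has_derivative_add[OF partial_deriv_has_derivative partial_deriv_has_derivative], of f _ g]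
    by auto
  with Suc show ?case by auto
qed

lemma partial_deriv_mult:
  "f differentiable (at x) \<Longrightarrow> g differentiable (at x) \<Longrightarrow>
    partial_deriv b (\<lambda>x. f x * g x) x = f x * partial_deriv b g x + partial_deriv b f x * g x"
  using has_derivative_mult[OF partial_deriv_has_derivative partial_deriv_has_derivative, of f x g]
  by (simp add: partial_deriv_eq)

lemma Ck_mult: "Ck k f \<Longrightarrow> Ck k g \<Longrightarrow> Ck k (\<lambda>x. f x * g x)"
proof (induction k arbitrary: f g)
  case 0
  then show ?case by (auto intro: continuous_on_mult)
next
  case (Suc k)
  have "partial_deriv b (\<lambda>x. f x * g x) =
      (\<lambda>x. f x * partial_deriv b g x + partial_deriv b f x * g x)" for b
    using Suc.prems by (auto simp: partial_deriv_mult)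
  moreover have "Ck k (\<lambda>x. f x * partial_deriv b g x + partial_deriv b f x * g x)"
    if "b \<in> Basis" for b
    using that Suc.prems Ck_Suc_imp[OF Suc.prems(1)] Ck_Suc_imp[OF Suc.prems(2)]
    by (intro Ck_add Suc.IH) auto
  ultimately show ?case using Suc.prems by auto
qed

lemma Ck_diff: "Ck k f \<Longrightarrow> Ck k g \<Longrightarrow> Ck k (\<lambda>x. f x - g x)"
  using Ck_add[of k f "\<lambda>x. (-1) * g x"] Ck_mult[of k "\<lambda>x. -1" g] by simp

lemma Ck_sum: "(\<And>i. i \<in> I \<Longrightarrow> Ck k (f i)) \<Longrightarrow> Ck k (\<lambda>x. \<Sum>i\<in>I. f i x)"
  by (induction I rule: infinite_finite_induct) (auto intro: Ck_add)

text \<open>A one-sided derivative of \<open>f\<close> is enough, because all values of \<phi> lie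
  in S and the chain rule never leaves S. With \<phi> x = |x|^2 this gives differentiability at the
  origin for a profile known on [0, \<infinity>) only.\<close>

lemma has_derivative_compose_real_within:
  fixes \<phi> :: "'a::real_normed_vector \<Rightarrow> real"
  assumes "(f has_real_derivative d) (at (\<phi> x) within S)" "\<And>x. \<phi> x \<in> S"
    and "(\<phi> has_derivative D) (at x)"
  shows "((\<lambda>x. f (\<phi> x)) has_derivative (\<lambda>h. d * D h)) (at x)"
proof -
  have "(f has_derivative (\<lambda>x. d * x)) (at (\<phi> x) within range \<phi>)"
    using assms(1,2) by (metis DERIV_subset has_field_derivative_def image_subsetI)
  from has_derivative_in_compose[OF assms(3) this] show ?thesis .
qed

lemma Ck_compose:
  "Ck_on k S f \<Longrightarrow> Ck k \<phi> \<Longrightarrow> (\<And>x. \<phi> x \<in> S) \<Longrightarrow> Ck k (\<lambda>x. f (\<phi> x))"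
proof (induction k arbitrary: f)
  case 0
  then show ?case by (auto intro: continuous_on_compose2)
next
  case (Suc k)
  then obtain f' where f': "\<forall>x\<in>S. (f has_real_derivative f' x) (at x within S)" "Ck_on k S f'"
    by auto
  have d: "((\<lambda>x. f (\<phi> x)) has_derivative (\<lambda>b. f' (\<phi> x) * partial_deriv b \<phi> x)) (at x)" for x
    using f' Suc.prems by (intro has_derivative_compose_real_within[where S = S])
      (auto intro: partial_deriv_has_derivative)
  then have "partial_deriv b (\<lambda>x. f (\<phi> x)) = (\<lambda>x. f' (\<phi> x) * partial_deriv b \<phi> x)" for b
    using partial_deriv_eq[OF d] by blast
  moreover have "Ck k (\<lambda>x. f' (\<phi> x) * partial_deriv b \<phi> x)" if "b \<in> Basis" for b
    using Suc.IH[OF f'(2) Ck_Suc_imp[OF Suc.prems(2)] Suc.prems(3)] that Suc.prems(2)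
    by (intro Ck_mult) auto
  ultimately show ?case using d by (auto simp: differentiable_def)
qed

lemma Ck_inner_self: "Ck k (\<lambda>x. (x - p) \<bullet> (x - p))"
proof -
  have *: "Ck k (\<lambda>x. x \<bullet> b - p \<bullet> b)" for b
    by (intro Ck_diff Ck_bounded_linear bounded_linear_inner_left Ck_const)
  have "(\<lambda>x. (x - p) \<bullet> (x - p)) = (\<lambda>x. \<Sum>b\<in>Basis. (x \<bullet> b - p \<bullet> b) * (x \<bullet> b - p \<bullet> b))"
    by (subst euclidean_inner) (simp add: inner_diff_left)
  then show ?thesis using * by (auto intro!: Ck_sum Ck_mult)
qed

section \<open>Difference quotients along coordinate directions\<close>

lemma has_real_derivative_line:
  assumes "f differentiable (at (x + s *\<^sub>R b))"
  shows "((\<lambda>s. f (x + s *\<^sub>R b)) has_real_derivative partial_deriv b f (x + s *\<^sub>R b)) (at s)"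
proof -
  have "((\<lambda>s. x + s *\<^sub>R b) has_derivative (\<lambda>h. h *\<^sub>R b)) (at s)"
    by (auto intro!: derivative_eq_intros)
  from has_derivative_compose[OF this partial_deriv_has_derivative[OF assms]]
  have *: "((\<lambda>s. f (x + s *\<^sub>R b)) has_derivative (\<lambda>h. partial_deriv (h *\<^sub>R b) f (x + s *\<^sub>R b))) (at s)" .
  have "partial_deriv (h *\<^sub>R b) f (x + s *\<^sub>R b) = partial_deriv b f (x + s *\<^sub>R b) * h" for h
    using linear_cmul[OF has_derivative_linear[OF partial_deriv_has_derivative[OF assms]], of h b]
    by (simp add: mult.commute)
  with * show ?thesis by (simp add: has_field_derivative_def)
qed

lemma first_difference:
  assumes "Ck 1 f" "b \<in> Basis" "h > 0"
  shows "\<exists>\<xi>. \<bar>\<xi>\<bar> < h \<and> f (x + h *\<^sub>R b) - f x = h * partial_deriv b f (x + \<xi> *\<^sub>R b)"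
proof -
  have "f differentiable (at y)" for y using assms(1) by (simp add: One_nat_def)
  then have "\<exists>z>0. z < h \<and> f (x + h *\<^sub>R b) - f (x + 0 *\<^sub>R b) =
      (h - 0) * partial_deriv b f (x + z *\<^sub>R b)"
    by (intro MVT2 assms has_real_derivative_line)
  then show ?thesis by force
qed

text \<open>Cauchy's mean value theorem compares the symmetric sum of \<open>f\<close> with s^2. At
  the point c so found the quotient is a first difference of the partial derivative over [-c, c],
  and the ordinary mean value theorem finishes. Two derivatives suffice; no Taylor remainder
  appears.\<close>

lemma second_difference:
  assumes "Ck 2 f" "b \<in> Basis" "h > 0"
  shows "\<exists>\<xi>. \<bar>\<xi>\<bar> < h \<and> f (x + h *\<^sub>R b) + f (x - h *\<^sub>R b) - 2 * f x =
    h\<^sup>2 * partial_deriv b (partial_deriv b f) (x + \<xi> *\<^sub>R b)"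
proof -
  define g where "g = partial_deriv b f"
  have f: "f differentiable (at y)" and g: "g differentiable (at y)" for y
    using assms(1,2) by (simp_all add: numeral_2_eq_2 g_def)
  define \<phi> where "\<phi> s = f (x + s *\<^sub>R b) + f (x - s *\<^sub>R b)" for s
  have d\<phi>: "(\<phi> has_real_derivative g (x + s *\<^sub>R b) - g (x - s *\<^sub>R b)) (at s)" for s
  proof -
    have "((\<lambda>s. f (x + (-s) *\<^sub>R b)) has_real_derivative - g (x + (-s) *\<^sub>R b)) (at s)"
      unfolding g_def by (rule DERIV_cong[OF DERIV_chain2[OF has_real_derivative_line]]) (auto intro!: f derivative_eq_intros)
    from DERIV_add[OF has_real_derivative_line[OF f] this] show ?thesis unfolding \<phi>_def g_def by simp
  qed
  have "\<exists>g'c f'c c. DERIV \<phi> c :> g'c \<and> DERIV (\<lambda>s. s\<^sup>2) c :> f'c \<and> 0 < c \<and> c < h \<and>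
      ((\<phi> h - \<phi> 0) * f'c) = ((h\<^sup>2 - 0\<^sup>2) * g'c)"
  proof -
    have 1: "\<forall>s. 0 \<le> s \<and> s \<le> h \<longrightarrow> isCont \<phi> s" using d\<phi> DERIV_isCont by blast
    have 2: "\<forall>s. 0 < s \<and> s < h \<longrightarrow> \<phi> differentiable (at s)" using d\<phi> real_differentiable_def by blast
    have 3: "\<forall>s. 0 \<le> s \<and> s \<le> h \<longrightarrow> isCont (\<lambda>s::real. s\<^sup>2) s" by simp
    have 4: "\<forall>s. 0 < s \<and> s < h \<longrightarrow> (\<lambda>s::real. s\<^sup>2) differentiable (at s)" by simp
    from GMVT[OF assms(3) 1 2 3 4] show ?thesis by blast
  qed
  then obtain g' f' c where c: "DERIV \<phi> c :> g'" "DERIV (\<lambda>s. s\<^sup>2) c :> f'" "0 < c" "c < h"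
    "(\<phi> h - \<phi> 0) * f' = (h\<^sup>2 - 0\<^sup>2) * g'" by blast
  have g': "g' = g (x + c *\<^sub>R b) - g (x - c *\<^sub>R b)" using DERIV_unique[OF c(1) d\<phi>] .
  have "DERIV (\<lambda>s. s\<^sup>2) c :> 2 * c" by (auto intro!: derivative_eq_intros)
  then have f': "f' = 2 * c" using DERIV_unique[OF c(2)] by blast
  have "\<exists>z>-c. z < c \<and> g (x + c *\<^sub>R b) - g (x + (-c) *\<^sub>R b) = (c - (-c)) * partial_deriv b g (x + z *\<^sub>R b)"
    using c by (intro MVT2 has_real_derivative_line g) auto
  then obtain z where z: "-c < z" "z < c"
    "g (x + c *\<^sub>R b) - g (x - c *\<^sub>R b) = 2 * c * partial_deriv b g (x + z *\<^sub>R b)" by auto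
  have "(\<phi> h - \<phi> 0) * (2 * c) = h\<^sup>2 * (2 * c * partial_deriv b g (x + z *\<^sub>R b))"
    using c(5) z(3) g' f' by simp
  then have "\<phi> h - \<phi> 0 = h\<^sup>2 * partial_deriv b g (x + z *\<^sub>R b)" using c by simp
  then show ?thesis using z c unfolding \<phi>_def g_def by (intro exI[of _ z]) auto
qed

text \<open>The mean value theorems give intermediate points about which nothing is known beyond
  \<bar>\<xi> k\<bar> \<le> h k; continuity of \<open>g\<close> then identifies the limit.\<close>

lemma tendsto_along_line:
  fixes g :: "'a::euclidean_space \<Rightarrow> real"
  assumes "continuous_on UNIV g" "h \<longlonglongrightarrow> 0" "\<And>k. \<bar>\<xi> k\<bar> \<le> h k"
  shows "(\<lambda>k. g (x + \<xi> k *\<^sub>R b)) \<longlonglongrightarrow> g x"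
proof -
  have "\<xi> \<longlonglongrightarrow> 0"
    by (rule Lim_null_comparison[OF _ assms(2)]) (use assms in auto)
  then have "(\<lambda>k. x + \<xi> k *\<^sub>R b) \<longlonglongrightarrow> x + 0 *\<^sub>R b" by (intro tendsto_intros)
  then have *: "(\<lambda>k. x + \<xi> k *\<^sub>R b) \<longlonglongrightarrow> x" by simp
  show ?thesis
    by (rule isCont_tendsto_compose[OF _ *]) (use assms(1) in \<open>simp add: continuous_on_eq_continuous_at\<close>)
qed

lemma first_difference_LIMSEQ:
  assumes "Ck 1 f" "b \<in> Basis" "\<And>k. h k > 0" "h \<longlonglongrightarrow> 0"
  shows "(\<lambda>k. (f (x + h k *\<^sub>R b) - f x) / h k) \<longlonglongrightarrow> partial_deriv b f x"
proof -
  have "\<exists>\<xi>. \<bar>\<xi>\<bar> < h k \<and> (f (x + h k *\<^sub>R b) - f x) / h k = partial_deriv b f (x + \<xi> *\<^sub>R b)" for k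
    using first_difference[OF assms(1,2) assms(3)[of k], of x] assms(3)[of k] by fastforce
  then obtain \<xi> where \<xi>: "\<And>k. \<bar>\<xi> k\<bar> < h k"
    "\<And>k. (f (x + h k *\<^sub>R b) - f x) / h k = partial_deriv b f (x + \<xi> k *\<^sub>R b)"
    by metis
  show ?thesis unfolding \<xi>(2)
    by (rule tendsto_along_line[OF _ assms(4)]) (use assms(1,2) \<xi>(1) in \<open>auto intro: less_imp_le simp: One_nat_def\<close>)
qed

lemma second_difference_LIMSEQ:
  assumes "Ck 2 f" "b \<in> Basis" "\<And>k. h k > 0" "h \<longlonglongrightarrow> 0"
  shows "(\<lambda>k. (f (x + h k *\<^sub>R b) + f (x - h k *\<^sub>R b) - 2 * f x) / (h k)\<^sup>2)
    \<longlonglongrightarrow> partial_deriv b (partial_deriv b f) x"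
proof -
  have "\<exists>\<xi>. \<bar>\<xi>\<bar> < h k \<and> (f (x + h k *\<^sub>R b) + f (x - h k *\<^sub>R b) - 2 * f x) / (h k)\<^sup>2
      = partial_deriv b (partial_deriv b f) (x + \<xi> *\<^sub>R b)" for k
    using second_difference[OF assms(1,2) assms(3)[of k], of x] assms(3)[of k] by fastforce
  then obtain \<xi> where \<xi>: "\<And>k. \<bar>\<xi> k\<bar> < h k"
    "\<And>k. (f (x + h k *\<^sub>R b) + f (x - h k *\<^sub>R b) - 2 * f x) / (h k)\<^sup>2
      = partial_deriv b (partial_deriv b f) (x + \<xi> k *\<^sub>R b)"
    by metis
  show ?thesis unfolding \<xi>(2)
    by (rule tendsto_along_line[OF _ assms(4)]) (use assms(1,2) \<xi>(1) in \<open>auto intro: less_imp_le simp: numeral_2_eq_2\<close>)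
qed

lemma partial_deriv_zero_outside:
  assumes "closed K" "\<And>x. x \<notin> K \<Longrightarrow> f x = 0" "x \<notin> K"
  shows "partial_deriv b f x = 0"
proof -
  have "(f has_derivative (\<lambda>h. 0)) (at x)"
    by (rule has_derivative_transform_within_open[of "\<lambda>_. 0" _ _ UNIV "-K"]) (use assms in auto)
  then show ?thesis by (rule partial_deriv_eq)
qed

lemma compact_support_bounded:
  fixes g :: "'a::euclidean_space \<Rightarrow> real"
  assumes "continuous_on UNIV g" "compact K" "\<And>x. x \<notin> K \<Longrightarrow> g x = 0"
  obtains M where "M \<ge> 0" "\<And>x. \<bar>g x\<bar> \<le> M"
proof -
  have "bounded (g ` K)"
    using assms by (meson compact_continuous_image compact_imp_bounded continuous_on_subset subset_UNIV)
  then obtain M where "\<forall>x\<in>K. \<bar>g x\<bar> \<le> M" "M > 0" unfolding bounded_pos by auto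
  then show ?thesis using that[of M] assms(3) by (metis abs_zero less_eq_real_def)
qed

lemma first_difference_bound:
  assumes "Ck 1 f" "b \<in> Basis" "h > 0" "\<And>x. \<bar>partial_deriv b f x\<bar> \<le> M"
  shows "\<bar>f (x + h *\<^sub>R b) - f x\<bar> \<le> h * M"
  using first_difference[OF assms(1-3), of x] assms(3,4) by (force simp: abs_mult)

lemma second_difference_bound:
  assumes "Ck 2 f" "b \<in> Basis" "h > 0" "\<And>x. \<bar>partial_deriv b (partial_deriv b f) x\<bar> \<le> M"
  shows "\<bar>f (x + h *\<^sub>R b) + f (x - h *\<^sub>R b) - 2 * f x\<bar> \<le> h\<^sup>2 * M"
  using second_difference[OF assms(1-3), of x] assms(3,4) by (force simp: abs_mult)

section \<open>Mollifiers\<close>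

text \<open>The classical flat function exp(-1/y), extended by zero, times (1/y)^N. The extra index
  makes the family closed under differentiation, so that smoothness is an induction over the order
  for all N at once.\<close>

definition flat_exp :: "nat \<Rightarrow> real \<Rightarrow> real" where
  "flat_exp N y = (if y \<le> 0 then 0 else (1/y)^N * exp (- (1/y)))"

lemma flat_exp_tendsto_0: "(flat_exp N \<longlongrightarrow> 0) (at 0)"
proof -
  have "((\<lambda>y::real. (1/y)^N * exp (- (1/y))) \<longlongrightarrow> 0) (at_right 0)"
    using filterlim_compose[OF tendsto_power_div_exp_0[of N] filterlim_inverse_at_top_right]
    by (simp add: exp_minus field_simps)
  moreover have "\<forall>\<^sub>F y in at_right (0::real). (1/y)^N * exp (- (1/y)) = flat_exp N y"
    unfolding flat_exp_def eventually_at_right_field by (auto intro!: exI[of _ 1])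
  ultimately have r: "(flat_exp N \<longlongrightarrow> 0) (at_right 0)" using tendsto_cong by fastforce
  have "\<forall>\<^sub>F y in at_left (0::real). 0 = flat_exp N y"
    unfolding flat_exp_def eventually_at_left_field by (auto intro!: exI[of _ "-1"])
  then have "(flat_exp N \<longlongrightarrow> 0) (at_left 0)" using tendsto_cong[of "\<lambda>_. 0" "flat_exp N"] by auto
  with r show ?thesis using filterlim_split_at by blast
qed

lemma flat_exp_deriv:
  "(flat_exp N has_real_derivative flat_exp (N + 2) y - N * flat_exp (N + 1) y) (at y)"
proof -
  consider "y < 0" | "y = 0" | "y > 0" by linarith
  then show ?thesis
  proof cases
    case 1
    have "((\<lambda>_. 0) has_real_derivative 0) (at y)" by simp
    then have "(flat_exp N has_real_derivative 0) (at y)"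
      by (rule has_field_derivative_transform_within_open[of _ _ _ "{..<0}"]) (use 1 in \<open>auto simp: flat_exp_def\<close>)
    then show ?thesis using 1 by (simp add: flat_exp_def)
  next
    case 2
    \<comment> \<open>The difference quotient at 0 is itself a member of the family, and all members
      tend to 0.\<close>
    have "(\<lambda>y. (flat_exp N y - flat_exp N 0) / (y - 0)) = flat_exp (N + 1)"
      by (auto simp: flat_exp_def fun_eq_iff)
    then have "(flat_exp N has_real_derivative 0) (at 0)"
      using flat_exp_tendsto_0[of "N + 1"] by (simp add: has_field_derivative_iff)
    then show ?thesis using 2 by (simp add: flat_exp_def)
  next
    case 3
    have "((\<lambda>y. (1/y)^N * exp (- (1/y))) has_real_derivative
        (1/y)^(N+2) * exp (- (1/y)) - N * ((1/y)^(N+1) * exp (- (1/y)))) (at y)"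
    proof -
      have r: "((\<lambda>y. 1/y) has_real_derivative - ((1/y)^2)) (at y)"
        using 3 by (auto intro!: derivative_eq_intros simp: power2_eq_square)
      have "((\<lambda>y. (1/y)^N) has_real_derivative - (N * (1/y)^(N+1))) (at y)"
      proof (cases N)
        case (Suc l)
        show ?thesis unfolding Suc by (rule DERIV_cong[OF DERIV_power_Suc[OF r]]) (simp add: power2_eq_square)
      qed simp
      moreover have "((\<lambda>y. exp (- (1/y))) has_real_derivative exp (- (1/y)) * (1/y)^2) (at y)"
        by (rule DERIV_cong[OF DERIV_chain2[OF DERIV_exp DERIV_minus[OF r]]]) simp
      ultimately show ?thesis
        by (rule DERIV_cong[OF DERIV_mult]) (simp add: power2_eq_square power_add algebra_simps)
    qed
    then have "(flat_exp N has_real_derivative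
        (1/y)^(N+2) * exp (- (1/y)) - N * ((1/y)^(N+1) * exp (- (1/y)))) (at y)"
      by (rule has_field_derivative_transform_within_open[of _ _ _ "{0<..}"]) (use 3 in \<open>auto simp: flat_exp_def\<close>)
    then show ?thesis using 3 by (simp add: flat_exp_def)
  qed
qed

lemma Ck_on_flat_exp: "Ck_on k UNIV (flat_exp N)"
proof (induction k arbitrary: N)
  case 0
  show ?case using flat_exp_deriv DERIV_isCont by (fastforce simp: continuous_on_eq_continuous_at)
next
  case (Suc k)
  have "Ck_on k UNIV (\<lambda>y. flat_exp (N + 2) y - N * flat_exp (N + 1) y)"
    by (intro Ck_on_diff Ck_on_cmult Suc)
  then show ?case by (rule Ck_on_SucI[rotated]) (use flat_exp_deriv in simp)
qed

lemma continuous_compact_support_integrable: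
  fixes g :: "'a::euclidean_space \<Rightarrow> real"
  assumes "continuous_on UNIV g" "compact K" "\<And>x. x \<notin> K \<Longrightarrow> g x = 0"
  shows "integrable lborel g"
proof -
  have "(\<lambda>x. indicat_real K x *\<^sub>R g x) = g" using assms(3) by (fastforce simp: indicator_def)
  then show ?thesis
    using borel_integrable_compact[OF assms(2), of g] assms(1) by (metis continuous_on_subset subset_UNIV)
qed

lemma AE_lborel_notin_open:
  assumes "open S" "AE x in lborel. x \<notin> S" shows "S = {}"
proof -
  have "S \<in> null_sets lborel" using assms by (subst AE_iff_null_sets) auto
  then have "negligible S" by (simp add: negligible_iff_null_sets null_sets_completionI)
  then show ?thesis using open_not_negligible[OF assms(1)] by blast
qed

text \<open>A normalised \<open>flat_exp 0\<close> of \<epsilon>^2 - |p|^2. Smoothness is recorded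
  also for the reflected kernel y \<mapsto> J (p - y), since that is the function inserted into weak
  equations.\<close>

lemma mollifier_exists:
  assumes "\<epsilon> > 0"
  obtains J :: "'a::euclidean_space \<Rightarrow> real" where "\<And>p. smooth (\<lambda>y. J (p - y))" "smooth J" "\<And>p. 0 \<le> J p"
    "\<And>p. \<epsilon> \<le> norm p \<Longrightarrow> J p = 0" "integral\<^sup>L lborel J = 1" "integrable lborel J"
proof -
  define H :: "'a \<Rightarrow> real" where "H p = flat_exp 0 (\<epsilon>\<^sup>2 - p \<bullet> p)" for p
  have Ck: "Ck k (\<lambda>y. H (y - p))" for k p unfolding H_def
    by (rule Ck_compose[of k UNIV "flat_exp 0"]) (auto intro!: Ck_on_flat_exp Ck_diff Ck_inner_self)
  have cont: "continuous_on UNIV H" using Ck[of 0 0] by simp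
  have nonneg: "0 \<le> H p" for p by (simp add: H_def flat_exp_def)
  have supp: "H p = 0" if "\<epsilon> \<le> norm p" for p
  proof -
    have "\<epsilon>\<^sup>2 \<le> p \<bullet> p" using that assms by (metis power2_norm_eq_inner less_imp_le power_mono)
    then show ?thesis by (simp add: H_def flat_exp_def)
  qed
  have int: "integrable lborel H"
    by (rule continuous_compact_support_integrable[OF cont compact_cball[of 0 \<epsilon>]]) (auto intro: supp)
  \<comment> \<open>A continuous function that vanishes almost everywhere vanishes everywhere, but
    \<open>H\<close> does not vanish at 0; so its integral is positive and can be
    normalised.\<close>
  have "\<not> (AE p in lborel. H p = 0)"
  proof
    assume "AE p in lborel. H p = 0"
    moreover have "open {p. H p \<noteq> 0}" using cont by (intro open_Collect_neq) auto
    moreover have "H 0 \<noteq> 0" using assms by (simp add: H_def flat_exp_def)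
    ultimately show False using AE_lborel_notin_open[of "{p. H p \<noteq> 0}"] by auto
  qed
  then have "integral\<^sup>L lborel H \<noteq> 0"
    using integral_nonneg_eq_0_iff_AE[OF int] nonneg by auto
  then have pos: "integral\<^sup>L lborel H > 0"
    using Bochner_Integration.integral_nonneg[of lborel H] nonneg by (simp add: less_le)
  define J where "J p = inverse (integral\<^sup>L lborel H) * H p" for p
  have sym: "H (p - y) = H (y - p)" for p y
    by (simp add: H_def inner_diff inner_commute algebra_simps)
  show thesis
  proof (rule that[of J])
    show "smooth (\<lambda>y. J (p - y))" for p
      unfolding smooth_def J_def sym by (auto intro!: Ck_mult Ck)
    show "smooth J"
      unfolding smooth_def J_def using Ck[of _ 0] by (auto intro!: Ck_mult)
    show "integral\<^sup>L lborel J = 1" unfolding J_def using pos by simp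
  qed (unfold J_def, use pos nonneg supp int in auto)
qed

section \<open>Translations and mollification in \<open>L\<^sup>1\<close>\<close>

lemma lborel_integral_translate:
  fixes f :: "'a::euclidean_space \<Rightarrow> real"
  assumes "f \<in> borel_measurable borel"
  shows "integral\<^sup>L lborel (\<lambda>x. f (x + c)) = integral\<^sup>L lborel f"
    and "integrable lborel (\<lambda>x. f (x + c)) \<longleftrightarrow> integrable lborel f"
    and "integral\<^sup>L lborel (\<lambda>x. f (c - x)) = integral\<^sup>L lborel f"
    and "integrable lborel (\<lambda>x. f (c - x)) \<longleftrightarrow> integrable lborel f"
proof -
  have r: "lborel = distr lborel borel (\<lambda>x. c - x)"
    using lborel_affine[of "-1" c] by (simp add: density_1)
  show "integral\<^sup>L lborel (\<lambda>x. f (x + c)) = integral\<^sup>L lborel f"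
    using integral_distr[of "(+) c" lborel borel f] assms by (simp add: lborel_distr_plus add.commute)
  show "integrable lborel (\<lambda>x. f (x + c)) \<longleftrightarrow> integrable lborel f"
    using integrable_distr_eq[of "(+) c" lborel borel f] assms by (simp add: lborel_distr_plus add.commute)
  show "integral\<^sup>L lborel (\<lambda>x. f (c - x)) = integral\<^sup>L lborel f"
    using integral_distr[of "\<lambda>x. c - x" lborel borel f] assms r by simp
  show "integrable lborel (\<lambda>x. f (c - x)) \<longleftrightarrow> integrable lborel f"
    using integrable_distr_eq[of "\<lambda>x. c - x" lborel borel f] assms r by simp
qed

text \<open>Inner regularity yields a closed subset. Intersecting it with large balls makes it
  compact, and the loss tends to zero by continuity from above, for which the finite measure of A is
  used.\<close>

lemma lborel_inner_compact:
  fixes A :: "'a::euclidean_space set"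
  assumes "A \<in> sets borel" "emeasure lborel A < \<infinity>" "e > 0"
  obtains K where "compact K" "K \<subseteq> A" "measure lborel (A - K) < e"
proof -
  have "A \<in> sets lebesgue" using assms(1) by simp
  then obtain T where T: "closed T" "T \<subseteq> A" "emeasure lebesgue (A - T) < ennreal e"
    by (rule sets_lebesgue_inner_closed[OF _ assms(3)])
  define D where "D k = A - (T \<inter> cball 0 (real k))" for k
  have [measurable]: "T \<in> sets borel" "A \<in> sets borel" using T assms by auto
  have fin: "emeasure lborel (D k) \<noteq> \<infinity>" for k
    using assms(2) emeasure_mono[of "D k" A lborel] by (auto simp: D_def less_top top_unique)
  have "(\<lambda>k. measure lborel (D k)) \<longlonglongrightarrow> measure lborel (\<Inter>k. D k)"
    by (rule Lim_measure_decseq[OF _ _ fin]) (auto simp: D_def decseq_def intro: order_trans)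
  moreover have "(\<Inter>k. D k) = A - T"
    unfolding D_def using real_arch_simple by (auto simp: dist_norm)
  moreover have "measure lborel (A - T) < e"
  proof -
    have less: "emeasure lborel (A - T) < ennreal e" using T(3) by simp
    then have "emeasure lborel (A - T) \<noteq> top" by auto
    from emeasure_eq_ennreal_measure[OF this] less show ?thesis by (simp add: ennreal_less_iff)
  qed
  ultimately have "\<forall>\<^sub>F k in sequentially. measure lborel (D k) < e"
    by (auto intro: order_tendstoD)
  then obtain k where "measure lborel (D k) < e" by (auto simp: eventually_sequentially)
  then show ?thesis using T by (intro that[of "T \<inter> cball 0 (real k)"]) (auto simp: D_def closed_Int_compact)
qed

lemma integrable_indicator_compact: "compact K \<Longrightarrow> integrable lborel (indicat_real K)"
  using emeasure_compact_finite[of K] by (simp add: borel_compact)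

text \<open>The closed neighbourhoods \<open>N i\<close> decrease to K, so one of them has measure
  close to that of K. It contains K and all small translates of K, and two sets of equal measure
  inside it differ by at most twice the excess measure.\<close>

lemma compact_translation_continuous:
  fixes K :: "'a::euclidean_space set"
  assumes "compact K" "e > 0"
  obtains d where "d > 0"
    "\<And>y. norm y < d \<Longrightarrow> integral\<^sup>L lborel (\<lambda>x. \<bar>indicat_real K (x + y) - indicat_real K x\<bar>) < e"
proof (cases "K = {}")
  case True
  then show ?thesis using that[of 1] assms by simp
next
  case False
  define N where "N i = {x. infdist x K \<le> 1 / real (Suc i)}" for i
  have closedN: "closed (N i)" for i
    unfolding N_def by (intro closed_Collect_le continuous_intros)
  obtain R where R: "\<And>x. x \<in> K \<Longrightarrow> norm x \<le> R" using compact_imp_bounded[OF assms(1)] by (auto simp: bounded_iff)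
  have "N i \<subseteq> cball 0 (R + 1)" for i
  proof
    fix x assume "x \<in> N i"
    then have le: "infdist x K \<le> 1" unfolding N_def using order_trans[of _ "1 / real (Suc i)" 1] by simp
    obtain y where "y \<in> K" "infdist x K = dist x y"
      using infdist_attains_inf[OF compact_imp_closed[OF assms(1)] False] by blast
    with le R[of y] show "x \<in> cball 0 (R + 1)" using norm_triangle_sub[of x y] by (simp add: dist_norm)
  qed
  then have compN: "compact (N i)" for i
    using closedN by (meson bounded_cball bounded_subset compact_eq_bounded_closed)
  have KN: "K \<subseteq> N i" for i by (auto simp: N_def)
  have "(\<lambda>i. measure lborel (N i)) \<longlonglongrightarrow> measure lborel (\<Inter>i. N i)"
  proof (rule Lim_measure_decseq)
    show "range N \<subseteq> sets lborel" using closedN by auto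
    show "decseq N" unfolding decseq_def N_def
      by (auto intro: order_trans simp: frac_le)
    show "emeasure lborel (N i) \<noteq> \<infinity>" for i using emeasure_compact_finite[OF compN] by (simp add: less_top)
  qed
  moreover have "(\<Inter>i. N i) = K"
  proof
    show "(\<Inter>i. N i) \<subseteq> K"
    proof
      fix x assume x: "x \<in> (\<Inter>i. N i)"
      have "infdist x K \<le> 0"
      proof (rule field_le_epsilon)
        fix e :: real assume "e > 0"
        then obtain i where "inverse (real (Suc i)) < e" using reals_Archimedean by blast
        moreover have "infdist x K \<le> 1 / real (Suc i)" using x by (auto simp: N_def)
        ultimately show "infdist x K \<le> 0 + e" by (simp add: inverse_eq_divide)
      qed
      then have "infdist x K = 0" using infdist_nonneg[of x K] by simp
      then show "x \<in> K" using in_closed_iff_infdist_zero[OF compact_imp_closed[OF assms(1)] False] by blast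
    qed
  qed (use KN in auto)
  ultimately have "\<forall>\<^sub>F i in sequentially. measure lborel (N i) < measure lborel K + e / 2"
    using assms(2) by (auto intro: order_tendstoD)
  then obtain i where i: "measure lborel (N i) < measure lborel K + e / 2"
    by (auto simp: eventually_sequentially)
  have [measurable]: "K \<in> sets borel" "N i \<in> sets borel"
    using assms(1) closedN by (auto intro: borel_compact)
  show thesis
  proof (rule that[of "1 / real (Suc i)"])
    fix y :: 'a assume y: "norm y < 1 / real (Suc i)"
    have sub: "x \<in> N i" if "x + y \<in> K" for x
      unfolding N_def using y infdist_le2[OF that, of x "1 / real (Suc i)"] by (simp add: dist_norm)
    have intK: "integrable lborel (\<lambda>x. indicat_real K (x + y))"
      using integrable_indicator_compact[OF assms(1)] by (subst lborel_integral_translate(2)) auto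
    have "integral\<^sup>L lborel (\<lambda>x. \<bar>indicat_real K (x + y) - indicat_real K x\<bar>) \<le>
      integral\<^sup>L lborel (\<lambda>x. 2 * indicat_real (N i) x - indicat_real K (x + y) - indicat_real K x)"
    proof (rule integral_mono)
      fix x show "\<bar>indicat_real K (x + y) - indicat_real K x\<bar> \<le>
          2 * indicat_real (N i) x - indicat_real K (x + y) - indicat_real K x"
        using sub[of x] KN[of i] by (auto simp: indicator_def)
    qed (use intK integrable_indicator_compact[OF assms(1)] integrable_indicator_compact[OF compN[of i]] in auto)
    also have "\<dots> = 2 * measure lborel (N i) - measure lborel K - measure lborel K"
      using intK integrable_indicator_compact[OF assms(1)] integrable_indicator_compact[OF compN[of i]]
        lborel_integral_translate(1)[of "indicat_real K" y] by simp
    finally show "integral\<^sup>L lborel (\<lambda>x. \<bar>indicat_real K (x + y) - indicat_real K x\<bar>) < e"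
      using i by simp
  qed simp
qed

definition translation_continuous :: "('a::euclidean_space \<Rightarrow> real) \<Rightarrow> bool" where
  "translation_continuous f \<longleftrightarrow> (\<forall>e>0. \<exists>d>0. \<forall>y. norm y < d \<longrightarrow>
     integral\<^sup>L lborel (\<lambda>x. \<bar>f (x + y) - f x\<bar>) < e)"

text \<open>The distance from f to g enters twice, once for each translate, because translation
  preserves the L^1 norm; hence e/4 twice and e/2 for g.\<close>

lemma translation_continuous_approx:
  fixes f :: "'a::euclidean_space \<Rightarrow> real"
  assumes f: "integrable lborel f"
    and approx: "\<And>e. e > 0 \<Longrightarrow> \<exists>g. integrable lborel g \<and> translation_continuous g \<and>
      integral\<^sup>L lborel (\<lambda>x. \<bar>f x - g x\<bar>) < e"
  shows "translation_continuous f"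
  unfolding translation_continuous_def
proof (intro allI impI)
  fix e :: real assume "e > 0"
  then obtain g where g: "integrable lborel g" "translation_continuous g"
    "integral\<^sup>L lborel (\<lambda>x. \<bar>f x - g x\<bar>) < e / 4" using approx[of "e / 4"] by auto
  have e2: "e / 2 > 0" using \<open>e > 0\<close> by simp
  obtain d where d: "d > 0"
    "\<forall>y. norm y < d \<longrightarrow> integral\<^sup>L lborel (\<lambda>x. \<bar>g (x + y) - g x\<bar>) < e / 2"
    using g(2)[unfolded translation_continuous_def, rule_format, OF e2] by blast
  have [measurable]: "f \<in> borel_measurable borel" "g \<in> borel_measurable borel"
    using f g(1) by auto
  show "\<exists>d>0. \<forall>y. norm y < d \<longrightarrow> integral\<^sup>L lborel (\<lambda>x. \<bar>f (x + y) - f x\<bar>) < e"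
  proof (intro exI[of _ d] conjI allI impI d)
    fix y :: 'a assume y: "norm y < d"
    have i: "integrable lborel (\<lambda>x. f (x + y))" "integrable lborel (\<lambda>x. g (x + y))"
      using f g by (simp_all add: lborel_integral_translate)
    have "integral\<^sup>L lborel (\<lambda>x. \<bar>f (x + y) - f x\<bar>) \<le> integral\<^sup>L lborel
       (\<lambda>x. \<bar>f (x + y) - g (x + y)\<bar> + \<bar>g (x + y) - g x\<bar> + \<bar>f x - g x\<bar>)"
      using i f g by (intro integral_mono) auto
    also have "\<dots> = integral\<^sup>L lborel (\<lambda>x. \<bar>f (x + y) - g (x + y)\<bar>)
        + integral\<^sup>L lborel (\<lambda>x. \<bar>g (x + y) - g x\<bar>) + integral\<^sup>L lborel (\<lambda>x. \<bar>f x - g x\<bar>)"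
      using i f g by simp
    also have "integral\<^sup>L lborel (\<lambda>x. \<bar>f (x + y) - g (x + y)\<bar>) = integral\<^sup>L lborel (\<lambda>x. \<bar>f x - g x\<bar>)"
      using lborel_integral_translate(1)[of "\<lambda>x. \<bar>f x - g x\<bar>" y] by simp
    finally show "integral\<^sup>L lborel (\<lambda>x. \<bar>f (x + y) - f x\<bar>) < e" using g(3) d(2)[rule_format, OF y] by simp
  qed
qed

text \<open>Induction over integrable functions. A set of finite measure is approximated from inside
  by a compact one, for which the neighbourhood argument applies; sums and dominated limits preserve
  the property.\<close>

lemma integrable_translation_continuous:
  fixes f :: "'a::euclidean_space \<Rightarrow> real"
  assumes "integrable lborel f"
  shows "translation_continuous f"
  using assms
proof (induction f rule: integrable_induct)
  case (base A c)
  then have [measurable]: "A \<in> sets borel" by simp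
  have intA: "integrable lborel (\<lambda>x. indicat_real A x * c)" using base by simp
  show ?case
  proof (rule translation_continuous_approx)
    fix e :: real assume e: "e > 0"
    \<comment> \<open>The denominator \<open>\<bar>c\<bar> + 1\<close> covers c = 0 as well.\<close>
    define e' where "e' = e / (\<bar>c\<bar> + 1)"
    have e': "e' > 0" "\<bar>c\<bar> * e' < e" using e by (auto simp: e'_def divide_simps)
    obtain K where K: "compact K" "K \<subseteq> A" "measure lborel (A - K) < e'"
      using lborel_inner_compact[of A e'] base e' by auto
    have [measurable]: "K \<in> sets borel" using K by (auto intro: borel_compact)
    have "translation_continuous (\<lambda>x. indicat_real K x * c)"
      unfolding translation_continuous_def
    proof (intro allI impI)
      fix r :: real assume r: "r > 0"
      define r' where "r' = r / (\<bar>c\<bar> + 1)"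
      have r': "r' > 0" "\<bar>c\<bar> * r' < r" using r by (auto simp: r'_def divide_simps)
      obtain d where d: "d > 0" "\<And>y. norm y < d \<Longrightarrow>
          integral\<^sup>L lborel (\<lambda>x. \<bar>indicat_real K (x + y) - indicat_real K x\<bar>) < r'"
        using compact_translation_continuous[OF K(1) r'(1)] by blast
      have "integral\<^sup>L lborel (\<lambda>x. \<bar>indicat_real K (x + y) * c - indicat_real K x * c\<bar>) < r"
        if "norm y < d" for y
      proof -
        have "integral\<^sup>L lborel (\<lambda>x. \<bar>indicat_real K (x + y) * c - indicat_real K x * c\<bar>) =
           \<bar>c\<bar> * integral\<^sup>L lborel (\<lambda>x. \<bar>indicat_real K (x + y) - indicat_real K x\<bar>)"
          unfolding left_diff_distrib[symmetric] abs_mult by simp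
        also have "\<dots> \<le> \<bar>c\<bar> * r'" using d(2)[OF that] by (intro mult_left_mono) auto
        finally show ?thesis using r'(2) by simp
      qed
      then show "\<exists>d>0. \<forall>y. norm y < d \<longrightarrow>
          integral\<^sup>L lborel (\<lambda>x. \<bar>indicat_real K (x + y) * c - indicat_real K x * c\<bar>) < r"
        using d(1) by blast
    qed
    moreover have "integral\<^sup>L lborel (\<lambda>x. \<bar>indicat_real A x * c - indicat_real K x * c\<bar>) < e"
    proof -
      have "(\<lambda>x. \<bar>indicat_real A x * c - indicat_real K x * c\<bar>) = (\<lambda>x. \<bar>c\<bar> * indicat_real (A - K) x)"
        using K(2) by (auto simp: indicator_def fun_eq_iff)
      then have "integral\<^sup>L lborel (\<lambda>x. \<bar>indicat_real A x * c - indicat_real K x * c\<bar>) =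
          \<bar>c\<bar> * measure lborel (A - K)" by simp
      also have "\<dots> \<le> \<bar>c\<bar> * e'" using K(3) by (intro mult_left_mono) auto
      finally show ?thesis using e'(2) by simp
    qed
    ultimately show "\<exists>g. integrable lborel g \<and> translation_continuous g \<and>
      integral\<^sup>L lborel (\<lambda>x. \<bar>indicat_real A x *\<^sub>R c - g x\<bar>) < e"
      using integrable_indicator_compact[OF K(1)] by (intro exI[of _ "\<lambda>x. indicat_real K x * c"]) simp
  qed (use intA in simp)
next
  case (add f g)
  then have [measurable]: "f \<in> borel_measurable borel" "g \<in> borel_measurable borel" by auto
  show ?case unfolding translation_continuous_def
  proof (intro allI impI)
    fix e :: real assume "e > 0"
    then have e2: "e / 2 > 0" by simp
    obtain d1 where d1: "d1 > 0"
      "\<forall>y. norm y < d1 \<longrightarrow> integral\<^sup>L lborel (\<lambda>x. \<bar>f (x + y) - f x\<bar>) < e / 2"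
      using add.IH(1)[unfolded translation_continuous_def, rule_format, OF e2] by blast
    obtain d2 where d2: "d2 > 0"
      "\<forall>y. norm y < d2 \<longrightarrow> integral\<^sup>L lborel (\<lambda>x. \<bar>g (x + y) - g x\<bar>) < e / 2"
      using add.IH(2)[unfolded translation_continuous_def, rule_format, OF e2] by blast
    show "\<exists>d>0. \<forall>y. norm y < d \<longrightarrow> integral\<^sup>L lborel (\<lambda>x. \<bar>f (x + y) + g (x + y) - (f x + g x)\<bar>) < e"
    proof (intro exI[of _ "min d1 d2"] conjI allI impI)
      fix y :: 'a assume y: "norm y < min d1 d2"
      have i: "integrable lborel (\<lambda>x. f (x + y))" "integrable lborel (\<lambda>x. g (x + y))"
        using add.hyps by (simp_all add: lborel_integral_translate)
      have "integral\<^sup>L lborel (\<lambda>x. \<bar>f (x + y) + g (x + y) - (f x + g x)\<bar>) \<le>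
        integral\<^sup>L lborel (\<lambda>x. \<bar>f (x + y) - f x\<bar> + \<bar>g (x + y) - g x\<bar>)"
        using i add.hyps by (intro integral_mono) auto
      also have "\<dots> = integral\<^sup>L lborel (\<lambda>x. \<bar>f (x + y) - f x\<bar>) + integral\<^sup>L lborel (\<lambda>x. \<bar>g (x + y) - g x\<bar>)"
        using i add.hyps by simp
      finally show "integral\<^sup>L lborel (\<lambda>x. \<bar>f (x + y) + g (x + y) - (f x + g x)\<bar>) < e"
        using d1(2) d2(2) y by fastforce
    qed (use d1 d2 in simp)
  qed
next
  case (lim f s)
  have [measurable]: "f \<in> borel_measurable borel" "\<And>i. s i \<in> borel_measurable borel"
    using lim.hyps by auto
  have "(\<lambda>i. integral\<^sup>L lborel (\<lambda>x. \<bar>f x - s i x\<bar>)) \<longlonglongrightarrow> integral\<^sup>L lborel (\<lambda>x::'a. 0::real)"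
  \<comment> \<open>The approximating functions of the induction rule satisfy \<bar>s i x\<bar>
    \<le> 2 \<bar>f x\<bar>, hence the majorant 3 \<bar>f\<bar>.\<close>
  proof (rule integral_dominated_convergence[where w = "\<lambda>x. 3 * \<bar>f x\<bar>"])
    show "AE x in lborel. (\<lambda>i. \<bar>f x - s i x\<bar>) \<longlonglongrightarrow> 0"
    proof (rule AE_I2)
      fix x have "(\<lambda>i. s i x) \<longlonglongrightarrow> f x" using lim.hyps by auto
      then have "(\<lambda>i. \<bar>f x - s i x\<bar>) \<longlonglongrightarrow> \<bar>f x - f x\<bar>" by (intro tendsto_intros)
      then show "(\<lambda>i. \<bar>f x - s i x\<bar>) \<longlonglongrightarrow> 0" by simp
    qed
    show "AE x in lborel. norm \<bar>f x - s i x\<bar> \<le> 3 * \<bar>f x\<bar>" for i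
    proof (rule AE_I2)
      fix x show "norm \<bar>f x - s i x\<bar> \<le> 3 * \<bar>f x\<bar>" using lim.hyps(3)[of x i] by auto
    qed
  qed (use lim.hyps in auto)
  then have lim0: "(\<lambda>i. integral\<^sup>L lborel (\<lambda>x. \<bar>f x - s i x\<bar>)) \<longlonglongrightarrow> 0" by simp
  show ?case
  proof (rule translation_continuous_approx)
    fix e :: real assume "e > 0"
    then have "\<forall>\<^sub>F i in sequentially. integral\<^sup>L lborel (\<lambda>x. \<bar>f x - s i x\<bar>) < e"
      using lim0 by (auto intro: order_tendstoD)
    then obtain i where "integral\<^sup>L lborel (\<lambda>x. \<bar>f x - s i x\<bar>) < e" by (auto simp: eventually_sequentially)
    then show "\<exists>g. integrable lborel g \<and> translation_continuous g \<and>
      integral\<^sup>L lborel (\<lambda>x. \<bar>f x - g x\<bar>) < e" using lim.hyps(1) lim.IH by blast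
  qed (use lim.hyps in auto)
qed

definition mollify :: "('a::euclidean_space \<Rightarrow> real) \<Rightarrow> ('a \<Rightarrow> real) \<Rightarrow> 'a \<Rightarrow> real" where
  "mollify J f p = integral\<^sup>L lborel (\<lambda>y. f y * J (p - y))"

lemma mollify_measurable [measurable]:
  assumes [measurable]: "f \<in> borel_measurable borel" "J \<in> borel_measurable borel"
  shows "mollify J f \<in> borel_measurable borel"
  unfolding mollify_def[abs_def] by measurable

lemma mollify_bound:
  fixes f :: "'a::euclidean_space \<Rightarrow> real"
  assumes "integrable lborel f" "\<And>p. \<bar>J p\<bar> \<le> M"
  shows "\<bar>mollify J f p\<bar> \<le> M * integral\<^sup>L lborel (\<lambda>y. \<bar>f y\<bar>)"
proof -
  have "\<bar>mollify J f p\<bar> \<le> integral\<^sup>L lborel (\<lambda>y. \<bar>f y * J (p - y)\<bar>)"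
    unfolding mollify_def by (rule integral_abs_bound)
  also have "\<dots> \<le> integral\<^sup>L lborel (\<lambda>y. M * \<bar>f y\<bar>)"
  proof (rule integral_mono')
    fix y show "\<bar>f y * J (p - y)\<bar> \<le> M * \<bar>f y\<bar>"
      using mult_right_mono[OF assms(2)[of "p - y"] abs_ge_zero[of "f y"]] by (simp add: abs_mult mult.commute)
  next
    fix y show "0 \<le> M * \<bar>f y\<bar>" using assms(2)[of 0] by (auto intro: mult_nonneg_nonneg)
  qed (use assms in auto)
  finally show ?thesis by simp
qed

text \<open>The smoothing error is an average of translation errors. The radius d depends on f and e
  only and not on the kernel, so that several functions can later be smoothed by one and the same
  J.\<close>

lemma mollify_L1:
  fixes f :: "'a::euclidean_space \<Rightarrow> real"
  assumes f: "integrable lborel f" and "e > 0"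
  obtains d where "d > 0" "\<And>J M. integrable lborel J \<Longrightarrow> (\<And>p. 0 \<le> J p) \<Longrightarrow> (\<And>p. J p \<le> M) \<Longrightarrow>
    integral\<^sup>L lborel J = 1 \<Longrightarrow> (\<And>p. d \<le> norm p \<Longrightarrow> J p = 0) \<Longrightarrow>
    integrable lborel (mollify J f) \<and> integral\<^sup>L lborel (\<lambda>p. \<bar>mollify J f p - f p\<bar>) \<le> e"
proof -
  obtain d where d: "d > 0" "\<And>y. norm y < d \<Longrightarrow> integral\<^sup>L lborel (\<lambda>x. \<bar>f (x + y) - f x\<bar>) < e"
    using integrable_translation_continuous[OF f] \<open>e > 0\<close> unfolding translation_continuous_def by blast
  have [measurable]: "f \<in> borel_measurable borel" using f by auto
  show thesis
  proof (rule that[OF d(1)])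
    fix J :: "'a \<Rightarrow> real" and M
    assume J: "integrable lborel J" "\<And>p. 0 \<le> J p" "\<And>p. J p \<le> M" "integral\<^sup>L lborel J = 1"
      "\<And>p. d \<le> norm p \<Longrightarrow> J p = 0"
    have [measurable]: "J \<in> borel_measurable borel" using J(1) by auto
    have pw: "ennreal \<bar>mollify J f p - f p\<bar> \<le> (\<integral>\<^sup>+y. ennreal (\<bar>f (p - y) - f p\<bar> * J y) \<partial>lborel)" for p
    proof -
      have i1: "integrable lborel (\<lambda>y. f y * J (p - y))"
      proof (rule Bochner_Integration.integrable_bound[of _ "\<lambda>y. M * f y"])
        show "AE y in lborel. norm (f y * J (p - y)) \<le> norm (M * f y)"
        proof (rule AE_I2)
          fix y show "norm (f y * J (p - y)) \<le> norm (M * f y)"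
            using mult_right_mono[OF J(3)[of "p - y"] abs_ge_zero[of "f y"]] J(2)[of "p - y"]
              order_trans[OF J(2,3)]
            by (simp add: abs_mult mult.commute)
        qed
      qed (use f in auto)
      have i1': "integrable lborel (\<lambda>y. f (p - y) * J y)"
        using lborel_integral_translate(4)[of "\<lambda>y. f y * J (p - y)" p] i1 by simp
      have i2: "integrable lborel (\<lambda>y. f p * J y)" using J(1) by simp
      have eq: "mollify J f p = integral\<^sup>L lborel (\<lambda>y. f (p - y) * J y)"
        using lborel_integral_translate(3)[of "\<lambda>y. f y * J (p - y)" p] by (simp add: mollify_def)
      have "mollify J f p - f p = integral\<^sup>L lborel (\<lambda>y. f (p - y) * J y) - integral\<^sup>L lborel (\<lambda>y. f p * J y)"
        using J(4) by (simp add: eq)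
      also have "\<dots> = integral\<^sup>L lborel (\<lambda>y. (f (p - y) - f p) * J y)"
        using i1' i2 by (simp add: left_diff_distrib)
      finally have eq2: "mollify J f p - f p = integral\<^sup>L lborel (\<lambda>y. (f (p - y) - f p) * J y)" .
      have i3: "integrable lborel (\<lambda>y. (f (p - y) - f p) * J y)"
        using Bochner_Integration.integrable_diff[OF i1' i2] by (simp add: left_diff_distrib)
      have "\<bar>mollify J f p - f p\<bar> \<le> integral\<^sup>L lborel (\<lambda>y. \<bar>f (p - y) - f p\<bar> * J y)"
        unfolding eq2 using integral_abs_bound[of lborel "\<lambda>y. (f (p - y) - f p) * J y"] J(2) by (simp add: abs_mult)
      also have "ennreal \<dots> = (\<integral>\<^sup>+y. ennreal (\<bar>f (p - y) - f p\<bar> * J y) \<partial>lborel)"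
        using integrable_abs[OF i3] J(2) by (subst nn_integral_eq_integral) (auto simp: abs_mult)
      finally show ?thesis by (simp add: ennreal_leI)
    qed
    have "(\<integral>\<^sup>+p. ennreal \<bar>mollify J f p - f p\<bar> \<partial>lborel) \<le>
      (\<integral>\<^sup>+p. \<integral>\<^sup>+y. ennreal (\<bar>f (p - y) - f p\<bar> * J y) \<partial>lborel \<partial>lborel)"
      by (intro nn_integral_mono pw)
    \<comment> \<open>Tonelli's theorem for nonnegative integrands: integrability on the product is
      not presupposed, and integrability of the mollified function falls out of the finite
      bound.\<close>
    also have "\<dots> = (\<integral>\<^sup>+y. \<integral>\<^sup>+p. ennreal (\<bar>f (p - y) - f p\<bar> * J y) \<partial>lborel \<partial>lborel)"
      by (rule lborel_pair.Fubini') measurable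
    also have "\<dots> \<le> (\<integral>\<^sup>+y. ennreal e * ennreal (J y) \<partial>lborel)"
    proof (rule nn_integral_mono)
      fix y :: 'a
      show "(\<integral>\<^sup>+p. ennreal (\<bar>f (p - y) - f p\<bar> * J y) \<partial>lborel) \<le> ennreal e * ennreal (J y)"
      proof (cases "norm y < d")
        case True
        have i: "integrable lborel (\<lambda>p. \<bar>f (p - y) - f p\<bar>)"
          using f lborel_integral_translate(2)[of f "-y"] by auto
        have "(\<integral>\<^sup>+p. ennreal (\<bar>f (p - y) - f p\<bar> * J y) \<partial>lborel) =
           ennreal (integral\<^sup>L lborel (\<lambda>p. \<bar>f (p - y) - f p\<bar> * J y))"
          using i J(2) by (intro nn_integral_eq_integral) auto
        also have "\<dots> = ennreal (integral\<^sup>L lborel (\<lambda>p. \<bar>f (p - y) - f p\<bar>) * J y)" by simp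
        also have "\<dots> \<le> ennreal (e * J y)"
          using d(2)[of "-y"] True J(2) by (intro ennreal_leI mult_right_mono) auto
        finally show ?thesis using \<open>e > 0\<close> J(2) by (simp add: ennreal_mult)
      qed (use J(5) in simp)
    qed
    also have "\<dots> = ennreal e"
      using J(1,2,4) \<open>e > 0\<close> by (simp add: nn_integral_cmult nn_integral_eq_integral)
    finally have fin: "(\<integral>\<^sup>+p. ennreal \<bar>mollify J f p - f p\<bar> \<partial>lborel) \<le> ennreal e" .
    have i: "integrable lborel (\<lambda>p. mollify J f p - f p)"
      using fin by (intro integrableI_bounded) (auto simp: less_top[symmetric] top_unique)
    have "ennreal (integral\<^sup>L lborel (\<lambda>p. \<bar>mollify J f p - f p\<bar>)) \<le> ennreal e"
      using fin i by (subst nn_integral_eq_integral[symmetric]) auto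
    then have "integral\<^sup>L lborel (\<lambda>p. \<bar>mollify J f p - f p\<bar>) \<le> e" using \<open>e > 0\<close> by simp
    moreover have "integrable lborel (mollify J f)"
      using Bochner_Integration.integrable_add[OF i f] by simp
    ultimately show "integrable lborel (mollify J f) \<and> integral\<^sup>L lborel (\<lambda>p. \<bar>mollify J f p - f p\<bar>) \<le> e"
      by simp
  qed
qed

section \<open>Kato's inequality\<close>

lemma smooth_ball_support_bounded:
  assumes "smooth J" "\<And>p. \<epsilon> \<le> norm p \<Longrightarrow> J p = 0"
  obtains M where "\<And>p. \<bar>J p\<bar> \<le> M"
proof -
  have "continuous_on UNIV J" using assms(1) by (auto simp: smooth_def intro: Ck_imp_continuous)
  moreover have "J p = 0" if "p \<notin> cball 0 \<epsilon>" for p using assms(2) that by auto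
  ultimately show ?thesis using compact_support_bounded[OF _ compact_cball[of 0 \<epsilon>]] that by metis
qed

lemma integrable_mult_bounded:
  fixes f g :: "'a \<Rightarrow> real"
  assumes "integrable M f" "g \<in> borel_measurable M" "\<And>x. \<bar>g x\<bar> \<le> B"
  shows "integrable M (\<lambda>x. g x * f x)" "integrable M (\<lambda>x. f x * g x)"
proof -
  show "integrable M (\<lambda>x. g x * f x)"
  proof (rule Bochner_Integration.integrable_bound[of _ "\<lambda>x. B * f x"])
    show "AE x in M. norm (g x * f x) \<le> norm (B * f x)"
    proof (rule AE_I2)
      fix x show "norm (g x * f x) \<le> norm (B * f x)"
        using mult_right_mono[OF order_trans[OF assms(3)[of x] abs_ge_self], of "\<bar>f x\<bar>"] by (simp add: abs_mult)
    qed
  qed (use assms in auto)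
  then show "integrable M (\<lambda>x. f x * g x)" by (simp add: mult.commute)
qed

lemma integrable_bounded_support:
  fixes f :: "'a::euclidean_space \<Rightarrow> real"
  assumes "f \<in> borel_measurable borel" "compact K" "\<And>x. x \<notin> K \<Longrightarrow> f x = 0" "\<And>x. \<bar>f x\<bar> \<le> B"
  shows "integrable lborel f"
proof -
  have "integrable lborel (\<lambda>x. f x * indicat_real K x)"
    by (rule integrable_mult_bounded(1)[OF integrable_indicator_compact[OF assms(2)], of f B]) (use assms in auto)
  moreover have "(\<lambda>x. f x * indicat_real K x) = f" using assms(3) by (fastforce simp: indicator_def)
  ultimately show ?thesis by simp
qed

text \<open>The operator \<open>L\<close> is the limit of the adjoints of the difference operators
  \<open>F \<mapsto> \<Sum>v\<in>V. c k * (F (p + h k v) - F p)\<close> with nonnegative weights. Convexity survives such differences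
  without any regularity of \<open>F\<close>, so that no derivative ever falls on a mollified function.\<close>

locale difference_operator =
  fixes V :: "'a::euclidean_space set" and c h :: "nat \<Rightarrow> real"
    and L :: "('a \<Rightarrow> real) \<Rightarrow> 'a \<Rightarrow> real"
  assumes finite_V: "finite V" and c_nonneg: "\<And>k. 0 \<le> c k"
    and L_limit: "\<And>\<eta> y. smooth \<eta> \<Longrightarrow>
      (\<lambda>k. \<Sum>v\<in>V. c k * (\<eta> (y - h k *\<^sub>R v) - \<eta> y)) \<longlonglongrightarrow> L \<eta> y"
    and L_bound: "\<And>\<eta> K. smooth \<eta> \<Longrightarrow> compact K \<Longrightarrow> (\<And>y. y \<notin> K \<Longrightarrow> \<eta> y = 0) \<Longrightarrow>
      \<exists>C. \<forall>k y. \<bar>\<Sum>v\<in>V. c k * (\<eta> (y - h k *\<^sub>R v) - \<eta> y)\<bar> \<le> C"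
begin

text \<open>\<open>D\<close> is meant for the unknown; \<open>D'\<close>, with the opposite step, is
  its formal adjoint and is meant for test functions.\<close>

definition D :: "nat \<Rightarrow> ('a \<Rightarrow> real) \<Rightarrow> 'a \<Rightarrow> real" where
  "D k F p = (\<Sum>v\<in>V. c k * (F (p + h k *\<^sub>R v) - F p))"

definition D' :: "nat \<Rightarrow> ('a \<Rightarrow> real) \<Rightarrow> 'a \<Rightarrow> real" where
  "D' k F p = (\<Sum>v\<in>V. c k * (F (p - h k *\<^sub>R v) - F p))"

lemma D_measurable [measurable]:
  assumes [measurable]: "F \<in> borel_measurable borel"
  shows "D k F \<in> borel_measurable borel"
  unfolding D_def[abs_def] by measurable

lemma D'_measurable [measurable]:
  assumes [measurable]: "F \<in> borel_measurable borel"
  shows "D' k F \<in> borel_measurable borel"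
  unfolding D'_def[abs_def] by measurable

text \<open>The subgradient inequality for \<open>j\<close> survives multiplication by nonnegative
  weights and summation: a discrete Kato inequality without any regularity of F.\<close>

lemma D_convex:
  assumes "\<And>x y. j' x * (y - x) \<le> j y - j x"
  shows "j' (F p) * D k F p \<le> D k (\<lambda>p. j (F p)) p"
  unfolding D_def sum_distrib_left
proof (rule sum_mono)
  fix v
  have "c k * (j' (F p) * (F (p + h k *\<^sub>R v) - F p)) \<le> c k * (j (F (p + h k *\<^sub>R v)) - j (F p))"
    using assms c_nonneg by (intro mult_left_mono) auto
  then show "j' (F p) * (c k * (F (p + h k *\<^sub>R v) - F p)) \<le> c k * (j (F (p + h k *\<^sub>R v)) - j (F p))"
    by (simp add: mult_ac)
qed

text \<open>Summation by parts: translating the integration variable moves each step to the other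
  factor. A bounded H against an integrable \<phi> makes every summand integrable.\<close>

lemma D_adjoint:
  assumes [measurable]: "H \<in> borel_measurable borel" and H: "\<And>p. \<bar>H p\<bar> \<le> B"
    and \<phi>: "integrable lborel \<phi>"
  shows "integral\<^sup>L lborel (\<lambda>p. D k H p * \<phi> p) = integral\<^sup>L lborel (\<lambda>p. H p * D' k \<phi> p)"
proof -
  have [measurable]: "\<phi> \<in> borel_measurable borel" using \<phi> by auto
  have bdd: "integrable lborel (\<lambda>p. H (p + s) * \<phi> p)" for s
    by (rule integrable_mult_bounded(1)[OF \<phi> _ H]) measurable
  have shift: "integral\<^sup>L lborel (\<lambda>p. H (p + s) * \<phi> p) = integral\<^sup>L lborel (\<lambda>p. H p * \<phi> (p - s))"
    "integrable lborel (\<lambda>p. H p * \<phi> (p - s))" for s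
    using lborel_integral_translate(1,2)[of "\<lambda>p. H p * \<phi> (p - s)" s] bdd[of s] by simp_all
  have i0: "integrable lborel (\<lambda>p. H p * \<phi> p)" using bdd[of 0] by simp
  have e1: "D k H p * \<phi> p = (\<Sum>v\<in>V. c k * (H (p + h k *\<^sub>R v) * \<phi> p - H p * \<phi> p))" for p
    unfolding D_def sum_distrib_right by (intro sum.cong) (auto simp: algebra_simps)
  have e2: "H p * D' k \<phi> p = (\<Sum>v\<in>V. c k * (H p * \<phi> (p - h k *\<^sub>R v) - H p * \<phi> p))" for p
    unfolding D'_def sum_distrib_left by (intro sum.cong) (auto simp: algebra_simps)
  have "integral\<^sup>L lborel (\<lambda>p. D k H p * \<phi> p) =
     integral\<^sup>L lborel (\<lambda>p. \<Sum>v\<in>V. c k * (H (p + h k *\<^sub>R v) * \<phi> p - H p * \<phi> p))"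
    by (simp only: e1)
  also have "\<dots> = (\<Sum>v\<in>V. integral\<^sup>L lborel (\<lambda>p. c k * (H (p + h k *\<^sub>R v) * \<phi> p - H p * \<phi> p)))"
    using bdd i0 by (intro Bochner_Integration.integral_sum) auto
  also have "\<dots> = (\<Sum>v\<in>V. integral\<^sup>L lborel (\<lambda>p. c k * (H p * \<phi> (p - h k *\<^sub>R v) - H p * \<phi> p)))"
    using bdd i0 shift by simp
  also have "\<dots> = integral\<^sup>L lborel (\<lambda>p. \<Sum>v\<in>V. c k * (H p * \<phi> (p - h k *\<^sub>R v) - H p * \<phi> p))"
    using shift i0 by (intro Bochner_Integration.integral_sum[symmetric]) auto
  also have "\<dots> = integral\<^sup>L lborel (\<lambda>p. H p * D' k \<phi> p)"
    by (simp only: e2)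
  finally show ?thesis .
qed

text \<open>A step in p of the kernel J (p - y) is the opposite step in y, so the difference falls
  on the smooth kernel and Z stays untouched.\<close>

lemma D_mollify_eq:
  assumes Z: "integrable lborel Z" and J: "smooth J" "\<And>p. \<epsilon> \<le> norm p \<Longrightarrow> J p = 0"
  shows "D k (mollify J Z) p = integral\<^sup>L lborel (\<lambda>y. Z y * D' k (\<lambda>y. J (p - y)) y)"
proof -
  have cont: "continuous_on UNIV J" using J(1) by (auto simp: smooth_def intro: Ck_imp_continuous)
  then have [measurable]: "J \<in> borel_measurable borel" by (rule borel_measurable_continuous_onI)
  have [measurable]: "Z \<in> borel_measurable borel" using Z by auto
  obtain M where M: "\<And>p. \<bar>J p\<bar> \<le> M" using smooth_ball_support_bounded[OF J] by blast
  have i: "integrable lborel (\<lambda>y. Z y * J (p - y))" for p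
    by (rule integrable_mult_bounded(2)[OF Z _ M]) measurable
  have e: "Z y * D' k (\<lambda>y. J (p - y)) y =
      (\<Sum>v\<in>V. c k * (Z y * J (p + h k *\<^sub>R v - y) - Z y * J (p - y)))" for y
    unfolding D'_def sum_distrib_left by (intro sum.cong) (auto simp: algebra_simps)
  have "D k (mollify J Z) p = (\<Sum>v\<in>V. integral\<^sup>L lborel (\<lambda>y. c k * (Z y * J (p + h k *\<^sub>R v - y) - Z y * J (p - y))))"
    unfolding D_def mollify_def using i by simp
  also have "\<dots> = integral\<^sup>L lborel (\<lambda>y. \<Sum>v\<in>V. c k * (Z y * J (p + h k *\<^sub>R v - y) - Z y * J (p - y)))"
    using i by (intro Bochner_Integration.integral_sum[symmetric]) auto
  also have "\<dots> = integral\<^sup>L lborel (\<lambda>y. Z y * D' k (\<lambda>y. J (p - y)) y)"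
    by (simp only: e)
  finally show ?thesis .
qed

text \<open>The expression depends on y - p only, so the bound for p = 0 is uniform in p.\<close>

lemma D'_reflect_bound:
  assumes J: "\<And>p. smooth (\<lambda>y. J (p - y))" "\<And>p. \<epsilon> \<le> norm p \<Longrightarrow> J p = 0"
  obtains C where "\<And>k p y. \<bar>D' k (\<lambda>y. J (p - y)) y\<bar> \<le> C"
proof -
  have "\<exists>C. \<forall>k y. \<bar>\<Sum>v\<in>V. c k * (J (0 - (y - h k *\<^sub>R v)) - J (0 - y))\<bar> \<le> C"
    by (rule L_bound[OF J(1) compact_cball[of 0 \<epsilon>]]) (use J(2) in auto)
  then obtain C where C: "\<And>k y. \<bar>D' k (\<lambda>y. J (0 - y)) y\<bar> \<le> C" unfolding D'_def by blast
  have "\<bar>D' k (\<lambda>y. J (p - y)) y\<bar> \<le> C" for k p y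
    using C[of k "y - p"] by (simp add: D'_def algebra_simps)
  then show ?thesis using that by blast
qed

lemma D_mollify_bound:
  assumes Z: "integrable lborel Z" and J: "\<And>p. smooth (\<lambda>y. J (p - y))" "smooth J"
    "\<And>p. \<epsilon> \<le> norm p \<Longrightarrow> J p = 0"
  obtains C where "\<And>k p. \<bar>D k (mollify J Z) p\<bar> \<le> C"
proof -
  obtain C where C: "\<And>k p y. \<bar>D' k (\<lambda>y. J (p - y)) y\<bar> \<le> C" using D'_reflect_bound J(1,3) by blast
  have bnd: "\<bar>Z y * D' k (\<lambda>y. J (p - y)) y\<bar> \<le> C * \<bar>Z y\<bar>" for k p y
    using mult_right_mono[OF C, of "\<bar>Z y\<bar>"] by (simp add: abs_mult mult.commute)
  have "\<bar>D k (mollify J Z) p\<bar> \<le> integral\<^sup>L lborel (\<lambda>y. C * \<bar>Z y\<bar>)" for k p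
  proof -
    have "\<bar>D k (mollify J Z) p\<bar> \<le> integral\<^sup>L lborel (\<lambda>y. \<bar>Z y * D' k (\<lambda>y. J (p - y)) y\<bar>)"
      using integral_abs_bound by (subst D_mollify_eq[OF Z J(2,3)]) auto
    also have "\<dots> \<le> integral\<^sup>L lborel (\<lambda>y. C * \<bar>Z y\<bar>)"
      using Z bnd by (intro integral_mono') (auto intro: order_trans[OF _ bnd])
    finally show ?thesis .
  qed
  then show ?thesis using that by blast
qed

text \<open>\<open>D k\<close> of a mollified function is controlled by testing the weak equation with the
  mollifier itself.\<close>

lemma D_mollify_LIMSEQ:
  assumes Z: "integrable lborel Z" and J: "\<And>p. smooth (\<lambda>y. J (p - y))" "smooth J"
    "\<And>p. \<epsilon> \<le> norm p \<Longrightarrow> J p = 0"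
    and weak: "integral\<^sup>L lborel (\<lambda>y. Z y * L (\<lambda>y. J (p - y)) y) = integral\<^sup>L lborel (\<lambda>y. G y * J (p - y))"
  shows "(\<lambda>k. D k (mollify J Z) p) \<longlonglongrightarrow> mollify J G p"
proof -
  have cont: "continuous_on UNIV J" using J(2) by (auto simp: smooth_def intro: Ck_imp_continuous)
  then have [measurable]: "J \<in> borel_measurable borel" by (rule borel_measurable_continuous_onI)
  have [measurable]: "Z \<in> borel_measurable borel" using Z by auto
  obtain C where C: "\<And>k p y. \<bar>D' k (\<lambda>y. J (p - y)) y\<bar> \<le> C" using D'_reflect_bound J(1,3) by blast
  have bnd: "\<bar>Z y * D' k (\<lambda>y. J (p - y)) y\<bar> \<le> C * \<bar>Z y\<bar>" for k p y
    using mult_right_mono[OF C, of "\<bar>Z y\<bar>"] by (simp add: abs_mult mult.commute)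
  have "(\<lambda>k. integral\<^sup>L lborel (\<lambda>y. Z y * D' k (\<lambda>y. J (p - y)) y)) \<longlonglongrightarrow>
     integral\<^sup>L lborel (\<lambda>y. Z y * L (\<lambda>y. J (p - y)) y)"
  proof (rule integral_dominated_convergence[where w = "\<lambda>y. C * \<bar>Z y\<bar>"])
    have lim: "(\<lambda>k. D' k (\<lambda>y. J (p - y)) y) \<longlonglongrightarrow> L (\<lambda>y. J (p - y)) y" for y
      unfolding D'_def by (rule L_limit[OF J(1)])
    have "(\<lambda>y. L (\<lambda>y. J (p - y)) y) \<in> borel_measurable borel"
      by (rule borel_measurable_LIMSEQ_real[OF lim]) measurable
    then show "(\<lambda>y. Z y * L (\<lambda>y. J (p - y)) y) \<in> borel_measurable lborel" by simp
    show "AE y in lborel. (\<lambda>k. Z y * D' k (\<lambda>y. J (p - y)) y) \<longlonglongrightarrow> Z y * L (\<lambda>y. J (p - y)) y"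
      by (intro AE_I2 tendsto_mult lim tendsto_const)
    show "AE y in lborel. norm (Z y * D' k (\<lambda>y. J (p - y)) y) \<le> C * \<bar>Z y\<bar>" for k
      using bnd by simp
  qed (use Z in auto)
  then show ?thesis
    unfolding weak by (simp add: D_mollify_eq[OF Z J(2,3)]) (simp add: mollify_def)
qed

end

context difference_operator
begin

text \<open>At fixed k this is convexity followed by adjointness; then k tends to infinity by
  dominated convergence on both sides. The conditions on \<phi> speak of its difference quotients
  alone, which admits a cut-off that is merely Lipschitz in time.\<close>

lemma kato_mollified:
  assumes Z: "integrable lborel Z" and J: "\<And>p. smooth (\<lambda>y. J (p - y))" "smooth J"
    "\<And>p. \<epsilon> \<le> norm p \<Longrightarrow> J p = 0"
    and weak: "\<And>p. p \<in> K \<Longrightarrow> integral\<^sup>L lborel (\<lambda>y. Z y * L (\<lambda>y. J (p - y)) y) = integral\<^sup>L lborel (\<lambda>y. G y * J (p - y))"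
    and G: "integrable lborel G"
    and \<phi> [measurable]: "\<phi> \<in> borel_measurable borel" and \<phi>0: "\<And>p. 0 \<le> \<phi> p" and \<phi>B: "\<And>p. \<phi> p \<le> B"
    and K: "compact K" "\<And>p. p \<notin> K \<Longrightarrow> \<phi> p = 0"
    and \<phi>' [measurable]: "\<phi>' \<in> borel_measurable borel"
    and lim: "AE p in lborel. (\<lambda>k. D' k \<phi> p) \<longlonglongrightarrow> \<phi>' p"
    and K': "compact K'" "\<And>p k. p \<notin> K' \<Longrightarrow> D' k \<phi> p = 0" and bnd: "\<And>p k. \<bar>D' k \<phi> p\<bar> \<le> B'"
    and j: "\<And>x y. j' x * (y - x) \<le> j y - j x" "\<And>x. \<bar>j' x\<bar> \<le> 1" "\<And>x. \<bar>j x\<bar> \<le> \<bar>x\<bar>"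
    and [measurable]: "j \<in> borel_measurable borel" "j' \<in> borel_measurable borel"
  shows "integral\<^sup>L lborel (\<lambda>p. j' (mollify J Z p) * mollify J G p * \<phi> p)
    \<le> integral\<^sup>L lborel (\<lambda>p. j (mollify J Z p) * \<phi>' p)"
proof -
  have cont: "continuous_on UNIV J" using J(2) by (auto simp: smooth_def intro: Ck_imp_continuous)
  then have [measurable]: "J \<in> borel_measurable borel" by (rule borel_measurable_continuous_onI)
  have [measurable]: "Z \<in> borel_measurable borel" "G \<in> borel_measurable borel" using Z G by auto
  obtain M where M: "\<And>p. \<bar>J p\<bar> \<le> M" using smooth_ball_support_bounded[OF J(2,3)] by blast
  define N where "N = M * integral\<^sup>L lborel (\<lambda>y. \<bar>Z y\<bar>)"
  have N: "\<bar>mollify J Z p\<bar> \<le> N" for p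
    unfolding N_def by (rule mollify_bound[OF Z M])
  have jN: "\<bar>j (mollify J Z p)\<bar> \<le> N" for p using N[of p] j(3) order_trans by blast
  have N0: "0 \<le> N" using N[of undefined] by linarith
  have B'0: "0 \<le> B'" using bnd[of undefined undefined] by linarith
  have B0: "0 \<le> B" using \<phi>0 \<phi>B order_trans by blast
  obtain C where C: "\<And>k p. \<bar>D k (mollify J Z) p\<bar> \<le> C" using D_mollify_bound[OF Z J] by blast
  have int\<phi>: "integrable lborel \<phi>"
    by (rule integrable_bounded_support[OF \<phi> K]) (use \<phi>0 \<phi>B in auto)
  have mult_le: "\<bar>a * b\<bar> \<le> A * B" if "\<bar>a\<bar> \<le> A" "\<bar>b\<bar> \<le> B" for a b A B :: real
    using mult_mono[OF that] that by (simp add: abs_mult order_trans[OF abs_ge_zero])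
  have step: "integral\<^sup>L lborel (\<lambda>p. j' (mollify J Z p) * D k (mollify J Z) p * \<phi> p) \<le>
     integral\<^sup>L lborel (\<lambda>p. j (mollify J Z p) * D' k \<phi> p)" for k
  proof -
    have "\<bar>D k (\<lambda>p. j (mollify J Z p)) p\<bar> \<le> (\<Sum>v\<in>V. c k * (2 * N))" for p
      unfolding D_def
    proof (rule order_trans[OF sum_abs sum_mono])
      fix v
      have "\<bar>j (mollify J Z (p + h k *\<^sub>R v)) - j (mollify J Z p)\<bar> \<le> 2 * N"
        using jN[of "p + h k *\<^sub>R v"] jN[of p] by linarith
      then show "\<bar>c k * (j (mollify J Z (p + h k *\<^sub>R v)) - j (mollify J Z p))\<bar> \<le> c k * (2 * N)"
        using c_nonneg[of k] by (simp add: abs_mult mult_left_mono)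
    qed
    then have i2: "integrable lborel (\<lambda>p. D k (\<lambda>p. j (mollify J Z p)) p * \<phi> p)"
      by (intro integrable_mult_bounded(1)[OF int\<phi>]) auto
    have i1: "integrable lborel (\<lambda>p. j' (mollify J Z p) * D k (mollify J Z) p * \<phi> p)"
      by (rule integrable_mult_bounded(1)[OF int\<phi>, of _ "1 * C"]) (use mult_le[OF j(2) C] in auto)
    have "integral\<^sup>L lborel (\<lambda>p. j' (mollify J Z p) * D k (mollify J Z) p * \<phi> p) \<le>
      integral\<^sup>L lborel (\<lambda>p. D k (\<lambda>p. j (mollify J Z p)) p * \<phi> p)"
      by (rule integral_mono[OF i1 i2]) (use \<phi>0 D_convex[OF j(1)] in \<open>auto intro: mult_right_mono\<close>)
    also have "\<dots> = integral\<^sup>L lborel (\<lambda>p. j (mollify J Z p) * D' k \<phi> p)"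
      by (rule D_adjoint[OF _ jN int\<phi>]) measurable
    finally show ?thesis .
  qed
  have l1: "(\<lambda>k. integral\<^sup>L lborel (\<lambda>p. j' (mollify J Z p) * D k (mollify J Z) p * \<phi> p)) \<longlonglongrightarrow>
     integral\<^sup>L lborel (\<lambda>p. j' (mollify J Z p) * mollify J G p * \<phi> p)"
  proof (rule integral_dominated_convergence[where w = "\<lambda>p. C * \<phi> p"])
    have "(\<lambda>k. j' (mollify J Z p) * D k (mollify J Z) p * \<phi> p) \<longlonglongrightarrow> j' (mollify J Z p) * mollify J G p * \<phi> p" for p
    \<comment> \<open>The weak equation is available only at points p where the reflected kernel is
      an admissible test function; elsewhere \<phi> vanishes.\<close>
    proof (cases "p \<in> K")
      case True
      show ?thesis by (intro tendsto_intros D_mollify_LIMSEQ[OF Z J] weak True)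
    qed (use K in simp)
    then show "AE p in lborel. (\<lambda>k. j' (mollify J Z p) * D k (mollify J Z) p * \<phi> p) \<longlonglongrightarrow> j' (mollify J Z p) * mollify J G p * \<phi> p"
      by simp
    show "AE p in lborel. norm (j' (mollify J Z p) * D k (mollify J Z) p * \<phi> p) \<le> C * \<phi> p" for k
    proof (rule AE_I2)
      fix p show "norm (j' (mollify J Z p) * D k (mollify J Z) p * \<phi> p) \<le> C * \<phi> p"
        using mult_right_mono[OF mult_le[OF j(2) C, of "mollify J Z p" k p] \<phi>0[of p]] \<phi>0[of p] by (simp add: abs_mult)
    qed
  qed (use int\<phi> in auto)
  have l2: "(\<lambda>k. integral\<^sup>L lborel (\<lambda>p. j (mollify J Z p) * D' k \<phi> p)) \<longlonglongrightarrow>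
     integral\<^sup>L lborel (\<lambda>p. j (mollify J Z p) * \<phi>' p)"
  proof (rule integral_dominated_convergence[where w = "\<lambda>p. N * B' * indicat_real K' p"])
    show "AE p in lborel. (\<lambda>k. j (mollify J Z p) * D' k \<phi> p) \<longlonglongrightarrow> j (mollify J Z p) * \<phi>' p"
      using lim by eventually_elim (intro tendsto_intros)
    show "AE p in lborel. norm (j (mollify J Z p) * D' k \<phi> p) \<le> N * B' * indicat_real K' p" for k
    proof (rule AE_I2)
      fix p show "norm (j (mollify J Z p) * D' k \<phi> p) \<le> N * B' * indicat_real K' p"
        using mult_le[OF jN[of p] bnd[of k p]] K'(2)[of p k] by (cases "p \<in> K'") auto
    qed
  qed (use integrable_indicator_compact[OF K'(1)] in auto)
  show ?thesis by (rule LIMSEQ_le[OF l1 l2]) (use step in auto)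
qed

text \<open>Prepares the limit in products j'(Z) G with unbounded G: where \<bar>G\<bar> \<le> N the
  Lipschitz bound of j' is used, and the rest is this small tail.\<close>

lemma integrable_truncation:
  fixes G :: "'b \<Rightarrow> real"
  assumes "integrable M G" "e > 0"
  obtains N :: nat where "integral\<^sup>L M (\<lambda>p. \<bar>G p\<bar> * of_bool (\<bar>G p\<bar> > N)) \<le> e"
proof -
  have [measurable]: "G \<in> borel_measurable M" using assms by auto
  have "(\<lambda>N::nat. integral\<^sup>L M (\<lambda>p. \<bar>G p\<bar> * of_bool (\<bar>G p\<bar> > N))) \<longlonglongrightarrow> integral\<^sup>L M (\<lambda>p. 0::real)"
  proof (rule integral_dominated_convergence[where w = "\<lambda>p. \<bar>G p\<bar>"])
    show "AE p in M. (\<lambda>N::nat. \<bar>G p\<bar> * of_bool (\<bar>G p\<bar> > N)) \<longlonglongrightarrow> 0"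
    proof (rule AE_I2)
      fix p
      obtain N0 :: nat where "\<bar>G p\<bar> \<le> N0" using real_arch_simple by blast
      then have "\<forall>\<^sub>F N in sequentially. \<bar>G p\<bar> * of_bool (\<bar>G p\<bar> > real N) = 0"
        by (intro eventually_sequentiallyI[of N0]) auto
      then show "(\<lambda>N::nat. \<bar>G p\<bar> * of_bool (\<bar>G p\<bar> > N)) \<longlonglongrightarrow> 0" by (rule tendsto_eventually)
    qed
  qed (use assms in auto)
  then have "\<forall>\<^sub>F N in sequentially. integral\<^sup>L M (\<lambda>p. \<bar>G p\<bar> * of_bool (\<bar>G p\<bar> > real N)) < e"
    using assms(2) by (auto intro: order_tendstoD)
  then obtain N :: nat where "integral\<^sup>L M (\<lambda>p. \<bar>G p\<bar> * of_bool (\<bar>G p\<bar> > real N)) < e"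
    unfolding eventually_sequentially by blast
  then show ?thesis by (intro that[of N]) linarith
qed

text \<open>Removal of the mollifier. On the right, \<open>j\<close> is Lipschitz and L^1
  convergence suffices. On the left, the error splits into the L^1 error of G, the Lipschitz error
  of j' on {\<bar>G\<bar> \<le> N}, and twice the tail of G.\<close>

lemma kato_convex:
  assumes Z: "integrable lborel Z" and G: "integrable lborel G" and "open U"
    and weak: "\<And>\<eta>. test_function U \<eta> \<Longrightarrow> integral\<^sup>L lborel (\<lambda>y. Z y * L \<eta> y) = integral\<^sup>L lborel (\<lambda>y. G y * \<eta> y)"
    and \<phi> [measurable]: "\<phi> \<in> borel_measurable borel" and \<phi>0: "\<And>p. 0 \<le> \<phi> p" and \<phi>B: "\<And>p. \<phi> p \<le> B"
    and K: "compact K" "\<And>p. p \<notin> K \<Longrightarrow> \<phi> p = 0" "K \<subseteq> U"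
    and \<phi>' [measurable]: "\<phi>' \<in> borel_measurable borel" and \<phi>'B: "\<And>p. \<bar>\<phi>' p\<bar> \<le> B'"
    and lim: "AE p in lborel. (\<lambda>k. D' k \<phi> p) \<longlonglongrightarrow> \<phi>' p"
    and K': "compact K'" "\<And>p k. p \<notin> K' \<Longrightarrow> D' k \<phi> p = 0" and bnd: "\<And>p k. \<bar>D' k \<phi> p\<bar> \<le> B'"
    and j: "\<And>x y. j' x * (y - x) \<le> j y - j x" "\<And>x. \<bar>j' x\<bar> \<le> 1" "\<And>x. \<bar>j x\<bar> \<le> \<bar>x\<bar>"
    and j_lip: "\<And>x y. \<bar>j x - j y\<bar> \<le> \<bar>x - y\<bar>" "\<And>x y. \<bar>j' x - j' y\<bar> \<le> \<Lambda> * \<bar>x - y\<bar>"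
    and [measurable]: "j \<in> borel_measurable borel" "j' \<in> borel_measurable borel"
  shows "integral\<^sup>L lborel (\<lambda>p. j' (Z p) * G p * \<phi> p) \<le> integral\<^sup>L lborel (\<lambda>p. j (Z p) * \<phi>' p)"
proof (rule field_le_epsilon)
  fix e :: real assume e: "e > 0"
  have [measurable]: "Z \<in> borel_measurable borel" "G \<in> borel_measurable borel" using Z G by auto
  have B0: "0 \<le> B" using \<phi>0 \<phi>B order_trans by blast
  have B'0: "0 \<le> B'" using bnd[of undefined undefined] by linarith
  have \<Lambda>0: "0 \<le> \<Lambda>" using j_lip(2)[of 0 1] by simp
  define eG where "eG = e / (4 * (B + 1))"
  have eG: "eG > 0" "B * eG \<le> e / 4" using e B0 by (auto simp: eG_def divide_simps mult_left_mono)
  define eN where "eN = e / (8 * (B + 1))"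
  have eN: "eN > 0" "2 * B * eN \<le> e / 4" using e B0 by (auto simp: eN_def divide_simps mult_left_mono)
  obtain N :: nat where N: "integral\<^sup>L lborel (\<lambda>p. \<bar>G p\<bar> * of_bool (\<bar>G p\<bar> > N)) \<le> eN"
    using integrable_truncation[OF G eN(1)] by blast
  \<comment> \<open>\<open>Q\<close> collects both factors of the L^1 error of Z: the one from the
    truncated left side and the bound of \<phi>' on the right.\<close>
  define Q where "Q = B * N * \<Lambda> + B'"
  have Q0: "0 \<le> Q" using B0 B'0 \<Lambda>0 by (simp add: Q_def)
  define eZ where "eZ = e / (4 * (Q + 1))"
  have eZ: "eZ > 0" "Q * eZ \<le> e / 4" using e Q0 by (auto simp: eZ_def divide_simps mult_left_mono)
  obtain d1 where d1: "d1 > 0" "\<And>J M. integrable lborel J \<Longrightarrow> (\<And>p. 0 \<le> J p) \<Longrightarrow> (\<And>p. J p \<le> M) \<Longrightarrow>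
    integral\<^sup>L lborel J = 1 \<Longrightarrow> (\<And>p. d1 \<le> norm p \<Longrightarrow> J p = 0) \<Longrightarrow>
    integrable lborel (mollify J Z) \<and> integral\<^sup>L lborel (\<lambda>p. \<bar>mollify J Z p - Z p\<bar>) \<le> eZ"
    using mollify_L1[OF Z eZ(1)] by blast
  obtain d2 where d2: "d2 > 0" "\<And>J M. integrable lborel J \<Longrightarrow> (\<And>p. 0 \<le> J p) \<Longrightarrow> (\<And>p. J p \<le> M) \<Longrightarrow>
    integral\<^sup>L lborel J = 1 \<Longrightarrow> (\<And>p. d2 \<le> norm p \<Longrightarrow> J p = 0) \<Longrightarrow>
    integrable lborel (mollify J G) \<and> integral\<^sup>L lborel (\<lambda>p. \<bar>mollify J G p - G p\<bar>) \<le> eG"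
    using mollify_L1[OF G eG(1)] by blast
  obtain r where r: "r > 0" "(\<Union>x\<in>K. ball x r) \<subseteq> U"
    using compact_subset_open_imp_ball_epsilon_subset[OF K(1) \<open>open U\<close> K(3)] by blast
  \<comment> \<open>Below d1 and d2, one kernel approximates both Z and G; below r, its translates
    centred in K are supported inside U.\<close>
  define \<epsilon> where "\<epsilon> = min (min d1 d2) (r / 2)"
  have \<epsilon>: "\<epsilon> > 0" "\<epsilon> \<le> d1" "\<epsilon> \<le> d2" "\<epsilon> < r" using d1(1) d2(1) r(1) by (auto simp: \<epsilon>_def)
  obtain J :: "'a \<Rightarrow> real" where J: "\<And>p. smooth (\<lambda>y. J (p - y))" "smooth J" "\<And>p. 0 \<le> J p"
    "\<And>p. \<epsilon> \<le> norm p \<Longrightarrow> J p = 0" "integral\<^sup>L lborel J = 1" "integrable lborel J"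
    using mollifier_exists[OF \<epsilon>(1)] by blast
  obtain M where M: "\<And>p. \<bar>J p\<bar> \<le> M" using smooth_ball_support_bounded[OF J(2,4)] by blast
  have [measurable]: "J \<in> borel_measurable borel" using J(6) by auto
  have M': "J p \<le> M" for p using M[of p] by simp
  have mZ: "integrable lborel (mollify J Z)" "integral\<^sup>L lborel (\<lambda>p. \<bar>mollify J Z p - Z p\<bar>) \<le> eZ"
    using d1(2)[OF J(6,3) M' J(5)] J(4) \<epsilon>(2) by auto
  have mG: "integrable lborel (mollify J G)" "integral\<^sup>L lborel (\<lambda>p. \<bar>mollify J G p - G p\<bar>) \<le> eG"
    using d2(2)[OF J(6,3) M' J(5)] J(4) \<epsilon>(3) by auto
  have test: "test_function U (\<lambda>y. J (p - y))" if "p \<in> K" for p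
  proof -
    have sub: "closure {y. J (p - y) \<noteq> 0} \<subseteq> cball p \<epsilon>"
    proof (rule closure_minimal)
      show "{y. J (p - y) \<noteq> 0} \<subseteq> cball p \<epsilon>" using J(4) by (force simp: dist_norm)
    qed simp
    moreover have "cball p \<epsilon> \<subseteq> U" using r(2) that \<epsilon>(4) by force
    ultimately show ?thesis
      unfolding test_function_def using J(1)[of p] compact_closure bounded_subset[OF bounded_cball sub]
      by (auto simp: compact_eq_bounded_closed)
  qed
  have mol: "integral\<^sup>L lborel (\<lambda>p. j' (mollify J Z p) * mollify J G p * \<phi> p)
    \<le> integral\<^sup>L lborel (\<lambda>p. j (mollify J Z p) * \<phi>' p)"
    by (rule kato_mollified[OF Z J(1,2,4) weak[OF test] G \<phi> \<phi>0 \<phi>B K(1,2) \<phi>' lim K' bnd j]) auto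
  have pw1: "j' (Z p) * G p * \<phi> p - j' (mollify J Z p) * mollify J G p * \<phi> p \<le>
    B * \<bar>mollify J G p - G p\<bar> + (B * N * \<Lambda>) * \<bar>mollify J Z p - Z p\<bar> + 2 * B * (\<bar>G p\<bar> * of_bool (\<bar>G p\<bar> > N))" for p
  proof -
    let ?z = "mollify J Z p" and ?g = "mollify J G p"
    have a: "\<bar>j' (Z p) - j' ?z\<bar> * \<bar>G p\<bar> \<le> N * \<Lambda> * \<bar>?z - Z p\<bar> + 2 * (\<bar>G p\<bar> * of_bool (\<bar>G p\<bar> > N))"
    proof (cases "\<bar>G p\<bar> > N")
      case True
      have "\<bar>j' (Z p) - j' ?z\<bar> \<le> 2" using j(2)[of "Z p"] j(2)[of ?z] by linarith
      then have "\<bar>j' (Z p) - j' ?z\<bar> * \<bar>G p\<bar> \<le> 2 * \<bar>G p\<bar>" by (intro mult_right_mono) auto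
      then show ?thesis using True \<Lambda>0 by (simp add: add_increasing)
    next
      case False
      have "\<bar>j' (Z p) - j' ?z\<bar> * \<bar>G p\<bar> \<le> (\<Lambda> * \<bar>?z - Z p\<bar>) * N"
        using j_lip(2)[of "Z p" ?z] False \<Lambda>0 by (intro mult_mono) (auto simp: abs_minus_commute)
      then show ?thesis using False by (simp add: mult_ac)
    qed
    have b: "\<bar>j' ?z\<bar> * \<bar>?g - G p\<bar> \<le> \<bar>?g - G p\<bar>"
      using mult_right_mono[OF j(2)[of ?z], of "\<bar>?g - G p\<bar>"] by simp
    have "j' (Z p) * G p - j' ?z * ?g = (j' (Z p) - j' ?z) * G p - j' ?z * (?g - G p)" by (simp add: algebra_simps)
    also have "\<dots> \<le> \<bar>j' (Z p) - j' ?z\<bar> * \<bar>G p\<bar> + \<bar>j' ?z\<bar> * \<bar>?g - G p\<bar>"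
      unfolding abs_mult[symmetric] by linarith
    also have "\<dots> \<le> \<bar>?g - G p\<bar> + N * \<Lambda> * \<bar>?z - Z p\<bar> + 2 * (\<bar>G p\<bar> * of_bool (\<bar>G p\<bar> > N))"
      using a b by linarith
    finally have c: "j' (Z p) * G p - j' ?z * ?g \<le> \<bar>?g - G p\<bar> + N * \<Lambda> * \<bar>?z - Z p\<bar> + 2 * (\<bar>G p\<bar> * of_bool (\<bar>G p\<bar> > N))" .
    have "(j' (Z p) * G p - j' ?z * ?g) * \<phi> p \<le>
        (\<bar>?g - G p\<bar> + N * \<Lambda> * \<bar>?z - Z p\<bar> + 2 * (\<bar>G p\<bar> * of_bool (\<bar>G p\<bar> > N))) * B"
      using \<Lambda>0 by (intro order_trans[OF mult_right_mono[OF c \<phi>0] mult_left_mono[OF \<phi>B]]) auto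
    then show ?thesis by (simp add: algebra_simps)
  qed
  have \<phi>abs: "\<bar>\<phi> p\<bar> \<le> B" for p using \<phi>0[of p] \<phi>B[of p] by simp
  have iL: "integrable lborel (\<lambda>p. j' (Z p) * G p * \<phi> p)"
    "integrable lborel (\<lambda>p. j' (mollify J Z p) * mollify J G p * \<phi> p)"
    using integrable_mult_bounded(2)[OF integrable_mult_bounded(1)[OF G _ j(2)] _ \<phi>abs]
      integrable_mult_bounded(2)[OF integrable_mult_bounded(1)[OF mG(1) _ j(2)] _ \<phi>abs] by simp_all
  have int_le: "integrable lborel (\<lambda>p. j (F p))" if "integrable lborel F" for F :: "'a \<Rightarrow> real"
  proof -
    have [measurable]: "F \<in> borel_measurable borel" using that by auto
    show ?thesis
    proof (rule Bochner_Integration.integrable_bound[OF that])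
      show "AE p in lborel. norm (j (F p)) \<le> norm (F p)" unfolding real_norm_def by (rule AE_I2) (rule j(3))
    qed measurable
  qed
  have iR: "integrable lborel (\<lambda>p. j (Z p) * \<phi>' p)" "integrable lborel (\<lambda>p. j (mollify J Z p) * \<phi>' p)"
    using integrable_mult_bounded(2)[OF int_le[OF Z] _ \<phi>'B] integrable_mult_bounded(2)[OF int_le[OF mZ(1)] _ \<phi>'B]
    by simp_all
  have iT: "integrable lborel (\<lambda>p. \<bar>G p\<bar> * of_bool (\<bar>G p\<bar> > N))"
    by (rule integrable_mult_bounded(2)[where B = 1]) (use G in auto)
  have "integral\<^sup>L lborel (\<lambda>p. j' (Z p) * G p * \<phi> p) - integral\<^sup>L lborel (\<lambda>p. j' (mollify J Z p) * mollify J G p * \<phi> p)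
    = integral\<^sup>L lborel (\<lambda>p. j' (Z p) * G p * \<phi> p - j' (mollify J Z p) * mollify J G p * \<phi> p)"
    using iL by simp
  also have "\<dots> \<le> integral\<^sup>L lborel (\<lambda>p. B * \<bar>mollify J G p - G p\<bar> + (B * N * \<Lambda>) * \<bar>mollify J Z p - Z p\<bar>
      + 2 * B * (\<bar>G p\<bar> * of_bool (\<bar>G p\<bar> > N)))"
    using iL iT mZ(1) mG(1) Z G pw1
    by (intro integral_mono Bochner_Integration.integrable_diff Bochner_Integration.integrable_add integrable_mult_right integrable_abs) auto
  also have "\<dots> = B * integral\<^sup>L lborel (\<lambda>p. \<bar>mollify J G p - G p\<bar>)
      + (B * N * \<Lambda>) * integral\<^sup>L lborel (\<lambda>p. \<bar>mollify J Z p - Z p\<bar>)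
      + 2 * B * integral\<^sup>L lborel (\<lambda>p. \<bar>G p\<bar> * of_bool (\<bar>G p\<bar> > N))"
    using iT mZ(1) mG(1) Z G by (simp del: of_bool_def)
  also have "\<dots> \<le> B * eG + (B * N * \<Lambda>) * eZ + 2 * B * eN"
    using mZ(2) mG(2) N B0 \<Lambda>0 by (intro add_mono mult_left_mono) auto
  finally have 1: "integral\<^sup>L lborel (\<lambda>p. j' (Z p) * G p * \<phi> p) - integral\<^sup>L lborel (\<lambda>p. j' (mollify J Z p) * mollify J G p * \<phi> p)
     \<le> B * eG + (B * N * \<Lambda>) * eZ + 2 * B * eN" .
  have pw2: "j (mollify J Z p) * \<phi>' p - j (Z p) * \<phi>' p \<le> B' * \<bar>mollify J Z p - Z p\<bar>" for p
  proof -
    have "j (mollify J Z p) * \<phi>' p - j (Z p) * \<phi>' p \<le> \<bar>j (mollify J Z p) - j (Z p)\<bar> * \<bar>\<phi>' p\<bar>"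
      unfolding abs_mult[symmetric] left_diff_distrib by linarith
    also have "\<dots> \<le> \<bar>mollify J Z p - Z p\<bar> * B'" using j_lip(1) \<phi>'B by (intro mult_mono) auto
    finally show ?thesis by (simp add: mult.commute)
  qed
  have "integral\<^sup>L lborel (\<lambda>p. j (mollify J Z p) * \<phi>' p) - integral\<^sup>L lborel (\<lambda>p. j (Z p) * \<phi>' p) =
    integral\<^sup>L lborel (\<lambda>p. j (mollify J Z p) * \<phi>' p - j (Z p) * \<phi>' p)"
    using iR by simp
  also have "\<dots> \<le> integral\<^sup>L lborel (\<lambda>p. B' * \<bar>mollify J Z p - Z p\<bar>)"
    using iR mZ(1) Z pw2 by (intro integral_mono Bochner_Integration.integrable_diff) auto
  also have "\<dots> \<le> B' * eZ" using mZ(2) B'0 by (simp add: mult_left_mono)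
  finally have 2: "integral\<^sup>L lborel (\<lambda>p. j (mollify J Z p) * \<phi>' p) - integral\<^sup>L lborel (\<lambda>p. j (Z p) * \<phi>' p) \<le> B' * eZ" .
  have "(B * N * \<Lambda>) * eZ + B' * eZ = Q * eZ" by (simp add: Q_def algebra_simps)
  then show "integral\<^sup>L lborel (\<lambda>p. j' (Z p) * G p * \<phi> p) \<le> integral\<^sup>L lborel (\<lambda>p. j (Z p) * \<phi>' p) + e"
    using mol 1 2 eG(2) eN(2) eZ(2) e by linarith
qed

end

text \<open>\<open>x s - \<delta> s\<^sup>2 / 2\<close> is maximal over \<open>s \<in> [0, 1]\<close> at \<open>s = unit_clamp (x / \<delta>)\<close>; hence \<open>smooth_pos\<close> is a
  supremum of affine functions.\<close>

definition unit_clamp :: "real \<Rightarrow> real" where "unit_clamp x = max 0 (min 1 x)"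

definition smooth_pos :: "real \<Rightarrow> real \<Rightarrow> real" where
  "smooth_pos \<delta> x = x * unit_clamp (x / \<delta>) - \<delta> * (unit_clamp (x / \<delta>))\<^sup>2 / 2"

text \<open>The difference of the two values factors as (r - s)(y - \<delta> (r + s)/2), where r is
  the claimed maximiser; its sign is clear in each of the three regimes of the clamp.\<close>

lemma smooth_pos_max:
  assumes "\<delta> > 0" "0 \<le> s" "s \<le> 1"
  shows "y * s - \<delta> * s\<^sup>2 / 2 \<le> smooth_pos \<delta> y"
proof -
  define r where "r = unit_clamp (y / \<delta>)"
  have "0 \<le> (r - s) * (y - \<delta> * (r + s) / 2)"
  proof -
    consider "y \<le> 0" | "y \<ge> \<delta>" | "0 < y" "y < \<delta>" by linarith
    then show ?thesis
    proof cases
      case 1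
      then have "r = 0" using assms by (simp add: r_def unit_clamp_def divide_nonpos_pos)
      moreover have "0 \<le> \<delta> * s" using assms by simp
      then have "y - \<delta> * (0 + s) / 2 \<le> 0" using 1 by simp
      ultimately show ?thesis using assms(2) by (intro mult_nonpos_nonpos) auto
    next
      case 2
      then have r: "r = 1" using assms by (simp add: r_def unit_clamp_def)
      have "\<delta> * ((1 + s) / 2) \<le> \<delta> * 1" using assms by (intro mult_left_mono) auto
      then have "\<delta> * (1 + s) / 2 \<le> y" using 2 by simp
      then show ?thesis using r assms by (auto intro!: mult_nonneg_nonneg)
    next
      case 3
      then have "r = y / \<delta>" using assms by (simp add: r_def unit_clamp_def)
      then have "y = \<delta> * r" using assms by simp
      then have "(r - s) * (y - \<delta> * (r + s) / 2) = \<delta> * (r - s)\<^sup>2 / 2" by (simp add: power2_eq_square field_simps)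
      then show ?thesis using assms(1) by (simp only:) simp
    qed
  qed
  also have "\<dots> = (y * r - \<delta> * r\<^sup>2 / 2) - (y * s - \<delta> * s\<^sup>2 / 2)" by (simp add: power2_eq_square field_simps)
  finally show ?thesis by (simp add: smooth_pos_def r_def)
qed

lemma unit_clamp_range: "0 \<le> unit_clamp x" "unit_clamp x \<le> 1"
  by (auto simp: unit_clamp_def)

text \<open>The affine function of slope \<open>unit_clamp (x / \<delta>)\<close> agrees with
  \<open>smooth_pos \<delta>\<close> at x and, being one of the family in the supremum, lies below
  it everywhere.\<close>

lemma smooth_pos_convex:
  assumes "\<delta> > 0" shows "unit_clamp (x / \<delta>) * (y - x) \<le> smooth_pos \<delta> y - smooth_pos \<delta> x"
  using smooth_pos_max[OF assms unit_clamp_range, of y "x / \<delta>"] by (simp add: smooth_pos_def algebra_simps)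

lemma smooth_pos_lipschitz:
  assumes "\<delta> > 0" shows "\<bar>smooth_pos \<delta> x - smooth_pos \<delta> y\<bar> \<le> \<bar>x - y\<bar>"
proof -
  have "\<bar>unit_clamp (a / \<delta>) * b\<bar> \<le> \<bar>b\<bar>" for a b
    using unit_clamp_range[of "a / \<delta>"] by (simp add: abs_mult mult_left_le_one_le)
  from this[of x "y - x"] this[of y "x - y"] show ?thesis
    using smooth_pos_convex[OF assms, of x y] smooth_pos_convex[OF assms, of y x] by linarith
qed

lemma smooth_pos_abs: assumes "\<delta> > 0" shows "\<bar>smooth_pos \<delta> x\<bar> \<le> \<bar>x\<bar>"
  using smooth_pos_lipschitz[OF assms, of x 0] by (simp add: smooth_pos_def unit_clamp_def)

lemma unit_clamp_lipschitz: "\<bar>unit_clamp x - unit_clamp y\<bar> \<le> \<bar>x - y\<bar>"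
  by (auto simp: unit_clamp_def)

lemma unit_clamp_measurable [measurable]: "unit_clamp \<in> borel_measurable borel"
  unfolding unit_clamp_def[abs_def] by measurable

lemma smooth_pos_measurable [measurable]: "smooth_pos \<delta> \<in> borel_measurable borel"
  unfolding smooth_pos_def[abs_def] by measurable

text \<open>At x = 0 the clamp is constantly 0, so the limit is the indicator of the strict
  inequality.\<close>

lemma unit_clamp_limit: "(\<lambda>k. unit_clamp (x / inverse (real (Suc k)))) \<longlonglongrightarrow> of_bool (x > 0)"
proof (cases "x > 0")
  case True
  obtain k0 :: nat where "1 / x \<le> k0" using real_arch_simple by blast
  then have "unit_clamp (x / inverse (real (Suc k))) = of_bool (x > 0)" if "k \<ge> k0" for k
  proof -
    have "1 / x \<le> real (Suc k)" using \<open>1 / x \<le> k0\<close> that by simp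
    then have "1 \<le> x * real (Suc k)" using True by (simp add: divide_simps mult.commute)
    then show ?thesis using True by (simp add: unit_clamp_def divide_inverse min_absorb1)
  qed
  then show ?thesis by (auto intro!: tendsto_eventually eventually_sequentiallyI)
next
  case False
  have "unit_clamp (x / inverse (real (Suc k))) = 0" for k
  proof -
    have "x / inverse (real (Suc k)) \<le> 0" using False by (intro divide_nonpos_pos) auto
    then show ?thesis by (simp add: unit_clamp_def)
  qed
  then show ?thesis using False by simp
qed

lemma smooth_pos_limit: "(\<lambda>k. smooth_pos (inverse (real (Suc k))) x) \<longlonglongrightarrow> max 0 x"
proof -
  have "(\<lambda>k. x * unit_clamp (x / inverse (real (Suc k))) -
      inverse (real (Suc k)) * (unit_clamp (x / inverse (real (Suc k))))\<^sup>2 / 2)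
    \<longlonglongrightarrow> x * of_bool (x > 0) - 0 * (of_bool (x > 0))\<^sup>2 / 2"
    by (intro tendsto_intros unit_clamp_limit LIMSEQ_inverse_real_of_nat) simp
  then show ?thesis unfolding smooth_pos_def by (cases "x > 0") (auto simp: max_def)
qed

context difference_operator
begin

text \<open>The order of limits matters: the mollifier has been removed at fixed \<delta>, where the
  slope of \<open>smooth_pos\<close> has the Lipschitz constant 1/\<delta>; only now does \<delta>
  tend to zero.\<close>

lemma kato_positive:
  assumes Z: "integrable lborel Z" and G: "integrable lborel G" and "open U"
    and weak: "\<And>\<eta>. test_function U \<eta> \<Longrightarrow> integral\<^sup>L lborel (\<lambda>y. Z y * L \<eta> y) = integral\<^sup>L lborel (\<lambda>y. G y * \<eta> y)"
    and \<phi> [measurable]: "\<phi> \<in> borel_measurable borel" and \<phi>0: "\<And>p. 0 \<le> \<phi> p" and \<phi>B: "\<And>p. \<phi> p \<le> B"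
    and K: "compact K" "\<And>p. p \<notin> K \<Longrightarrow> \<phi> p = 0" "K \<subseteq> U"
    and \<phi>' [measurable]: "\<phi>' \<in> borel_measurable borel" and \<phi>'B: "\<And>p. \<bar>\<phi>' p\<bar> \<le> B'"
    and lim: "AE p in lborel. (\<lambda>k. \<Sum>v\<in>V. c k * (\<phi> (p - h k *\<^sub>R v) - \<phi> p)) \<longlonglongrightarrow> \<phi>' p"
    and K': "compact K'" "\<And>p k. p \<notin> K' \<Longrightarrow> (\<Sum>v\<in>V. c k * (\<phi> (p - h k *\<^sub>R v) - \<phi> p)) = 0"
    and bnd: "\<And>p k. \<bar>\<Sum>v\<in>V. c k * (\<phi> (p - h k *\<^sub>R v) - \<phi> p)\<bar> \<le> B'"
  shows "integral\<^sup>L lborel (\<lambda>p. of_bool (Z p > 0) * G p * \<phi> p) \<le> integral\<^sup>L lborel (\<lambda>p. max 0 (Z p) * \<phi>' p)"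
proof -
  have [measurable]: "Z \<in> borel_measurable borel" "G \<in> borel_measurable borel" using Z G by auto
  define \<delta> where "\<delta> k = inverse (real (Suc k))" for k
  have \<delta>: "\<delta> k > 0" for k by (simp add: \<delta>_def)
  have le: "integral\<^sup>L lborel (\<lambda>p. unit_clamp (Z p / \<delta> k) * G p * \<phi> p) \<le>
      integral\<^sup>L lborel (\<lambda>p. smooth_pos (\<delta> k) (Z p) * \<phi>' p)" for k
  proof (rule kato_convex[OF Z G \<open>open U\<close> weak \<phi> \<phi>0 \<phi>B K \<phi>' \<phi>'B lim[folded D'_def] K'[folded D'_def] bnd[folded D'_def]])
    show "\<bar>unit_clamp (x / \<delta> k) - unit_clamp (y / \<delta> k)\<bar> \<le> inverse (\<delta> k) * \<bar>x - y\<bar>" for x y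
    proof -
      have "\<bar>x / \<delta> k - y / \<delta> k\<bar> = inverse (\<delta> k) * \<bar>x - y\<bar>"
        using \<delta>[of k] unfolding diff_divide_distrib[symmetric] abs_divide by (simp add: field_simps)
      then show ?thesis using unit_clamp_lipschitz[of "x / \<delta> k" "y / \<delta> k"] by simp
    qed
    show "\<bar>unit_clamp (x / \<delta> k)\<bar> \<le> 1" for x using unit_clamp_range[of "x / \<delta> k"] by simp
  qed (use \<delta> smooth_pos_convex smooth_pos_abs smooth_pos_lipschitz in auto)
  have \<phi>abs: "\<bar>\<phi> p\<bar> \<le> B" for p using \<phi>0[of p] \<phi>B[of p] by simp
  have l1: "(\<lambda>k. integral\<^sup>L lborel (\<lambda>p. unit_clamp (Z p / \<delta> k) * G p * \<phi> p)) \<longlonglongrightarrow>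
    integral\<^sup>L lborel (\<lambda>p. of_bool (Z p > 0) * G p * \<phi> p)"
  proof (rule integral_dominated_convergence[where w = "\<lambda>p. \<bar>G p\<bar> * B"])
    show "AE p in lborel. (\<lambda>k. unit_clamp (Z p / \<delta> k) * G p * \<phi> p) \<longlonglongrightarrow> of_bool (Z p > 0) * G p * \<phi> p"
      unfolding \<delta>_def by (intro AE_I2 tendsto_intros unit_clamp_limit)
    show "AE p in lborel. norm (unit_clamp (Z p / \<delta> k) * G p * \<phi> p) \<le> \<bar>G p\<bar> * B" for k
    proof (rule AE_I2)
      fix p
      have "\<bar>unit_clamp (Z p / \<delta> k) * G p\<bar> \<le> \<bar>G p\<bar>"
        using unit_clamp_range[of "Z p / \<delta> k"] by (simp add: abs_mult mult_left_le_one_le)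
      then show "norm (unit_clamp (Z p / \<delta> k) * G p * \<phi> p) \<le> \<bar>G p\<bar> * B"
        unfolding real_norm_def abs_mult[of _ "\<phi> p"] by (intro mult_mono \<phi>abs) auto
    qed
  qed (use G in auto)
  have l2: "(\<lambda>k. integral\<^sup>L lborel (\<lambda>p. smooth_pos (\<delta> k) (Z p) * \<phi>' p)) \<longlonglongrightarrow>
    integral\<^sup>L lborel (\<lambda>p. max 0 (Z p) * \<phi>' p)"
  proof (rule integral_dominated_convergence[where w = "\<lambda>p. \<bar>Z p\<bar> * B'"])
    show "AE p in lborel. (\<lambda>k. smooth_pos (\<delta> k) (Z p) * \<phi>' p) \<longlonglongrightarrow> max 0 (Z p) * \<phi>' p"
      unfolding \<delta>_def by (intro AE_I2 tendsto_intros smooth_pos_limit)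
    show "AE p in lborel. norm (smooth_pos (\<delta> k) (Z p) * \<phi>' p) \<le> \<bar>Z p\<bar> * B'" for k
      using \<phi>'B smooth_pos_abs[OF \<delta>] by (intro AE_I2) (auto simp: abs_mult intro!: mult_mono)
  qed (use Z in auto)
  show ?thesis by (rule LIMSEQ_le[OF l1 l2]) (use le in auto)
qed

end

section \<open>The slicewise Laplacian and time derivative as difference operators on
  space-time\<close>

lemma partial_deriv_slice_fst:
  fixes \<eta> :: "'a::euclidean_space \<times> real \<Rightarrow> real"
  assumes "\<eta> differentiable (at (x, t))"
  shows "partial_deriv b (\<lambda>y. \<eta> (y, t)) x = partial_deriv (b, 0) \<eta> (x, t)"
proof -
  have "((\<lambda>y. (y, t)) has_derivative (\<lambda>h. (h, 0))) (at x)" by (auto intro!: derivative_eq_intros)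
  from partial_deriv_eq[OF has_derivative_compose[OF this partial_deriv_has_derivative[OF assms]]]
  show ?thesis .
qed

lemma partial_deriv_slice_snd:
  fixes \<eta> :: "'a::euclidean_space \<times> real \<Rightarrow> real"
  assumes "\<eta> differentiable (at (x, t))"
  shows "((\<lambda>s. \<eta> (x, s)) has_real_derivative partial_deriv (0, 1) \<eta> (x, t)) (at t)"
proof -
  have "\<eta> differentiable (at ((x, t) + 0 *\<^sub>R (0, 1)))" using assms by simp
  from has_real_derivative_line[OF this]
  have "((\<lambda>s. \<eta> (x, t + s)) has_real_derivative partial_deriv (0, 1) \<eta> (x, t)) (at 0)" by simp
  then show ?thesis using DERIV_shift[of "\<lambda>s. \<eta> (x, s)" _ 0 t] by (simp add: add.commute)
qed

text \<open>The weak formulation differentiates slices of a test function, while smoothness is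
  stated on the product space; this translates one into the other.\<close>

lemma laplacian_slice:
  fixes \<eta> :: "'a::euclidean_space \<times> real \<Rightarrow> real"
  assumes "Ck 2 \<eta>"
  shows "laplacian (\<lambda>y. \<eta> (y, t)) x = (\<Sum>b\<in>Basis. partial_deriv (b, 0) (partial_deriv (b, 0) \<eta>) (x, t))"
  unfolding laplacian_def
proof (rule sum.cong)
  fix b :: 'a assume "b \<in> Basis"
  then have b: "(b, 0::real) \<in> Basis" by (simp add: Basis_prod_def)
  have d: "\<eta> differentiable (at p)" "partial_deriv (b, 0) \<eta> differentiable (at p)" for p
    using assms b by (simp_all only: numeral_2_eq_2 Ck.simps)
  have "partial_deriv b (\<lambda>y. \<eta> (y, t)) = (\<lambda>y. partial_deriv (b, 0) \<eta> (y, t))"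
    using partial_deriv_slice_fst[OF d(1)] by blast
  then show "partial_deriv b (partial_deriv b (\<lambda>y. \<eta> (y, t))) x = partial_deriv (b, 0) (partial_deriv (b, 0) \<eta>) (x, t)"
    using partial_deriv_slice_fst[OF d(2)] by simp
qed simp

text \<open>Both signs of every spatial direction: a second difference then is a sum of two first
  differences with the same positive weight 1/h^2, as the sign condition in
  \<open>difference_operator\<close> demands.\<close>

definition lap_dirs :: "('a::euclidean_space \<times> real) set" where
  "lap_dirs = (\<lambda>b. (b, 0)) ` Basis \<union> (\<lambda>b. (- b, 0)) ` Basis"

lemma sum_lap_dirs:
  fixes f :: "'a::euclidean_space \<times> real \<Rightarrow> real"
  shows "(\<Sum>v\<in>lap_dirs. f v) = (\<Sum>b\<in>Basis. f (b, 0) + f (- b, 0))"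
proof -
  have "(b, 0::real) \<noteq> (- b', 0)" if "b \<in> Basis" "b' \<in> Basis" for b b' :: 'a
  proof
    assume "(b, 0::real) = (- b', 0)"
    then have "b \<bullet> b' = - (b' \<bullet> b')" by simp
    then show False using that inner_Basis[of b b'] inner_Basis[of b' b'] by (auto split: if_splits)
  qed
  then have "(\<Sum>v\<in>lap_dirs. f v) = (\<Sum>v\<in>(\<lambda>b. (b, 0)) ` Basis. f v) + (\<Sum>v\<in>(\<lambda>b. (- b, 0)) ` Basis. f v)"
    unfolding lap_dirs_def by (intro sum.union_disjoint) auto
  also have "\<dots> = (\<Sum>b\<in>Basis. f (b, 0)) + (\<Sum>b\<in>Basis. f (- b, 0))"
    by (subst (1 2) sum.reindex) (auto simp: inj_on_def)
  finally show ?thesis by (simp add: sum.distrib)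
qed

abbreviation (input) "hstep k \<equiv> inverse (real (Suc k))"

lemma second_difference_sum_bound:
  fixes \<eta> :: "'a::euclidean_space \<Rightarrow> real"
  assumes "Ck 2 \<eta>" "compact K" "\<And>y. y \<notin> K \<Longrightarrow> \<eta> y = 0" "finite B" "B \<subseteq> Basis"
  obtains C where "\<And>h y. h > 0 \<Longrightarrow>
    \<bar>\<Sum>b\<in>B. (\<eta> (y + h *\<^sub>R b) + \<eta> (y - h *\<^sub>R b) - 2 * \<eta> y) / h\<^sup>2\<bar> \<le> C"
proof -
  have "\<exists>C. \<forall>y. \<bar>partial_deriv b (partial_deriv b \<eta>) y\<bar> \<le> C" if "b \<in> B" for b
  proof -
    have b: "b \<in> Basis" using that assms(5) by auto
    have "continuous_on UNIV (partial_deriv b (partial_deriv b \<eta>))"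
      using assms(1) b by (auto simp: numeral_2_eq_2)
    moreover have "partial_deriv b (partial_deriv b \<eta>) y = 0" if "y \<notin> K" for y
      using that assms(2,3) by (auto intro!: partial_deriv_zero_outside[of K] dest: compact_imp_closed)
    ultimately show ?thesis using compact_support_bounded[OF _ assms(2)] by metis
  qed
  then obtain C where C: "\<And>b y. b \<in> B \<Longrightarrow> \<bar>partial_deriv b (partial_deriv b \<eta>) y\<bar> \<le> C b" by metis
  show ?thesis
  proof (rule that[of "sum C B"])
    fix h :: real and y :: 'a assume h: "h > 0"
    show "\<bar>\<Sum>b\<in>B. (\<eta> (y + h *\<^sub>R b) + \<eta> (y - h *\<^sub>R b) - 2 * \<eta> y) / h\<^sup>2\<bar> \<le> sum C B"
    proof (rule order_trans[OF sum_abs sum_mono])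
      fix b assume b: "b \<in> B"
      then have "b \<in> Basis" using assms(5) by auto
      from second_difference_bound[OF assms(1) this h C[OF b], of y]
      show "\<bar>(\<eta> (y + h *\<^sub>R b) + \<eta> (y - h *\<^sub>R b) - 2 * \<eta> y) / h\<^sup>2\<bar> \<le> C b"
        using h by (simp add: abs_divide divide_simps mult.commute)
    qed
  qed
qed

lemma difference_operator_laplacian:
  "difference_operator lap_dirs (\<lambda>k. 1 / (hstep k)\<^sup>2) (\<lambda>k. hstep k)
     (\<lambda>\<eta> (x::'a::euclidean_space, t). laplacian (\<lambda>y. \<eta> (y, t)) x)"
proof
  have B: "(\<lambda>b. (b, 0::real)) ` (Basis :: 'a set) \<subseteq> Basis" by (auto simp: Basis_prod_def)
  have eq: "(\<Sum>v\<in>lap_dirs. 1 / (hstep k)\<^sup>2 * (\<eta> (y - hstep k *\<^sub>R v) - \<eta> y)) =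
    (\<Sum>b\<in>(\<lambda>b. (b, 0)) ` Basis. (\<eta> (y + hstep k *\<^sub>R b) + \<eta> (y - hstep k *\<^sub>R b) - 2 * \<eta> y) / (hstep k)\<^sup>2)"
    for k y and \<eta> :: "'a \<times> real \<Rightarrow> real"
  proof -
    have "1 / (hstep k)\<^sup>2 * (\<eta> (y - hstep k *\<^sub>R (b, 0)) - \<eta> y) + 1 / (hstep k)\<^sup>2 * (\<eta> (y - hstep k *\<^sub>R (- b, 0)) - \<eta> y)
      = (\<eta> (y + hstep k *\<^sub>R (b, 0)) + \<eta> (y - hstep k *\<^sub>R (b, 0)) - 2 * \<eta> y) / (hstep k)\<^sup>2" for b
    proof -
      have "y - hstep k *\<^sub>R (- b, 0) = y + hstep k *\<^sub>R (b, 0)" by (simp add: prod_eq_iff)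
      then show ?thesis by (simp only: diff_divide_distrib add_divide_distrib) (simp add: divide_inverse algebra_simps)
    qed
    then show ?thesis unfolding sum_lap_dirs by (subst sum.reindex) (auto simp: inj_on_def)
  qed
  show "(\<lambda>k. \<Sum>v\<in>lap_dirs. 1 / (hstep k)\<^sup>2 * (\<eta> (y - hstep k *\<^sub>R v) - \<eta> y))
      \<longlonglongrightarrow> (case y of (x, t) \<Rightarrow> laplacian (\<lambda>y. \<eta> (y, t)) x)"
    if "smooth \<eta>" for \<eta> and y :: "'a \<times> real"
  proof -
    have C2: "Ck 2 \<eta>" using that by (simp add: smooth_def)
    have "(\<lambda>k. \<Sum>b\<in>(\<lambda>b. (b, 0)) ` Basis. (\<eta> (y + hstep k *\<^sub>R b) + \<eta> (y - hstep k *\<^sub>R b) - 2 * \<eta> y) / (hstep k)\<^sup>2)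
      \<longlonglongrightarrow> (\<Sum>b\<in>(\<lambda>b. (b, 0)) ` Basis. partial_deriv b (partial_deriv b \<eta>) y)"
      using B by (intro tendsto_sum second_difference_LIMSEQ[OF C2] LIMSEQ_inverse_real_of_nat) auto
    also have "(\<Sum>b\<in>(\<lambda>b. (b, 0)) ` Basis. partial_deriv b (partial_deriv b \<eta>) y) =
       (case y of (x, t) \<Rightarrow> laplacian (\<lambda>y. \<eta> (y, t)) x)"
      by (subst sum.reindex) (auto simp: inj_on_def laplacian_slice[OF C2] split: prod.split)
    finally show ?thesis unfolding eq .
  qed
  show "\<exists>C. \<forall>k y. \<bar>\<Sum>v\<in>lap_dirs. 1 / (hstep k)\<^sup>2 * (\<eta> (y - hstep k *\<^sub>R v) - \<eta> y)\<bar> \<le> C"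
    if "smooth \<eta>" "compact K" "\<And>y. y \<notin> K \<Longrightarrow> \<eta> y = 0" for \<eta> and K :: "('a \<times> real) set"
  proof -
    have "Ck 2 \<eta>" using that by (simp add: smooth_def)
    from second_difference_sum_bound[OF this that(2,3) _ B]
    obtain C where C: "\<And>h y. h > 0 \<Longrightarrow>
      \<bar>\<Sum>b\<in>(\<lambda>b. (b, 0)) ` Basis. (\<eta> (y + h *\<^sub>R b) + \<eta> (y - h *\<^sub>R b) - 2 * \<eta> y) / h\<^sup>2\<bar> \<le> C"
      using finite_imageI[OF finite_Basis] by blast
    show ?thesis unfolding eq by (intro exI[of _ C] allI C) simp
  qed
qed (auto simp: lap_dirs_def)

text \<open>The direction (0, -1) makes the adjoint quotient look forward in time and converge to
  plus the time derivative of the test function; on the unknown the operator approximates minus the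
  time derivative.\<close>

lemma difference_operator_time:
  "difference_operator {(0, -1)} (\<lambda>k. 1 / hstep k) (\<lambda>k. hstep k)
     (\<lambda>\<eta> (x::'a::euclidean_space, t). deriv (\<lambda>s. \<eta> (x, s)) t)"
proof
  have B: "(0::'a, 1::real) \<in> Basis" by (auto simp: Basis_prod_def)
  have eq: "(\<Sum>v\<in>{(0, -1)}. 1 / hstep k * (\<eta> (y - hstep k *\<^sub>R v) - \<eta> y)) =
    (\<eta> (y + hstep k *\<^sub>R (0, 1)) - \<eta> y) / hstep k"
    for k y and \<eta> :: "'a \<times> real \<Rightarrow> real"
    by (auto simp: minus_prod_def plus_prod_def)
  show "(\<lambda>k. \<Sum>v\<in>{(0, -1)}. 1 / hstep k * (\<eta> (y - hstep k *\<^sub>R v) - \<eta> y))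
      \<longlonglongrightarrow> (case y of (x, t) \<Rightarrow> deriv (\<lambda>s. \<eta> (x, s)) t)"
    if "smooth \<eta>" for \<eta> and y :: "'a \<times> real"
  proof -
    have C1: "Ck 1 \<eta>" using that by (simp add: smooth_def)
    then have "\<eta> differentiable (at p)" for p by (simp only: One_nat_def Ck.simps)
    then have "(case y of (x, t) \<Rightarrow> deriv (\<lambda>s. \<eta> (x, s)) t) = partial_deriv (0, 1) \<eta> y"
      by (auto split: prod.split intro!: DERIV_imp_deriv partial_deriv_slice_snd)
    moreover have "(\<lambda>k. (\<eta> (y + hstep k *\<^sub>R (0, 1)) - \<eta> y) / hstep k) \<longlonglongrightarrow> partial_deriv (0, 1) \<eta> y"
      by (intro first_difference_LIMSEQ[OF C1 B] LIMSEQ_inverse_real_of_nat) auto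
    ultimately show ?thesis unfolding eq by simp
  qed
  show "\<exists>C. \<forall>k y. \<bar>\<Sum>v\<in>{(0, -1)}. 1 / hstep k * (\<eta> (y - hstep k *\<^sub>R v) - \<eta> y)\<bar> \<le> C"
    if "smooth \<eta>" "compact K" "\<And>y. y \<notin> K \<Longrightarrow> \<eta> y = 0" for \<eta> and K :: "('a \<times> real) set"
  proof -
    have C1: "Ck 1 \<eta>" using that by (simp add: smooth_def)
    note K = that(2,3)
    from C1 have "continuous_on UNIV (partial_deriv (0, 1) \<eta>)" using B by (simp add: One_nat_def)
    moreover have "partial_deriv (0, 1) \<eta> y = 0" if "y \<notin> K" for y
      using that K by (auto intro!: partial_deriv_zero_outside[of K] dest: compact_imp_closed)
    ultimately obtain C where C: "\<And>y. \<bar>partial_deriv (0, 1) \<eta> y\<bar> \<le> C"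
      using compact_support_bounded[OF _ K(1)] by metis
    show ?thesis unfolding eq
    proof (intro exI[of _ C] allI)
      fix k y
      show "\<bar>(\<eta> (y + hstep k *\<^sub>R (0, 1)) - \<eta> y) / hstep k\<bar> \<le> C"
        using first_difference_bound[OF C1 B _ C, of "hstep k" y] by (simp add: abs_mult divide_simps mult.commute)
    qed
  qed
qed auto

text \<open>Time slices are null sets, so the corners of a piecewise linear time cut-off are
  invisible to an almost everywhere limit.\<close>

lemma AE_lborel_snd_notin_finite:
  assumes "finite X"
  shows "AE p in (lborel :: ('a::euclidean_space \<times> real) measure). snd p \<notin> X"
proof -
  have "AE p in (lborel :: ('a \<times> real) measure). snd p \<noteq> a" for a
  proof -
    have "emeasure (lborel :: ('a \<times> real) measure) (UNIV \<times> {a}) = 0"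
      unfolding lborel_prod[symmetric] by (subst lborel.emeasure_pair_measure_Times) auto
    moreover have "UNIV \<times> {a} \<in> sets (lborel :: ('a \<times> real) measure)"
      by (simp add: borel_closed closed_Times)
    ultimately have "UNIV \<times> {a} \<in> null_sets (lborel :: ('a \<times> real) measure)" by auto
    from AE_not_in[OF this] show ?thesis by eventually_elim auto
  qed
  then have "AE p in (lborel :: ('a \<times> real) measure). \<forall>a\<in>X. snd p \<noteq> a"
    using assms by (simp add: AE_finite_all)
  then show ?thesis by eventually_elim auto
qed

text \<open>The two limits of difference quotients are linked by the sign condition: \<open>U1 > U2\<close> iff
  \<open>U1 powr m > U2 powr m\<close>.\<close>

lemma kato_pair:
  fixes U1 U2 F :: "'a::euclidean_space \<times> real \<Rightarrow> real"
  assumes int: "integrable lborel U1" "integrable lborel U2" "integrable lborel F"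
    "integrable lborel (\<lambda>p. U1 p powr m - U2 p powr m)"
    and nonneg: "\<And>p. 0 \<le> U1 p" "\<And>p. 0 \<le> U2 p" and "0 < m" "0 < c" and "open O1"
    and time: "\<And>\<eta>. test_function O1 \<eta> \<Longrightarrow>
      integral\<^sup>L lborel (\<lambda>p. (U1 p - U2 p) * deriv (\<lambda>s. \<eta> (fst p, s)) (snd p)) = - integral\<^sup>L lborel (\<lambda>p. F p * \<eta> p)"
    and space: "\<And>\<eta>. test_function O1 \<eta> \<Longrightarrow>
      c * integral\<^sup>L lborel (\<lambda>p. (U1 p powr m - U2 p powr m) * laplacian (\<lambda>y. \<eta> (y, snd p)) (fst p)) =
      integral\<^sup>L lborel (\<lambda>p. F p * \<eta> p)"
    and \<eta>: "Ck 2 \<eta>" "\<And>x. 0 \<le> \<eta> x" "\<And>x. R \<le> norm x \<Longrightarrow> \<eta> x = 0"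
    and \<theta>: "\<And>t. 0 \<le> \<theta> t" "\<And>t. \<theta> t \<le> 1" "\<And>s t. \<bar>\<theta> s - \<theta> t\<bar> \<le> M * \<bar>s - t\<bar>" "\<And>t. t \<notin> {s1..s2} \<Longrightarrow> \<theta> t = 0"
    and \<theta>': "finite X" "\<And>t. t \<notin> X \<Longrightarrow> (\<theta> has_real_derivative \<theta>' t) (at t)" "\<And>t. \<bar>\<theta>' t\<bar> \<le> M"
    and \<theta>'_meas [measurable]: "\<theta>' \<in> borel_measurable borel"
    and sub: "cball 0 R \<times> {s1..s2} \<subseteq> O1"
  shows "- integral\<^sup>L lborel (\<lambda>p. max 0 (U1 p - U2 p) * (\<eta> (fst p) * \<theta>' (snd p)))
    \<le> c * integral\<^sup>L lborel (\<lambda>p. max 0 (U1 p powr m - U2 p powr m) * (\<theta> (snd p) * laplacian \<eta> (fst p)))"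
proof -
  have h0: "hstep k > 0" and h1: "hstep k \<le> 1" for k by (auto simp: field_simps)
  have hlim: "(\<lambda>k. hstep k) \<longlonglongrightarrow> 0" by (rule LIMSEQ_inverse_real_of_nat)
  have M0: "0 \<le> M" using \<theta>'(3)[of 0] by linarith
  have cont\<eta>: "continuous_on UNIV \<eta>" using \<eta>(1) by (rule Ck_imp_continuous)
  have cont\<theta>: "continuous_on UNIV \<theta>"
    unfolding continuous_on_iff
  proof (intro ballI allI impI)
    fix x e :: real assume e: "0 < e"
    have "dist (\<theta> y) (\<theta> x) < e" if "dist y x < e / (M + 1)" for y
    proof -
      have "\<bar>\<theta> y - \<theta> x\<bar> \<le> M * (e / (M + 1))"
        using order_trans[OF \<theta>(3) mult_left_mono[OF less_imp_le[OF that[unfolded dist_real_def]] M0]] .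
      also have "\<dots> < e" using e M0 by (simp add: divide_simps)
      finally show ?thesis by (simp add: dist_real_def)
    qed
    then show "\<exists>d>0. \<forall>y\<in>UNIV. dist y x < d \<longrightarrow> dist (\<theta> y) (\<theta> x) < e"
      using e M0 by (intro exI[of _ "e / (M + 1)"]) auto
  qed
  have [measurable]: "\<eta> \<in> borel_measurable borel" "\<theta> \<in> borel_measurable borel"
    using cont\<eta> cont\<theta> by (auto intro: borel_measurable_continuous_onI)
  have supp: "\<eta> x = 0" if "x \<notin> cball 0 R" for x using that \<eta>(3)[of x] by auto
  obtain B where B: "\<And>x. \<bar>\<eta> x\<bar> \<le> B" using compact_support_bounded[OF cont\<eta> compact_cball supp] by blast
  have B0: "0 \<le> B" using B[of 0] by linarith
  define \<phi> where "\<phi> p = \<eta> (fst p) * \<theta> (snd p)" for p :: "'a \<times> real"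
  have \<phi>_meas: "\<phi> \<in> borel_measurable borel"
    unfolding \<phi>_def[abs_def] borel_prod[symmetric] by measurable
  have \<phi>0: "0 \<le> \<phi> p" for p using \<eta>(2) \<theta>(1) by (simp add: \<phi>_def)
  have \<phi>B: "\<phi> p \<le> B" for p
    unfolding \<phi>_def using mult_mono[OF order_trans[OF abs_ge_self B] \<theta>(2) B0 \<theta>(1)] by simp
  have \<phi>supp: "\<phi> p = 0" if "p \<notin> cball 0 R \<times> {s1..s2}" for p
    using that supp[of "fst p"] \<theta>(4)[of "snd p"] by (auto simp: \<phi>_def mem_Times_iff)
  have compK: "compact (cball (0::'a) R \<times> {s1..s2})" by (intro compact_Times) auto
  interpret lap: difference_operator lap_dirs "\<lambda>k. 1 / (hstep k)\<^sup>2" "\<lambda>k. hstep k"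
     "\<lambda>\<eta> (x::'a, t). laplacian (\<lambda>y. \<eta> (y, t)) x" by (rule difference_operator_laplacian)
  interpret tim: difference_operator "{(0, -1)}" "\<lambda>k. 1 / hstep k" "\<lambda>k. hstep k"
     "\<lambda>\<eta> (x::'a, t). deriv (\<lambda>s. \<eta> (x, s)) t" by (rule difference_operator_time)

  \<comment> \<open>Kato's inequality in time, applied to U1 - U2, whose weak time derivative is F;
    the operator corresponds to minus that derivative, hence - F.\<close>
  have T: "integral\<^sup>L lborel (\<lambda>p. of_bool (U1 p - U2 p > 0) * (- F p) * \<phi> p)
    \<le> integral\<^sup>L lborel (\<lambda>p. max 0 (U1 p - U2 p) * (\<eta> (fst p) * \<theta>' (snd p)))"
  proof (rule tim.kato_positive[OF _ _ \<open>open O1\<close> _ \<phi>_meas \<phi>0 \<phi>B compK \<phi>supp sub])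
    show "integrable lborel (\<lambda>p. U1 p - U2 p)" "integrable lborel (\<lambda>p. - F p)" using int by auto
    show "(LBINT y. (U1 y - U2 y) * (case y of (x, t) \<Rightarrow> deriv (\<lambda>s. \<eta> (x, s)) t)) = (LBINT y. - F y * \<eta> y)"
      if "test_function O1 \<eta>" for \<eta>
      using time[OF that] by (simp add: case_prod_beta)
    show "(\<lambda>p. \<eta> (fst p) * \<theta>' (snd p)) \<in> borel_measurable borel"
      unfolding borel_prod[symmetric] by measurable
    show "\<bar>\<eta> (fst p) * \<theta>' (snd p)\<bar> \<le> B * M" for p
      unfolding abs_mult using B \<theta>'(3) B0 by (intro mult_mono) auto
    have eq: "(\<Sum>v\<in>{(0, -1)}. 1 / hstep k * (\<phi> (p - hstep k *\<^sub>R v) - \<phi> p)) =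
      \<eta> (fst p) * ((\<theta> (snd p + hstep k) - \<theta> (snd p)) / hstep k)" for k p
      by (simp add: \<phi>_def divide_inverse algebra_simps)
    show "AE p in lborel. (\<lambda>k. \<Sum>v\<in>{(0, -1)}. 1 / hstep k * (\<phi> (p - hstep k *\<^sub>R v) - \<phi> p))
      \<longlonglongrightarrow> \<eta> (fst p) * \<theta>' (snd p)"
      unfolding eq using AE_lborel_snd_notin_finite[OF \<theta>'(1)]
    proof eventually_elim
      case (elim p)
      from \<theta>'(2)[OF elim] have "((\<lambda>h. (\<theta> (snd p + h) - \<theta> (snd p)) / h) \<longlongrightarrow> \<theta>' (snd p)) (at 0)"
        by (simp add: DERIV_def)
      moreover have "filterlim (\<lambda>k. hstep k) (at 0) sequentially"
        using hlim h0 by (auto simp: filterlim_at intro!: always_eventually)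
      ultimately have "(\<lambda>k. (\<theta> (snd p + hstep k) - \<theta> (snd p)) / hstep k) \<longlonglongrightarrow> \<theta>' (snd p)"
        by (rule filterlim_compose)
      then show ?case by (intro tendsto_intros)
    qed
    \<comment> \<open>The quotient looks forward by a step of at most 1, so its support extends that
      of \<phi> only towards earlier times.\<close>
    show "compact (cball (0::'a) R \<times> {s1 - 1..s2})" by (intro compact_Times) auto
    show "(\<Sum>v\<in>{(0, -1)}. 1 / hstep k * (\<phi> (p - hstep k *\<^sub>R v) - \<phi> p)) = 0"
      if "p \<notin> cball 0 R \<times> {s1 - 1..s2}" for p k
    proof (cases "fst p \<in> cball 0 R")
      case True
      then have "snd p < s1 - 1 \<or> snd p > s2" using that by (auto simp: mem_Times_iff)
      then have "snd p \<notin> {s1..s2} \<and> snd p + hstep k \<notin> {s1..s2}"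
        using h0[of k] h1[of k] unfolding atLeastAtMost_iff by linarith
      then have "\<theta> (snd p) = 0" "\<theta> (snd p + hstep k) = 0" using \<theta>(4) by blast+
      then show ?thesis unfolding eq by simp
    next
      case False
      show ?thesis unfolding eq supp[OF False] by simp
    qed
    show "\<bar>\<Sum>v\<in>{(0, -1)}. 1 / hstep k * (\<phi> (p - hstep k *\<^sub>R v) - \<phi> p)\<bar> \<le> B * M" for p k
      unfolding eq abs_mult
    proof (intro mult_mono B B0)
      have "\<bar>\<theta> (snd p + hstep k) - \<theta> (snd p)\<bar> \<le> M * hstep k"
        using \<theta>(3)[of "snd p + hstep k" "snd p"] h0[of k] by simp
      then show "\<bar>(\<theta> (snd p + hstep k) - \<theta> (snd p)) / hstep k\<bar> \<le> M"
        using h0[of k] unfolding abs_divide by (subst pos_divide_le_eq) auto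
    qed simp
  qed
  have B1: "(Basis :: 'a set) \<subseteq> Basis" by simp
  obtain C where C: "\<And>h y. h > 0 \<Longrightarrow>
      \<bar>\<Sum>b\<in>Basis. (\<eta> (y + h *\<^sub>R b) + \<eta> (y - h *\<^sub>R b) - 2 * \<eta> y) / h\<^sup>2\<bar> \<le> C"
    using second_difference_sum_bound[OF \<eta>(1) compact_cball supp finite_Basis B1] by blast
  have C0: "0 \<le> C" using C[of 1 0] by linarith
  have limL: "(\<lambda>k. \<Sum>b\<in>Basis. (\<eta> (y + hstep k *\<^sub>R b) + \<eta> (y - hstep k *\<^sub>R b) - 2 * \<eta> y) / (hstep k)\<^sup>2)
     \<longlonglongrightarrow> laplacian \<eta> y" for y
    unfolding laplacian_def by (intro tendsto_sum second_difference_LIMSEQ[OF \<eta>(1) _ h0 hlim])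
  have lapB: "\<bar>laplacian \<eta> y\<bar> \<le> C" for y
    by (rule LIMSEQ_le_const2[OF tendsto_rabs[OF limL]]) (use C[OF h0] in auto)
  have [measurable]: "laplacian \<eta> \<in> borel_measurable borel"
    by (rule borel_measurable_LIMSEQ_real[OF limL]) measurable
  \<comment> \<open>Kato's inequality in space, applied to the difference of the powers, whose weak
    Laplacian is F / c with the same F.\<close>
  have S: "integral\<^sup>L lborel (\<lambda>p. of_bool (U1 p powr m - U2 p powr m > 0) * (F p / c) * \<phi> p)
    \<le> integral\<^sup>L lborel (\<lambda>p. max 0 (U1 p powr m - U2 p powr m) * (\<theta> (snd p) * laplacian \<eta> (fst p)))"
  proof (rule lap.kato_positive[OF int(4) _ \<open>open O1\<close> _ \<phi>_meas \<phi>0 \<phi>B compK \<phi>supp sub])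
    show "integrable lborel (\<lambda>p. F p / c)" using int by auto
    show "(LBINT y. (U1 y powr m - U2 y powr m) * (case y of (x, t) \<Rightarrow> laplacian (\<lambda>y. \<eta> (y, t)) x)) = (LBINT y. F y / c * \<eta> y)"
      if "test_function O1 \<eta>" for \<eta>
      using space[OF that] \<open>0 < c\<close> by (simp add: case_prod_beta field_simps)
    show "(\<lambda>p. \<theta> (snd p) * laplacian \<eta> (fst p)) \<in> borel_measurable borel"
      unfolding borel_prod[symmetric] by measurable
    show "\<bar>\<theta> (snd p) * laplacian \<eta> (fst p)\<bar> \<le> C" for p
      unfolding abs_mult using mult_mono[OF _ lapB, of "\<bar>\<theta> (snd p)\<bar>" 1 "fst p"] \<theta>(1,2)[of "snd p"] by simp
    have eq: "(\<Sum>v\<in>lap_dirs. 1 / (hstep k)\<^sup>2 * (\<phi> (p - hstep k *\<^sub>R v) - \<phi> p)) =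
      \<theta> (snd p) * (\<Sum>b\<in>Basis. (\<eta> (fst p + hstep k *\<^sub>R b) + \<eta> (fst p - hstep k *\<^sub>R b) - 2 * \<eta> (fst p)) / (hstep k)\<^sup>2)" for k p
      unfolding sum_lap_dirs sum_distrib_left
    proof (rule sum.cong)
      fix b :: 'a
      show "1 / (hstep k)\<^sup>2 * (\<phi> (p - hstep k *\<^sub>R (b, 0)) - \<phi> p) + 1 / (hstep k)\<^sup>2 * (\<phi> (p - hstep k *\<^sub>R (- b, 0)) - \<phi> p) =
        \<theta> (snd p) * ((\<eta> (fst p + hstep k *\<^sub>R b) + \<eta> (fst p - hstep k *\<^sub>R b) - 2 * \<eta> (fst p)) / (hstep k)\<^sup>2)"
        by (simp only: \<phi>_def fst_diff snd_diff fst_scaleR snd_scaleR fst_conv snd_conv scaleR_zero_right diff_0_right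
            scaleR_minus_right diff_minus_eq_add)
          (simp add: divide_inverse algebra_simps)
    qed simp
    show "AE p in lborel. (\<lambda>k. \<Sum>v\<in>lap_dirs. 1 / (hstep k)\<^sup>2 * (\<phi> (p - hstep k *\<^sub>R v) - \<phi> p))
      \<longlonglongrightarrow> \<theta> (snd p) * laplacian \<eta> (fst p)"
      unfolding eq by (intro AE_I2 tendsto_intros limL)
    show "compact (cball (0::'a) (R + 1) \<times> {s1..s2})" by (intro compact_Times) auto
    show "(\<Sum>v\<in>lap_dirs. 1 / (hstep k)\<^sup>2 * (\<phi> (p - hstep k *\<^sub>R v) - \<phi> p)) = 0"
      if "p \<notin> cball 0 (R + 1) \<times> {s1..s2}" for p k
    proof (cases "snd p \<in> {s1..s2}")
      case True
      then have far: "norm (fst p) > R + 1" using that by (auto simp: mem_Times_iff)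
      have "\<eta> (fst p + hstep k *\<^sub>R b) = 0" "\<eta> (fst p - hstep k *\<^sub>R b) = 0" if "b \<in> Basis" for b
      proof -
        have n: "norm (hstep k *\<^sub>R b) \<le> 1" using that h0[of k] h1[of k] by simp
        show "\<eta> (fst p + hstep k *\<^sub>R b) = 0" "\<eta> (fst p - hstep k *\<^sub>R b) = 0"
          using n far norm_triangle_ineq2[of "fst p" "hstep k *\<^sub>R b"] norm_diff_ineq[of "fst p" "hstep k *\<^sub>R b"]
          by (auto intro!: \<eta>(3))
      qed
      moreover have "\<eta> (fst p) = 0" using far by (intro \<eta>(3)) auto
      ultimately show ?thesis unfolding eq by simp
    next
      case False
      show ?thesis unfolding eq \<theta>(4)[OF False] by simp
    qed
    show "\<bar>\<Sum>v\<in>lap_dirs. 1 / (hstep k)\<^sup>2 * (\<phi> (p - hstep k *\<^sub>R v) - \<phi> p)\<bar> \<le> C" for p k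
      unfolding eq abs_mult using mult_mono[OF _ C[OF h0], of "\<bar>\<theta> (snd p)\<bar>" 1 "fst p" k] \<theta>(1,2)[of "snd p"] by simp
  qed
  \<comment> \<open>By strict monotonicity of the power, the two indicators coincide. Both
    inequalities then bound the same integral of F \<phi> from opposite sides and can be
    chained.\<close>
  have sign: "U1 p powr m - U2 p powr m > 0 \<longleftrightarrow> U1 p - U2 p > 0" for p
    using nonneg[of p] \<open>0 < m\<close> powr_less_mono2[of m "U2 p" "U1 p"] powr_mono2[of m "U1 p" "U2 p"]
    by (auto simp: not_less[symmetric])
  have "integral\<^sup>L lborel (\<lambda>p. of_bool (U1 p - U2 p > 0) * F p * \<phi> p) =
      - integral\<^sup>L lborel (\<lambda>p. of_bool (U1 p - U2 p > 0) * (- F p) * \<phi> p)" by simp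
  moreover have "c * integral\<^sup>L lborel (\<lambda>p. of_bool (U1 p powr m - U2 p powr m > 0) * (F p / c) * \<phi> p) =
    integral\<^sup>L lborel (\<lambda>p. of_bool (U1 p - U2 p > 0) * F p * \<phi> p)"
    unfolding sign using \<open>0 < c\<close> by (subst integral_mult_right_zero[symmetric]) simp
  ultimately show ?thesis using T mult_left_mono[OF S less_imp_le[OF \<open>0 < c\<close>]] by linarith
qed

section \<open>Comparison of solutions on time slices\<close>

lemma AE_lborel_prod_snd:
  fixes P :: "'a::euclidean_space \<times> 'b::euclidean_space \<Rightarrow> bool"
  assumes "AE p in lborel. P p"
  shows "AE t in lborel. AE x in lborel. P (x, t)"
proof -
  obtain N where N: "N \<in> null_sets (lborel :: ('a \<times> 'b) measure)" "{p. \<not> P p} \<subseteq> N"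
    using assms by (auto simp: eventually_ae_filter)
  have [measurable]: "N \<in> sets (lborel \<Otimes>\<^sub>M lborel)" using N(1) unfolding lborel_prod by auto
  have "(\<integral>\<^sup>+t. \<integral>\<^sup>+x. indicator N (x, t) \<partial>lborel \<partial>lborel) = (\<integral>\<^sup>+p. indicator N p \<partial>(lborel \<Otimes>\<^sub>M lborel))"
    by (rule lborel_pair.nn_integral_snd) measurable
  also have "\<dots> = emeasure lborel N" unfolding lborel_prod using N(1) by (intro nn_integral_indicator) auto
  also have "\<dots> = 0" using N(1) by (rule null_setsD1)
  finally have "AE t in lborel. (\<integral>\<^sup>+x. indicator N (x, t) \<partial>lborel) = 0"
    by (subst (asm) nn_integral_0_iff_AE) auto
  then show ?thesis
  proof eventually_elim
    case (elim t)
    then have "AE x in lborel. indicator N (x, t) = (0::ennreal)"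
      by (subst (asm) nn_integral_0_iff_AE) auto
    then show ?case by (rule eventually_mono) (use N(2) in \<open>auto split: split_indicator_asm\<close>)
  qed
qed

section \<open>Borel representatives of solutions on compact cylinders\<close>

text \<open>Solutions are integrated against \<open>lebesgue\<close>, a completed measure, whereas
  convolution and Tonelli's theorem are applied over \<open>lborel\<close>. A Borel function that
  equals f almost everywhere on the support of the test factor carries the integrals over.\<close>

lemma lebesgue_representative:
  fixes f g :: "'a::euclidean_space \<Rightarrow> real"
  assumes f: "f absolutely_integrable_on K" and f' [measurable]: "f' \<in> borel_measurable borel"
    and ae: "AE p in lborel. f' p = indicat_real K p * f p"
    and g: "g \<in> borel_measurable borel" "\<And>p. p \<notin> K \<Longrightarrow> g p = 0"
  shows "integral\<^sup>L lebesgue (\<lambda>p. f p * g p) = integral\<^sup>L lborel (\<lambda>p. f' p * g p)"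
proof -
  have m1: "(\<lambda>p. indicat_real K p * f p) \<in> borel_measurable lebesgue"
    using f by (auto simp: set_integrable_def)
  have m2: "g \<in> borel_measurable lebesgue" "f' \<in> borel_measurable lebesgue"
    using g(1) f' by (auto intro: measurable_completion)
  have "(\<lambda>p. f p * g p) = (\<lambda>p. (indicat_real K p * f p) * g p)"
    using g(2) by (auto simp: indicator_def fun_eq_iff)
  then have "integral\<^sup>L lebesgue (\<lambda>p. f p * g p) = integral\<^sup>L lebesgue (\<lambda>p. (indicat_real K p * f p) * g p)" by simp
  also have "\<dots> = integral\<^sup>L lebesgue (\<lambda>p. f' p * g p)"
  proof (rule integral_cong_AE)
    show "AE p in lebesgue. indicat_real K p * f p * g p = f' p * g p"
      using AE_completion[OF ae] by eventually_elim simp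
  qed (use m1 m2 in auto)
  also have "\<dots> = integral\<^sup>L lborel (\<lambda>p. f' p * g p)"
    using g(1) by (intro integral_completion) auto
  finally show ?thesis .
qed

lemma absolutely_integrable_representative:
  fixes f :: "'a::euclidean_space \<Rightarrow> real"
  assumes "f absolutely_integrable_on K"
  obtains f' where "f' \<in> borel_measurable borel" "AE p in lborel. f' p = indicat_real K p * f p"
    "integrable lborel f'"
proof -
  have i: "integrable lebesgue (\<lambda>p. indicat_real K p * f p)"
    using assms by (auto simp: set_integrable_def)
  from completion_ex_borel_measurable_real[of "\<lambda>p. indicat_real K p * f p" lborel]
  obtain f' where f': "f' \<in> borel_measurable lborel" "AE p in lborel. indicat_real K p * f p = f' p"
    using i by auto
  have "integrable lebesgue f'"
    using i f' AE_completion[OF f'(2)]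
    by (subst integrable_cong_AE[symmetric, where f = "\<lambda>p. indicat_real K p * f p"]) (auto intro: measurable_completion)
  then have "integrable lborel f'" using f'(1) by (simp add: integrable_completion)
  then show ?thesis using that[of f'] f' by (simp add: eq_commute)
qed

lemma test_function_deriv_measurable:
  fixes \<eta> :: "'a::euclidean_space \<times> real \<Rightarrow> real"
  assumes "test_function S \<eta>"
  shows "(\<lambda>p. deriv (\<lambda>s. \<eta> (fst p, s)) (snd p)) \<in> borel_measurable borel"
    and "(\<lambda>p. laplacian (\<lambda>y. \<eta> (y, snd p)) (fst p)) \<in> borel_measurable borel"
    and "\<eta> \<in> borel_measurable borel"
    and "p \<notin> S \<Longrightarrow> deriv (\<lambda>s. \<eta> (fst p, s)) (snd p) = 0"
    and "p \<notin> S \<Longrightarrow> laplacian (\<lambda>y. \<eta> (y, snd p)) (fst p) = 0"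
    and "p \<notin> S \<Longrightarrow> \<eta> p = 0"
    and "\<exists>B. \<forall>p. \<bar>deriv (\<lambda>s. \<eta> (fst p, s)) (snd p)\<bar> \<le> B"
    and "\<exists>B. \<forall>p. \<bar>laplacian (\<lambda>y. \<eta> (y, snd p)) (fst p)\<bar> \<le> B"
    and "\<exists>B. \<forall>p. \<bar>\<eta> p\<bar> \<le> B"
proof -
  define K where "K = closure {p. \<eta> p \<noteq> 0}"
  have K: "compact K" "K \<subseteq> S" "\<And>p. p \<notin> K \<Longrightarrow> \<eta> p = 0"
    using assms closure_subset[of "{p. \<eta> p \<noteq> 0}"] by (auto simp: test_function_def K_def)
  have C: "Ck k \<eta>" for k using assms by (auto simp: test_function_def smooth_def)
  have d: "\<eta> differentiable (at q)" for q using C[of 1] by (simp only: One_nat_def Ck.simps)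
  have B: "(b, 0) \<in> (Basis :: ('a \<times> real) set)" if "b \<in> Basis" for b using that by (auto simp: Basis_prod_def)
  have B1: "(0, 1) \<in> (Basis :: ('a \<times> real) set)" by (auto simp: Basis_prod_def)
  have e1: "deriv (\<lambda>s. \<eta> (fst p, s)) (snd p) = partial_deriv (0, 1) \<eta> p" for p
    using partial_deriv_slice_snd[of \<eta> "fst p" "snd p"] d by (auto intro: DERIV_imp_deriv)
  have e2: "laplacian (\<lambda>y. \<eta> (y, snd p)) (fst p) = (\<Sum>b\<in>Basis. partial_deriv (b, 0) (partial_deriv (b, 0) \<eta>) p)" for p
    using laplacian_slice[OF C[of 2]] by simp
  have c1: "continuous_on UNIV (partial_deriv (0, 1) \<eta>)" using C[of 1] B1 by (simp only: One_nat_def Ck.simps)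
  have "continuous_on UNIV (partial_deriv (b, 0) (partial_deriv (b, 0) \<eta>))" if "b \<in> Basis" for b
    using C[of 2] B[OF that] by (simp only: numeral_2_eq_2 Ck.simps)
  then have c2: "continuous_on UNIV (\<lambda>p. \<Sum>b\<in>Basis. partial_deriv (b, 0) (partial_deriv (b, 0) \<eta>) p)"
    by (intro continuous_on_sum)
  have c3: "continuous_on UNIV \<eta>" using C[of 0] by simp
  show "(\<lambda>p. deriv (\<lambda>s. \<eta> (fst p, s)) (snd p)) \<in> borel_measurable borel"
    "(\<lambda>p. laplacian (\<lambda>y. \<eta> (y, snd p)) (fst p)) \<in> borel_measurable borel" "\<eta> \<in> borel_measurable borel"
    unfolding e1 e2 using c1 c2 c3 by (auto intro: borel_measurable_continuous_onI)
  have z1: "partial_deriv b \<eta> p = 0" if "p \<notin> K" for b p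
    using partial_deriv_zero_outside[OF compact_imp_closed[OF K(1)] K(3) that] .
  have z2: "partial_deriv b (partial_deriv b \<eta>) p = 0" if "p \<notin> K" for b p
    using partial_deriv_zero_outside[OF compact_imp_closed[OF K(1)] z1 that] .
  show "deriv (\<lambda>s. \<eta> (fst p, s)) (snd p) = 0" if "p \<notin> S" unfolding e1 using z1 that K(2) by blast
  have "p \<notin> S \<Longrightarrow> p \<notin> K" using K(2) by blast
  then show "laplacian (\<lambda>y. \<eta> (y, snd p)) (fst p) = 0" if "p \<notin> S" unfolding e2 using z2 that by simp
  show "\<eta> p = 0" if "p \<notin> S" using that K(2,3) by blast
  show "\<exists>B. \<forall>p. \<bar>deriv (\<lambda>s. \<eta> (fst p, s)) (snd p)\<bar> \<le> B" unfolding e1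
    using compact_support_bounded[OF c1 K(1) z1] by blast
  show "\<exists>B. \<forall>p. \<bar>laplacian (\<lambda>y. \<eta> (y, snd p)) (fst p)\<bar> \<le> B" unfolding e2
  proof (rule compact_support_bounded[OF c2 K(1)])
    show "(\<Sum>b\<in>Basis. partial_deriv (b, 0) (partial_deriv (b, 0) \<eta>) p) = 0" if "p \<notin> K" for p
      using z2[OF that] by simp
  qed blast
  show "\<exists>B. \<forall>p. \<bar>\<eta> p\<bar> \<le> B" using compact_support_bounded[OF c3 K(1,3)] by blast
qed

lemma powr_le_one_plus: "0 \<le> x \<Longrightarrow> 0 \<le> m \<Longrightarrow> m \<le> 1 \<Longrightarrow> x powr m \<le> 1 + (x::real)"
  using powr_mono[of m 1 x] powr_le_one_le[of x] by (cases "x \<le> 1") (auto intro: order_trans[OF powr_le1])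

lemma integrable_powr_support:
  fixes U :: "'a::euclidean_space \<Rightarrow> real"
  assumes "integrable lborel U" "\<And>p. 0 \<le> U p" "0 < m" "m \<le> 1" "compact K" "\<And>p. p \<notin> K \<Longrightarrow> U p = 0"
  shows "integrable lborel (\<lambda>p. U p powr m)"
proof (rule Bochner_Integration.integrable_bound[of _ "\<lambda>p. indicat_real K p + U p"])
  show "integrable lborel (\<lambda>p. indicat_real K p + U p)"
    using assms(1) integrable_indicator_compact[OF assms(5)] by simp
  have [measurable]: "U \<in> borel_measurable borel" using assms(1) by auto
  show "(\<lambda>p. U p powr m) \<in> borel_measurable lborel" by measurable
  show "AE p in lborel. norm (U p powr m) \<le> norm (indicat_real K p + U p)"
  proof (rule AE_I2)
    fix p show "norm (U p powr m) \<le> norm (indicat_real K p + U p)"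
      using powr_le_one_plus[OF assms(2)[of p], of m] assms(2)[of p] assms(3,4,6)
      by (cases "p \<in> K") auto
  qed
qed

text \<open>One function W serves both identities: it represents the time derivative, and the
  distributional equation identifies it with a multiple of the Laplacian of the power. This is where
  the strong-solution condition enters. The bound 0 < a keeps the cylinder inside the open
  half-space.\<close>

lemma fast_diffusion_representative:
  fixes u :: "real^'n \<Rightarrow> real \<Rightarrow> real"
  assumes sol: "fast_diffusion_solution m u u0" and m: "0 < m" "m \<le> 1" and "0 < a"
  obtains U W :: "(real^'n) \<times> real \<Rightarrow> real" where
    "integrable lborel U" "integrable lborel W" "integrable lborel (\<lambda>p. U p powr m)" "\<And>p. 0 \<le> U p"
    "AE t in lborel. t \<in> {a..b} \<longrightarrow> (AE x in lborel. x \<in> cball 0 R \<longrightarrow> U (x, t) = u x t)"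
    "\<And>\<eta>. test_function (ball 0 R \<times> {a<..<b}) \<eta> \<Longrightarrow>
      integral\<^sup>L lborel (\<lambda>p. U p * deriv (\<lambda>s. \<eta> (fst p, s)) (snd p)) = - integral\<^sup>L lborel (\<lambda>p. W p * \<eta> p)"
    "\<And>\<eta>. test_function (ball 0 R \<times> {a<..<b}) \<eta> \<Longrightarrow>
      (real CARD('n) - 1) / m * integral\<^sup>L lborel (\<lambda>p. U p powr m * laplacian (\<lambda>y. \<eta> (y, snd p)) (fst p))
        = integral\<^sup>L lborel (\<lambda>p. W p * \<eta> p)"
proof -
  define K where "K = cball (0::real^'n) R \<times> {a..b}"
  define S where "S = ball (0::real^'n) R \<times> {a<..<b}"
  have K: "compact K" "K \<subseteq> space_time" using \<open>0 < a\<close> by (auto simp: K_def intro!: compact_Times)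
  have SK: "S \<subseteq> K" by (auto simp: S_def K_def)
  define f where "f p = u (fst p) (snd p)" for p
  have f_eq: "(\<lambda>(x, t). u x t) = f" by (auto simp: f_def)
  obtain w where w: "(\<lambda>(x, t). w x t) locally_integrable_on space_time" "weak_time_deriv u w"
    using sol by (auto simp: fast_diffusion_solution_def)
  define g where "g p = w (fst p) (snd p)" for p
  have g_eq: "(\<lambda>(x, t). w x t) = g" by (auto simp: g_def)
  have fK: "f absolutely_integrable_on K"
    using sol K unfolding fast_diffusion_solution_def f_eq locally_integrable_on_def by blast
  have gK: "g absolutely_integrable_on K"
    using w(1) K unfolding g_eq locally_integrable_on_def by blast
  obtain f' where f': "f' \<in> borel_measurable borel" "AE p in lborel. f' p = indicat_real K p * f p" "integrable lborel f'"
    using absolutely_integrable_representative[OF fK] .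
  obtain W where W: "W \<in> borel_measurable borel" "AE p in lborel. W p = indicat_real K p * g p" "integrable lborel W"
    using absolutely_integrable_representative[OF gK] .
  have [measurable]: "K \<in> sets borel" using K(1) by (rule borel_compact)
  \<comment> \<open>\<open>max 0\<close> makes the representative nonnegative at every point, and
    the indicator confines it to K.\<close>
  define U where "U p = indicat_real K p * max 0 (f' p)" for p
  have [measurable]: "f' \<in> borel_measurable borel" "W \<in> borel_measurable borel" using f' W by auto
  have U_meas [measurable]: "U \<in> borel_measurable borel" unfolding U_def[abs_def] by measurable
  have U0: "0 \<le> U p" for p by (simp add: U_def)
  have Uint: "integrable lborel U"
    unfolding U_def[abs_def] using f'(3) by (intro integrable_mult_bounded(1)[where B = 1]) auto
  have Usupp: "U p = 0" if "p \<notin> K" for p using that by (simp add: U_def)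
  \<comment> \<open>negative values of \<open>u\<close> are confined to null sets of every time slice, hence of \<open>K\<close>\<close>
  have slice: "AE t in lborel. AE x in lborel. f' (x, t) = indicat_real K (x, t) * u x t"
    using AE_lborel_prod_snd[OF f'(2)] by (simp add: f_def)
  have neg: "AE p in lborel. 0 \<le> f' p"
  proof -
    have "AE t in lborel. AE x in lborel. 0 \<le> f' (x, t)"
      using slice
    proof eventually_elim
      case (elim t)
      show ?case
      proof (cases "0 \<le> t")
        case True
        then have "AE x in lebesgue. 0 \<le> u x t" using sol by (auto simp: fast_diffusion_solution_def)
        then have "AE x in lborel. 0 \<le> u x t" by (simp add: AE_completion_iff)
        with elim show ?thesis by eventually_elim simp
      next
        case False
        then have "(x, t) \<notin> K" for x using \<open>0 < a\<close> by (auto simp: K_def)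
        with elim show ?thesis by (auto elim: AE_mp)
      qed
    qed
    then have z: "AE t in lborel. (\<integral>\<^sup>+x. indicator {p. f' p < 0} (x, t) \<partial>lborel) = 0"
    proof eventually_elim
      case (elim t)
      have m: "(\<lambda>x. indicator {p. f' p < 0} (x, t) :: ennreal) \<in> borel_measurable lborel"
        unfolding indicator_def by measurable
      show ?case using elim by (subst nn_integral_0_iff_AE[OF m]) (auto simp: indicator_def not_less elim: AE_mp)
    qed
    have [measurable]: "{p. f' p < 0} \<in> sets (lborel \<Otimes>\<^sub>M lborel)" unfolding lborel_prod by measurable
    have "(\<integral>\<^sup>+p. indicator {p. f' p < 0} p \<partial>(lborel \<Otimes>\<^sub>M lborel)) = (\<integral>\<^sup>+t. \<integral>\<^sup>+x. indicator {p. f' p < 0} (x, t) \<partial>lborel \<partial>lborel)"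
      by (rule lborel_pair.nn_integral_snd[symmetric]) measurable
    also have "\<dots> = (\<integral>\<^sup>+t. 0 \<partial>(lborel::real measure))" by (rule nn_integral_cong_AE[OF z])
    finally have "emeasure lborel {p. f' p < 0} = 0" by (simp add: lborel_prod)
    then have "{p. f' p < 0} \<in> null_sets lborel" by (auto intro!: null_setsI)
    from AE_not_in[OF this] show ?thesis by eventually_elim auto
  qed
  have Uf: "AE p in lborel. U p = indicat_real K p * f p"
    using f'(2) neg by eventually_elim (auto simp: U_def indicator_def)
  have c1: "AE t in lborel. t \<in> {a..b} \<longrightarrow> (AE x in lborel. x \<in> cball 0 R \<longrightarrow> U (x, t) = u x t)"
    using AE_lborel_prod_snd[OF Uf]
  proof eventually_elim
    case (elim t)
    show ?case using elim by (auto simp: f_def K_def indicator_def elim!: AE_mp)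
  qed
  have test_mono: "test_function space_time \<eta>" if "test_function S \<eta>" for \<eta>
    using that SK K(2) by (auto simp: test_function_def)
  have c2: "integral\<^sup>L lborel (\<lambda>p. U p * deriv (\<lambda>s. \<eta> (fst p, s)) (snd p)) = - integral\<^sup>L lborel (\<lambda>p. W p * \<eta> p)"
    if t: "test_function S \<eta>" for \<eta>
  proof -
    have "integral\<^sup>L lebesgue (\<lambda>(x, t). u x t * deriv (\<lambda>s. \<eta> (x, s)) t) = - integral\<^sup>L lebesgue (\<lambda>(x, t). w x t * \<eta> (x, t))"
      using w(2) test_mono[OF t] by (auto simp: weak_time_deriv_def)
    moreover have "integral\<^sup>L lebesgue (\<lambda>p. f p * deriv (\<lambda>s. \<eta> (fst p, s)) (snd p)) =
        integral\<^sup>L lborel (\<lambda>p. U p * deriv (\<lambda>s. \<eta> (fst p, s)) (snd p))"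
      using test_function_deriv_measurable(1,4)[OF t] SK by (intro lebesgue_representative[OF fK U_meas Uf]) auto
    moreover have "integral\<^sup>L lebesgue (\<lambda>p. g p * \<eta> p) = integral\<^sup>L lborel (\<lambda>p. W p * \<eta> p)"
      using test_function_deriv_measurable(3,6)[OF t] SK by (intro lebesgue_representative[OF gK W(1,2)]) auto
    ultimately show ?thesis by (simp add: f_def g_def case_prod_beta')
  qed
  have Um: "integrable lborel (\<lambda>p. U p powr m)" by (rule integrable_powr_support[OF Uint U0 m K(1) Usupp])
  have c3: "(real CARD('n) - 1) / m * integral\<^sup>L lborel (\<lambda>p. U p powr m * laplacian (\<lambda>y. \<eta> (y, snd p)) (fst p))
        = integral\<^sup>L lborel (\<lambda>p. W p * \<eta> p)" if t: "test_function S \<eta>" for \<eta>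
  proof -
    let ?c = "(real CARD('n) - 1) / m"
    obtain B1 B2 where B: "\<And>p. \<bar>deriv (\<lambda>s. \<eta> (fst p, s)) (snd p)\<bar> \<le> B1"
      "\<And>p. \<bar>laplacian (\<lambda>y. \<eta> (y, snd p)) (fst p)\<bar> \<le> B2"
      using test_function_deriv_measurable(7,8)[OF t] by blast
    note [measurable] = test_function_deriv_measurable(1,2)[OF t]
    have "0 = integral\<^sup>L lebesgue (\<lambda>(x, t). u x t * deriv (\<lambda>s. \<eta> (x, s)) t
          + ?c * (u x t powr m) * laplacian (\<lambda>y. \<eta> (y, t)) x)"
      using sol test_mono[OF t] by (auto simp: fast_diffusion_solution_def)
    also have "\<dots> = integral\<^sup>L lebesgue (\<lambda>p. U p * deriv (\<lambda>s. \<eta> (fst p, s)) (snd p)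
          + ?c * (U p powr m) * laplacian (\<lambda>y. \<eta> (y, snd p)) (fst p))"
    proof (rule integral_cong_AE)
      let ?h = "\<lambda>p. u (fst p) (snd p) * deriv (\<lambda>s. \<eta> (fst p, s)) (snd p)
          + ?c * (u (fst p) (snd p) powr m) * laplacian (\<lambda>y. \<eta> (y, snd p)) (fst p)"
      have m1: "(\<lambda>p. indicat_real K p * f p) \<in> borel_measurable lebesgue"
        using fK by (auto simp: set_integrable_def)
      have m2: "(\<lambda>p. deriv (\<lambda>s. \<eta> (fst p, s)) (snd p)) \<in> borel_measurable lebesgue"
        "(\<lambda>p. laplacian (\<lambda>y. \<eta> (y, snd p)) (fst p)) \<in> borel_measurable lebesgue"
        by (auto intro!: measurable_completion)
      have "?h = (\<lambda>p. (indicat_real K p * f p) * deriv (\<lambda>s. \<eta> (fst p, s)) (snd p)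
          + ?c * ((indicat_real K p * f p) powr m) * laplacian (\<lambda>y. \<eta> (y, snd p)) (fst p))"
      proof
        fix p show "?h p = (indicat_real K p * f p) * deriv (\<lambda>s. \<eta> (fst p, s)) (snd p)
          + ?c * ((indicat_real K p * f p) powr m) * laplacian (\<lambda>y. \<eta> (y, snd p)) (fst p)"
        proof (cases "p \<in> K")
          case False
          then have "p \<notin> S" using SK by blast
          then show ?thesis using test_function_deriv_measurable(4,5)[OF t, of p] by simp
        qed (simp add: f_def)
      qed
      then show "(\<lambda>(x, t). u x t * deriv (\<lambda>s. \<eta> (x, s)) t + ?c * (u x t powr m) * laplacian (\<lambda>y. \<eta> (y, t)) x)
        \<in> borel_measurable lebesgue"
        using m1 m2 by (simp add: case_prod_beta')
      show "(\<lambda>p. U p * deriv (\<lambda>s. \<eta> (fst p, s)) (snd p)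
          + ?c * (U p powr m) * laplacian (\<lambda>y. \<eta> (y, snd p)) (fst p)) \<in> borel_measurable lebesgue"
        by (intro measurable_completion) measurable
      show "AE p in lebesgue. (case p of (x, t) \<Rightarrow> u x t * deriv (\<lambda>s. \<eta> (x, s)) t + ?c * (u x t powr m) * laplacian (\<lambda>y. \<eta> (y, t)) x)
        = U p * deriv (\<lambda>s. \<eta> (fst p, s)) (snd p) + ?c * (U p powr m) * laplacian (\<lambda>y. \<eta> (y, snd p)) (fst p)"
        using AE_completion[OF Uf]
      proof eventually_elim
        case (elim p)
        show ?case
        proof (cases "p \<in> K")
          case True
          with elim show ?thesis by (simp add: f_def case_prod_beta')
        next
          case False
          then have "p \<notin> S" using SK by blast
          then show ?thesis using test_function_deriv_measurable(4,5)[OF t, of p] by (simp add: case_prod_beta')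
        qed
      qed
    qed
    also have "\<dots> = integral\<^sup>L lborel (\<lambda>p. U p * deriv (\<lambda>s. \<eta> (fst p, s)) (snd p)
          + ?c * (U p powr m * laplacian (\<lambda>y. \<eta> (y, snd p)) (fst p)))"
      by (subst integral_completion) (auto simp: mult.assoc)
    also have "\<dots> = integral\<^sup>L lborel (\<lambda>p. U p * deriv (\<lambda>s. \<eta> (fst p, s)) (snd p))
          + ?c * integral\<^sup>L lborel (\<lambda>p. U p powr m * laplacian (\<lambda>y. \<eta> (y, snd p)) (fst p))"
      using integrable_mult_bounded(2)[OF Uint _ B(1)] integrable_mult_bounded(2)[OF Um _ B(2)]
      by (subst Bochner_Integration.integral_add) auto
    finally show ?thesis using c2[OF t] by simp
  qed
  show thesis
    by (rule that[OF Uint W(3) Um U0 c1 c2 c3]) (auto simp: S_def)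
qed

lemma fast_diffusion_slice:
  assumes "fast_diffusion_solution m u u0" "0 \<le> t"
  shows "(\<lambda>x. u x t) absolutely_integrable_on cball 0 R"
    "AE x in lebesgue. 0 \<le> u x t"
    "((\<lambda>s. LINT x:cball 0 R|lebesgue. \<bar>u x s - u x t\<bar>) \<longlongrightarrow> 0) (at t within {0..})"
  using assms unfolding fast_diffusion_solution_def L1loc_tendsto_def locally_integrable_on_def
  by (auto simp: compact_cball)

text \<open>The positive part is 1-Lipschitz, so continuity in L^1_loc is inherited. The closed
  interval matters: continuity at t = 0 connects estimates on positive times with the initial
  data.\<close>

lemma positive_part_continuous:
  fixes u v :: "real^'n \<Rightarrow> real \<Rightarrow> real"
  assumes u: "fast_diffusion_solution m u u0" and v: "fast_diffusion_solution m' v v0"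
    and [measurable]: "\<eta> \<in> borel_measurable borel" and B: "\<And>x. \<bar>\<eta> x\<bar> \<le> B"
    and supp: "\<And>x. x \<notin> cball 0 R \<Longrightarrow> \<eta> x = 0"
  shows "continuous_on {0..} (\<lambda>t. integral\<^sup>L lebesgue (\<lambda>x. max 0 (u x t - v x t) * \<eta> x))"
    and "0 \<le> t \<Longrightarrow> integrable lebesgue (\<lambda>x. max 0 (u x t - v x t) * \<eta> x)"
proof -
  let ?C = "cball (0::real^'n) R"
  have \<eta>_meas: "\<eta> \<in> borel_measurable lebesgue" by (rule measurable_completion) simp
  have B0: "0 \<le> B" using B[of 0] by linarith
  have iu: "integrable lebesgue (\<lambda>x. indicat_real ?C x * u x s)" if "0 \<le> s" for s
    using fast_diffusion_slice(1)[OF u that, of R] by (simp add: set_integrable_def)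
  have iv: "integrable lebesgue (\<lambda>x. indicat_real ?C x * v x s)" if "0 \<le> s" for s
    using fast_diffusion_slice(1)[OF v that, of R] by (simp add: set_integrable_def)
  have eq: "max 0 (u x s - v x s) * \<eta> x =
      \<eta> x * max 0 (indicat_real ?C x * u x s - indicat_real ?C x * v x s)" for x s
    using supp[of x] by (cases "x \<in> ?C") auto
  have i: "integrable lebesgue (\<lambda>x. max 0 (u x s - v x s) * \<eta> x)" if "0 \<le> s" for s
    unfolding eq
    using iu[OF that] iv[OF that] by (intro integrable_mult_bounded(1)[OF _ \<eta>_meas B]) (auto intro: integrable_max)
  then show "0 \<le> t \<Longrightarrow> integrable lebesgue (\<lambda>x. max 0 (u x t - v x t) * \<eta> x)" .
  show "continuous_on {0..} (\<lambda>t. integral\<^sup>L lebesgue (\<lambda>x. max 0 (u x t - v x t) * \<eta> x))"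
    unfolding continuous_on_def
  proof
    fix t :: real assume t: "t \<in> {0..}"
    define Y where "Y s = integral\<^sup>L lebesgue (\<lambda>x. max 0 (u x s - v x s) * \<eta> x)" for s
    define E where "E s = B * ((LINT x:?C|lebesgue. \<bar>u x s - u x t\<bar>) + (LINT x:?C|lebesgue. \<bar>v x s - v x t\<bar>))" for s
    have "(E \<longlongrightarrow> B * (0 + 0)) (at t within {0..})"
      unfolding E_def using t fast_diffusion_slice(3)[OF u, of t R] fast_diffusion_slice(3)[OF v, of t R]
      by (intro tendsto_intros) auto
    then have E: "(E \<longlongrightarrow> 0) (at t within {0..})" by simp
    have "((\<lambda>s. Y s - Y t) \<longlongrightarrow> 0) (at t within {0..})"
    proof (rule Lim_null_comparison[OF _ E])
      have le: "norm (Y s - Y t) \<le> E s" if "0 \<le> s" for s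
      proof -
        have t0: "0 \<le> t" using t by simp
        have iu': "integrable lebesgue (\<lambda>x. indicat_real ?C x * \<bar>u x s - u x t\<bar>)"
          using integrable_abs[OF Bochner_Integration.integrable_diff[OF iu[OF that] iu[OF t0]]]
          by (simp add: right_diff_distrib[symmetric] abs_mult)
        have iv': "integrable lebesgue (\<lambda>x. indicat_real ?C x * \<bar>v x s - v x t\<bar>)"
          using integrable_abs[OF Bochner_Integration.integrable_diff[OF iv[OF that] iv[OF t0]]]
          by (simp add: right_diff_distrib[symmetric] abs_mult)
        have "norm (Y s - Y t) = \<bar>integral\<^sup>L lebesgue (\<lambda>x. max 0 (u x s - v x s) * \<eta> x - max 0 (u x t - v x t) * \<eta> x)\<bar>"
          unfolding Y_def using i[OF that] i[OF t0] by simp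
        also have "\<dots> \<le> integral\<^sup>L lebesgue (\<lambda>x. \<bar>max 0 (u x s - v x s) * \<eta> x - max 0 (u x t - v x t) * \<eta> x\<bar>)"
          by (rule integral_abs_bound)
        also have "\<dots> \<le> integral\<^sup>L lebesgue (\<lambda>x. B * (indicat_real ?C x * \<bar>u x s - u x t\<bar> + indicat_real ?C x * \<bar>v x s - v x t\<bar>))"
        proof (rule integral_mono)
          show "integrable lebesgue (\<lambda>x. \<bar>max 0 (u x s - v x s) * \<eta> x - max 0 (u x t - v x t) * \<eta> x\<bar>)"
            using i[OF that] i[OF t0] by (intro integrable_abs Bochner_Integration.integrable_diff)
          show "integrable lebesgue (\<lambda>x. B * (indicat_real ?C x * \<bar>u x s - u x t\<bar> + indicat_real ?C x * \<bar>v x s - v x t\<bar>))"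
            using iu' iv' by simp
          fix x
          show "\<bar>max 0 (u x s - v x s) * \<eta> x - max 0 (u x t - v x t) * \<eta> x\<bar> \<le>
            B * (indicat_real ?C x * \<bar>u x s - u x t\<bar> + indicat_real ?C x * \<bar>v x s - v x t\<bar>)"
          proof (cases "x \<in> ?C")
            case True
            have "\<bar>max 0 (u x s - v x s) - max 0 (u x t - v x t)\<bar> * \<bar>\<eta> x\<bar> \<le> (\<bar>u x s - u x t\<bar> + \<bar>v x s - v x t\<bar>) * B"
              by (intro mult_mono B) auto
            then show ?thesis unfolding left_diff_distrib[symmetric] abs_mult using True by (simp add: mult.commute)
          qed (simp add: supp)
        qed
        also have "\<dots> = E s" unfolding E_def set_lebesgue_integral_def using iu' iv' by simp
        finally show ?thesis .
      qed
      show "\<forall>\<^sub>F s in at t within {0..}. norm (Y s - Y t) \<le> E s"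
        unfolding eventually_at_filter by (rule always_eventually) (use le in auto)
    qed
    then show "((\<lambda>t. integral\<^sup>L lebesgue (\<lambda>x. max 0 (u x t - v x t) * \<eta> x)) \<longlongrightarrow>
       integral\<^sup>L lebesgue (\<lambda>x. max 0 (u x t - v x t) * \<eta> x)) (at t within {0..})"
      unfolding Y_def[symmetric] by (simp add: LIM_zero_iff)
  qed
qed

text \<open>Stated for a general Borel function \<open>h\<close> of two values, so that it covers
  the positive part of the difference and that of the difference of powers.\<close>

lemma slice_integral_eq:
  fixes u v :: "real^'n \<Rightarrow> real \<Rightarrow> real" and U1 U2 :: "(real^'n) \<times> real \<Rightarrow> real"
    and g :: "real^'n \<Rightarrow> real" and h :: "real \<Rightarrow> real \<Rightarrow> real"
  assumes u: "fast_diffusion_solution m u u0" and v: "fast_diffusion_solution m' v v0" and t: "0 \<le> t"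
    and [measurable]: "g \<in> borel_measurable borel" and supp: "\<And>x. x \<notin> cball 0 R \<Longrightarrow> g x = 0"
    and [measurable]: "U1 \<in> borel_measurable borel" "U2 \<in> borel_measurable borel"
    and U1: "AE x in lborel. x \<in> cball 0 R \<longrightarrow> U1 (x, t) = u x t"
    and U2: "AE x in lborel. x \<in> cball 0 R \<longrightarrow> U2 (x, t) = v x t"
    and h [measurable]: "(\<lambda>(a, b). h a b) \<in> borel_measurable (borel \<Otimes>\<^sub>M borel)"
  shows "integral\<^sup>L lborel (\<lambda>x. h (U1 (x, t)) (U2 (x, t)) * g x) = integral\<^sup>L lebesgue (\<lambda>x. h (u x t) (v x t) * g x)"
proof -
  let ?C = "cball (0::real^'n) R"
  have mu: "(\<lambda>x. indicat_real ?C x * u x t) \<in> borel_measurable lebesgue"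
    using fast_diffusion_slice(1)[OF u t, of R] by (auto simp: set_integrable_def)
  have mv: "(\<lambda>x. indicat_real ?C x * v x t) \<in> borel_measurable lebesgue"
    using fast_diffusion_slice(1)[OF v t, of R] by (auto simp: set_integrable_def)
  have [measurable]: "g \<in> borel_measurable lebesgue" by (rule measurable_completion) simp
  have [measurable]: "(\<lambda>x. U1 (x, t)) \<in> borel_measurable borel" "(\<lambda>x. U2 (x, t)) \<in> borel_measurable borel"
    by (auto intro!: measurable_compose[OF _ assms(6)] measurable_compose[OF _ assms(7)] borel_measurable_continuous_onI continuous_intros)
  have hm: "(\<lambda>x. h (a x) (b x)) \<in> borel_measurable M"
    if "a \<in> borel_measurable M" "b \<in> borel_measurable M" for a b and M :: "(real^'n) measure"
    using measurable_compose[OF measurable_Pair[OF that] h] by simp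
  have m1: "(\<lambda>x. h (U1 (x, t)) (U2 (x, t)) * g x) \<in> borel_measurable borel"
  proof (rule borel_measurable_times)
    show "(\<lambda>x. h (U1 (x, t)) (U2 (x, t))) \<in> borel_measurable borel" by (rule hm) measurable
  qed measurable
  have "integral\<^sup>L lborel (\<lambda>x. h (U1 (x, t)) (U2 (x, t)) * g x) = integral\<^sup>L lebesgue (\<lambda>x. h (U1 (x, t)) (U2 (x, t)) * g x)"
    using m1 by (intro integral_completion[symmetric]) simp
  also have "\<dots> = integral\<^sup>L lebesgue (\<lambda>x. h (u x t) (v x t) * g x)"
  proof (rule integral_cong_AE)
    show "(\<lambda>x. h (U1 (x, t)) (U2 (x, t)) * g x) \<in> borel_measurable lebesgue"
      using m1 by (intro measurable_completion) simp
    have "(\<lambda>x. h (u x t) (v x t) * g x) = (\<lambda>x. h (indicat_real ?C x * u x t) (indicat_real ?C x * v x t) * g x)"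
    proof
      fix x show "h (u x t) (v x t) * g x = h (indicat_real ?C x * u x t) (indicat_real ?C x * v x t) * g x"
        using supp[of x] by (cases "x \<in> ?C") auto
    qed
    then show "(\<lambda>x. h (u x t) (v x t) * g x) \<in> borel_measurable lebesgue"
      using hm[OF mu mv] by simp
    show "AE x in lebesgue. h (U1 (x, t)) (U2 (x, t)) * g x = h (u x t) (v x t) * g x"
      using AE_completion[OF U1] AE_completion[OF U2]
    proof eventually_elim
      case (elim x)
      then show ?case using supp[of x] by (cases "x \<in> ?C") auto
    qed
  qed
  finally show ?thesis .
qed

text \<open>It rises on [\<kappa>, 2\<kappa>] and falls on [T - 2\<kappa>, T - \<kappa>]. Minus its
  derivative is therefore the averaging kernel of a window near T minus that of a window near
  0.\<close>

definition trapezoid :: "real \<Rightarrow> real \<Rightarrow> real \<Rightarrow> real" where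
  "trapezoid \<kappa> T t = max 0 (min 1 (min ((t - \<kappa>) / \<kappa>) ((T - \<kappa> - t) / \<kappa>)))"

lemma trapezoid:
  assumes "0 < \<kappa>" "4 * \<kappa> < T"
  shows "0 \<le> trapezoid \<kappa> T t" "trapezoid \<kappa> T t \<le> 1"
    "\<bar>trapezoid \<kappa> T s - trapezoid \<kappa> T t\<bar> \<le> 1 / \<kappa> * \<bar>s - t\<bar>"
    "t \<notin> {\<kappa>..T - \<kappa>} \<Longrightarrow> trapezoid \<kappa> T t = 0"
    "t \<notin> {\<kappa>, 2 * \<kappa>, T - 2 * \<kappa>, T - \<kappa>} \<Longrightarrow> (trapezoid \<kappa> T has_real_derivative
      (1 / \<kappa>) * (indicat_real {\<kappa><..<2 * \<kappa>} t - indicat_real {T - 2 * \<kappa><..<T - \<kappa>} t)) (at t)"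
proof -
  show "0 \<le> trapezoid \<kappa> T t" "trapezoid \<kappa> T t \<le> 1" by (auto simp: trapezoid_def)
  have clamp: "\<bar>max 0 (min 1 (min a b)) - max 0 (min 1 (min c d))\<bar> \<le> max \<bar>a - c\<bar> \<bar>b - d\<bar>" for a b c d :: real
    by (auto simp: max_def min_def abs_if)
  have e: "(s - \<kappa>) / \<kappa> - (t - \<kappa>) / \<kappa> = (s - t) / \<kappa>" "(T - \<kappa> - s) / \<kappa> - (T - \<kappa> - t) / \<kappa> = - ((s - t) / \<kappa>)"
    by (simp_all add: diff_divide_distrib)
  have ab: "\<bar>(s - t) / \<kappa>\<bar> = 1 / \<kappa> * \<bar>s - t\<bar>" using assms by (simp add: abs_divide)
  show "\<bar>trapezoid \<kappa> T s - trapezoid \<kappa> T t\<bar> \<le> 1 / \<kappa> * \<bar>s - t\<bar>"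
    using clamp[of "(s - \<kappa>) / \<kappa>" "(T - \<kappa> - s) / \<kappa>" "(t - \<kappa>) / \<kappa>" "(T - \<kappa> - t) / \<kappa>"]
    unfolding e trapezoid_def abs_minus_cancel ab max.idem .
  show "trapezoid \<kappa> T t = 0" if "t \<notin> {\<kappa>..T - \<kappa>}"
  proof -
    have "(t - \<kappa>) / \<kappa> \<le> 0 \<or> (T - \<kappa> - t) / \<kappa> \<le> 0"
      using that assms by (auto simp: divide_le_0_iff)
    then show ?thesis by (auto simp: trapezoid_def)
  qed
  assume t: "t \<notin> {\<kappa>, 2 * \<kappa>, T - 2 * \<kappa>, T - \<kappa>}"
  have piece: "(trapezoid \<kappa> T has_real_derivative d) (at t)"
    if "(f has_real_derivative d) (at t)" "open S" "t \<in> S" "\<And>s. s \<in> S \<Longrightarrow> trapezoid \<kappa> T s = f s" for f d S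
    by (rule has_field_derivative_transform_within_open[OF that(1-3)]) (use that(4) in simp)
  have dz: "((\<lambda>_. c) has_real_derivative 0) (at t)" for c :: real by simp
  consider "t < \<kappa>" | "\<kappa> < t" "t < 2 * \<kappa>" | "2 * \<kappa> < t" "t < T - 2 * \<kappa>" | "T - 2 * \<kappa> < t" "t < T - \<kappa>" | "T - \<kappa> < t"
    using t by fastforce
  then show "(trapezoid \<kappa> T has_real_derivative
      (1 / \<kappa>) * (indicat_real {\<kappa><..<2 * \<kappa>} t - indicat_real {T - 2 * \<kappa><..<T - \<kappa>} t)) (at t)"
  proof cases
    case 1
    have "trapezoid \<kappa> T s = 0" if "s \<in> {..<\<kappa>}" for s
    proof -
      have "(s - \<kappa>) / \<kappa> \<le> 0" using that assms by (simp add: divide_le_0_iff)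
      then show ?thesis by (simp add: trapezoid_def)
    qed
    from piece[OF dz open_lessThan _ this] 1 assms show ?thesis by simp
  next
    case 2
    have "trapezoid \<kappa> T s = (s - \<kappa>) / \<kappa>" if "s \<in> {\<kappa><..<2 * \<kappa>}" for s
    proof -
      have "0 \<le> (s - \<kappa>) / \<kappa>" "(s - \<kappa>) / \<kappa> \<le> 1" "1 \<le> (T - \<kappa> - s) / \<kappa>"
        using that assms by (auto simp: divide_simps)
      then show ?thesis by (simp add: trapezoid_def)
    qed
    moreover have "((\<lambda>s. (s - \<kappa>) / \<kappa>) has_real_derivative 1 / \<kappa>) (at t)"
      using assms by (auto intro!: derivative_eq_intros)
    ultimately show ?thesis using piece[OF _ open_greaterThanLessThan, of "\<lambda>s. (s - \<kappa>) / \<kappa>" "1 / \<kappa>" \<kappa> "2 * \<kappa>"] 2 assms by simp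
  next
    case 3
    have "trapezoid \<kappa> T s = 1" if "s \<in> {2 * \<kappa><..<T - 2 * \<kappa>}" for s
    proof -
      have "1 \<le> (s - \<kappa>) / \<kappa>" "1 \<le> (T - \<kappa> - s) / \<kappa>"
        using that assms by (auto simp: divide_simps)
      then show ?thesis by (simp add: trapezoid_def)
    qed
    from piece[OF dz open_greaterThanLessThan _ this] 3 assms show ?thesis by simp
  next
    case 4
    have "trapezoid \<kappa> T s = (T - \<kappa> - s) / \<kappa>" if "s \<in> {T - 2 * \<kappa><..<T - \<kappa>}" for s
    proof -
      have "1 \<le> (s - \<kappa>) / \<kappa>" "(T - \<kappa> - s) / \<kappa> \<le> 1" "0 \<le> (T - \<kappa> - s) / \<kappa>"
        using that assms by (auto simp: divide_simps)
      then show ?thesis by (simp add: trapezoid_def)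
    qed
    moreover have "((\<lambda>s. (T - \<kappa> - s) / \<kappa>) has_real_derivative - (1 / \<kappa>)) (at t)"
      using assms by (auto intro!: derivative_eq_intros simp: divide_inverse)
    ultimately show ?thesis
      using piece[OF _ open_greaterThanLessThan, of "\<lambda>s. (T - \<kappa> - s) / \<kappa>" "- (1 / \<kappa>)" "T - 2 * \<kappa>" "T - \<kappa>"] 4 assms by simp
  next
    case 5
    have "trapezoid \<kappa> T s = 0" if "s \<in> {T - \<kappa><..}" for s
    proof -
      have "(T - \<kappa> - s) / \<kappa> \<le> 0" using that assms by (simp add: divide_le_0_iff)
      then show ?thesis by (simp add: trapezoid_def)
    qed
    from piece[OF dz open_greaterThan _ this] 5 assms show ?thesis by simp
  qed
qed

text \<open>Kato's inequality with a product test function, trapezoidal in time. The two window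
  averages tend to the values at T and at 0 by continuity, and the right side is at most T \<Lambda>
  because the trapezoid lies between 0 and 1 and \<Lambda> \<ge> 0.\<close>

lemma fast_diffusion_comparison:
  fixes u v :: "real^'n \<Rightarrow> real \<Rightarrow> real"
  assumes u: "fast_diffusion_solution m u u0" and v: "fast_diffusion_solution m v v0"
    and m: "0 < m" "m \<le> 1" and n: "CARD('n) \<ge> 2"
    and \<eta>: "Ck 2 \<eta>" "\<And>x. 0 \<le> \<eta> x" "\<And>x. R \<le> norm x \<Longrightarrow> \<eta> x = 0"
    and T: "0 < T" and \<Lambda>: "0 \<le> \<Lambda>"
      "\<And>t. 0 < t \<Longrightarrow> t < T \<Longrightarrow>
        integral\<^sup>L lebesgue (\<lambda>x. max 0 (u x t powr m - v x t powr m) * laplacian \<eta> x) \<le> \<Lambda>"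
  shows "integral\<^sup>L lebesgue (\<lambda>x. max 0 (u x T - v x T) * \<eta> x) \<le>
     integral\<^sup>L lebesgue (\<lambda>x. max 0 (u x 0 - v x 0) * \<eta> x) + (real CARD('n) - 1) / m * T * \<Lambda>"
proof -
  let ?c = "(real CARD('n) - 1) / m"
  have c: "0 < ?c" using n m by simp
  have supp: "\<eta> x = 0" if "x \<notin> cball 0 R" for x using that \<eta>(3)[of x] by auto
  have cont\<eta>: "continuous_on UNIV \<eta>" using \<eta>(1) by (rule Ck_imp_continuous)
  then have [measurable]: "\<eta> \<in> borel_measurable borel" by (rule borel_measurable_continuous_onI)
  have "continuous_on UNIV (partial_deriv b (partial_deriv b \<eta>))" if "b \<in> Basis" for b
    using \<eta>(1) that by (simp only: numeral_2_eq_2 Ck.simps)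
  then have contL: "continuous_on UNIV (laplacian \<eta>)"
    unfolding laplacian_def[abs_def] by (intro continuous_on_sum)
  then have [measurable]: "laplacian \<eta> \<in> borel_measurable borel" by (rule borel_measurable_continuous_onI)
  have suppL: "laplacian \<eta> x = 0" if "x \<notin> cball 0 R" for x
  proof -
    have z1: "partial_deriv b \<eta> y = 0" if "y \<notin> cball 0 R" for b y
      by (rule partial_deriv_zero_outside[OF closed_cball supp that])
    have "partial_deriv b (partial_deriv b \<eta>) x = 0" for b
      by (rule partial_deriv_zero_outside[OF closed_cball z1 that])
    then show ?thesis by (simp add: laplacian_def)
  qed
  obtain B where B: "\<And>x. \<bar>\<eta> x\<bar> \<le> B" using compact_support_bounded[OF cont\<eta> compact_cball supp] by blast
  obtain BL where BL: "\<And>x. \<bar>laplacian \<eta> x\<bar> \<le> BL" using compact_support_bounded[OF contL compact_cball suppL] by blast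
  define Y where "Y t = integral\<^sup>L lebesgue (\<lambda>x. max 0 (u x t - v x t) * \<eta> x)" for t
  have contY: "continuous_on {0..} Y"
    unfolding Y_def by (rule positive_part_continuous(1)[OF u v _ B supp]) measurable
  have "Y T - Y 0 \<le> ?c * T * \<Lambda>"
  proof (rule field_le_epsilon)
    fix e2 :: real assume "e2 > 0"
    \<comment> \<open>Each of the two windows contributes an error e.\<close>
    define e where "e = e2 / 2"
    have e: "e > 0" using \<open>e2 > 0\<close> by (simp add: e_def)
    obtain d0 where d0: "d0 > 0" "\<And>s. 0 \<le> s \<Longrightarrow> dist s 0 < d0 \<Longrightarrow> dist (Y s) (Y 0) < e"
      using contY e unfolding continuous_on_iff by (metis atLeast_iff order_refl)
    obtain dT where dT: "dT > 0" "\<And>s. 0 \<le> s \<Longrightarrow> dist s T < dT \<Longrightarrow> dist (Y s) (Y T) < e"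
      using contY e T unfolding continuous_on_iff by (metis atLeast_iff less_imp_le)
    \<comment> \<open>Division by 5 gives 4\<kappa> < T and places both windows where
      \<open>Y\<close> differs by less than e from its end value.\<close>
    define \<kappa> where "\<kappa> = min (min d0 dT) T / 5"
    have \<kappa>: "0 < \<kappa>" "4 * \<kappa> < T" "2 * \<kappa> < d0" "2 * \<kappa> < dT" using d0(1) dT(1) T by (auto simp: \<kappa>_def min_def)
    have Y0: "Y s \<le> Y 0 + e" if "\<kappa> < s" "s < 2 * \<kappa>" for s
      using d0(2)[of s] that \<kappa> by (simp add: dist_real_def)
    have YT: "Y T - e \<le> Y s" if "T - 2 * \<kappa> < s" "s < T - \<kappa>" for s
      using dT(2)[of s] that \<kappa> by (simp add: dist_real_def)
    \<comment> \<open>The cylinder has to start at a positive time, strictly before the support of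
      the trapezoid.\<close>
    define a where "a = \<kappa> / 2"
    have a: "0 < a" "a < \<kappa>" using \<kappa> by (auto simp: a_def)
    obtain U1 W1 where U1: "integrable lborel U1" "integrable lborel W1" "integrable lborel (\<lambda>p. U1 p powr m)" "\<And>p. 0 \<le> U1 p"
      "AE t in lborel. t \<in> {a..T} \<longrightarrow> (AE x in lborel. x \<in> cball 0 (R + 1) \<longrightarrow> U1 (x, t) = u x t)"
      "\<And>\<eta>. test_function (ball 0 (R + 1) \<times> {a<..<T}) \<eta> \<Longrightarrow>
        integral\<^sup>L lborel (\<lambda>p. U1 p * deriv (\<lambda>s. \<eta> (fst p, s)) (snd p)) = - integral\<^sup>L lborel (\<lambda>p. W1 p * \<eta> p)"
      "\<And>\<eta>. test_function (ball 0 (R + 1) \<times> {a<..<T}) \<eta> \<Longrightarrow>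
        ?c * integral\<^sup>L lborel (\<lambda>p. U1 p powr m * laplacian (\<lambda>y. \<eta> (y, snd p)) (fst p)) = integral\<^sup>L lborel (\<lambda>p. W1 p * \<eta> p)"
      using fast_diffusion_representative[OF u m a(1)] by blast
    obtain U2 W2 where U2: "integrable lborel U2" "integrable lborel W2" "integrable lborel (\<lambda>p. U2 p powr m)" "\<And>p. 0 \<le> U2 p"
      "AE t in lborel. t \<in> {a..T} \<longrightarrow> (AE x in lborel. x \<in> cball 0 (R + 1) \<longrightarrow> U2 (x, t) = v x t)"
      "\<And>\<eta>. test_function (ball 0 (R + 1) \<times> {a<..<T}) \<eta> \<Longrightarrow>
        integral\<^sup>L lborel (\<lambda>p. U2 p * deriv (\<lambda>s. \<eta> (fst p, s)) (snd p)) = - integral\<^sup>L lborel (\<lambda>p. W2 p * \<eta> p)"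
      "\<And>\<eta>. test_function (ball 0 (R + 1) \<times> {a<..<T}) \<eta> \<Longrightarrow>
        ?c * integral\<^sup>L lborel (\<lambda>p. U2 p powr m * laplacian (\<lambda>y. \<eta> (y, snd p)) (fst p)) = integral\<^sup>L lborel (\<lambda>p. W2 p * \<eta> p)"
      using fast_diffusion_representative[OF v m a(1)] by blast
    have [measurable]: "U1 \<in> borel_measurable borel" "U2 \<in> borel_measurable borel"
      using U1(1) U2(1) by auto
    define \<theta> where "\<theta> = trapezoid \<kappa> T"
    define \<theta>' where "\<theta>' t = (1 / \<kappa>) * (indicat_real {\<kappa><..<2 * \<kappa>} t - indicat_real {T - 2 * \<kappa><..<T - \<kappa>} t)" for t
    have [measurable]: "\<theta>' \<in> borel_measurable borel" unfolding \<theta>'_def[abs_def] by measurable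
    have \<theta>'_bound: "\<bar>\<theta>' t\<bar> \<le> 1 / \<kappa>" for t using \<kappa> by (auto simp: \<theta>'_def indicator_def)
    have [measurable]: "\<theta> \<in> borel_measurable borel" unfolding \<theta>_def trapezoid_def[abs_def] by measurable
    have kato: "- integral\<^sup>L lborel (\<lambda>p. max 0 (U1 p - U2 p) * (\<eta> (fst p) * \<theta>' (snd p)))
      \<le> ?c * integral\<^sup>L lborel (\<lambda>p. max 0 (U1 p powr m - U2 p powr m) * (\<theta> (snd p) * laplacian \<eta> (fst p)))"
    proof (rule kato_pair[where F = "\<lambda>p. W1 p - W2 p" and ?O1.0 = "ball 0 (R + 1) \<times> {a<..<T}" and M = "1 / \<kappa>"
          and X = "{\<kappa>, 2 * \<kappa>, T - 2 * \<kappa>, T - \<kappa>}" and R = R and ?s1.0 = \<kappa> and ?s2.0 = "T - \<kappa>"])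
      show "cball 0 R \<times> {\<kappa>..T - \<kappa>} \<subseteq> ball 0 (R + 1) \<times> {a<..<T}" using a \<kappa> by auto
      fix \<zeta> assume t: "test_function (ball (0::real^'n) (R + 1) \<times> {a<..<T}) \<zeta>"
      obtain B1 B2 B3 where Bs: "\<And>p. \<bar>deriv (\<lambda>s. \<zeta> (fst p, s)) (snd p)\<bar> \<le> B1"
        "\<And>p. \<bar>laplacian (\<lambda>y. \<zeta> (y, snd p)) (fst p)\<bar> \<le> B2" "\<And>p. \<bar>\<zeta> p\<bar> \<le> B3"
        using test_function_deriv_measurable(7-9)[OF t] by blast
      note [measurable] = test_function_deriv_measurable(1-3)[OF t]
      have sub: "integral\<^sup>L lborel (\<lambda>p. (f p - g p) * h p) = integral\<^sup>L lborel (\<lambda>p. f p * h p) - integral\<^sup>L lborel (\<lambda>p. g p * h p)"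
        if "integrable lborel f" "integrable lborel g" "h \<in> borel_measurable lborel" "\<And>p. \<bar>h p\<bar> \<le> C"
        for f g h :: "(real^'n) \<times> real \<Rightarrow> real" and C
        using integrable_mult_bounded(2)[OF that(1,3,4)] integrable_mult_bounded(2)[OF that(2,3,4)]
        by (simp add: left_diff_distrib)
      show "integral\<^sup>L lborel (\<lambda>p. (U1 p - U2 p) * deriv (\<lambda>s. \<zeta> (fst p, s)) (snd p)) = - integral\<^sup>L lborel (\<lambda>p. (W1 p - W2 p) * \<zeta> p)"
        using U1(6)[OF t] U2(6)[OF t] sub[OF U1(1) U2(1) _ Bs(1)] sub[OF U1(2) U2(2) _ Bs(3)] by simp
      show "?c * integral\<^sup>L lborel (\<lambda>p. (U1 p powr m - U2 p powr m) * laplacian (\<lambda>y. \<zeta> (y, snd p)) (fst p)) =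
        integral\<^sup>L lborel (\<lambda>p. (W1 p - W2 p) * \<zeta> p)"
        using U1(7)[OF t] U2(7)[OF t] sub[OF U1(3) U2(3) _ Bs(2)] sub[OF U1(2) U2(2) _ Bs(3)]
        by (simp add: right_diff_distrib)
    next
      show "(\<theta> has_real_derivative \<theta>' t) (at t)" if "t \<notin> {\<kappa>, 2 * \<kappa>, T - 2 * \<kappa>, T - \<kappa>}" for t
        using trapezoid(5)[OF \<kappa>(1,2) that] by (simp add: \<theta>_def \<theta>'_def)
    qed (use U1 U2 m c \<eta> trapezoid(1-4)[OF \<kappa>(1,2)] \<theta>'_bound in \<open>auto simp: \<theta>_def intro!: open_Times\<close>)
    have slices: "AE t in lborel. t \<in> {a..T} \<longrightarrow>
        integral\<^sup>L lborel (\<lambda>x. max 0 (U1 (x, t) - U2 (x, t)) * \<eta> x) = Y t \<and>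
        integral\<^sup>L lborel (\<lambda>x. max 0 (U1 (x, t) powr m - U2 (x, t) powr m) * laplacian \<eta> x) =
        integral\<^sup>L lebesgue (\<lambda>x. max 0 (u x t powr m - v x t powr m) * laplacian \<eta> x)"
      using U1(5) U2(5)
    proof eventually_elim
      case (elim t)
      show ?case
      proof (intro impI conjI)
        assume t: "t \<in> {a..T}"
        have r: "AE x in lborel. x \<in> cball 0 R \<longrightarrow> U1 (x, t) = u x t" "AE x in lborel. x \<in> cball 0 R \<longrightarrow> U2 (x, t) = v x t"
        proof -
          have "AE x in lborel. x \<in> cball 0 (R + 1) \<longrightarrow> U1 (x, t) = u x t" using elim(1) t by blast
          then show "AE x in lborel. x \<in> cball 0 R \<longrightarrow> U1 (x, t) = u x t" by eventually_elim auto
          have "AE x in lborel. x \<in> cball 0 (R + 1) \<longrightarrow> U2 (x, t) = v x t" using elim(2) t by blast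
          then show "AE x in lborel. x \<in> cball 0 R \<longrightarrow> U2 (x, t) = v x t" by eventually_elim auto
        qed
        have t0: "0 \<le> t" using t a by simp
        show "integral\<^sup>L lborel (\<lambda>x. max 0 (U1 (x, t) - U2 (x, t)) * \<eta> x) = Y t"
          unfolding Y_def by (rule slice_integral_eq[OF u v t0 _ supp _ _ r]) measurable
        show "integral\<^sup>L lborel (\<lambda>x. max 0 (U1 (x, t) powr m - U2 (x, t) powr m) * laplacian \<eta> x) =
          integral\<^sup>L lebesgue (\<lambda>x. max 0 (u x t powr m - v x t powr m) * laplacian \<eta> x)"
          by (rule slice_integral_eq[OF u v t0 _ suppL _ _ r, where h = "\<lambda>a b. max 0 (a powr m - b powr m)"]) measurable
      qed
    qed
    have fubini: "integral\<^sup>L lborel H = (LBINT t. LBINT x. H (x, t))" "integrable lborel (\<lambda>t. LBINT x. H (x, t))"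
      if "integrable lborel H" for H :: "(real^'n) \<times> real \<Rightarrow> real"
    proof -
      have i: "integrable (lborel \<Otimes>\<^sub>M lborel) (\<lambda>(x, t). H (x, t))" using that by (simp add: lborel_prod)
      show "integral\<^sup>L lborel H = (LBINT t. LBINT x. H (x, t))"
        using lborel_pair.integral_snd[OF i] by (simp add: lborel_prod)
      show "integrable lborel (\<lambda>t. LBINT x. H (x, t))" using lborel_pair.integrable_snd[OF i] by simp
    qed
    have prod_meas: "(\<lambda>p. f (fst p) * g (snd p)) \<in> borel_measurable lborel"
      if [measurable]: "f \<in> borel_measurable borel" "g \<in> borel_measurable borel" for f :: "real^'n \<Rightarrow> real" and g :: "real \<Rightarrow> real"
      unfolding lborel_prod[symmetric] by measurable
    have ii: "integrable lborel (indicat_real {x<..<y})" "integral\<^sup>L lborel (indicat_real {x<..<y}) = y - x"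
      if "x \<le> y" for x y :: real using that by auto
    \<comment> \<open>After Tonelli the integral over space is \<theta>' t times \<open>Y t\<close>;
      replacing Y by its bounds on the two windows leaves elementary integrals of length
      \<kappa>.\<close>
    have left: "Y T - Y 0 - 2 * e \<le> - integral\<^sup>L lborel (\<lambda>p. max 0 (U1 p - U2 p) * (\<eta> (fst p) * \<theta>' (snd p)))"
    proof -
      let ?H = "\<lambda>p. max 0 (U1 p - U2 p) * (\<eta> (fst p) * \<theta>' (snd p))"
      have bd: "\<bar>\<eta> (fst p) * \<theta>' (snd p)\<bar> \<le> B * (1 / \<kappa>)" for p :: "(real^'n) \<times> real"
        unfolding abs_mult using order_trans[OF abs_ge_zero B] by (intro mult_mono B \<theta>'_bound) auto
      have iH: "integrable lborel ?H"
      proof (rule integrable_mult_bounded(2)[OF _ _ bd])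
        show "integrable lborel (\<lambda>p. max 0 (U1 p - U2 p))" using U1(1) U2(1) by (auto intro: integrable_max)
        show "(\<lambda>p. \<eta> (fst p) * \<theta>' (snd p)) \<in> borel_measurable lborel" by (rule prod_meas) measurable
      qed
      have "integral\<^sup>L lborel ?H = (LBINT t. LBINT x. ?H (x, t))" by (rule fubini(1)[OF iH])
      also have "\<dots> \<le> (LBINT t. (1 / \<kappa>) * ((Y 0 + e) * indicat_real {\<kappa><..<2 * \<kappa>} t - (Y T - e) * indicat_real {T - 2 * \<kappa><..<T - \<kappa>} t))"
      proof (rule integral_mono_AE)
        show "integrable lborel (\<lambda>t. LBINT x. ?H (x, t))" by (rule fubini(2)[OF iH])
        show "integrable lborel (\<lambda>t. (1 / \<kappa>) * ((Y 0 + e) * indicat_real {\<kappa><..<2 * \<kappa>} t - (Y T - e) * indicat_real {T - 2 * \<kappa><..<T - \<kappa>} t))"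
          by (intro integrable_mult_right Bochner_Integration.integrable_diff ii) (use \<kappa> in auto)
        show "AE t in lborel. (LBINT x. ?H (x, t)) \<le> (1 / \<kappa>) * ((Y 0 + e) * indicat_real {\<kappa><..<2 * \<kappa>} t - (Y T - e) * indicat_real {T - 2 * \<kappa><..<T - \<kappa>} t)"
          using slices
        proof eventually_elim
          case (elim t)
          have eq: "(LBINT x. ?H (x, t)) = \<theta>' t * (LBINT x. max 0 (U1 (x, t) - U2 (x, t)) * \<eta> x)"
            by (subst integral_mult_right_zero[symmetric]) (simp add: mult_ac)
          show ?case
          proof (cases "t \<in> {\<kappa>..T - \<kappa>}")
            case True
            then have "t \<in> {a..T}" using a \<kappa> by auto
            with elim have eq2: "(LBINT x. ?H (x, t)) = \<theta>' t * Y t" unfolding eq by simp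
            consider "t \<in> {\<kappa><..<2 * \<kappa>}" "t \<notin> {T - 2 * \<kappa><..<T - \<kappa>}" | "t \<in> {T - 2 * \<kappa><..<T - \<kappa>}" "t \<notin> {\<kappa><..<2 * \<kappa>}"
              | "t \<notin> {\<kappa><..<2 * \<kappa>}" "t \<notin> {T - 2 * \<kappa><..<T - \<kappa>}" using \<kappa> by fastforce
            then show ?thesis
            proof cases
              case 1
              then have "Y t / \<kappa> \<le> (Y 0 + e) / \<kappa>" using Y0[of t] \<kappa> by (intro divide_right_mono) auto
              then show ?thesis unfolding eq2 unfolding \<theta>'_def using 1 by simp
            next
              case 2
              then have "(- Y t) / \<kappa> \<le> (e - Y T) / \<kappa>" using YT[of t] \<kappa> by (intro divide_right_mono) auto
              then show ?thesis unfolding eq2 unfolding \<theta>'_def using 2 by simp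
            next
              case 3
              then show ?thesis unfolding eq2 unfolding \<theta>'_def by simp
            qed
          next
            case False
            then have "t \<notin> {\<kappa><..<2 * \<kappa>}" "t \<notin> {T - 2 * \<kappa><..<T - \<kappa>}" using \<kappa> by auto
            then show ?thesis unfolding eq unfolding \<theta>'_def by simp
          qed
        qed
      qed
      also have "\<dots> = (1 / \<kappa>) * ((Y 0 + e) * \<kappa> - (Y T - e) * \<kappa>)"
      proof -
        have i1: "integrable lborel (\<lambda>t. (Y 0 + e) * indicat_real {\<kappa><..<2 * \<kappa>} t)"
          and i2: "integrable lborel (\<lambda>t. (Y T - e) * indicat_real {T - 2 * \<kappa><..<T - \<kappa>} t)"
          by (intro integrable_mult_right ii; use \<kappa> in simp)+
        show ?thesis
          unfolding integral_mult_right_zero Bochner_Integration.integral_diff[OF i1 i2]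
          using \<kappa> by (simp add: ii(2))
      qed
      also have "\<dots> = Y 0 + e - (Y T - e)" using \<kappa> by (simp add: left_diff_distrib[symmetric])
      finally show ?thesis by simp
    qed
    have right: "integral\<^sup>L lborel (\<lambda>p. max 0 (U1 p powr m - U2 p powr m) * (\<theta> (snd p) * laplacian \<eta> (fst p))) \<le> T * \<Lambda>"
    proof -
      let ?H = "\<lambda>p. max 0 (U1 p powr m - U2 p powr m) * (\<theta> (snd p) * laplacian \<eta> (fst p))"
      have bd: "\<bar>laplacian \<eta> (fst p) * \<theta> (snd p)\<bar> \<le> BL * 1" for p :: "(real^'n) \<times> real"
        unfolding abs_mult using order_trans[OF abs_ge_zero BL] trapezoid(1,2)[OF \<kappa>(1,2), of "snd p"]
        by (intro mult_mono BL) (auto simp: \<theta>_def)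
      have iH: "integrable lborel ?H"
        unfolding mult.commute[of "\<theta> _"]
      proof (rule integrable_mult_bounded(2)[OF _ _ bd])
        show "integrable lborel (\<lambda>p. max 0 (U1 p powr m - U2 p powr m))" using U1(3) U2(3) by (auto intro: integrable_max)
        show "(\<lambda>p. laplacian \<eta> (fst p) * \<theta> (snd p)) \<in> borel_measurable lborel" by (rule prod_meas) measurable
      qed
      have "integral\<^sup>L lborel ?H = (LBINT t. LBINT x. ?H (x, t))" by (rule fubini(1)[OF iH])
      also have "\<dots> \<le> (LBINT t. \<Lambda> * indicat_real {0..T} t)"
      proof (rule integral_mono_AE)
        show "integrable lborel (\<lambda>t. LBINT x. ?H (x, t))" by (rule fubini(2)[OF iH])
        show "integrable lborel (\<lambda>t. \<Lambda> * indicat_real {0..T} t)"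
          by (intro integrable_mult_right integrable_indicator_compact) simp
        show "AE t in lborel. (LBINT x. ?H (x, t)) \<le> \<Lambda> * indicat_real {0..T} t"
          using slices
        proof eventually_elim
          case (elim t)
          have eq: "(LBINT x. ?H (x, t)) = \<theta> t * (LBINT x. max 0 (U1 (x, t) powr m - U2 (x, t) powr m) * laplacian \<eta> x)"
            by (subst integral_mult_right_zero[symmetric]) (simp add: mult_ac)
          show ?case
          proof (cases "t \<in> {\<kappa>..T - \<kappa>}")
            case True
            then have t: "t \<in> {a..T}" "0 < t" "t < T" using a \<kappa> by auto
            have "(LBINT x. ?H (x, t)) \<le> \<theta> t * \<Lambda>"
              unfolding eq using elim t \<Lambda>(2)[OF t(2,3)] trapezoid(1)[OF \<kappa>(1,2)]
              by (intro mult_left_mono) (auto simp: \<theta>_def)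
            also have "\<dots> \<le> 1 * \<Lambda>" using \<Lambda>(1) trapezoid(2)[OF \<kappa>(1,2)] by (intro mult_right_mono) (auto simp: \<theta>_def)
            finally show ?thesis using t by simp
          next
            case False
            then have "\<theta> t = 0" using trapezoid(4)[OF \<kappa>(1,2)] by (simp add: \<theta>_def)
            then show ?thesis unfolding eq using \<Lambda>(1) by simp
          qed
        qed
      qed
      also have "\<dots> = T * \<Lambda>" using T by simp
      finally show ?thesis .
    qed
    have "Y T - Y 0 - 2 * e \<le> ?c * (T * \<Lambda>)"
      using left kato mult_left_mono[OF right less_imp_le[OF c]] by linarith
    then show "Y T - Y 0 \<le> ?c * T * \<Lambda> + e2" unfolding e_def by (simp add: mult.assoc)
  qed
  then show ?thesis unfolding Y_def by simp
qed

section \<open>The contraction estimate\<close>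

text \<open>The affine argument \<alpha> |x|^2 + a serves cut-offs (\<alpha> = 1/R^2), the
  superharmonic weight (a > 0) and travelling waves (\<alpha> = e^(-2 \<beta> t)). Derivatives are
  taken within S, so the origin is no exception.\<close>

lemma laplacian_radial:
  fixes x :: "'a::euclidean_space"
  assumes g: "\<And>s. s \<in> S \<Longrightarrow> (g has_real_derivative g' s) (at s within S)"
    and g': "\<And>s. s \<in> S \<Longrightarrow> (g' has_real_derivative g'' s) (at s within S)"
    and S: "\<And>x::'a. \<alpha> * (x \<bullet> x) + a \<in> S"
  shows "partial_deriv b (\<lambda>x. g (\<alpha> * (x \<bullet> x) + a)) x = g' (\<alpha> * (x \<bullet> x) + a) * (2 * \<alpha> * (x \<bullet> b))"
    and "laplacian (\<lambda>x. g (\<alpha> * (x \<bullet> x) + a)) x =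
      4 * \<alpha>\<^sup>2 * (x \<bullet> x) * g'' (\<alpha> * (x \<bullet> x) + a) + 2 * \<alpha> * DIM('a) * g' (\<alpha> * (x \<bullet> x) + a)"
proof -
  let ?\<phi> = "\<lambda>x::'a. \<alpha> * (x \<bullet> x) + a"
  have d\<phi>: "(?\<phi> has_derivative (\<lambda>h. 2 * \<alpha> * (x \<bullet> h))) (at x)" for x
    by (auto intro!: derivative_eq_intros simp: inner_commute algebra_simps)
  have pd: "partial_deriv b (\<lambda>x. g (?\<phi> x)) x = g' (?\<phi> x) * (2 * \<alpha> * (x \<bullet> b))" for b x
    using partial_deriv_eq[OF has_derivative_compose_real_within[OF g[OF S] S d\<phi>]] .
  then show "partial_deriv b (\<lambda>x. g (?\<phi> x)) x = g' (?\<phi> x) * (2 * \<alpha> * (x \<bullet> b))" .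
  have "partial_deriv b (partial_deriv b (\<lambda>x. g (?\<phi> x))) x =
     g'' (?\<phi> x) * (2 * \<alpha> * (x \<bullet> b)) * (2 * \<alpha> * (x \<bullet> b)) + g' (?\<phi> x) * (2 * \<alpha> * (b \<bullet> b))" for b
  proof -
    have "((\<lambda>x. 2 * \<alpha> * (x \<bullet> b)) has_derivative (\<lambda>h. 2 * \<alpha> * (h \<bullet> b))) (at x)"
      by (auto intro!: derivative_eq_intros)
    from has_derivative_mult[OF has_derivative_compose_real_within[OF g'[OF S] S d\<phi>] this]
    have "((\<lambda>x. g' (?\<phi> x) * (2 * \<alpha> * (x \<bullet> b))) has_derivative
      (\<lambda>h. g' (?\<phi> x) * (2 * \<alpha> * (h \<bullet> b)) + g'' (?\<phi> x) * (2 * \<alpha> * (x \<bullet> h)) * (2 * \<alpha> * (x \<bullet> b)))) (at x)" .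
    from partial_deriv_eq[OF this, of b] have "partial_deriv b (\<lambda>x. g' (?\<phi> x) * (2 * \<alpha> * (x \<bullet> b))) x =
      g' (?\<phi> x) * (2 * \<alpha> * (b \<bullet> b)) + g'' (?\<phi> x) * (2 * \<alpha> * (x \<bullet> b)) * (2 * \<alpha> * (x \<bullet> b))" .
    moreover have "partial_deriv b (\<lambda>x. g (?\<phi> x)) = (\<lambda>x. g' (?\<phi> x) * (2 * \<alpha> * (x \<bullet> b)))" using pd by blast
    ultimately show ?thesis by simp
  qed
  then have "laplacian (\<lambda>x. g (?\<phi> x)) x =
    (\<Sum>b\<in>Basis. 4 * \<alpha>\<^sup>2 * g'' (?\<phi> x) * ((x \<bullet> b) * (x \<bullet> b)) + 2 * \<alpha> * g' (?\<phi> x))"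
    unfolding laplacian_def by (intro sum.cong) (auto simp: power2_eq_square)
  also have "\<dots> = 4 * \<alpha>\<^sup>2 * g'' (?\<phi> x) * (x \<bullet> x) + DIM('a) * (2 * \<alpha> * g' (?\<phi> x))"
    by (simp add: sum.distrib sum_distrib_left[symmetric] euclidean_inner[of x x])
  finally show "laplacian (\<lambda>x. g (?\<phi> x)) x = 4 * \<alpha>\<^sup>2 * (x \<bullet> x) * g'' (?\<phi> x) + 2 * \<alpha> * DIM('a) * g' (?\<phi> x)"
    by simp
qed

section \<open>Cut-off functions and bounds for their Laplacians\<close>

lemma pos_part_power_deriv:
  "((\<lambda>y::real. max 0 y ^ (N + 2)) has_real_derivative real (N + 2) * max 0 y ^ (N + 1)) (at y)"
proof -
  consider "y < 0" | "y = 0" | "y > 0" by linarith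
  then show ?thesis
  proof cases
    case 1
    have "((\<lambda>_. 0) has_real_derivative 0) (at y)" by simp
    then have "((\<lambda>y::real. max 0 y ^ (N + 2)) has_real_derivative 0) (at y)"
      by (rule has_field_derivative_transform_within_open[of _ _ _ "{..<0}"]) (use 1 in auto)
    then show ?thesis using 1 by simp
  next
    case 2
    have "((\<lambda>h::real. max 0 h ^ (N + 2) / h) \<longlongrightarrow> 0) (at 0)"
    proof (rule Lim_null_comparison)
      show "\<forall>\<^sub>F h in at (0::real). norm (max 0 h ^ (N + 2) / h) \<le> \<bar>h\<bar> ^ (N + 1)"
      proof (rule always_eventually, rule allI)
        fix h :: real show "norm (max 0 h ^ (N + 2) / h) \<le> \<bar>h\<bar> ^ (N + 1)"
        proof (cases "h > 0")
          case False
          then have "norm (max 0 h ^ (N + 2) / h) = 0" by simp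
          also have "0 \<le> \<bar>h\<bar> ^ (N + 1)" by (rule zero_le_power) simp
          finally show ?thesis .
        qed auto
      qed
      have "((\<lambda>h::real. \<bar>h\<bar> ^ (N + 1)) \<longlongrightarrow> \<bar>0\<bar> ^ (N + 1)) (at 0)" by (intro tendsto_intros)
      then show "((\<lambda>h::real. \<bar>h\<bar> ^ (N + 1)) \<longlongrightarrow> 0) (at 0)" by simp
    qed
    then show ?thesis using 2 by (simp add: has_field_derivative_iff)
  next
    case 3
    have "((\<lambda>y. y ^ (N + 2)) has_real_derivative real (N + 2) * y ^ (N + 1)) (at y)"
      by (rule DERIV_cong[OF DERIV_pow[of "N + 2"]]) simp
    then have "((\<lambda>y::real. max 0 y ^ (N + 2)) has_real_derivative real (N + 2) * y ^ (N + 1)) (at y)"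
      by (rule has_field_derivative_transform_within_open[of _ _ _ "{0<..}"]) (use 3 in auto)
    moreover have "max 0 y = y" using 3 by simp
    ultimately show ?thesis by (simp only:)
  qed
qed

text \<open>To be evaluated at multiples of |x|^2 or |x|^2 + a. A large N keeps the second
  derivative comparable to a power of the function itself near s = 1; a large l makes the first
  derivative of order s^(l+1) at 0, which offsets a negative power of s. The exponent N + 3 is at
  least 3, hence C^2.\<close>

definition cutoff :: "nat \<Rightarrow> nat \<Rightarrow> real \<Rightarrow> real" where
  "cutoff l N s = max 0 (1 - s ^ (l + 2)) ^ (N + 3)"

definition cutoff' :: "nat \<Rightarrow> nat \<Rightarrow> real \<Rightarrow> real" where
  "cutoff' l N s = - (real (N + 3) * real (l + 2)) * (s ^ (l + 1) * max 0 (1 - s ^ (l + 2)) ^ (N + 2))"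

definition cutoff'' :: "nat \<Rightarrow> nat \<Rightarrow> real \<Rightarrow> real" where
  "cutoff'' l N s = - (real (N + 3) * real (l + 2)) * (real (l + 1) * s ^ l * max 0 (1 - s ^ (l + 2)) ^ (N + 2)
     - s ^ (l + 1) * (real (N + 2) * max 0 (1 - s ^ (l + 2)) ^ (N + 1) * (real (l + 2) * s ^ (l + 1))))"

lemma cutoff_deriv:
  "(cutoff l N has_real_derivative cutoff' l N s) (at s within S)"
  "(cutoff' l N has_real_derivative cutoff'' l N s) (at s within S)"
proof -
  have r: "((\<lambda>s. 1 - s ^ (l + 2)) has_real_derivative - (real (l + 2) * s ^ (l + 1))) (at s)" for s :: real
    by (rule DERIV_cong[OF DERIV_diff[OF DERIV_const DERIV_pow[of "l + 2"]]]) simp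
  have p: "((\<lambda>s. max 0 (1 - s ^ (l + 2)) ^ (N + 2)) has_real_derivative
     real (N + 2) * max 0 (1 - s ^ (l + 2)) ^ (N + 1) * - (real (l + 2) * s ^ (l + 1))) (at s)" for s and N
    using DERIV_chain2[OF pos_part_power_deriv[of N] r] .
  have e: "N + 1 + 2 = N + 3" "N + 1 + 1 = N + 2" by simp_all
  have "(cutoff l N has_real_derivative cutoff' l N s) (at s)"
    unfolding cutoff_def[abs_def] cutoff'_def
    by (rule DERIV_cong[OF p[of "N + 1" s, unfolded e]]) simp
  then show "(cutoff l N has_real_derivative cutoff' l N s) (at s within S)"
    by (rule has_field_derivative_at_within)
  have "((\<lambda>s. s ^ (l + 1)) has_real_derivative real (l + 1) * s ^ l) (at s)"
    by (rule DERIV_cong[OF DERIV_pow[of "l + 1"]]) simp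
  from DERIV_cmult[OF DERIV_mult[OF this p[of N s]], of "- (real (N + 3) * real (l + 2))"]
  have "(cutoff' l N has_real_derivative cutoff'' l N s) (at s)"
    unfolding cutoff'_def[abs_def] cutoff''_def by (rule DERIV_cong) (simp add: algebra_simps)
  then show "(cutoff' l N has_real_derivative cutoff'' l N s) (at s within S)"
    by (rule has_field_derivative_at_within)
qed

lemma Ck_on_cutoff: "Ck_on 2 S (cutoff l N)"
proof -
  have "continuous_on S (cutoff'' l N)" unfolding cutoff''_def[abs_def] by (intro continuous_intros)
  then show ?thesis unfolding numeral_2_eq_2 Ck_on.simps using cutoff_deriv by blast
qed

text \<open>Only upper bounds for Laplacians will be needed. Hence the nonpositive summand of
  \<open>cutoff''\<close> is dropped, and the remaining one carries s^(2 l + 2) and the power N +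
  1.\<close>

lemma cutoff_bounds:
  assumes "0 \<le> s"
  shows "0 \<le> cutoff l N s" "cutoff l N s \<le> 1" "1 \<le> s \<Longrightarrow> cutoff l N s = 0" "1 \<le> s \<Longrightarrow> cutoff' l N s = 0"
    "1 \<le> s \<Longrightarrow> cutoff'' l N s = 0" "cutoff' l N s \<le> 0"
    "- cutoff' l N s \<le> (real (N + 3) * real (l + 2))\<^sup>2 * s ^ (l + 1)"
    "cutoff'' l N s \<le> (real (N + 3) * real (l + 2))\<^sup>2 * s ^ (2 * l + 2) * max 0 (1 - s ^ (l + 2)) ^ (N + 1)"
proof -
  let ?q = "max 0 (1 - s ^ (l + 2))" and ?A = "real (N + 3) * real (l + 2)"
  have q: "0 \<le> ?q" "?q \<le> 1" using assms by auto
  have q0: "?q = 0" if "1 \<le> s" using one_le_power[OF that, of "l + 2"] by (simp add: max_def)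
  have A1: "1 \<le> ?A" using mult_mono[of 1 "real (N + 3)" 1 "real (l + 2)"] by simp
  show "0 \<le> cutoff l N s" "cutoff l N s \<le> 1" using q by (auto simp: cutoff_def power_le_one)
  show "1 \<le> s \<Longrightarrow> cutoff l N s = 0" "1 \<le> s \<Longrightarrow> cutoff' l N s = 0" "1 \<le> s \<Longrightarrow> cutoff'' l N s = 0"
    unfolding cutoff_def cutoff'_def cutoff''_def using q0 by auto
  have nn: "0 \<le> ?A * (s ^ (l + 1) * ?q ^ (N + 2))" using assms q by (intro mult_nonneg_nonneg) auto
  then show "cutoff' l N s \<le> 0" unfolding cutoff'_def mult_minus_left by linarith
  have "?A * (s ^ (l + 1) * ?q ^ (N + 2)) \<le> ?A\<^sup>2 * (s ^ (l + 1) * 1)"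
  proof (intro mult_mono)
    show "?A \<le> ?A\<^sup>2" using mult_left_mono[OF A1, of ?A] A1 unfolding power2_eq_square by linarith
    show "?q ^ (N + 2) \<le> 1" by (rule power_le_one[OF q])
  qed (use assms q in \<open>auto intro!: zero_le_power\<close>)
  then show "- cutoff' l N s \<le> ?A\<^sup>2 * s ^ (l + 1)" unfolding cutoff'_def mult_minus_left by simp
  have "cutoff'' l N s = ?A * (real (N + 2) * real (l + 2)) * (s ^ (2 * l + 2) * ?q ^ (N + 1))
      - ?A * (real (l + 1) * s ^ l * ?q ^ (N + 2))"
  proof -
    have pw: "s ^ (2 * l + 2) = s ^ (l + 1) * s ^ (l + 1)"
      unfolding power_add[symmetric] by (rule arg_cong[of _ _ "power s"]) simp
    have "- A * (X - Y * (Z * W * (V * Y))) = A * (Z * V) * ((Y * Y) * W) - A * X" for A X Y Z W V :: real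
      by (simp add: algebra_simps)
    then show ?thesis unfolding cutoff''_def pw .
  qed
  also have "\<dots> \<le> ?A * (real (N + 2) * real (l + 2)) * (s ^ (2 * l + 2) * ?q ^ (N + 1))"
  proof -
    have "0 \<le> ?A * (real (l + 1) * s ^ l * ?q ^ (N + 2))"
      by (intro mult_nonneg_nonneg zero_le_power assms q) auto
    then show ?thesis by linarith
  qed
  also have "\<dots> \<le> ?A * ?A * (s ^ (2 * l + 2) * ?q ^ (N + 1))"
    by (intro mult_right_mono mult_left_mono mult_nonneg_nonneg zero_le_power assms q) auto
  finally show "cutoff'' l N s \<le> ?A\<^sup>2 * s ^ (2 * l + 2) * ?q ^ (N + 1)"
    by (simp only: power2_eq_square mult.assoc)
qed

text \<open>Subadditivity of a concave power: x \<le> x^m on [0, 1], applied to the fractions (a -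
  b)/a and b/a, which add up to 1.\<close>

lemma powr_diff_le:
  fixes a b :: real
  assumes "0 \<le> a" "0 \<le> b" "0 < m" "m \<le> 1"
  shows "max 0 (a powr m - b powr m) \<le> max 0 (a - b) powr m"
proof (cases "b < a")
  case True
  have frac: "x \<le> x powr m" if "0 \<le> x" "x \<le> 1" for x :: real
    using that assms powr_mono'[of m 1 x] by (cases "x = 0") auto
  have "1 = (a - b) / a + b / a" using True assms by (simp add: field_simps)
  also have "\<dots> \<le> ((a - b) / a) powr m + (b / a) powr m"
    using True assms by (intro add_mono frac) auto
  also have "\<dots> = ((a - b) powr m + b powr m) / a powr m"
    using True assms by (simp add: powr_divide add_divide_distrib)
  finally have "a powr m \<le> (a - b) powr m + b powr m" using True assms by (simp add: field_simps)
  then show ?thesis using True by simp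
next
  case False
  then have "a powr m \<le> b powr m" using assms by (intro powr_mono2) auto
  then show ?thesis by simp
qed

lemma integrable_indicator_compact_lebesgue:
  fixes K :: "'a::euclidean_space set"
  assumes "compact K"
  shows "integrable lebesgue (indicat_real K)"
proof -
  have "indicat_real K \<in> borel_measurable lborel" using borel_compact[OF assms] by measurable
  then show ?thesis using integrable_indicator_compact[OF assms] by (simp add: integrable_completion)
qed

lemma Ck_radial:
  fixes \<alpha> a :: real
  assumes "Ck_on k S g" "\<And>x::'a::euclidean_space. \<alpha> * (x \<bullet> x) + a \<in> S"
  shows "Ck k (\<lambda>x::'a. g (\<alpha> * (x \<bullet> x) + a))"
  by (rule Ck_compose[OF assms(1) _ assms(2)])
    (use Ck_inner_self[of k "0::'a"] in \<open>auto intro!: Ck_add Ck_mult\<close>)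

definition HP_cutoff :: "nat \<Rightarrow> nat \<Rightarrow> real \<Rightarrow> 'a::euclidean_space \<Rightarrow> real" where
  "HP_cutoff l N R x = cutoff l N (1 / R\<^sup>2 * (x \<bullet> x) + 0)"

text \<open>The first-order part of the radial Laplacian is nonpositive because the cut-off
  decreases, so the upper bound comes from the second derivative alone; two differentiations lower
  the power from N + 3 to N + 1.\<close>

lemma HP_cutoff:
  fixes x :: "'a::euclidean_space"
  assumes "0 < R"
  shows "Ck 2 (HP_cutoff l N R :: 'a \<Rightarrow> real)" "0 \<le> HP_cutoff l N R x" "HP_cutoff l N R x \<le> 1"
    "R \<le> norm x \<Longrightarrow> HP_cutoff l N R x = 0"
    "R \<le> norm x \<Longrightarrow> laplacian (HP_cutoff l N R) x = 0"
    "norm x < R \<Longrightarrow> laplacian (HP_cutoff l N R) x \<le> 4 * (real (N + 3) * real (l + 2))\<^sup>2 / R\<^sup>2 *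
       max 0 (1 - (1 / R\<^sup>2 * (x \<bullet> x)) ^ (l + 2)) ^ (N + 1)"
proof -
  let ?s = "1 / R\<^sup>2 * (x \<bullet> x) + 0" and ?A = "real (N + 3) * real (l + 2)"
  have S: "1 / R\<^sup>2 * (x \<bullet> x) + 0 \<in> {0..}" for x :: 'a by simp
  have s0: "0 \<le> ?s" by simp
  show "Ck 2 (HP_cutoff l N R :: 'a \<Rightarrow> real)"
    unfolding HP_cutoff_def[abs_def] by (rule Ck_radial[OF Ck_on_cutoff S])
  show "0 \<le> HP_cutoff l N R x" "HP_cutoff l N R x \<le> 1"
    using cutoff_bounds(1,2)[OF s0] by (simp_all add: HP_cutoff_def)
  have s1: "1 \<le> ?s \<longleftrightarrow> R \<le> norm x"
    using assms by (simp add: power2_norm_eq_inner[symmetric] pos_le_divide_eq power2_le_iff_abs_le)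
  then show "R \<le> norm x \<Longrightarrow> HP_cutoff l N R x = 0"
    using cutoff_bounds(3)[OF s0] by (simp add: HP_cutoff_def)
  have L: "laplacian (HP_cutoff l N R) x = 4 * (1 / R\<^sup>2)\<^sup>2 * (x \<bullet> x) * cutoff'' l N ?s + 2 * (1 / R\<^sup>2) * DIM('a) * cutoff' l N ?s"
    unfolding HP_cutoff_def[abs_def] by (rule laplacian_radial(2)[OF cutoff_deriv S])
  show "R \<le> norm x \<Longrightarrow> laplacian (HP_cutoff l N R) x = 0"
    unfolding L using s1 cutoff_bounds(4,5)[OF s0] by simp
  assume "norm x < R"
  then have s_le: "?s \<le> 1" using s1 by linarith
  let ?q = "max 0 (1 - ?s ^ (l + 2))"
  have "2 * (1 / R\<^sup>2) * DIM('a) * cutoff' l N ?s \<le> 0"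
    using cutoff_bounds(6)[OF s0] by (intro mult_nonneg_nonpos) auto
  then have "laplacian (HP_cutoff l N R) x \<le> 4 / R\<^sup>2 * (?s * cutoff'' l N ?s)"
    unfolding L by (simp add: power2_eq_square)
  also have "\<dots> \<le> 4 / R\<^sup>2 * (1 * (?A\<^sup>2 * 1 * ?q ^ (N + 1)))"
  proof (rule mult_left_mono)
    have "?s * cutoff'' l N ?s \<le> ?s * (?A\<^sup>2 * ?s ^ (2 * l + 2) * ?q ^ (N + 1))"
      by (intro mult_left_mono cutoff_bounds(8) s0)
    also have "\<dots> \<le> 1 * (?A\<^sup>2 * 1 * ?q ^ (N + 1))"
      using s0 s_le by (intro mult_mono mult_nonneg_nonneg zero_le_power power_le_one) auto
    finally show "?s * cutoff'' l N ?s \<le> 1 * (?A\<^sup>2 * 1 * ?q ^ (N + 1))" .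
  qed simp
  finally have "laplacian (HP_cutoff l N R) x \<le> 4 / R\<^sup>2 * (1 * (?A\<^sup>2 * 1 * ?q ^ (N + 1)))" .
  then show "laplacian (HP_cutoff l N R) x \<le> 4 * ?A\<^sup>2 / R\<^sup>2 * max 0 (1 - (1 / R\<^sup>2 * (x \<bullet> x)) ^ (l + 2)) ^ (N + 1)"
    by (simp only: add_0_right mult_1_left mult_1_right) (simp only: mult.assoc times_divide_eq_left times_divide_eq_right)
qed

text \<open>The exponents match: \<open>z\<^sub>+ \<Delta>\<psi> \<le> C R\<^sup>-\<^sup>2 (d \<psi>)\<^sup>m\<close> because \<open>N + 1 \<ge> m (N + 3)\<close>. The crude bound
  \<open>y\<^sup>m \<le> 1 + y\<close> replaces the sharp differential inequality of Herrero and Pierre.\<close>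

lemma herrero_pierre_bound:
  fixes u v :: "real^'n \<Rightarrow> real \<Rightarrow> real"
  assumes u: "fast_diffusion_solution m u u0" and v: "fast_diffusion_solution m v v0"
    and m: "0 < m" "m < 1" and n: "CARD('n) \<ge> 2" and T: "0 < T"
    and N: "m * real (N + 3) \<le> real (N + 1)"
    and f0: "integrable lebesgue (\<lambda>x. max 0 (u x 0 - v x 0))"
  obtains C R0 where "0 \<le> C" "0 < R0" "\<And>R t. R0 \<le> R \<Longrightarrow> 0 \<le> t \<Longrightarrow> t \<le> T \<Longrightarrow>
    integral\<^sup>L lebesgue (\<lambda>x. max 0 (u x t - v x t) * HP_cutoff l N R x) \<le>
      2 * integral\<^sup>L lebesgue (\<lambda>x. max 0 (u x 0 - v x 0)) + C * R ^ CARD('n) / R\<^sup>2"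
proof -
  define F where "F = integral\<^sup>L lebesgue (\<lambda>x. max 0 (u x 0 - v x 0))"
  define c where "c = (real CARD('n) - 1) / m"
  have c0: "0 < c" using n m by (simp add: c_def)
  define A where "A = 4 * (real (N + 3) * real (l + 2))\<^sup>2"
  have A0: "0 \<le> A" by (simp add: A_def)
  define w where "w = unit_ball_vol (real CARD('n))"
  have w0: "0 \<le> w" by (simp add: w_def)
  \<comment> \<open>From this radius on, c T A / R^2 \<le> 1/2, so that the mass on the right side
    can be absorbed into the left.\<close>
  define R0 where "R0 = sqrt (2 * c * T * A) + 1"
  have R0: "0 < R0" unfolding R0_def using c0 T A0 by (simp add: add_nonneg_pos)
  have main: "integral\<^sup>L lebesgue (\<lambda>x. max 0 (u x t - v x t) * HP_cutoff l N R x) \<le>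
      2 * F + (2 * c * T * A * w) * R ^ CARD('n) / R\<^sup>2" if R: "R0 \<le> R" and t: "0 \<le> t" "t \<le> T" for R t
  proof -
    have Rpos: "0 < R" using R R0 by simp
    have "2 * c * T * A \<le> R\<^sup>2"
    proof -
      have "sqrt (2 * c * T * A) \<le> R" using R by (simp add: R0_def)
      then have "(sqrt (2 * c * T * A))\<^sup>2 \<le> R\<^sup>2" using c0 T A0 by (intro power_mono) auto
      then show ?thesis using c0 T A0 by simp
    qed
    then have small: "c * T * (A / R\<^sup>2) \<le> 1 / 2" using Rpos by (simp add: divide_simps)
    let ?\<psi> = "HP_cutoff l N R :: real^'n \<Rightarrow> real"
    define d where "d x s = max 0 (u x s - v x s)" for x s
    define M where "M s = integral\<^sup>L lebesgue (\<lambda>x. d x s * ?\<psi> x)" for s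
    have \<psi>0: "0 \<le> ?\<psi> x" and \<psi>1: "?\<psi> x \<le> 1" for x using HP_cutoff(2,3)[OF Rpos] by blast+
    have \<psi>_meas: "?\<psi> \<in> borel_measurable borel"
      by (rule borel_measurable_continuous_onI[OF Ck_imp_continuous[OF HP_cutoff(1)[OF Rpos]]])
    have \<psi>_abs: "\<bar>?\<psi> x\<bar> \<le> 1" for x using \<psi>0[of x] \<psi>1[of x] by simp
    have supp: "?\<psi> x = 0" if "x \<notin> cball 0 R" for x using that HP_cutoff(4)[OF Rpos, of x] by simp
    have contM: "continuous_on {0..} M" unfolding M_def d_def
      by (rule positive_part_continuous(1)[OF u v \<psi>_meas \<psi>_abs supp])
    have intM: "integrable lebesgue (\<lambda>x. d x s * ?\<psi> x)" if "0 \<le> s" for s unfolding d_def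
      by (rule positive_part_continuous(2)[OF u v \<psi>_meas \<psi>_abs supp that])
    \<comment> \<open>A time of maximal localised mass. The flux at all earlier times is bounded
      through \<open>M s\<close>, and the inequality at time s closes on itself without a
      differential inequality.\<close>
    obtain s where s: "s \<in> {0..T}" "\<And>r. r \<in> {0..T} \<Longrightarrow> M r \<le> M s"
    proof -
      have "continuous_on {0..T} M" by (rule continuous_on_subset[OF contM]) auto
      from continuous_attains_sup[OF compact_Icc _ this] T that show ?thesis by auto
    qed
    have M_nonneg: "0 \<le> M r" for r unfolding M_def d_def
      using \<psi>0 by (intro Bochner_Integration.integral_nonneg) auto
    have M0: "M 0 \<le> F" unfolding M_def F_def d_def
    proof (rule integral_mono)
      show "max 0 (u x 0 - v x 0) * ?\<psi> x \<le> max 0 (u x 0 - v x 0)" for x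
        using \<psi>1 by (intro mult_right_le_one_le \<psi>0) auto
    qed (use intM[of 0] f0 in \<open>auto simp: d_def\<close>)
    have vol: "measure lebesgue (cball (0::real^'n) R) = w * R ^ CARD('n)"
      using content_cball[of R "0::real^'n"] Rpos by (simp add: w_def)
    have iB: "integrable lebesgue (indicat_real (cball (0::real^'n) R))"
      by (rule integrable_indicator_compact_lebesgue) simp
    have bound: "integral\<^sup>L lebesgue (\<lambda>x. max 0 (u x r powr m - v x r powr m) * laplacian ?\<psi> x) \<le>
       A / R\<^sup>2 * (w * R ^ CARD('n) + M s)" if r: "0 < r" "r < T" for r
    proof -
      have "integral\<^sup>L lebesgue (\<lambda>x. max 0 (u x r powr m - v x r powr m) * laplacian ?\<psi> x) \<le>
        integral\<^sup>L lebesgue (\<lambda>x. A / R\<^sup>2 * (indicat_real (cball 0 R) x + d x r * ?\<psi> x))"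
      proof (rule integral_mono_AE')
        show "integrable lebesgue (\<lambda>x. A / R\<^sup>2 * (indicat_real (cball 0 R) x + d x r * ?\<psi> x))"
          using iB intM[of r] r by (intro integrable_mult_right Bochner_Integration.integrable_add) auto
        show "AE x in lebesgue. 0 \<le> A / R\<^sup>2 * (indicat_real (cball 0 R) x + d x r * ?\<psi> x)"
          using A0 \<psi>0 by (intro AE_I2 mult_nonneg_nonneg add_nonneg_nonneg) (auto simp: d_def)
        have "AE x in lebesgue. 0 \<le> u x r" "AE x in lebesgue. 0 \<le> v x r"
          using fast_diffusion_slice(2)[OF u] fast_diffusion_slice(2)[OF v] r by auto
        then show "AE x in lebesgue. max 0 (u x r powr m - v x r powr m) * laplacian ?\<psi> x \<le>
          A / R\<^sup>2 * (indicat_real (cball 0 R) x + d x r * ?\<psi> x)"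
        proof eventually_elim
          case (elim x)
          have RHS0: "0 \<le> A / R\<^sup>2 * (indicat_real (cball 0 R) x + d x r * ?\<psi> x)"
            using A0 \<psi>0 by (intro mult_nonneg_nonneg add_nonneg_nonneg) (auto simp: d_def)
          show ?case
          proof (cases "norm x < R")
            case False
            then show ?thesis using RHS0 HP_cutoff(5)[OF Rpos, of x l N] by simp
          next
            case True
            let ?q = "max 0 (1 - (1 / R\<^sup>2 * (x \<bullet> x)) ^ (l + 2))"
            have q: "0 \<le> ?q" "?q \<le> 1" by auto
            have \<psi>q: "?\<psi> x = ?q ^ (N + 3)" by (simp add: HP_cutoff_def cutoff_def)
            have qm: "?q ^ (N + 1) \<le> (?q ^ (N + 3)) powr m"
            proof (cases "?q = 0")
              case False
              then have qpos: "0 < ?q" using q(1) by linarith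
              have "?q ^ (N + 1) = ?q powr real (N + 1)" by (rule powr_realpow[OF qpos, symmetric])
              also have "\<dots> \<le> ?q powr (real (N + 3) * m)"
                using N qpos q(2) by (intro powr_mono') (auto simp: mult.commute)
              also have "\<dots> = (?q ^ (N + 3)) powr m"
                by (simp only: powr_powr[symmetric] powr_realpow[OF qpos])
              finally show ?thesis .
            next
              case True
              then show ?thesis by simp
            qed
            have d0: "0 \<le> d x r" by (simp add: d_def)
            have "max 0 (u x r powr m - v x r powr m) * laplacian ?\<psi> x \<le> d x r powr m * (A / R\<^sup>2 * ?q ^ (N + 1))"
            proof (rule order_trans[OF mult_left_mono mult_right_mono])
              show "laplacian ?\<psi> x \<le> A / R\<^sup>2 * ?q ^ (N + 1)"
                using HP_cutoff(6)[OF Rpos True, of l N] by (simp only: A_def)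
              show "max 0 (u x r powr m - v x r powr m) \<le> d x r powr m"
                unfolding d_def using elim m by (intro powr_diff_le) auto
              show "0 \<le> A / R\<^sup>2 * ?q ^ (N + 1)" using A0 q by (intro mult_nonneg_nonneg zero_le_power) auto
            qed simp
            also have "\<dots> \<le> d x r powr m * (A / R\<^sup>2 * (?\<psi> x) powr m)"
              unfolding \<psi>q using A0 by (intro mult_left_mono qm) auto
            also have "\<dots> = A / R\<^sup>2 * (d x r * ?\<psi> x) powr m"
              using d0 \<psi>0[of x] by (simp add: powr_mult)
            also have "\<dots> \<le> A / R\<^sup>2 * (1 + d x r * ?\<psi> x)"
              using A0 m d0 \<psi>0[of x] by (intro mult_left_mono powr_le_one_plus) auto
            also have "\<dots> = A / R\<^sup>2 * (indicat_real (cball 0 R) x + d x r * ?\<psi> x)" using True by simp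
            finally show ?thesis .
          qed
        qed
      qed
      also have "\<dots> = A / R\<^sup>2 * (w * R ^ CARD('n) + M r)"
        using iB intM[of r] r vol by (simp add: M_def)
      also have "\<dots> \<le> A / R\<^sup>2 * (w * R ^ CARD('n) + M s)"
        using s(2)[of r] r A0 by (intro mult_left_mono) auto
      finally show ?thesis .
    qed
    have \<Lambda>0: "0 \<le> A / R\<^sup>2 * (w * R ^ CARD('n) + M s)"
      using A0 w0 Rpos M_nonneg by (intro mult_nonneg_nonneg add_nonneg_nonneg) auto
    have "M s \<le> F + c * T * (A / R\<^sup>2 * (w * R ^ CARD('n) + M s))"
    proof (cases "s = 0")
      case True
      have "0 \<le> c * T * (A / R\<^sup>2 * (w * R ^ CARD('n) + M s))" using \<Lambda>0 c0 T by (intro mult_nonneg_nonneg[OF _ \<Lambda>0]) auto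
      moreover have "M s = M 0" using True by simp
      ultimately show ?thesis using M0 by linarith
    next
      case False
      then have sp: "0 < s" "s \<le> T" using s(1) by auto
      have "M s \<le> M 0 + c * s * (A / R\<^sup>2 * (w * R ^ CARD('n) + M s))"
        unfolding M_def[of s] M_def[of 0] d_def c_def
      proof (rule fast_diffusion_comparison[OF u v m(1) less_imp_le[OF m(2)] n HP_cutoff(1)[OF Rpos] \<psi>0 HP_cutoff(4)[OF Rpos] sp(1)])
        show "0 \<le> A / R\<^sup>2 * (w * R ^ CARD('n) + (LINT x|lebesgue. max 0 (u x s - v x s) * ?\<psi> x))"
          using \<Lambda>0 by (simp add: M_def d_def)
        show "(LINT x|lebesgue. max 0 (u x t powr m - v x t powr m) * laplacian ?\<psi> x) \<le>
          A / R\<^sup>2 * (w * R ^ CARD('n) + (LINT x|lebesgue. max 0 (u x s - v x s) * ?\<psi> x))" if "0 < t" "t < s" for t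
          using bound[of t] that sp by (simp add: M_def d_def)
      qed
      also have "\<dots> \<le> F + c * T * (A / R\<^sup>2 * (w * R ^ CARD('n) + M s))"
        using M0 sp c0 \<Lambda>0 by (intro add_mono mult_right_mono mult_left_mono) auto
      finally show ?thesis .
    qed
    also have "\<dots> = F + (c * T * (A / R\<^sup>2)) * (w * R ^ CARD('n)) + (c * T * (A / R\<^sup>2)) * M s" by (simp add: algebra_simps)
    also have "\<dots> \<le> F + (c * T * (A / R\<^sup>2)) * (w * R ^ CARD('n)) + (1 / 2) * M s"
      using small M_nonneg[of s] by (intro add_left_mono mult_right_mono) auto
    finally have "M s \<le> 2 * F + 2 * (c * T * (A / R\<^sup>2)) * (w * R ^ CARD('n))" by linarith
    also have "\<dots> = 2 * F + (2 * c * T * A * w) * R ^ CARD('n) / R\<^sup>2" by (simp add: mult_ac)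
    finally show ?thesis using s(2)[of t] t unfolding M_def d_def by auto
  qed
  have C0: "0 \<le> 2 * c * T * A * w" using c0 T A0 w0 by simp
  show ?thesis by (rule that[OF C0 R0 main[unfolded F_def]])
qed

text \<open>Since \<open>\<tau>\<^sup>-\<^sup>k\<close> with \<open>\<tau> = \<bar>x\<bar>\<^sup>2 + a\<close> and \<open>2 k = n - 2\<close> is superharmonic, the cut-off is the only source of
  positive Laplacian, and it costs only \<open>R\<^sup>-\<^sup>n\<close>.\<close>

definition superharmonic_cutoff :: "real \<Rightarrow> nat \<Rightarrow> nat \<Rightarrow> real \<Rightarrow> real \<Rightarrow> 'a::euclidean_space \<Rightarrow> real" where
  "superharmonic_cutoff k l N a R x =
    (1 * (x \<bullet> x) + a) powr (- k) * cutoff l N (1 / R\<^sup>2 * (1 * (x \<bullet> x) + a))"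

text \<open>In the Laplacian of the product, the part without derivatives of the cut-off is
  nonpositive. All other terms carry at least s^(l+1) with s = \<tau> / R^2, and k \<le> l + 1 lets
  this power absorb the factor \<tau>^(-k).\<close>

lemma superharmonic_cutoff:
  fixes x :: "'a::euclidean_space"
  assumes R: "0 < R" and a: "0 < a" and k: "0 < k" "4 * (k + 1) = 2 * real DIM('a)" "k \<le> real (l + 1)"
  shows "Ck 2 (superharmonic_cutoff k l N a R :: 'a \<Rightarrow> real)" "0 \<le> superharmonic_cutoff k l N a R x"
    "superharmonic_cutoff k l N a R x \<le> a powr (- k)"
    "R \<le> norm x \<Longrightarrow> superharmonic_cutoff k l N a R x = 0"
    "laplacian (superharmonic_cutoff k l N a R) x \<le>
       (8 * k + 4) * (real (N + 3) * real (l + 2))\<^sup>2 / R powr (2 * k + 2) * indicat_real (cball 0 R) x"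
proof -
  define \<tau> where "\<tau> = 1 * (x \<bullet> x) + a"
  define \<alpha> where "\<alpha> = 1 / R\<^sup>2"
  have \<alpha>: "0 < \<alpha>" using R by (simp add: \<alpha>_def)
  let ?A = "real (N + 3) * real (l + 2)"
  have S: "1 * (x \<bullet> x) + a \<in> {a..}" for x :: 'a by simp
  have \<tau>a: "a \<le> \<tau>" "0 < \<tau>" using a by (auto simp: \<tau>_def add_nonneg_pos)
  define p where "p t = t powr (- k)" for t :: real
  define \<zeta> where "\<zeta> t = cutoff l N (\<alpha> * t)" for t
  define \<zeta>' where "\<zeta>' t = \<alpha> * cutoff' l N (\<alpha> * t)" for t
  define \<zeta>'' where "\<zeta>'' t = \<alpha>\<^sup>2 * cutoff'' l N (\<alpha> * t)" for t
  define g where "g t = p t * \<zeta> t" for t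
  define g' where "g' t = p t * (\<zeta>' t - k / t * \<zeta> t)" for t
  define g'' where "g'' t = p t * (\<zeta>'' t - 2 * k / t * \<zeta>' t + k * (k + 1) / t\<^sup>2 * \<zeta> t)" for t
  have eq: "superharmonic_cutoff k l N a R = (\<lambda>x::'a. g (1 * (x \<bullet> x) + a))"
    by (simp add: fun_eq_iff superharmonic_cutoff_def g_def p_def \<zeta>_def \<alpha>_def)
  have dp: "(p has_real_derivative p t * (- (k / t))) (at t within {a..})" if "t \<in> {a..}" for t
  proof -
    have t: "0 < t" using that a by simp
    have "(p has_real_derivative - k * t powr (- k - 1)) (at t)"
      unfolding p_def[abs_def] by (rule has_real_derivative_powr[OF t])
    moreover have "- k * t powr (- k - 1) = p t * (- (k / t))" using t by (simp add: p_def powr_diff)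
    ultimately show ?thesis by (simp add: has_field_derivative_at_within)
  qed
  have lin: "((\<lambda>t. \<alpha> * t) has_real_derivative \<alpha>) (at t within U)" for t U by (auto intro!: derivative_eq_intros)
  have d\<zeta>: "(\<zeta> has_real_derivative \<zeta>' t) (at t within {a..})" for t
    unfolding \<zeta>_def[abs_def] \<zeta>'_def by (rule DERIV_cong[OF DERIV_chain2[OF cutoff_deriv(1) lin]]) simp
  have d\<zeta>': "(\<zeta>' has_real_derivative \<zeta>'' t) (at t within {a..})" for t
    unfolding \<zeta>'_def[abs_def] \<zeta>''_def
    by (rule DERIV_cong[OF DERIV_cmult[OF DERIV_chain2[OF cutoff_deriv(2) lin]]]) (simp add: power2_eq_square)
  have dg: "(g has_real_derivative g' t) (at t within {a..})" if "t \<in> {a..}" for t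
    unfolding g_def[abs_def] g'_def
    by (rule DERIV_cong[OF DERIV_mult[OF dp[OF that] d\<zeta>]]) (simp add: algebra_simps)
  have dinv: "((\<lambda>t. k / t) has_real_derivative - (k / t\<^sup>2)) (at t within {a..})" if "t \<in> {a..}" for t
    using that a by (auto intro!: derivative_eq_intros simp: power2_eq_square divide_simps)
  have dg': "(g' has_real_derivative g'' t) (at t within {a..})" if "t \<in> {a..}" for t
  proof -
    have t: "t \<noteq> 0" using that a by auto
    have "(g' has_real_derivative p t * (- (k / t)) * (\<zeta>' t - k / t * \<zeta> t) +
        (\<zeta>'' t - (- (k / t\<^sup>2) * \<zeta> t + \<zeta>' t * (k / t))) * p t) (at t within {a..})"
      unfolding g'_def[abs_def]
      by (rule DERIV_mult[OF dp[OF that] DERIV_diff[OF d\<zeta>' DERIV_mult[OF dinv[OF that] d\<zeta>]]])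
    moreover have "p t * (- (k / t)) * (\<zeta>' t - k / t * \<zeta> t) +
        (\<zeta>'' t - (- (k / t\<^sup>2) * \<zeta> t + \<zeta>' t * (k / t))) * p t = g'' t"
      unfolding g''_def using t by (simp add: field_simps power2_eq_square)
    ultimately show ?thesis by simp
  qed
  have contg'': "continuous_on {a..} g''"
    unfolding g''_def[abs_def] p_def \<zeta>_def \<zeta>'_def \<zeta>''_def cutoff_def cutoff'_def cutoff''_def
    using a by (intro continuous_intros) auto
  have Ckg: "Ck_on 2 {a..} g"
    unfolding numeral_2_eq_2 by (rule Ck_on_SucI[OF dg Ck_on_SucI[OF dg']]) (use contg'' in auto)
  show "Ck 2 (superharmonic_cutoff k l N a R :: 'a \<Rightarrow> real)"
    unfolding eq by (rule Ck_radial[OF Ckg S])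
  define s where "s = \<alpha> * \<tau>"
  have s0: "0 < s" using \<alpha> \<tau>a by (simp add: s_def)
  have val: "superharmonic_cutoff k l N a R x = p \<tau> * cutoff l N s"
    by (simp add: eq g_def \<zeta>_def s_def \<tau>_def)
  have p0: "0 < p \<tau>" using \<tau>a by (simp add: p_def)
  show "0 \<le> superharmonic_cutoff k l N a R x"
    unfolding val using p0 cutoff_bounds(1)[of s] s0 by simp
  have "p \<tau> \<le> a powr (- k)" unfolding p_def using a \<tau>a k by (simp add: powr_minus powr_mono2 le_imp_inverse_le)
  then show "superharmonic_cutoff k l N a R x \<le> a powr (- k)"
    unfolding val using p0 cutoff_bounds(1,2)[of s l N] s0 mult_mono[of "p \<tau>" "a powr (- k)" "cutoff l N s" 1] by simp
  have s1: "1 \<le> s" if "R \<le> norm x"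
  proof -
    have "R\<^sup>2 \<le> x \<bullet> x" unfolding power2_norm_eq_inner[symmetric] using that R by (intro power_mono) auto
    then show ?thesis using R a by (simp add: s_def \<alpha>_def \<tau>_def)
  qed
  show "superharmonic_cutoff k l N a R x = 0" if "R \<le> norm x"
    unfolding val using cutoff_bounds(3)[OF less_imp_le[OF s0] s1[OF that]] by simp
  have L: "laplacian (superharmonic_cutoff k l N a R) x = 4 * (\<tau> - a) * g'' \<tau> + 2 * real DIM('a) * g' \<tau>"
    using laplacian_radial(2)[OF dg dg' S] unfolding eq by (simp add: \<tau>_def)
  let ?B = "(8 * k + 4) * ?A\<^sup>2 / R powr (2 * k + 2)"
  have B0: "0 \<le> ?B" using k by (intro divide_nonneg_nonneg mult_nonneg_nonneg) auto
  show "laplacian (superharmonic_cutoff k l N a R) x \<le> ?B * indicat_real (cball 0 R) x"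
  proof (cases "1 \<le> s")
    case True
    have "\<zeta> \<tau> = 0" "\<zeta>' \<tau> = 0" "\<zeta>'' \<tau> = 0"
      using cutoff_bounds(3,4,5)[OF less_imp_le[OF s0] True] by (simp_all add: \<zeta>_def \<zeta>'_def \<zeta>''_def s_def[symmetric])
    then have L0: "laplacian (superharmonic_cutoff k l N a R) x = 0" unfolding L g'_def g''_def by simp
    show ?thesis unfolding L0 by (intro mult_nonneg_nonneg B0) simp
  next
    case False
    then have sle: "s \<le> 1" by simp
    have inR: "x \<in> cball 0 R" using False s1 by force
    define c0 where "c0 = cutoff l N s"
    define c1 where "c1 = - cutoff' l N s"
    define c2 where "c2 = cutoff'' l N s"
    have c: "0 \<le> c0" "0 \<le> c1" "c1 \<le> ?A\<^sup>2 * s ^ (l + 1)"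
      using cutoff_bounds(1,6,7)[OF less_imp_le[OF s0]] by (simp_all add: c0_def c1_def)
    have c2: "c2 \<le> ?A\<^sup>2 * s ^ (2 * l + 2)"
    proof -
      have "c2 \<le> ?A\<^sup>2 * s ^ (2 * l + 2) * max 0 (1 - s ^ (l + 2)) ^ (N + 1)"
        unfolding c2_def by (rule cutoff_bounds(8)[OF less_imp_le[OF s0]])
      also have "\<dots> \<le> ?A\<^sup>2 * s ^ (2 * l + 2) * 1"
        using s0 by (intro mult_left_mono power_le_one mult_nonneg_nonneg zero_le_power) auto
      finally show ?thesis by simp
    qed
    \<comment> \<open>By 4 (k + 1) = 2 n, the terms of order zero in the cut-off combine to - 4 a k
      (k + 1) / \<tau>^2 times the weight; without the shift a they would cancel, the unshifted
      weight being harmonic away from the origin.\<close>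
    have expand: "laplacian (superharmonic_cutoff k l N a R) x = p \<tau> *
       (- (4 * a * k * (k + 1) / \<tau>\<^sup>2) * c0 + \<alpha> * c1 * (8 * k * (\<tau> - a) / \<tau> - 2 * real DIM('a)) + 4 * (\<tau> - a) * \<alpha>\<^sup>2 * c2)"
    proof -
      have n: "2 * real DIM('a) = 4 * (k + 1)" using k by simp
      have "\<zeta> \<tau> = c0" "\<zeta>' \<tau> = - \<alpha> * c1" "\<zeta>'' \<tau> = \<alpha>\<^sup>2 * c2"
        by (simp_all add: \<zeta>_def \<zeta>'_def \<zeta>''_def s_def[symmetric] c0_def c1_def c2_def)
      then show ?thesis unfolding L g'_def g''_def n using \<tau>a by (simp add: field_simps power2_eq_square)
    qed
    have t1: "- (4 * a * k * (k + 1) / \<tau>\<^sup>2) * c0 \<le> 0"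
      using a k c(1) by (simp add: mult_nonneg_nonneg)
    have t2: "\<alpha> * c1 * (8 * k * (\<tau> - a) / \<tau> - 2 * real DIM('a)) \<le> \<alpha> * (?A\<^sup>2 * s ^ (l + 1)) * (8 * k)"
    proof -
      have "(\<tau> - a) / \<tau> \<le> 1" using \<tau>a a by simp
      then have "8 * k * ((\<tau> - a) / \<tau>) \<le> 8 * k * 1" using k by (intro mult_left_mono) auto
      then have "8 * k * (\<tau> - a) / \<tau> - 2 * real DIM('a) \<le> 8 * k" by simp
      then have "\<alpha> * c1 * (8 * k * (\<tau> - a) / \<tau> - 2 * real DIM('a)) \<le> \<alpha> * c1 * (8 * k)"
        using \<alpha> c by (intro mult_left_mono) auto
      also have "\<dots> \<le> \<alpha> * (?A\<^sup>2 * s ^ (l + 1)) * (8 * k)"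
        using \<alpha> c k by (intro mult_right_mono mult_left_mono) auto
      finally show ?thesis .
    qed
    have t3: "4 * (\<tau> - a) * \<alpha>\<^sup>2 * c2 \<le> \<alpha> * (?A\<^sup>2 * s ^ (l + 1)) * 4"
    proof -
      have "4 * (\<tau> - a) * \<alpha>\<^sup>2 * c2 \<le> 4 * (\<tau> - a) * \<alpha>\<^sup>2 * (?A\<^sup>2 * s ^ (2 * l + 2))"
        using \<tau>a c2 by (intro mult_left_mono mult_nonneg_nonneg) auto
      also have "\<dots> \<le> 4 * \<tau> * \<alpha>\<^sup>2 * (?A\<^sup>2 * s ^ (2 * l + 2))"
        using \<tau>a a s0 \<alpha> by (intro mult_right_mono mult_nonneg_nonneg zero_le_power) auto
      also have "\<dots> = 4 * \<alpha> * ?A\<^sup>2 * s ^ (2 * l + 3)"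
        by (simp only: power2_eq_square s_def power_add power_one_right) (simp add: power3_eq_cube power2_eq_square mult_ac)
      also have "\<dots> \<le> 4 * \<alpha> * ?A\<^sup>2 * s ^ (l + 1)"
        using \<alpha> s0 sle by (intro mult_left_mono power_decreasing mult_nonneg_nonneg) auto
      finally show ?thesis by (simp add: mult_ac)
    qed
    have "laplacian (superharmonic_cutoff k l N a R) x \<le> p \<tau> * (\<alpha> * (?A\<^sup>2 * s ^ (l + 1)) * (8 * k + 4))"
      unfolding expand
    proof (rule mult_left_mono[OF _ less_imp_le[OF p0]])
      show "- (4 * a * k * (k + 1) / \<tau>\<^sup>2) * c0 + \<alpha> * c1 * (8 * k * (\<tau> - a) / \<tau> - 2 * real DIM('a)) + 4 * (\<tau> - a) * \<alpha>\<^sup>2 * c2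
        \<le> \<alpha> * (?A\<^sup>2 * s ^ (l + 1)) * (8 * k + 4)"
        using t1 t2 t3 unfolding distrib_left by linarith
    qed
    also have "\<dots> = (8 * k + 4) * ?A\<^sup>2 * (\<alpha> * (p \<tau> * s ^ (l + 1)))" by (simp only: mult_ac)
    also have "\<dots> \<le> (8 * k + 4) * ?A\<^sup>2 * (1 / R powr (2 * k + 2))"
    proof (rule mult_left_mono)
      \<comment> \<open>Substituting \<tau> = R^2 s separates R^(-2 k) from a nonnegative power of s
        \<le> 1; with \<alpha> = R^(-2) the total is R^(-(2 k + 2)).\<close>
      have \<tau>s: "\<tau> = R\<^sup>2 * s" using R by (simp add: s_def \<alpha>_def)
      have R2: "R\<^sup>2 = R powr 2" using R by simp
      have sp: "s ^ (l + 1) = s powr real (l + 1)" by (rule powr_realpow[OF s0, symmetric])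
      have "s powr (- k) * s powr real (l + 1) = s powr (real (l + 1) - k)"
        unfolding powr_add[symmetric] by (simp add: algebra_simps)
      also have "\<dots> \<le> 1" using s0 sle k by (intro powr_le1) auto
      finally have s1: "s powr (- k) * s powr real (l + 1) \<le> 1" .
      have "p \<tau> * s ^ (l + 1) = (R\<^sup>2) powr (- k) * (s powr (- k) * s powr real (l + 1))"
        unfolding p_def \<tau>s sp using R s0 by (subst powr_mult) (auto simp: mult.assoc)
      also have "\<dots> \<le> (R\<^sup>2) powr (- k) * 1" by (intro mult_left_mono s1) simp
      finally have "p \<tau> * s ^ (l + 1) \<le> (R\<^sup>2) powr (- k)" by simp
      then have "\<alpha> * (p \<tau> * s ^ (l + 1)) \<le> \<alpha> * (R\<^sup>2) powr (- k)" using \<alpha> by (intro mult_left_mono) auto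
      also have "\<dots> = 1 / R powr (2 * k + 2)"
        unfolding \<alpha>_def R2 powr_powr using R by (simp add: powr_minus powr_add divide_inverse mult_ac)
      finally show "\<alpha> * (p \<tau> * s ^ (l + 1)) \<le> 1 / R powr (2 * k + 2)" .
    qed (use k in auto)
    finally show ?thesis using inR by simp
  qed
qed

lemma cutoff_antimono:
  assumes "0 \<le> s" "s \<le> t" shows "cutoff l N t \<le> cutoff l N s"
proof -
  have "s ^ (l + 2) \<le> t ^ (l + 2)" using assms by (intro power_mono)
  then show ?thesis unfolding cutoff_def by (intro power_mono) auto
qed

text \<open>The factor compares two values of the weight \<tau>^(-k) with a = r^2: at most a^(-k)
  everywhere, at least (2 a)^(-k) on the ball of radius r. Their quotient 2^k is free of r.\<close>

theorem fast_diffusion_L1_stability: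
  fixes u v :: "real^'n \<Rightarrow> real \<Rightarrow> real"
  assumes u: "fast_diffusion_solution m u u0" and v: "fast_diffusion_solution m v v0"
    and m: "0 < m" "m < 1" and n: "CARD('n) \<ge> 3" and T: "0 < T" and r: "0 < r"
    and f0: "integrable lebesgue (\<lambda>x. max 0 (u x 0 - v x 0))"
  shows "integral\<^sup>L lebesgue (\<lambda>x. max 0 (u x T - v x T) * indicat_real (cball 0 r) x) \<le>
    2 powr ((real CARD('n) - 2) / 2) * integral\<^sup>L lebesgue (\<lambda>x. max 0 (u x 0 - v x 0))"
proof -
  define F where "F = integral\<^sup>L lebesgue (\<lambda>x. max 0 (u x 0 - v x 0))"
  have F0: "0 \<le> F" unfolding F_def by (intro Bochner_Integration.integral_nonneg) auto
  define k where "k = (real CARD('n) - 2) / 2"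
  define l where "l = CARD('n)"
  have k: "0 < k" "4 * (k + 1) = 2 * real DIM(real^'n)" "k \<le> real (l + 1)" "2 * k + 2 = real CARD('n)"
    using n by (auto simp: k_def l_def field_simps)
  define c where "c = (real CARD('n) - 1) / m"
  have c0: "0 < c" using n m by (simp add: c_def)
  \<comment> \<open>This makes (1 - m) N \<ge> 3, which implies the exponent condition m (N + 3)
    \<le> N + 1.\<close>
  obtain N :: nat where N3: "3 / (1 - m) \<le> real N" using real_arch_simple by blast
  have N: "m * real (N + 3) \<le> real (N + 1)"
  proof -
    have "3 \<le> real N * (1 - m)" using N3 m by (simp add: pos_divide_le_eq)
    then show ?thesis using m by (simp add: algebra_simps)
  qed
  have n2: "CARD('n) \<ge> 2" using n by simp
  obtain C R0 where C: "0 \<le> C" "0 < R0" "\<And>R t. R0 \<le> R \<Longrightarrow> 0 \<le> t \<Longrightarrow> t \<le> T \<Longrightarrow>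
    integral\<^sup>L lebesgue (\<lambda>x. max 0 (u x t - v x t) * HP_cutoff l N R x) \<le> 2 * F + C * R ^ CARD('n) / R\<^sup>2"
    using herrero_pierre_bound[OF u v m n2 T N f0] unfolding F_def by blast
  define A where "A = (8 * k + 4) * (real (N + 3) * real (l + 2))\<^sup>2"
  have A0: "0 \<le> A" using k by (simp add: A_def)
  define w where "w = unit_ball_vol (real CARD('n))"
  have w0: "0 \<le> w" by (simp add: w_def)
  define c1 where "c1 = cutoff l N (1 / 4)"
  have c1: "0 < c1"
  proof -
    have "(1 / 4 :: real) ^ (l + 2) < 1" using power_strict_decreasing[of 0 "l + 2" "1/4::real"] by simp
    then show ?thesis by (simp add: c1_def cutoff_def)
  qed
  define d where "d x t = max 0 (u x t - v x t)" for x t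
  have d0: "0 \<le> d x t" for x t by (simp add: d_def)
  define X where "X = integral\<^sup>L lebesgue (\<lambda>x. d x T * indicat_real (cball 0 r) x)"
  define a where "a = r\<^sup>2"
  have a: "0 < a" using r by (simp add: a_def)
  have intd: "integrable lebesgue (\<lambda>x. d x t * g x)"
    if "continuous_on UNIV g" "\<And>x. R \<le> norm x \<Longrightarrow> g x = 0" "\<And>x. \<bar>g x\<bar> \<le> B" "0 \<le> t"
    for g :: "real^'n \<Rightarrow> real" and R B t
    unfolding d_def
    by (rule positive_part_continuous(2)[OF u v borel_measurable_continuous_onI[OF that(1)] that(3) _ that(4), of R])
      (use that(2) in auto)
  have intHP: "integrable lebesgue (\<lambda>x. d x t * HP_cutoff l N R x)" if "0 < R" "0 \<le> t" for R t
    using HP_cutoff(2,3)[OF that(1), where 'a = "real^'n"]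
    by (intro intd[OF Ck_imp_continuous[OF HP_cutoff(1)[OF that(1)]] HP_cutoff(4)[OF that(1)] _ that(2), where B = 1]) auto
  have step: "(2 * a) powr (- k) * X \<le> a powr (- k) * F + \<delta>" if \<delta>: "\<delta> > 0" for \<delta>
  proof -
    define e1 where "e1 = \<delta> / (2 * (c * T * A * w + 1))"
    have cTAw: "0 \<le> c * T * A * w" using c0 T A0 w0 by simp
    have e1: "0 < e1" "c * T * A * w * e1 \<le> \<delta> / 2"
      using \<delta> cTAw by (auto simp: e1_def divide_simps mult_left_mono)
    define \<epsilon> where "\<epsilon> = e1 powr (1 / m)"
    have \<epsilon>: "0 < \<epsilon>" "\<epsilon> powr m = e1" using e1 m by (auto simp: \<epsilon>_def powr_powr)
    \<comment> \<open>A scaled form of y^m \<le> 1 + y with \<epsilon>^m = e1: the constant part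
      becomes small, while the large linear part will meet a mass of lower growth.\<close>
    have young: "y powr m \<le> e1 + e1 / \<epsilon> * y" if "0 \<le> y" for y
    proof -
      have "y powr m = e1 * (y / \<epsilon>) powr m" using that \<epsilon> e1(1) by (simp add: powr_divide)
      also have "\<dots> \<le> e1 * (1 + y / \<epsilon>)" using that \<epsilon> e1 m by (intro mult_left_mono powr_le_one_plus) auto
      finally show ?thesis by (simp add: algebra_simps)
    qed
    \<comment> \<open>The flux bound. The constant part integrates to e1 w R^n, which the R^(-n) of
      the Laplacian cancels; the linear part has mass at most 2 F + C (2R)^n / (2R)^2, which R^(-n)
      sends to zero.\<close>
    define \<Lambda> where "\<Lambda> R = A * (e1 * w + e1 / \<epsilon> / c1 * (2 * F * inverse (R ^ CARD('n)) + C * 2 ^ CARD('n) / 4 * inverse (R\<^sup>2)))" for R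
    have \<Lambda>0: "0 \<le> \<Lambda> R" if "0 < R" for R
      unfolding \<Lambda>_def using A0 e1 w0 \<epsilon> c1 F0 C that
      by (intro mult_nonneg_nonneg add_nonneg_nonneg divide_nonneg_nonneg) auto
    let ?\<eta> = "\<lambda>R. superharmonic_cutoff k l N a R :: real^'n \<Rightarrow> real"
    have int\<eta>: "integrable lebesgue (\<lambda>x. d x t * ?\<eta> R x)" if "0 < R" "0 \<le> t" for R t
      using superharmonic_cutoff(2,3)[OF that(1) a k(1-3), of N]
      by (intro intd[OF Ck_imp_continuous[OF superharmonic_cutoff(1)[OF that(1) a k(1-3)]]
            superharmonic_cutoff(4)[OF that(1) a k(1-3)] _ that(2), where B = "a powr (- k)"]) auto
    have lap: "integral\<^sup>L lebesgue (\<lambda>x. max 0 (u x t powr m - v x t powr m) * laplacian (?\<eta> R) x) \<le> \<Lambda> R"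
      if R: "R0 \<le> R" and t: "0 < t" "t < T" for R t
    proof -
      have Rp: "0 < R" using R C(2) by simp
      have Rp2: "0 < 2 * R" using Rp by simp
      have RR: "R powr (2 * k + 2) = R ^ CARD('n)" unfolding k(4) using Rp by (rule powr_realpow)
      let ?\<psi> = "HP_cutoff l N (2 * R) :: real^'n \<Rightarrow> real"
      have \<psi>0: "0 \<le> ?\<psi> x" for x by (rule HP_cutoff(2)[OF Rp2])
      \<comment> \<open>Mass in the ball of radius R is measured by the first cut-off with radius
        2R, which is bounded below there because |x|^2 / (2R)^2 \<le> 1/4.\<close>
      have \<psi>c: "c1 \<le> ?\<psi> x" if "x \<in> cball 0 R" for x
      proof -
        have "x \<bullet> x \<le> R\<^sup>2" unfolding power2_norm_eq_inner[symmetric] using that by (intro power_mono) auto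
        then have "1 / (2 * R)\<^sup>2 * (x \<bullet> x) + 0 \<le> 1 / 4" using Rp by (simp add: divide_simps power2_eq_square)
        then show ?thesis unfolding c1_def HP_cutoff_def by (intro cutoff_antimono) auto
      qed
      have iB: "integrable lebesgue (indicat_real (cball (0::real^'n) R))"
        by (rule integrable_indicator_compact_lebesgue) simp
      have iR: "integrable lebesgue (\<lambda>x. A / R ^ CARD('n) * (e1 * indicat_real (cball 0 R) x + e1 / \<epsilon> / c1 * (d x t * ?\<psi> x)))"
        using iB intHP[OF Rp2, of t] t by (intro integrable_mult_right Bochner_Integration.integrable_add) auto
      have vol: "measure lebesgue (cball (0::real^'n) R) = w * R ^ CARD('n)"
        using content_cball[of R "0::real^'n"] Rp by (simp add: w_def)
      have "integral\<^sup>L lebesgue (\<lambda>x. max 0 (u x t powr m - v x t powr m) * laplacian (?\<eta> R) x) \<le>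
        integral\<^sup>L lebesgue (\<lambda>x. A / R ^ CARD('n) * (e1 * indicat_real (cball 0 R) x + e1 / \<epsilon> / c1 * (d x t * ?\<psi> x)))"
      proof (rule integral_mono_AE'[OF iR])
        show "AE x in lebesgue. 0 \<le> A / R ^ CARD('n) * (e1 * indicat_real (cball 0 R) x + e1 / \<epsilon> / c1 * (d x t * ?\<psi> x))"
          using A0 e1 \<epsilon> c1 d0 \<psi>0 Rp by (intro AE_I2 mult_nonneg_nonneg add_nonneg_nonneg divide_nonneg_nonneg) auto
        have "AE x in lebesgue. 0 \<le> u x t" "AE x in lebesgue. 0 \<le> v x t"
          using fast_diffusion_slice(2)[OF u] fast_diffusion_slice(2)[OF v] t by auto
        then show "AE x in lebesgue. max 0 (u x t powr m - v x t powr m) * laplacian (?\<eta> R) x \<le>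
          A / R ^ CARD('n) * (e1 * indicat_real (cball 0 R) x + e1 / \<epsilon> / c1 * (d x t * ?\<psi> x))"
        proof eventually_elim
          case (elim x)
          have "max 0 (u x t powr m - v x t powr m) * laplacian (?\<eta> R) x \<le>
            d x t powr m * (A / R ^ CARD('n) * indicat_real (cball 0 R) x)"
          proof (rule order_trans[OF mult_left_mono mult_right_mono])
            show "laplacian (?\<eta> R) x \<le> A / R ^ CARD('n) * indicat_real (cball 0 R) x"
              using superharmonic_cutoff(5)[OF Rp a k(1-3), of N x] unfolding RR A_def .
            show "max 0 (u x t powr m - v x t powr m) \<le> d x t powr m"
              unfolding d_def using elim m by (intro powr_diff_le) auto
            show "0 \<le> A / R ^ CARD('n) * indicat_real (cball 0 R) x" using A0 Rp by (intro mult_nonneg_nonneg) auto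
          qed simp
          also have "\<dots> = A / R ^ CARD('n) * (d x t powr m * indicat_real (cball 0 R) x)" by simp
          also have "\<dots> \<le> A / R ^ CARD('n) * (e1 * indicat_real (cball 0 R) x + e1 / \<epsilon> / c1 * (d x t * ?\<psi> x))"
          proof (rule mult_left_mono)
            show "0 \<le> A / R ^ CARD('n)" using A0 Rp by simp
            show "d x t powr m * indicat_real (cball 0 R) x \<le> e1 * indicat_real (cball 0 R) x + e1 / \<epsilon> / c1 * (d x t * ?\<psi> x)"
            proof (cases "x \<in> cball 0 R")
              case True
              have "d x t * c1 \<le> d x t * ?\<psi> x" by (intro mult_left_mono \<psi>c True d0)
              then have "d x t \<le> d x t * ?\<psi> x / c1" using c1 by (simp add: pos_le_divide_eq)
              then have "e1 / \<epsilon> * d x t \<le> e1 / \<epsilon> * (d x t * ?\<psi> x / c1)" using e1 \<epsilon> by (intro mult_left_mono) auto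
              then show ?thesis using young[OF d0[of x t]] True by simp
            next
              case False
              have "0 \<le> e1 / \<epsilon> / c1 * (d x t * ?\<psi> x)" using e1 \<epsilon> c1 d0 \<psi>0 by (intro mult_nonneg_nonneg divide_nonneg_nonneg) auto
              then show ?thesis using False by simp
            qed
          qed
          finally show ?case .
        qed
      qed
      also have "\<dots> = A / R ^ CARD('n) * (e1 * (w * R ^ CARD('n)) + e1 / \<epsilon> / c1 * integral\<^sup>L lebesgue (\<lambda>x. d x t * ?\<psi> x))"
      proof -
        have i1: "integrable lebesgue (\<lambda>x. e1 * indicat_real (cball (0::real^'n) R) x)" using iB by simp
        have i2: "integrable lebesgue (\<lambda>x. e1 / \<epsilon> / c1 * (d x t * ?\<psi> x))" using intHP[OF Rp2, of t] t by simp
        show ?thesis unfolding integral_mult_right_zero Bochner_Integration.integral_add[OF i1 i2] using iB vol by simp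
      qed
      also have "\<dots> \<le> A / R ^ CARD('n) * (e1 * (w * R ^ CARD('n)) + e1 / \<epsilon> / c1 * (2 * F + C * (2 * R) ^ CARD('n) / (2 * R)\<^sup>2))"
        using C(3)[of "2 * R" t] R t A0 e1 \<epsilon> c1 Rp
        by (intro mult_left_mono add_left_mono divide_nonneg_nonneg) (auto simp: d_def)
      also have "\<dots> = \<Lambda> R"
      proof -
        have "A / Q * (e1 * (w * Q) + g * (2 * F + C * (P * Q) / (4 * S))) =
          A * (e1 * w + g * (2 * F * inverse Q + C * P / 4 * inverse S))" if "Q \<noteq> 0" "S \<noteq> 0" for Q P S g :: real
        proof -
          have ring: "A * i * (e1 * (w * Q) + g * (2 * F + C * (P * Q) * t)) =
            A * (e1 * (w * (Q * i)) + g * (2 * F * i + C * (P * (Q * i)) * t))" for i t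
            by (simp add: algebra_simps)
          have "Q * inverse Q = 1" using that by simp
          then show ?thesis
            using ring[of "inverse Q" "inverse (4 * S)"]
            by (simp only: divide_inverse mult_1_right inverse_mult_distrib mult.assoc)
        qed
        from this[of "R ^ CARD('n)" "R\<^sup>2" "e1 / \<epsilon> / c1" "2 ^ CARD('n)"] show ?thesis
          unfolding \<Lambda>_def power_mult_distrib using Rp by (simp only: power2_eq_square) simp
      qed
      finally show ?thesis .
    qed
    have "((\<lambda>R. \<Lambda> R) \<longlongrightarrow> A * (e1 * w + e1 / \<epsilon> / c1 * (2 * F * 0 + C * 2 ^ CARD('n) / 4 * 0))) at_top"
      unfolding \<Lambda>_def
      by (intro tendsto_intros tendsto_inverse_0_at_top filterlim_pow_at_top filterlim_ident) auto
    then have "((\<lambda>R. c * T * \<Lambda> R) \<longlongrightarrow> c * T * (A * (e1 * w))) at_top" by (auto intro: tendsto_mult_left)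
    moreover have "c * T * (A * (e1 * w)) < \<delta>" using e1(2) \<delta> by (simp add: mult_ac)
    ultimately have ev\<Lambda>: "\<forall>\<^sub>F R in at_top. c * T * \<Lambda> R < \<delta>" by (rule order_tendstoD)
    have "\<forall>\<^sub>F R in at_top. (2 * a) powr (- k) * cutoff l N (2 * a * inverse (R\<^sup>2)) * X \<le> a powr (- k) * F + \<delta>"
      using ev\<Lambda> eventually_ge_at_top[of R0]
    proof eventually_elim
      case (elim R)
      have Rp: "0 < R" using elim(2) C(2) by simp
      let ?z = "(2 * a) powr (- k) * cutoff l N (2 * a * inverse (R\<^sup>2))"
      have z0: "0 \<le> ?z" using cutoff_bounds(1)[of "2 * a * inverse (R\<^sup>2)"] a by simp
      have "?z * X = integral\<^sup>L lebesgue (\<lambda>x. ?z * (d x T * indicat_real (cball 0 r) x))" by (simp add: X_def)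
      also have "\<dots> \<le> integral\<^sup>L lebesgue (\<lambda>x. d x T * ?\<eta> R x)"
      proof (rule integral_mono_AE'[OF int\<eta>[OF Rp less_imp_le[OF T]]])
        show "AE x in lebesgue. 0 \<le> d x T * ?\<eta> R x"
          using d0 superharmonic_cutoff(2)[OF Rp a k(1-3)] by (intro AE_I2 mult_nonneg_nonneg) auto
        show "AE x in lebesgue. ?z * (d x T * indicat_real (cball 0 r) x) \<le> d x T * ?\<eta> R x"
        proof (rule AE_I2)
          fix x :: "real^'n"
          show "?z * (d x T * indicat_real (cball 0 r) x) \<le> d x T * ?\<eta> R x"
          proof (cases "x \<in> cball 0 r")
            case True
            have xx: "x \<bullet> x \<le> a" unfolding a_def power2_norm_eq_inner[symmetric] using True by (intro power_mono) auto
            have "(2 * a) powr (- k) \<le> (1 * (x \<bullet> x) + a) powr (- k)"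
              using xx a k(1) by (intro powr_mono2') (auto simp: add_nonneg_pos)
            moreover have "cutoff l N (2 * a * inverse (R\<^sup>2)) \<le> cutoff l N (1 / R\<^sup>2 * (1 * (x \<bullet> x) + a))"
              using xx a Rp by (intro cutoff_antimono) (auto simp: field_simps)
            ultimately have "?z \<le> ?\<eta> R x" unfolding superharmonic_cutoff_def
              using cutoff_bounds(1)[of "2 * a * inverse (R\<^sup>2)"] a by (intro mult_mono) auto
            then show ?thesis using True mult_left_mono[OF _ d0, of ?z "?\<eta> R x" x T] by (simp add: mult.commute)
          next
            case False
            then show ?thesis using d0 superharmonic_cutoff(2)[OF Rp a k(1-3), of N x] by simp
          qed
        qed
      qed
      also have "\<dots> \<le> integral\<^sup>L lebesgue (\<lambda>x. d x 0 * ?\<eta> R x) + c * T * \<Lambda> R"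
        unfolding d_def c_def
        by (rule fast_diffusion_comparison[OF u v m(1) less_imp_le[OF m(2)] n2 superharmonic_cutoff(1)[OF Rp a k(1-3)]
              superharmonic_cutoff(2)[OF Rp a k(1-3)] superharmonic_cutoff(4)[OF Rp a k(1-3)] T \<Lambda>0[OF Rp] lap[OF elim(2)]])
      also have "integral\<^sup>L lebesgue (\<lambda>x. d x 0 * ?\<eta> R x) \<le> integral\<^sup>L lebesgue (\<lambda>x. a powr (- k) * d x 0)"
      proof (rule integral_mono[OF int\<eta>[OF Rp order_refl]])
        show "integrable lebesgue (\<lambda>x. a powr (- k) * d x 0)" using f0 by (simp add: d_def)
        show "d x 0 * ?\<eta> R x \<le> a powr (- k) * d x 0" for x
          using mult_left_mono[OF superharmonic_cutoff(3)[OF Rp a k(1-3), of N x] d0[of x 0]] by (simp add: mult.commute)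
      qed
      also have "\<dots> = a powr (- k) * F" by (simp add: F_def d_def)
      finally show ?case using elim(1) by simp
    qed
    \<comment> \<open>As R grows, the cut-off factor tends to its value 1 at 0, and the bare weight
      remains.\<close>
    moreover have "((\<lambda>R. (2 * a) powr (- k) * cutoff l N (2 * a * inverse (R\<^sup>2)) * X) \<longlongrightarrow> (2 * a) powr (- k) * cutoff l N (2 * a * 0) * X) at_top"
      unfolding cutoff_def
      by (intro tendsto_intros tendsto_inverse_0_at_top filterlim_pow_at_top filterlim_ident) auto
    ultimately have "(2 * a) powr (- k) * cutoff l N (2 * a * 0) * X \<le> a powr (- k) * F + \<delta>"
      by (intro tendsto_upperbound[where F = "at_top :: real filter"]) auto
    then show ?thesis by (simp add: cutoff_def)
  qed
  have "(2 * a) powr (- k) * X \<le> a powr (- k) * F" by (rule field_le_epsilon) (rule step)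
  then have "a powr (- k) * (2 powr (- k) * X) \<le> a powr (- k) * F" using a by (simp add: powr_mult mult_ac)
  then have "2 powr (- k) * X \<le> F" using a by simp
  then have "X \<le> 2 powr k * F" by (simp add: powr_minus field_simps)
  then show ?thesis unfolding X_def F_def d_def k_def .
qed

section \<open>Classical solutions\<close>

lemma integrable_continuous_on_compact:
  fixes f :: "'a::euclidean_space \<Rightarrow> real"
  assumes "continuous_on K f" "compact K"
  shows "integrable lebesgue (\<lambda>x. indicat_real K x * f x)"
  using borel_integrable_compact[OF assms(2,1)] by (simp add: integrable_completion borel_measurable_integrable)

lemma continuous_locally_integrable:
  fixes f :: "'a::euclidean_space \<Rightarrow> real"
  assumes "continuous_on UNIV f"
  shows "f locally_integrable_on S"
  unfolding locally_integrable_on_def set_integrable_def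
  using integrable_continuous_on_compact[OF continuous_on_subset[OF assms]] by simp

text \<open>By compactness of C, joint continuity is uniform in x near each time t.\<close>

lemma L1_continuous_on_compact:
  fixes f :: "'a::euclidean_space \<Rightarrow> 'b::metric_space \<Rightarrow> real"
  assumes f: "continuous_on (UNIV \<times> T) (\<lambda>(x, t). f x t)" and t: "t \<in> T" and C: "compact C"
  shows "((\<lambda>s. LINT x:C|lebesgue. \<bar>f x s - f x t\<bar>) \<longlongrightarrow> 0) (at t within T)"
proof (rule tendstoI)
  fix e :: real assume e: "0 < e"
  define A where "A = integral\<^sup>L lebesgue (indicat_real C)"
  have A: "0 \<le> A" unfolding A_def by (intro Bochner_Integration.integral_nonneg) auto
  define d where "d = e / (A + 1)"
  have d: "0 < d" "d * A < e" using e A by (auto simp: d_def field_simps)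
  have "continuous_on (T \<times> UNIV) (\<lambda>(s, x). f x s)"
    unfolding case_prod_beta by (rule continuous_on_compose2[OF f[unfolded case_prod_beta], of _ prod.swap, simplified])
      (auto intro!: continuous_intros)
  then have "continuous_on (T \<times> C) (\<lambda>(s, x). f x s)" by (rule continuous_on_subset) auto
  then obtain X where X: "t \<in> X" "open X" "\<forall>s\<in>X \<inter> T. \<forall>x\<in>C. dist (f x s) (f x t) \<le> d"
    using continuous_on_prod_compactE[OF _ C t d(1)] by (metis case_prod_conv)
  have "\<forall>\<^sub>F s in at t within T. s \<in> X \<inter> T"
    using X(1,2) by (auto simp: eventually_at_topological)
  then show "\<forall>\<^sub>F s in at t within T. dist (LINT x:C|lebesgue. \<bar>f x s - f x t\<bar>) 0 < e"
  proof eventually_elim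
    case (elim s)
    have cont: "continuous_on C (\<lambda>x. f x s)" if "s \<in> T" for s
      using that by (intro continuous_on_compose2[OF f, of C "\<lambda>x. (x, s)", simplified]) (auto intro!: continuous_intros)
    have i: "integrable lebesgue (\<lambda>x. indicat_real C x * \<bar>f x s - f x t\<bar>)"
      using elim t by (intro integrable_continuous_on_compact continuous_intros cont C) auto
    have "integral\<^sup>L lebesgue (\<lambda>x. indicat_real C x * \<bar>f x s - f x t\<bar>) \<le> integral\<^sup>L lebesgue (\<lambda>x. d * indicat_real C x)"
    proof (rule integral_mono[OF i])
      show "integrable lebesgue (\<lambda>x. d * indicat_real C x)"
        by (intro integrable_mult_right integrable_indicator_compact_lebesgue C)
      show "indicat_real C x * \<bar>f x s - f x t\<bar> \<le> d * indicat_real C x" for x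
        using X(3) elim by (auto simp: indicator_def dist_real_def)
    qed
    also have "\<dots> = d * A" by (simp add: A_def)
    finally have "integral\<^sup>L lebesgue (\<lambda>x. indicat_real C x * \<bar>f x s - f x t\<bar>) < e" using d by simp
    moreover have "0 \<le> integral\<^sup>L lebesgue (\<lambda>x. indicat_real C x * \<bar>f x s - f x t\<bar>)"
      by (intro Bochner_Integration.integral_nonneg) auto
    ultimately show ?case by (simp add: set_lebesgue_integral_def)
  qed
qed

text \<open>Every difference quotient has integral zero by translation invariance; the quotients are
  bounded by the maximum of the derivative on one compact set, so dominated convergence
  applies.\<close>

lemma integral_partial_deriv_zero:
  fixes h :: "'a::euclidean_space \<Rightarrow> real"
  assumes h: "Ck 1 h" and K: "compact K" "\<And>x. x \<notin> K \<Longrightarrow> h x = 0" and b: "b \<in> Basis"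
  shows "integral\<^sup>L lborel (partial_deriv b h) = 0"
proof -
  have hc: "continuous_on UNIV h" by (rule Ck_imp_continuous[OF h])
  have dc: "continuous_on UNIV (partial_deriv b h)" using h b by simp
  have dz: "partial_deriv b h x = 0" if "x \<notin> K" for x
    using partial_deriv_zero_outside[OF compact_imp_closed[OF K(1)] K(2) that] .
  obtain M where M: "0 \<le> M" "\<And>x. \<bar>partial_deriv b h x\<bar> \<le> M"
    using compact_support_bounded[OF dc K(1) dz] by blast
  define \<epsilon> where "\<epsilon> j = inverse (real (Suc j))" for j
  have \<epsilon>: "0 < \<epsilon> j" "\<epsilon> j \<le> 1" "\<epsilon> \<longlonglongrightarrow> 0" for j
    unfolding \<epsilon>_def[abs_def] using LIMSEQ_inverse_real_of_nat by (auto simp: inverse_le_1_iff)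
  \<comment> \<open>Steps have length at most 1, so this enlargement of K contains the supports of
    all quotients.\<close>
  define K' where "K' = {x - y | x y. x \<in> K \<and> y \<in> cball 0 (1::real)}"
  have K': "compact K'" unfolding K'_def by (intro compact_differences K(1)) simp
  define q where "q j x = (h (x + \<epsilon> j *\<^sub>R b) - h x) / \<epsilon> j" for j x
  have hi: "integrable lborel h" by (rule continuous_compact_support_integrable[OF hc K])
  have hi': "integrable lborel (\<lambda>x. h (x + a))" for a
  proof -
    have "integrable (distr lborel borel ((+) a)) h" using hi by (simp add: lborel_distr_plus)
    then show ?thesis using integrable_distr_eq[of "(+) a" lborel borel h] borel_measurable_continuous_onI[OF hc]
      by (simp add: add.commute)
  qed
  have qi: "integral\<^sup>L lborel (q j) = 0" for j
  proof -
    have "integral\<^sup>L lborel (\<lambda>x. h (x + \<epsilon> j *\<^sub>R b) - h x) = 0"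
      using lborel_integral_translate[of h "\<epsilon> j *\<^sub>R b"] borel_measurable_continuous_onI[OF hc] by (simp add: hi hi')
    then show ?thesis by (simp add: q_def[abs_def])
  qed
  have "(\<lambda>j. integral\<^sup>L lborel (q j)) \<longlonglongrightarrow> integral\<^sup>L lborel (partial_deriv b h)"
  proof (rule integral_dominated_convergence)
    show "partial_deriv b h \<in> borel_measurable lborel" "q j \<in> borel_measurable lborel" for j
      using dc hi hi' unfolding q_def[abs_def] by (auto intro!: borel_measurable_continuous_onI borel_measurable_divide borel_measurable_diff simp: borel_measurable_integrable)
    show "integrable lborel (\<lambda>x. M * indicat_real K' x)"
      by (intro integrable_mult_right integrable_indicator_compact K')
    show "AE x in lborel. (\<lambda>j. q j x) \<longlonglongrightarrow> partial_deriv b h x"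
      unfolding q_def using first_difference_LIMSEQ[OF h b \<epsilon>(1) \<epsilon>(3)] by simp
    show "AE x in lborel. norm (q j x) \<le> M * indicat_real K' x" for j
    proof (rule AE_I2)
      fix x
      show "norm (q j x) \<le> M * indicat_real K' x"
      proof (cases "x \<in> K'")
        case True
        have "\<bar>h (x + \<epsilon> j *\<^sub>R b) - h x\<bar> \<le> \<epsilon> j * M" by (rule first_difference_bound[OF h b \<epsilon>(1) M(2)])
        then show ?thesis using True \<epsilon>(1)[of j] by (simp add: q_def field_simps)
      next
        case False
        have "x \<notin> K" using False by (force simp: K'_def)
        moreover have "x + \<epsilon> j *\<^sub>R b \<notin> K"
        proof
          assume "x + \<epsilon> j *\<^sub>R b \<in> K"
          moreover have "x = (x + \<epsilon> j *\<^sub>R b) - \<epsilon> j *\<^sub>R b" by simp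
          moreover have "\<epsilon> j *\<^sub>R b \<in> cball 0 1" using \<epsilon>(1,2)[of j] b by simp
          ultimately show False using False unfolding K'_def by blast
        qed
        ultimately show ?thesis using K(2) M(1) by (simp add: q_def)
      qed
    qed
  qed
  then show ?thesis by (simp add: qi LIMSEQ_const_iff)
qed

text \<open>V is of class C^2 for all real times, so t = 0 is an interior time and continuity up to
  the initial data is immediate. The locally integrable time derivative is the classical
  one.\<close>

theorem classical_fast_diffusion_solution:
  fixes V :: "(real^'n) \<times> real \<Rightarrow> real"
  assumes V: "Ck 2 V" "\<And>p. 0 < V p"
    and pde: "\<And>x t. partial_deriv (0, 1) V (x, t) = (real CARD('n) - 1) / m * laplacian (\<lambda>y. V (y, t) powr m) x"
  shows "fast_diffusion_solution m (\<lambda>x t. V (x, t)) (\<lambda>x. V (x, 0))"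
proof -
  define C where "C = (real CARD('n) - 1) / m"
  define \<psi> where "\<psi> p = V p powr m" for p
  have \<psi>: "Ck 2 \<psi>" unfolding \<psi>_def[abs_def] by (rule Ck_compose[OF Ck_on_powr V(1)]) (simp add: V(2))
  have Ck1: "Ck 1 f" "f differentiable (at p)" "v \<in> Basis \<Longrightarrow> Ck 1 (partial_deriv v f)"
      "v \<in> Basis \<Longrightarrow> partial_deriv v f differentiable (at p)"
    if "Ck 2 f" for f :: "(real^'n) \<times> real \<Rightarrow> real" and p v
  proof -
    have f: "(\<forall>x. f differentiable at x) \<and> (\<forall>b\<in>Basis. Ck (Suc 0) (partial_deriv b f))"
      using that unfolding numeral_2_eq_2 by (rule Ck.simps(2)[THEN iffD1])
    show "Ck 1 f" using Ck_le[OF that, of 1] by simp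
    show "f differentiable (at p)" using f by blast
    show v: "Ck 1 (partial_deriv v f)" if "v \<in> Basis" using f that by simp
    show "partial_deriv v f differentiable (at p)" if "v \<in> Basis" using f that by (simp only: Ck.simps(2)[of 0])
  qed
  have Vc: "continuous_on UNIV V" by (rule Ck_imp_continuous[OF V(1)])
  have b_Basis: "(b, 0) \<in> Basis" if "b \<in> Basis" for b :: "real^'n"
    using that by (auto simp: Basis_prod_def)
  have t_Basis: "(0 :: real^'n, 1 :: real) \<in> Basis" by (auto simp: Basis_prod_def)
  have Vt: "continuous_on UNIV (partial_deriv (0, 1) V)"
    by (rule Ck_imp_continuous[OF Ck1(3)[OF V(1) t_Basis]])
  have test: "integrable lebesgue (\<lambda>p. V p * deriv (\<lambda>s. \<eta> (fst p, s)) (snd p))"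
      "integrable lebesgue (\<lambda>p. partial_deriv (0, 1) V p * \<eta> p)"
      "integral\<^sup>L lebesgue (\<lambda>p. V p * deriv (\<lambda>s. \<eta> (fst p, s)) (snd p)) =
        - integral\<^sup>L lebesgue (\<lambda>p. partial_deriv (0, 1) V p * \<eta> p)"
      "integral\<^sup>L lebesgue (\<lambda>p. V p * deriv (\<lambda>s. \<eta> (fst p, s)) (snd p) +
        C * \<psi> p * laplacian (\<lambda>y. \<eta> (y, snd p)) (fst p)) = 0"
    if test: "test_function space_time \<eta>" for \<eta> :: "(real^'n) \<times> real \<Rightarrow> real"
  proof -
    have \<eta>: "Ck j \<eta>" for j using test by (simp add: test_function_def smooth_def)
    define K where "K = closure {p. \<eta> p \<noteq> 0}"
    have K: "compact K" using test by (simp add: test_function_def K_def)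
    have \<eta>0: "\<eta> p = 0" if "p \<notin> K" for p using that closure_subset[of "{p. \<eta> p \<noteq> 0}"] by (auto simp: K_def)
    have D\<eta>0: "partial_deriv v \<eta> p = 0" if "p \<notin> K" for p v
      by (rule partial_deriv_zero_outside[OF compact_imp_closed[OF K] \<eta>0 that])
    have D\<eta>c: "continuous_on UNIV (partial_deriv v \<eta>)" if "v \<in> Basis" for v
      by (rule Ck_imp_continuous[OF Ck1(3)[OF \<eta> that]])
    have dt: "deriv (\<lambda>s. \<eta> (fst p, s)) (snd p) = partial_deriv (0, 1) \<eta> p" for p
      using DERIV_imp_deriv[OF partial_deriv_slice_snd[of \<eta> "fst p" "snd p"]] Ck1(2)[OF \<eta>] by simp
    have ci: "integrable lebesgue (\<lambda>p. f p * g p)"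
      if "continuous_on UNIV f" "continuous_on UNIV g" "\<And>p. p \<notin> K \<Longrightarrow> g p = 0" for f g :: "(real^'n) \<times> real \<Rightarrow> real"
    proof -
      have "integrable lborel (\<lambda>p. f p * g p)"
        by (rule continuous_compact_support_integrable[OF _ K]) (use that in \<open>auto intro!: continuous_intros\<close>)
      then show ?thesis by (simp add: integrable_completion borel_measurable_integrable)
    qed
    have ibp: "integral\<^sup>L lebesgue (partial_deriv v h) = 0" "integrable lebesgue (partial_deriv v h)"
      if "Ck 1 h" "\<And>p. p \<notin> K \<Longrightarrow> h p = 0" "v \<in> Basis" for h v
    proof -
      have c: "continuous_on UNIV (partial_deriv v h)" using that by simp
      have z: "partial_deriv v h p = 0" if "p \<notin> K" for p
        by (rule partial_deriv_zero_outside[OF compact_imp_closed[OF K] \<open>\<And>p. p \<notin> K \<Longrightarrow> h p = 0\<close> that])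
      show "integral\<^sup>L lebesgue (partial_deriv v h) = 0"
        using integral_partial_deriv_zero[OF that(1) K that(2,3)] borel_measurable_continuous_onI[OF c] by (simp add: integral_completion)
      show "integrable lebesgue (partial_deriv v h)" using ci[OF continuous_on_const[of _ 1] c z] by simp
    qed
    show i1: "integrable lebesgue (\<lambda>p. V p * deriv (\<lambda>s. \<eta> (fst p, s)) (snd p))"
      unfolding dt by (rule ci[OF Vc D\<eta>c[OF t_Basis] D\<eta>0])
    show i2: "integrable lebesgue (\<lambda>p. partial_deriv (0, 1) V p * \<eta> p)"
      by (rule ci[OF Vt Ck_imp_continuous[OF \<eta>] \<eta>0])
    have pd: "partial_deriv (0, 1) (\<lambda>p. V p * \<eta> p) = (\<lambda>p. V p * partial_deriv (0, 1) \<eta> p + partial_deriv (0, 1) V p * \<eta> p)"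
      by (intro ext partial_deriv_mult Ck1 V \<eta>)
    have ht: "Ck 1 (\<lambda>p. V p * \<eta> p)" by (intro Ck_mult Ck1 V \<eta>)
    have time: "integral\<^sup>L lebesgue (\<lambda>p. V p * partial_deriv (0, 1) \<eta> p + partial_deriv (0, 1) V p * \<eta> p) = 0"
      "integrable lebesgue (\<lambda>p. V p * partial_deriv (0, 1) \<eta> p + partial_deriv (0, 1) V p * \<eta> p)"
      using ibp[OF ht _ t_Basis] \<eta>0 unfolding pd by auto
    show "integral\<^sup>L lebesgue (\<lambda>p. V p * deriv (\<lambda>s. \<eta> (fst p, s)) (snd p)) =
        - integral\<^sup>L lebesgue (\<lambda>p. partial_deriv (0, 1) V p * \<eta> p)"
      using time(1) i1 i2 unfolding dt by simp
    \<comment> \<open>The components of the field with divergence \<psi> \<Delta>\<eta> - \<eta>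
      \<Delta>\<psi>, as in Green's second identity.\<close>
    define h where "h b p = \<psi> p * partial_deriv (b, 0) \<eta> p - \<eta> p * partial_deriv (b, 0) \<psi> p" for b :: "real^'n" and p
    have hC: "Ck 1 (h b)" if "b \<in> Basis" for b
      unfolding h_def[abs_def] by (intro Ck_diff Ck_mult Ck1 \<psi> \<eta> b_Basis that)
    have h: "integral\<^sup>L lebesgue (partial_deriv (b, 0) (h b)) = 0" "integrable lebesgue (partial_deriv (b, 0) (h b))"
      if "b \<in> Basis" for b
      by (rule ibp[OF hC[OF that] _ b_Basis[OF that]], simp add: h_def \<eta>0 D\<eta>0)+
    have dh: "partial_deriv (b, 0) (h b) p = \<psi> p * partial_deriv (b, 0) (partial_deriv (b, 0) \<eta>) p
        - \<eta> p * partial_deriv (b, 0) (partial_deriv (b, 0) \<psi>) p" if b: "b \<in> Basis" for b p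
    proof -
      note b' = b_Basis[OF b]
      from has_derivative_diff[OF has_derivative_mult[OF partial_deriv_has_derivative[OF Ck1(2)[OF \<psi>]] partial_deriv_has_derivative[OF Ck1(4)[OF \<eta> b']]]
        has_derivative_mult[OF partial_deriv_has_derivative[OF Ck1(2)[OF \<eta>]] partial_deriv_has_derivative[OF Ck1(4)[OF \<psi> b']]], of p]
      show ?thesis unfolding h_def[abs_def] by (subst partial_deriv_eq) (assumption, simp)
    qed
    have eq: "V p * deriv (\<lambda>s. \<eta> (fst p, s)) (snd p) + C * \<psi> p * laplacian (\<lambda>y. \<eta> (y, snd p)) (fst p) =
      (V p * partial_deriv (0, 1) \<eta> p + partial_deriv (0, 1) V p * \<eta> p) + C * (\<Sum>b\<in>Basis. partial_deriv (b, 0) (h b) p)" for p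
    proof -
      have "partial_deriv (0, 1) V p = C * laplacian (\<lambda>y. \<psi> (y, snd p)) (fst p)"
        using pde[of "fst p" "snd p"] by (simp add: C_def \<psi>_def)
      then have "partial_deriv (0, 1) V p = C * (\<Sum>b\<in>Basis. partial_deriv (b, 0) (partial_deriv (b, 0) \<psi>) p)"
        by (simp add: laplacian_slice[OF \<psi>])
      then show ?thesis unfolding dt by (simp add: laplacian_slice[OF \<eta>] dh sum_subtractf sum_distrib_left[symmetric] algebra_simps)
    qed
    show "integral\<^sup>L lebesgue (\<lambda>p. V p * deriv (\<lambda>s. \<eta> (fst p, s)) (snd p) +
        C * \<psi> p * laplacian (\<lambda>y. \<eta> (y, snd p)) (fst p)) = 0"
      unfolding eq using time h by (simp add: Bochner_Integration.integral_sum)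
  qed
  have slice: "continuous_on UNIV (\<lambda>x. V (x, t))" for t
    by (rule continuous_on_compose2[OF Vc]) (auto intro!: continuous_intros)
  show ?thesis unfolding fast_diffusion_solution_def
  proof (intro conjI allI impI)
    show "AE x in lebesgue. 0 \<le> V (x, t)" for t using V(2) by (simp add: less_imp_le)
    show "L1loc_tendsto (\<lambda>s x. V (x, s)) (\<lambda>x. V (x, t)) (at t within {0..})" if "0 \<le> t" for t
      unfolding L1loc_tendsto_def
    proof (intro conjI allI impI)
      show "((\<lambda>s. LINT x:K|lebesgue. \<bar>V (x, s) - V (x, t)\<bar>) \<longlongrightarrow> 0) (at t within {0..})" if "compact K" for K
        by (rule L1_continuous_on_compact[OF _ _ that]) (use \<open>0 \<le> t\<close> Vc in \<open>auto intro: continuous_on_subset\<close>)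
    qed (simp_all add: continuous_locally_integrable[OF slice])
    show "(\<lambda>(x, t). V (x, t)) locally_integrable_on space_time"
      using continuous_locally_integrable[OF Vc] by simp
    show "integral\<^sup>L lebesgue (\<lambda>(x, t). V (x, t) * deriv (\<lambda>s. \<eta> (x, s)) t
          + (real CARD('n) - 1) / m * (V (x, t) powr m) * laplacian (\<lambda>y. \<eta> (y, t)) x) = 0"
      if "test_function space_time \<eta>" for \<eta>
      using test(4)[OF that] unfolding case_prod_beta prod.collapse C_def \<psi>_def .
    show "\<exists>w. (\<lambda>(x, t). w x t) locally_integrable_on space_time \<and> weak_time_deriv (\<lambda>x t. V (x, t)) w"
    proof (intro exI conjI)
      show "(\<lambda>(x, t). partial_deriv (0, 1) V (x, t)) locally_integrable_on space_time"
        using continuous_locally_integrable[OF Vt] by simp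
      show "weak_time_deriv (\<lambda>x t. V (x, t)) (\<lambda>x t. partial_deriv (0, 1) V (x, t))"
        unfolding weak_time_deriv_def case_prod_beta prod.collapse using test(3) by blast
    qed
  qed simp
qed

section \<open>The soliton equation\<close>

lemma at_within_atLeast_eq: "x \<in> {0..} \<Longrightarrow> at (x::real) within {0..x + 1} = at x within {0..}"
  by (rule at_within_nhd[of x "{..<x + 1}"]) auto

lemma integral_has_real_derivative_atLeast:
  assumes "continuous_on {0..} f" "0 \<le> x"
  shows "((\<lambda>x. integral {0..x} f) has_real_derivative f x) (at x within {0..})"
proof -
  have "((\<lambda>x. integral {0..x} f) has_real_derivative f x) (at x within {0..x + 1})"
    by (rule integral_has_real_derivative) (use assms in \<open>auto intro: continuous_on_subset\<close>)
  then show ?thesis using at_within_atLeast_eq[of x] assms by simp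
qed

lemma at_within_atLeast_interior: "0 < x \<Longrightarrow> at (x::real) within {0..} = at x"
  by (rule at_within_nhd[of x "{0<..}"]) auto

text \<open>Multiplied by the exponential of the integral of \<open>a\<close>, the function f is
  nondecreasing. Differentiability is asked for x > 0 only; continuity supplies the comparison with
  the value at 0.\<close>

lemma linear_differential_inequality:
  fixes f :: "real \<Rightarrow> real"
  assumes f: "continuous_on {0..} f" "\<And>x. 0 < x \<Longrightarrow> (f has_real_derivative f' x) (at x)"
    and a: "continuous_on {0..} a" and ineq: "\<And>x. 0 < x \<Longrightarrow> 0 \<le> f' x + a x * f x"
  shows "0 \<le> f 0 \<Longrightarrow> 0 \<le> x \<Longrightarrow> 0 \<le> f x" and "0 < f 0 \<Longrightarrow> 0 \<le> x \<Longrightarrow> 0 < f x"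
proof -
  define E where "E x = exp (integral {0..x} a)" for x
  have dI: "((\<lambda>x. integral {0..x} a) has_real_derivative a x) (at x within {0..})" if "0 \<le> x" for x
    by (rule integral_has_real_derivative_atLeast[OF a that])
  then have contI: "continuous_on {0..} (\<lambda>x. integral {0..x} a)" by (auto intro!: DERIV_continuous_on)
  have mono: "f 0 \<le> f x * E x" if "0 < x" for x
  proof -
    have "f 0 * E 0 \<le> f x * E x"
    proof (rule DERIV_nonneg_imp_increasing_open[OF less_imp_le[OF that]])
      show "continuous_on {0..x} (\<lambda>x. f x * E x)" unfolding E_def
        by (intro continuous_intros continuous_on_subset[OF f(1)] continuous_on_subset[OF contI]) auto
      fix y assume y: "0 < y" "y < x"
      have "((\<lambda>x. integral {0..x} a) has_real_derivative a y) (at y)"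
        using dI[of y] y at_within_atLeast_interior[of y] by simp
      then have dE: "(E has_real_derivative E y * a y) (at y)"
        unfolding E_def[abs_def] by (rule DERIV_chain2[OF DERIV_exp])
      have "((\<lambda>x. f x * E x) has_real_derivative f' y * E y + E y * a y * f y) (at y)"
        by (rule DERIV_mult[OF f(2)[OF y(1)] dE])
      moreover have "0 \<le> (f' y + a y * f y) * E y" using ineq[OF y(1)] by (simp add: E_def)
      ultimately show "\<exists>z. ((\<lambda>x. f x * E x) has_real_derivative z) (at y) \<and> 0 \<le> z"
        by (intro exI[of _ "f' y * E y + E y * a y * f y"]) (simp add: algebra_simps)
    qed
    then show ?thesis by (simp add: E_def)
  qed
  show "0 \<le> f 0 \<Longrightarrow> 0 \<le> x \<Longrightarrow> 0 \<le> f x"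
    using mono[of x] by (cases "x = 0") (auto simp: E_def zero_le_mult_iff intro: order_trans dest: order_trans)
  show "0 < f 0 \<Longrightarrow> 0 \<le> x \<Longrightarrow> 0 < f x"
    using mono[of x] by (cases "x = 0") (auto simp: E_def zero_less_mult_iff dest: less_le_trans)
qed

text \<open>In the variable r = |x|^2 with 2 k + 2 = n, the volume element is a multiple of r^k dr,
  so k + 1 times this is the mean of F over a ball. Scaling to [0, 1] avoids a division by r and
  shows regularity at r = 0.\<close>

definition radial_mean :: "real \<Rightarrow> (real \<Rightarrow> real) \<Rightarrow> real \<Rightarrow> real" where
  "radial_mean k F r = integral {0..1} (\<lambda>t. t powr k * F (t * r))"

lemma radial_mean_integrand_continuous:
  fixes F :: "real \<Rightarrow> real"
  assumes "continuous_on {0..} F" "0 < k"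
  shows "continuous_on ({0..} \<times> cbox 0 1) (\<lambda>(r, t). t powr k * F (t * r))"
  unfolding case_prod_beta
proof (rule continuous_on_mult)
  show "continuous_on ({0..} \<times> cbox 0 1) (\<lambda>p. snd p powr k :: real)"
    using assms(2) by (intro continuous_on_powr' continuous_intros) auto
  show "continuous_on ({0..} \<times> cbox 0 1) (\<lambda>p. F (snd p * fst p))"
    by (intro continuous_on_compose2[OF assms(1)] continuous_intros) (auto simp: mem_Times_iff)
qed

lemma radial_mean_integrable:
  fixes F :: "real \<Rightarrow> real"
  assumes "continuous_on {0..} F" "0 < k" "0 \<le> r"
  shows "(\<lambda>t. t powr k * F (t * r)) integrable_on {0..1}"
proof (rule integrable_continuous_real)
  show "continuous_on {0..1} (\<lambda>t. t powr k * F (t * r))"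
  proof (rule continuous_on_mult)
    show "continuous_on {0..1} (\<lambda>t. t powr k)" using assms(2) by (intro continuous_on_powr' continuous_intros) auto
    show "continuous_on {0..1} (\<lambda>t. F (t * r))"
      using assms(3) by (intro continuous_on_compose2[OF assms(1)] continuous_intros) auto
  qed
qed

lemma radial_mean_continuous:
  assumes "continuous_on {0..} F" "0 < k"
  shows "continuous_on {0..} (radial_mean k F)"
  using integral_continuous_on_param[OF radial_mean_integrand_continuous[OF assms]]
  unfolding radial_mean_def[abs_def] by simp

lemma radial_mean_bound:
  fixes F :: "real \<Rightarrow> real"
  assumes "continuous_on {0..} F" "0 < k" "0 \<le> r" "\<And>s. 0 \<le> s \<Longrightarrow> s \<le> r \<Longrightarrow> \<bar>F s\<bar> \<le> B"
  shows "\<bar>radial_mean k F r\<bar> \<le> B"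
proof -
  have B: "0 \<le> B" using assms(4)[of 0] assms(3) by linarith
  have "norm (radial_mean k F r) \<le> integral {0..1} (\<lambda>t::real. B)"
    unfolding radial_mean_def
  proof (rule integral_norm_bound_integral[OF radial_mean_integrable[OF assms(1-3)]])
    show "norm (t powr k * F (t * r)) \<le> B" if "t \<in> {0..1}" for t
    proof -
      have "t powr k \<le> 1" using that assms(2) by (intro powr_le1) auto
      moreover have "\<bar>F (t * r)\<bar> \<le> B" using that assms(3) by (intro assms(4)) (auto intro: mult_left_le_one_le)
      ultimately show ?thesis using mult_mono[of "t powr k" 1 "\<bar>F (t * r)\<bar>" B] by (simp add: abs_mult)
    qed
  qed (rule integrable_const_ivl)
  then show ?thesis by simp
qed

lemma radial_mean_diff:
  assumes "continuous_on {0..} F" "continuous_on {0..} G" "0 < k" "0 \<le> r"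
  shows "radial_mean k (\<lambda>s. F s - G s) r = radial_mean k F r - radial_mean k G r"
  unfolding radial_mean_def
  using integral_diff[OF radial_mean_integrable[OF assms(1,3,4)] radial_mean_integrable[OF assms(2-4)]]
  by (simp add: right_diff_distrib)

text \<open>Differentiation under the integral brings out a factor t and so raises the weight
  exponent by one; the family of means is closed under differentiation.\<close>

lemma radial_mean_deriv:
  assumes F: "\<And>x. 0 \<le> x \<Longrightarrow> (F has_real_derivative F' x) (at x within {0..})"
    and F': "continuous_on {0..} F'" and k: "0 < k" and r: "0 \<le> r"
  shows "(radial_mean k F has_real_derivative radial_mean (k + 1) F' r) (at r within {0..})"
proof -
  have contF: "continuous_on {0..} F" using F by (auto intro!: DERIV_continuous_on)
  have "((\<lambda>r. integral (cbox 0 1) (\<lambda>t. t powr k * F (t * r))) has_field_derivative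
     integral (cbox 0 1) (\<lambda>t. t powr (k + 1) * F' (t * r))) (at r within {0..})"
  proof (rule leibniz_rule_field_derivative)
    fix x t :: real assume x: "x \<in> {0..}" and t: "t \<in> cbox 0 1"
    have "((\<lambda>x. t * x) has_real_derivative t) (at x within {0..})" by (auto intro!: derivative_eq_intros)
    moreover have "(F has_real_derivative F' (t * x)) (at (t * x) within ((*) t) ` {0..})"
      using x t by (intro DERIV_subset[OF F]) auto
    ultimately have "((\<lambda>x. F (t * x)) has_real_derivative F' (t * x) * t) (at x within {0..})"
      using DERIV_image_chain[of F "F' (t * x)" "(*) t" x "{0..}" t] by (simp add: o_def)
    then have "((\<lambda>x. t powr k * F (t * x)) has_real_derivative t powr k * (F' (t * x) * t)) (at x within {0..})"
      by (rule DERIV_cmult)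
    moreover have "t powr k * (F' (t * x) * t) = t powr (k + 1) * F' (t * x)"
      using t by (cases "t = 0") (auto simp: powr_add)
    ultimately show "((\<lambda>x. t powr k * F (t * x)) has_real_derivative t powr (k + 1) * F' (t * x)) (at x within {0..})"
      by simp
  next
    show "(\<lambda>t. t powr k * F (t * x)) integrable_on cbox 0 1" if "x \<in> {0..}" for x
      using radial_mean_integrable[OF contF k, of x] that by simp
    show "continuous_on ({0..} \<times> cbox 0 1) (\<lambda>(x, t). t powr (k + 1) * F' (t * x))"
      using radial_mean_integrand_continuous[OF F', of "k + 1"] k by simp
  qed (use r in auto)
  then show ?thesis unfolding radial_mean_def[abs_def] by simp
qed

lemma Ck_on_radial_mean:
  "Ck_on j {0..} F \<Longrightarrow> 0 < k \<Longrightarrow> Ck_on j {0..} (radial_mean k F)"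
proof (induction j arbitrary: F k)
  case 0
  then show ?case by (simp add: radial_mean_continuous)
next
  case (Suc j)
  then obtain F' where F': "\<And>x. x \<in> {0..} \<Longrightarrow> (F has_real_derivative F' x) (at x within {0..})" "Ck_on j {0..} F'" by auto
  have cont: "continuous_on {0..} F'"
    using F'(2) by (induction j arbitrary: F') (auto intro: DERIV_continuous_on)
  show ?case
    by (rule Ck_on_SucI[OF radial_mean_deriv[OF F'(1) cont Suc.prems(2)] Suc.IH[OF F'(2)]]) (use Suc.prems in auto)
qed

text \<open>The fundamental theorem for t^(k+1) F (t r) on [0, 1]; it expresses the mean of F'
  without derivatives.\<close>

lemma radial_mean_by_parts:
  assumes F: "\<And>x. 0 \<le> x \<Longrightarrow> (F has_real_derivative F' x) (at x within {0..})"
    and F': "continuous_on {0..} F'" and k: "0 < k" and r: "0 \<le> r"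
  shows "r * radial_mean (k + 1) F' r = F r - (k + 1) * radial_mean k F r"
proof -
  have contF: "continuous_on {0..} F" using F by (auto intro!: DERIV_continuous_on)
  have i1: "(\<lambda>t. (k + 1) * (t powr k * F (t * r))) integrable_on {0..1}"
    using integrable_on_cmult_left[OF radial_mean_integrable[OF contF k r], of "k + 1"] by simp
  have i2: "(\<lambda>t. r * (t powr (k + 1) * F' (t * r))) integrable_on {0..1}"
    using integrable_on_cmult_left[OF radial_mean_integrable[OF F' _ r, of "k + 1"], of r] k by simp
  have "((\<lambda>t. (k + 1) * (t powr k * F (t * r)) + r * (t powr (k + 1) * F' (t * r))) has_integral
      1 powr (k + 1) * F (1 * r) - 0 powr (k + 1) * F (0 * r)) {0..1}"
  proof (rule fundamental_theorem_of_calculus_interior)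
    show "continuous_on {0..1} (\<lambda>t. t powr (k + 1) * F (t * r))"
    proof (rule continuous_on_mult)
      show "continuous_on {0..1} (\<lambda>t. t powr (k + 1))" using k by (intro continuous_on_powr' continuous_intros) auto
      show "continuous_on {0..1} (\<lambda>t. F (t * r))" using r by (intro continuous_on_compose2[OF contF] continuous_intros) auto
    qed
    fix t :: real assume t: "t \<in> {0<..<1}"
    have "(F has_real_derivative F' (t * r)) (at (t * r) within (\<lambda>t. t * r) ` {0<..<1})"
      using t r by (intro DERIV_subset[OF F]) auto
    moreover have "((\<lambda>t. t * r) has_real_derivative r) (at t within {0<..<1})" by (auto intro!: derivative_eq_intros)
    ultimately have "((\<lambda>t. F (t * r)) has_real_derivative F' (t * r) * r) (at t within {0<..<1})"
      using DERIV_image_chain[of F "F' (t * r)" "\<lambda>t. t * r" t "{0<..<1}" r] by (simp add: o_def)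
    then have dF: "((\<lambda>t. F (t * r)) has_real_derivative F' (t * r) * r) (at t)"
      using t at_within_open[of t "{0<..<1::real}"] by simp
    have "((\<lambda>t. t powr (k + 1)) has_real_derivative (k + 1) * t powr (k + 1 - 1)) (at t)"
      using t by (intro has_real_derivative_powr) auto
    from DERIV_mult[OF this dF]
    show "((\<lambda>t. t powr (k + 1) * F (t * r)) has_vector_derivative
       (k + 1) * (t powr k * F (t * r)) + r * (t powr (k + 1) * F' (t * r))) (at t)"
      by (simp add: has_real_derivative_iff_has_vector_derivative[symmetric] mult_ac)
  qed simp
  then have "integral {0..1} (\<lambda>t. (k + 1) * (t powr k * F (t * r)) + r * (t powr (k + 1) * F' (t * r))) = F r"
    by (simp add: integral_unique)
  then show ?thesis
    using integral_add[OF i1 i2] by (simp add: radial_mean_def)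
qed

section \<open>The integral equation of the soliton profile: uniqueness and existence\<close>

locale soliton_ode =
  fixes k c :: real
  assumes k: "0 < k" and c: "0 < c"
begin

text \<open>With k = (n - 2)/2 this is (n + 2)/(n - 2) = 1/m.\<close>

definition p :: real where "p = (k + 2) / k"

lemma p: "1 < p" "p - 1 = 2 / k" "k * p = k + 2" "0 < p"
  using k by (auto simp: p_def field_simps)

text \<open>Integrating the radial equation once over a ball gives G' = - c N F, where F is the
  soliton and G its m-th power as functions of |x|^2. The singular first-order term of the radial
  Laplacian has been absorbed into the mean.\<close>

definition N :: "(real \<Rightarrow> real) \<Rightarrow> real \<Rightarrow> real" where
  "N F r = 2 * F r - k * radial_mean k F r"

lemma N_continuous: "continuous_on {0..} F \<Longrightarrow> continuous_on {0..} (N F)"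
  unfolding N_def[abs_def] by (intro continuous_intros radial_mean_continuous k)

lemma N_diff:
  "continuous_on {0..} F \<Longrightarrow> continuous_on {0..} G \<Longrightarrow> 0 \<le> r \<Longrightarrow> N (\<lambda>s. F s - G s) r = N F r - N G r"
  by (simp add: N_def radial_mean_diff k algebra_simps)

text \<open>Against the weight e^(\<Lambda> s), integration gains a factor 1/\<Lambda>. This makes
  the integral operator a contraction on the whole half-line, for uniqueness as well as
  existence.\<close>

lemma N_integral_bound:
  assumes F: "continuous_on {0..} F" and r: "0 \<le> r" and \<Lambda>: "0 < \<Lambda>"
    and B: "\<And>s. 0 \<le> s \<Longrightarrow> s \<le> r \<Longrightarrow> \<bar>F s\<bar> \<le> B * exp (\<Lambda> * s)"
  shows "\<bar>integral {0..r} (N F)\<bar> \<le> (2 + k) * B / \<Lambda> * exp (\<Lambda> * r)"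
proof -
  have B0: "0 \<le> B" using B[of 0] r by simp
  have bound: "\<bar>N F s\<bar> \<le> (2 + k) * B * exp (\<Lambda> * s)" if s: "0 \<le> s" "s \<le> r" for s
  proof -
    have "\<bar>radial_mean k F s\<bar> \<le> B * exp (\<Lambda> * s)"
    proof (rule radial_mean_bound[OF F k s(1)])
      fix t assume t: "0 \<le> t" "t \<le> s"
      have "\<bar>F t\<bar> \<le> B * exp (\<Lambda> * t)" using t s by (intro B) auto
      also have "\<dots> \<le> B * exp (\<Lambda> * s)" using t \<Lambda> B0 by (intro mult_left_mono) auto
      finally show "\<bar>F t\<bar> \<le> B * exp (\<Lambda> * s)" .
    qed
    then have "k * \<bar>radial_mean k F s\<bar> \<le> k * (B * exp (\<Lambda> * s))" using k by (intro mult_left_mono) auto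
    moreover have "\<bar>N F s\<bar> \<le> 2 * \<bar>F s\<bar> + k * \<bar>radial_mean k F s\<bar>"
      unfolding N_def using abs_triangle_ineq4[of "2 * F s" "k * radial_mean k F s"] k by (simp add: abs_mult)
    ultimately show ?thesis using B[OF s] by (simp add: algebra_simps)
  qed
  have hi: "((\<lambda>s. (2 + k) * B * exp (\<Lambda> * s)) has_integral
      (2 + k) * B / \<Lambda> * exp (\<Lambda> * r) - (2 + k) * B / \<Lambda> * exp (\<Lambda> * 0)) {0..r}"
    using \<Lambda> r by (intro fundamental_theorem_of_calculus)
      (auto intro!: derivative_eq_intros simp: has_real_derivative_iff_has_vector_derivative[symmetric])
  have "norm (integral {0..r} (N F)) \<le> integral {0..r} (\<lambda>s. (2 + k) * B * exp (\<Lambda> * s))"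
  proof (rule integral_norm_bound_integral)
    show "N F integrable_on {0..r}"
      by (rule integrable_continuous_real) (rule continuous_on_subset[OF N_continuous[OF F]], auto)
    show "(\<lambda>s. (2 + k) * B * exp (\<Lambda> * s)) integrable_on {0..r}" using hi by (rule has_integral_integrable)
    show "norm (N F s) \<le> (2 + k) * B * exp (\<Lambda> * s)" if "s \<in> {0..r}" for s using bound[of s] that by simp
  qed
  also have "\<dots> = (2 + k) * B / \<Lambda> * exp (\<Lambda> * r) - (2 + k) * B / \<Lambda>" using integral_unique[OF hi] by simp
  also have "\<dots> \<le> (2 + k) * B / \<Lambda> * exp (\<Lambda> * r)" using k B0 \<Lambda> by simp
  finally show ?thesis by simp
qed

lemma N_integral_continuous:
  assumes "continuous_on {0..} F" shows "continuous_on {0..} (\<lambda>r. integral {0..r} (N F))"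
  using integral_has_real_derivative_atLeast[OF N_continuous[OF assms]] by (auto intro!: DERIV_continuous_on)

text \<open>Uniqueness by the weighted norm \<open>sup e\<^sup>-\<^sup>\<Lambda>\<^sup>r \<bar>G r\<bar>\<close>.\<close>

lemma integral_equation_unique:
  assumes G1: "continuous_on {0..} G1" "continuous_on {0..} F1" "\<And>r. 0 \<le> r \<Longrightarrow> G1 r = g0 - c * integral {0..r} (N F1)"
    and G2: "continuous_on {0..} G2" "continuous_on {0..} F2" "\<And>r. 0 \<le> r \<Longrightarrow> G2 r = g0 - c * integral {0..r} (N F2)"
    and lip: "\<And>b. \<exists>C. \<forall>r. 0 \<le> r \<longrightarrow> r \<le> b \<longrightarrow> \<bar>F1 r - F2 r\<bar> \<le> C * \<bar>G1 r - G2 r\<bar>"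
    and r: "0 \<le> r"
  shows "G1 r = G2 r"
proof -
  obtain C0 where C0: "\<And>s. 0 \<le> s \<Longrightarrow> s \<le> r \<Longrightarrow> \<bar>F1 s - F2 s\<bar> \<le> C0 * \<bar>G1 s - G2 s\<bar>" using lip by blast
  define C where "C = max C0 1"
  have C: "0 < C" "\<And>s. 0 \<le> s \<Longrightarrow> s \<le> r \<Longrightarrow> \<bar>F1 s - F2 s\<bar> \<le> C * \<bar>G1 s - G2 s\<bar>"
  proof -
    fix s assume s: "0 \<le> s" "s \<le> r"
    have "C0 * \<bar>G1 s - G2 s\<bar> \<le> C * \<bar>G1 s - G2 s\<bar>" unfolding C_def by (intro mult_right_mono) auto
    then show "\<bar>F1 s - F2 s\<bar> \<le> C * \<bar>G1 s - G2 s\<bar>" using C0[OF s] by linarith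
  qed (simp add: C_def)
  \<comment> \<open>Chosen so that the factor c (2 + k) C / \<Lambda> is exactly 1/2.\<close>
  define \<Lambda> where "\<Lambda> = 2 * c * (2 + k) * C"
  have \<Lambda>: "0 < \<Lambda>" using c k C by (simp add: \<Lambda>_def)
  let ?h = "\<lambda>s. \<bar>G1 s - G2 s\<bar> * exp (- \<Lambda> * s)"
  have "continuous_on {0..r} ?h"
    by (intro continuous_intros continuous_on_subset[OF G1(1)] continuous_on_subset[OF G2(1)]) auto
  then obtain s where s: "0 \<le> s" "s \<le> r" "\<And>t. 0 \<le> t \<Longrightarrow> t \<le> r \<Longrightarrow> ?h t \<le> ?h s"
    using continuous_attains_sup[of "{0..r}" ?h] r by auto
  define B where "B = ?h s"
  have Gt: "\<bar>G1 t - G2 t\<bar> \<le> B * exp (\<Lambda> * t)" if "0 \<le> t" "t \<le> r" for t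
  proof -
    have "?h t * exp (\<Lambda> * t) \<le> B * exp (\<Lambda> * t)" unfolding B_def using s(3)[OF that] by (intro mult_right_mono) auto
    then show ?thesis by (simp add: mult.assoc exp_add[symmetric])
  qed
  have "\<bar>integral {0..s} (N (\<lambda>t. F1 t - F2 t))\<bar> \<le> (2 + k) * (C * B) / \<Lambda> * exp (\<Lambda> * s)"
  proof (rule N_integral_bound[OF _ s(1) \<Lambda>])
    show "continuous_on {0..} (\<lambda>t. F1 t - F2 t)" by (intro continuous_intros G1 G2)
    fix t assume t: "0 \<le> t" "t \<le> s"
    have "\<bar>F1 t - F2 t\<bar> \<le> C * \<bar>G1 t - G2 t\<bar>" using t s by (intro C(2)) auto
    also have "\<dots> \<le> C * (B * exp (\<Lambda> * t))" using t s C(1) by (intro mult_left_mono Gt) auto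
    finally show "\<bar>F1 t - F2 t\<bar> \<le> C * B * exp (\<Lambda> * t)" by (simp add: mult.assoc)
  qed
  moreover have "integral {0..s} (N (\<lambda>t. F1 t - F2 t)) = integral {0..s} (N F1) - integral {0..s} (N F2)"
  proof -
    have i: "N F1 integrable_on {0..s}" "N F2 integrable_on {0..s}"
      by (rule integrable_continuous_real, rule continuous_on_subset[OF N_continuous], use G1 G2 in auto)+
    have "integral {0..s} (N (\<lambda>t. F1 t - F2 t)) = integral {0..s} (\<lambda>t. N F1 t - N F2 t)"
      using N_diff[OF G1(2) G2(2)] by (intro Henstock_Kurzweil_Integration.integral_cong) auto
    then show ?thesis using integral_diff[OF i] by simp
  qed
  moreover have "G1 s - G2 s = - (c * (integral {0..s} (N F1) - integral {0..s} (N F2)))"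
    using G1(3)[OF s(1)] G2(3)[OF s(1)] by (simp add: algebra_simps)
  ultimately have "\<bar>G1 s - G2 s\<bar> = c * \<bar>integral {0..s} (N (\<lambda>t. F1 t - F2 t))\<bar>"
    and "\<bar>integral {0..s} (N (\<lambda>t. F1 t - F2 t))\<bar> \<le> (2 + k) * (C * B) / \<Lambda> * exp (\<Lambda> * s)"
    using c by (simp_all add: abs_mult)
  then have "\<bar>G1 s - G2 s\<bar> \<le> c * ((2 + k) * (C * B) / \<Lambda> * exp (\<Lambda> * s))"
    using c by (simp only: mult_left_mono less_imp_le)
  also have "\<dots> = B / 2 * exp (\<Lambda> * s)" using c k C by (simp add: \<Lambda>_def)
  finally have "\<bar>G1 s - G2 s\<bar> * exp (- \<Lambda> * s) \<le> B / 2 * exp (\<Lambda> * s) * exp (- \<Lambda> * s)" by (intro mult_right_mono) auto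
  then have "B \<le> B / 2" unfolding B_def[symmetric] by (simp add: mult.assoc exp_add[symmetric])
  then have "B * exp (\<Lambda> * r) \<le> 0" by (intro mult_nonpos_nonneg) auto
  then show ?thesis using Gt[OF r order_refl] by linarith
qed

text \<open>A \<open>C\<^sup>1\<close> extension of \<open>y \<mapsto> y\<^sup>p\<close> from \<open>[0, 1]\<close> to the line with bounded derivative. The solution of
  the truncated equation turns out to take values in \<open>(0, 1]\<close> only.\<close>

definition trunc :: "real \<Rightarrow> real" where
  "trunc y = (if y \<le> 0 then 0 else if y \<le> 1 then y powr p else 1 + p * (y - 1))"

definition trunc' :: "real \<Rightarrow> real" where
  "trunc' y = p * max 0 (min 1 y) powr (p - 1)"

lemma trunc'_bounds: "0 \<le> trunc' y" "trunc' y \<le> p"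
proof -
  have "max 0 (min 1 y) powr (p - 1) \<le> 1" using p(1,4) by (intro powr_le1) auto
  then show "0 \<le> trunc' y" "trunc' y \<le> p" using p(1,4) by (auto simp: trunc'_def)
qed

lemma trunc'_continuous: "continuous_on UNIV trunc'"
  unfolding trunc'_def[abs_def] using p(1,4) by (intro continuous_intros continuous_on_powr') auto

lemma trunc_deriv: "(trunc has_real_derivative trunc' y) (at y)"
proof -
  have powr_d: "((\<lambda>y. y powr p) has_real_derivative p * y powr (p - 1)) (at y)" if "0 < y" for y
    using that by (rule has_real_derivative_powr)
  consider "y < 0" | "y = 0" | "0 < y" "y < 1" | "y = 1" | "1 < y" by linarith
  then show ?thesis
  proof cases
    case 1
    have "((\<lambda>_. 0) has_real_derivative 0) (at y)" by simp
    then have "(trunc has_real_derivative 0) (at y)"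
      by (rule has_field_derivative_transform_within_open[of _ _ _ "{..<0}"]) (use 1 in \<open>auto simp: trunc_def\<close>)
    then show ?thesis using 1 p(1,4) by (simp add: trunc'_def)
  next
    case 2
    have "((\<lambda>h. trunc h / h) \<longlongrightarrow> 0) (at 0)"
    proof (rule Lim_null_comparison)
      have "norm (trunc h / h) \<le> \<bar>h\<bar> powr (p - 1)" if "h < 1" for h
        using that p(1,4) by (cases "h \<le> 0") (auto simp: trunc_def powr_diff intro: divide_nonneg_nonpos)
      then show "\<forall>\<^sub>F h in at 0. norm (trunc h / h) \<le> \<bar>h\<bar> powr (p - 1)"
        unfolding eventually_at by (intro exI[of _ 1]) (auto simp: dist_real_def)
      have "continuous_on UNIV (\<lambda>h::real. \<bar>h\<bar> powr (p - 1))"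
        using p(1,4) by (intro continuous_on_powr' continuous_intros) auto
      then have "((\<lambda>h::real. \<bar>h\<bar> powr (p - 1)) \<longlongrightarrow> \<bar>0\<bar> powr (p - 1)) (at 0)"
        unfolding continuous_on_def by blast
      then show "((\<lambda>h::real. \<bar>h\<bar> powr (p - 1)) \<longlongrightarrow> 0) (at 0)" using p(1,4) by simp
    qed
    then show ?thesis using 2 p(1,4) by (simp add: has_field_derivative_iff trunc_def trunc'_def)
  next
    case 3
    have "(trunc has_real_derivative p * y powr (p - 1)) (at y)"
      by (rule has_field_derivative_transform_within_open[OF powr_d, of _ "{0<..<1}"]) (use 3 in \<open>auto simp: trunc_def\<close>)
    then show ?thesis using 3 by (simp add: trunc'_def)
  next
    case 4
    have t1: "trunc 1 = 1" by (simp add: trunc_def)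
    have r: "((\<lambda>h. (trunc h - trunc 1) / (h - 1)) \<longlongrightarrow> p) (at_right 1)"
    proof (rule tendsto_eventually)
      show "\<forall>\<^sub>F h in at_right 1. (trunc h - trunc 1) / (h - 1) = p"
        unfolding eventually_at_right_field t1 by (auto intro!: exI[of _ 2] simp: trunc_def)
    qed
    have "((\<lambda>h. (h powr p - 1 powr p) / (h - 1)) \<longlongrightarrow> p) (at 1)"
      using powr_d[of 1] by (simp add: has_field_derivative_iff)
    then have "((\<lambda>h. (h powr p - 1 powr p) / (h - 1)) \<longlongrightarrow> p) (at_left 1)"
      by (rule tendsto_mono[rotated]) (simp add: at_le)
    then have l: "((\<lambda>h. (trunc h - trunc 1) / (h - 1)) \<longlongrightarrow> p) (at_left 1)"
    proof (rule tendsto_cong[THEN iffD1, rotated])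
      show "\<forall>\<^sub>F h in at_left 1. (h powr p - 1 powr p) / (h - 1) = (trunc h - trunc 1) / (h - 1)"
        unfolding eventually_at_left_field t1 by (auto intro!: exI[of _ 0] simp: trunc_def)
    qed
    have "((\<lambda>h. (trunc h - trunc 1) / (h - 1)) \<longlongrightarrow> p) (at 1)" using filterlim_split_at[OF l r] .
    then show ?thesis using 4 by (simp add: has_field_derivative_iff trunc'_def)
  next
    case 5
    have "((\<lambda>y. 1 + p * (y - 1)) has_real_derivative p) (at y)" by (auto intro!: derivative_eq_intros)
    then have "(trunc has_real_derivative p) (at y)"
      by (rule has_field_derivative_transform_within_open[of _ _ _ "{1<..}"]) (use 5 in \<open>auto simp: trunc_def\<close>)
    then show ?thesis using 5 by (simp add: trunc'_def)
  qed
qed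

lemma trunc_continuous: "continuous_on S trunc"
  using trunc_deriv DERIV_isCont by (intro continuous_at_imp_continuous_on) blast

lemma trunc_lipschitz: "\<bar>trunc x - trunc y\<bar> \<le> p * \<bar>x - y\<bar>"
  using field_differentiable_bound[of UNIV trunc trunc' p x y] trunc_deriv trunc'_bounds by simp

lemma trunc_nonneg: "0 \<le> trunc y"
  using p(1,4) by (auto simp: trunc_def)

text \<open>Euler's identity for the homogeneous function y^p; for y \<le> 0 both sides vanish.
  Beyond 1 the function is affine, hence the restriction.\<close>

lemma trunc_euler: "y \<le> 1 \<Longrightarrow> trunc' y * y = p * trunc y"
  using p(1,4) by (cases "0 < y") (auto simp: trunc_def trunc'_def powr_diff)

text \<open>Banach's fixed point theorem for e^(-\<Lambda> r) G r among bounded continuous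
  functions. Since \<open>trunc\<close> is globally Lipschitz, the solution is global at once and no
  continuation argument arises.\<close>

lemma integral_equation_exists:
  obtains G where "continuous_on {0..} G" "\<And>r. 0 \<le> r \<Longrightarrow> G r = 1 - c * integral {0..r} (N (\<lambda>s. trunc (G s)))"
proof -
  define \<Lambda> where "\<Lambda> = 2 * c * (2 + k) * p"
  have \<Lambda>: "0 < \<Lambda>" using c k p by (simp add: \<Lambda>_def)
  define F where "F H s = trunc (exp (\<Lambda> * s) * apply_bcontfun H s)" for H :: "real \<Rightarrow>\<^sub>C real" and s
  define I where "I H r = integral {0..r} (N (F H))" for H r
  \<comment> \<open>\<open>max 0 x\<close> extends the operator to the whole line, on which the
    function space lives: to the left of 0 the value at 0 is repeated.\<close>
  define T where "T H x = exp (- \<Lambda> * max 0 x) * (1 - c * I H (max 0 x))" for H x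
  have contF: "continuous_on S (F H)" for H S
    unfolding F_def[abs_def] by (intro continuous_on_compose2[OF trunc_continuous] continuous_intros) auto
  have Fdiff: "\<bar>F H s - F H' s\<bar> \<le> p * dist H H' * exp (\<Lambda> * s)" for H H' s
  proof -
    have "\<bar>F H s - F H' s\<bar> \<le> p * \<bar>exp (\<Lambda> * s) * apply_bcontfun H s - exp (\<Lambda> * s) * apply_bcontfun H' s\<bar>"
      unfolding F_def by (rule trunc_lipschitz)
    also have "\<dots> = p * exp (\<Lambda> * s) * dist (apply_bcontfun H s) (apply_bcontfun H' s)"
      by (simp add: dist_real_def right_diff_distrib[symmetric] abs_mult)
    also have "\<dots> \<le> p * exp (\<Lambda> * s) * dist H H'" using p by (intro mult_left_mono dist_bounded) auto
    finally show ?thesis by (simp add: mult_ac)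
  qed
  have Fb: "\<bar>F H s\<bar> \<le> p * norm H * exp (\<Lambda> * s)" for H s
    using Fdiff[of H s 0] by (simp add: F_def trunc_def)
  have I_diff: "\<bar>I H r - I H' r\<bar> \<le> (2 + k) * (p * dist H H') / \<Lambda> * exp (\<Lambda> * r)" if r: "0 \<le> r" for H H' r
  proof -
    have i: "N (F H) integrable_on {0..r}" "N (F H') integrable_on {0..r}"
      by (rule integrable_continuous_real, rule continuous_on_subset[OF N_continuous[OF contF]], auto)+
    have "integral {0..r} (N (\<lambda>s. F H s - F H' s)) = integral {0..r} (\<lambda>s. N (F H) s - N (F H') s)"
      using N_diff[OF contF contF] by (intro Henstock_Kurzweil_Integration.integral_cong) auto
    also have "\<dots> = I H r - I H' r" unfolding I_def by (rule integral_diff[OF i])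
    finally have "I H r - I H' r = integral {0..r} (N (\<lambda>s. F H s - F H' s))" by simp
    moreover have "\<bar>integral {0..r} (N (\<lambda>s. F H s - F H' s))\<bar> \<le> (2 + k) * (p * dist H H') / \<Lambda> * exp (\<Lambda> * r)"
      by (rule N_integral_bound[OF _ r \<Lambda> Fdiff]) (intro continuous_intros contF)
    ultimately show ?thesis by simp
  qed
  have half: "c * ((2 + k) * (p * d) / \<Lambda>) = d / 2" for d using c k p by (simp add: \<Lambda>_def)
  have T_diff: "\<bar>T H x - T H' x\<bar> \<le> 1 / 2 * dist H H'" for H H' x
  proof -
    let ?r = "max 0 x"
    have "T H x - T H' x = exp (- \<Lambda> * ?r) * (c * (I H' ?r - I H ?r))" unfolding T_def by (simp add: algebra_simps)
    then have "\<bar>T H x - T H' x\<bar> = exp (- \<Lambda> * ?r) * (c * \<bar>I H' ?r - I H ?r\<bar>)" using c by (simp add: abs_mult)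
    also have "\<dots> \<le> exp (- \<Lambda> * ?r) * (c * ((2 + k) * (p * dist H' H) / \<Lambda> * exp (\<Lambda> * ?r)))"
      using c by (intro mult_left_mono I_diff) auto
    also have "\<dots> = c * ((2 + k) * (p * dist H' H) / \<Lambda>) * (exp (- \<Lambda> * ?r) * exp (\<Lambda> * ?r))" by (simp only: mult_ac)
    also have "\<dots> = 1 / 2 * dist H H'" unfolding half by (simp add: exp_add[symmetric] dist_commute)
    finally show ?thesis .
  qed
  have "T H \<in> bcontfun" for H
  proof -
    have "continuous_on UNIV (T H)" unfolding T_def[abs_def] I_def
      by (intro continuous_intros continuous_on_compose2[OF N_integral_continuous[OF contF]]) auto
    \<comment> \<open>\<open>T 0\<close> is bounded by 1 explicitly; the Lipschitz estimate
      transfers boundedness to \<open>T H\<close>.\<close>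
    moreover have "bounded (range (T H))"
      unfolding bounded_iff
    proof (intro exI ballI)
      fix y assume "y \<in> range (T H)"
      then obtain x where y: "y = T H x" by auto
      have "N (\<lambda>s. 0) = (\<lambda>s. 0)" by (simp add: N_def radial_mean_def fun_eq_iff)
      moreover have "F 0 = (\<lambda>s. 0)" by (simp add: F_def trunc_def fun_eq_iff)
      ultimately have "I 0 r = 0" for r by (simp add: I_def)
      then have "\<bar>T 0 x\<bar> \<le> 1" using \<Lambda> by (simp add: T_def)
      then show "norm y \<le> 1 + 1 / 2 * dist H 0" using T_diff[of H x 0] unfolding y real_norm_def by linarith
    qed
    ultimately show ?thesis by (simp add: bcontfun_def)
  qed
  then have app: "apply_bcontfun (Bcontfun (T H)) = T H" for H by (simp add: Bcontfun_inverse)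
  have "\<forall>H H'. dist (Bcontfun (T H)) (Bcontfun (T H')) \<le> 1 / 2 * dist H H'"
    by (intro allI dist_bound) (simp only: app dist_real_def T_diff)
  then obtain H where H: "Bcontfun (T H) = H"
    using banach_fix_type[of "1 / 2" "\<lambda>H. Bcontfun (T H)"] by auto
  define G where "G s = exp (\<Lambda> * s) * apply_bcontfun H s" for s
  have "continuous_on {0..} G" unfolding G_def[abs_def] by (intro continuous_intros) auto
  moreover have "G r = 1 - c * integral {0..r} (N (\<lambda>s. trunc (G s)))" if "0 \<le> r" for r
  proof -
    have "apply_bcontfun H r = T H r" using app[of H] H by simp
    then have "G r = exp (\<Lambda> * r) * exp (- \<Lambda> * r) * (1 - c * I H r)" using that by (simp add: G_def T_def)
    then show ?thesis by (simp add: exp_add[symmetric] I_def F_def[abs_def] G_def[symmetric])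
  qed
  ultimately show ?thesis using that by blast
qed

end

lemma antimono_bounded_below_tendsto:
  fixes J :: "real \<Rightarrow> real"
  assumes anti: "\<And>x y. 0 \<le> x \<Longrightarrow> x \<le> y \<Longrightarrow> J y \<le> J x" and bound: "\<And>x. 0 \<le> x \<Longrightarrow> L \<le> J x"
  obtains l where "(J \<longlongrightarrow> l) at_top"
proof -
  define l where "l = (INF x\<in>{0..}. J x)"
  have bdd: "bdd_below (J ` {0..})" using bound by (intro bdd_belowI[of _ L]) auto
  have le: "l \<le> J x" if "0 \<le> x" for x unfolding l_def using that bdd by (intro cINF_lower) auto
  have "(J \<longlongrightarrow> l) at_top"
  proof (rule order_tendstoI)
    fix b assume "b < l"
    then show "\<forall>\<^sub>F x in at_top. b < J x"
      using le by (intro eventually_at_top_linorderI[of 0]) (auto intro: less_le_trans)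
  next
    fix b assume "l < b"
    then obtain x where x: "0 \<le> x" "J x < b" using cINF_less_iff[of "{0::real..}" J b] bdd by (auto simp: l_def)
    then show "\<forall>\<^sub>F y in at_top. J y < b"
      using anti by (intro eventually_at_top_linorderI[of x]) (auto intro: le_less_trans)
  qed
  then show ?thesis using that by blast
qed

section \<open>Positivity, monotonicity and regularity of the profile\<close>

locale soliton_solution = soliton_ode +
  fixes G :: "real \<Rightarrow> real"
  assumes G_continuous: "continuous_on {0..} G"
    and G_eq: "0 \<le> r \<Longrightarrow> G r = 1 - c * integral {0..r} (N (\<lambda>s. trunc (G s)))"
begin

definition F :: "real \<Rightarrow> real" where "F r = trunc (G r)"

definition X :: "real \<Rightarrow> real" where "X = N F"

lemma F_continuous: "continuous_on {0..} F"
  unfolding F_def[abs_def] by (rule continuous_on_compose2[OF trunc_continuous G_continuous]) auto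

lemma X_continuous: "continuous_on {0..} X"
  unfolding X_def by (rule N_continuous[OF F_continuous])

lemma G_deriv: "0 \<le> r \<Longrightarrow> (G has_real_derivative - c * X r) (at r within {0..})"
proof -
  assume r: "0 \<le> r"
  have "((\<lambda>r. 1 - c * integral {0..r} X) has_real_derivative 0 - c * X r) (at r within {0..})"
    by (intro DERIV_diff DERIV_const DERIV_cmult integral_has_real_derivative_atLeast X_continuous r)
  then have "((\<lambda>r. 1 - c * integral {0..r} X) has_real_derivative - c * X r) (at r within {0..})" by simp
  then show ?thesis
    by (rule has_field_derivative_transform_within[where d = 1])
      (use G_eq r in \<open>auto simp: X_def F_def[abs_def]\<close>)
qed

definition F' :: "real \<Rightarrow> real" where "F' r = trunc' (G r) * (- c * X r)"

lemma F'_continuous: "continuous_on {0..} F'"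
  unfolding F'_def[abs_def]
  by (intro continuous_intros X_continuous continuous_on_compose2[OF trunc'_continuous G_continuous]) auto

lemma F_deriv: "0 \<le> r \<Longrightarrow> (F has_real_derivative F' r) (at r within {0..})"
  unfolding F_def[abs_def] F'_def by (rule DERIV_chain2[OF trunc_deriv G_deriv])

definition X' :: "real \<Rightarrow> real" where "X' r = 2 * F' r - k * radial_mean (k + 1) F' r"

lemma X_deriv: "0 \<le> r \<Longrightarrow> (X has_real_derivative X' r) (at r within {0..})"
  unfolding X_def N_def[abs_def] X'_def
  by (intro DERIV_diff DERIV_cmult F_deriv radial_mean_deriv[OF F_deriv F'_continuous k]) auto

text \<open>Integration by parts in the mean recovers the local second-order equation, in which no
  mean occurs any more.\<close>

lemma X_euler: "0 \<le> r \<Longrightarrow> r * X' r = 2 * r * F' r + (k + 2) * F r - (k + 1) * X r"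
proof -
  assume r: "0 \<le> r"
  have e: "r * radial_mean (k + 1) F' r = F r - (k + 1) * radial_mean k F r"
    by (rule radial_mean_by_parts[OF F_deriv F'_continuous k r])
  have "r * X' r = 2 * r * F' r - k * (r * radial_mean (k + 1) F' r)" unfolding X'_def by (simp add: algebra_simps)
  then show ?thesis unfolding e X_def N_def by (simp add: algebra_simps)
qed

lemma deriv_interior:
  "0 < r \<Longrightarrow> (G has_real_derivative - c * X r) (at r)"
  "0 < r \<Longrightarrow> (X has_real_derivative X' r) (at r)"
  using G_deriv[of r] X_deriv[of r] at_within_atLeast_interior[of r] by auto

lemma F_nonneg: "0 \<le> F r"
  by (simp add: F_def trunc_nonneg)

lemma trunc'_G_continuous: "continuous_on {0..} (\<lambda>r. 2 * c * trunc' (G r))"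
  by (intro continuous_intros continuous_on_compose2[OF trunc'_continuous G_continuous]) auto

text \<open>The weight r^(k+1) removes the term (k + 1) X of \<open>X_euler\<close>, and F' = - c
  trunc'(G) X becomes the linear term of a differential inequality. What remains is the nonnegative
  source (k + 2) r^k F, with initial value 0.\<close>

lemma X_nonneg: "0 < r \<Longrightarrow> 0 \<le> X r"
proof -
  assume r: "0 < r"
  let ?f = "\<lambda>r. r powr (k + 1) * X r"
  have "0 \<le> ?f r"
  proof (rule linear_differential_inequality(1)[where f = ?f and f' = "\<lambda>x. x powr k * ((k + 1) * X x + x * X' x)", OF _ _ trunc'_G_continuous])
    show "continuous_on {0..} ?f"
      using k by (intro continuous_on_mult continuous_on_powr' continuous_intros X_continuous) auto
  next
    fix x :: real assume x: "0 < x"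
    have "((\<lambda>x. x powr (k + 1)) has_real_derivative (k + 1) * x powr (k + 1 - 1)) (at x)"
      using x by (rule has_real_derivative_powr)
    from DERIV_mult[OF this deriv_interior(2)[OF x]]
    show "(?f has_real_derivative x powr k * ((k + 1) * X x + x * X' x)) (at x)"
      using x by (simp add: powr_add algebra_simps)
    have "(k + 1) * X x + x * X' x = (k + 2) * F x - 2 * c * trunc' (G x) * (x * X x)"
      using X_euler[of x] x by (simp add: F'_def algebra_simps)
    then have eq: "x powr k * ((k + 1) * X x + x * X' x) + 2 * c * trunc' (G x) * ?f x = x powr k * ((k + 2) * F x)"
      using x by (simp add: powr_add right_diff_distrib)
    show "0 \<le> x powr k * ((k + 1) * X x + x * X' x) + 2 * c * trunc' (G x) * ?f x"
      unfolding eq using k F_nonneg[of x] by simp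
  qed (use r k in auto)
  then show ?thesis using r by (simp add: zero_le_mult_iff)
qed

lemma G_0: "G 0 = 1"
  using G_eq[of 0] by simp

lemma G_le_1: "0 \<le> r \<Longrightarrow> G r \<le> 1"
proof -
  assume r: "0 \<le> r"
  have "G r \<le> G 0"
  proof (rule DERIV_nonpos_imp_decreasing_open[OF r])
    show "continuous_on {0..r} G" using G_continuous by (rule continuous_on_subset) auto
    show "\<exists>y. (G has_real_derivative y) (at x) \<and> y \<le> 0" if "0 < x" "x < r" for x
      using deriv_interior(1)[OF that(1)] X_nonneg[OF that(1)] c by (intro exI[of _ "- c * X x"]) simp
  qed
  then show ?thesis using G_0 by simp
qed

text \<open>The quantity is k G + 2 r G'; where G is positive, its sign is that of the growth of
  r^(k/2) G. Euler's identity rewrites (k + 2) F as trunc'(G) k G, so it solves a linear equation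
  with source c k X \<ge> 0 and initial value k.\<close>

lemma Y_pos: "0 \<le> r \<Longrightarrow> 0 < k * G r - 2 * c * r * X r"
proof -
  let ?Y = "\<lambda>r. k * G r - 2 * c * r * X r"
  assume r: "0 \<le> r"
  show ?thesis
  proof (rule linear_differential_inequality(2)[where f = ?Y and f' = "\<lambda>x. - k * c * X x - 2 * c * X x - 2 * c * (x * X' x)", OF _ _ trunc'_G_continuous _ _ r])
    show "continuous_on {0..} ?Y" by (intro continuous_intros G_continuous X_continuous)
  next
    fix x :: real assume x: "0 < x"
    have "(?Y has_real_derivative k * (- c * X x) - (2 * c * X x + X' x * (2 * c * x))) (at x)"
      by (intro DERIV_diff DERIV_cmult deriv_interior x DERIV_mult) (auto intro!: derivative_eq_intros)
    then show "(?Y has_real_derivative - k * c * X x - 2 * c * X x - 2 * c * (x * X' x)) (at x)"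
      by (simp add: algebra_simps)
    have "k * (trunc' (G x) * G x) = (k * p) * F x" using trunc_euler[OF G_le_1[of x]] x by (simp add: F_def)
    then have "trunc' (G x) * (k * G x) = (k + 2) * F x" unfolding p(3) by (simp add: mult_ac)
    then have eq: "(- k * c * X x - 2 * c * X x - 2 * c * (x * X' x)) + 2 * c * trunc' (G x) * ?Y x = c * k * X x"
      unfolding X_euler[OF less_imp_le[OF x]] F'_def by (simp add: algebra_simps)
    show "0 \<le> (- k * c * X x - 2 * c * X x - 2 * c * (x * X' x)) + 2 * c * trunc' (G x) * ?Y x"
      unfolding eq using X_nonneg[OF x] c k by simp
  qed (use k G_0 in simp)
qed

text \<open>From \<open>Y_pos\<close> and the sign of X. Together with \<open>G_le_1\<close> it
  shows that the truncation is never active.\<close>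

lemma G_pos: "0 \<le> r \<Longrightarrow> 0 < G r"
proof -
  assume r: "0 \<le> r"
  have "0 \<le> r * X r" using X_nonneg[of r] r by (cases "r = 0") auto
  then have "0 < k * G r" using Y_pos[OF r] c mult_nonneg_nonneg[of "2 * c" "r * X r"] by (smt (verit) mult.assoc)
  then show ?thesis using k by (simp add: zero_less_mult_iff)
qed

lemma F_eq: "0 \<le> r \<Longrightarrow> F r = G r powr p"
  using G_pos[of r] G_le_1[of r] by (simp add: F_def trunc_def)

lemma F'_eq: "0 \<le> r \<Longrightarrow> F' r = p * G r powr (p - 1) * (- c * X r)"
  using G_pos[of r] G_le_1[of r] by (simp add: F'_def trunc'_def)

text \<open>Bootstrapping: G of class C^j gives F = G^p of class C^j because G is positive, hence
  also its mean, hence G'.\<close>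

lemma G_Ck_on: "Ck_on j {0..} G"
proof (induction j)
  case 0
  then show ?case using G_continuous by simp
next
  case (Suc j)
  have "Ck_on j {0..} (\<lambda>r. G r powr p)"
    by (rule Ck_on_compose[OF Ck_on_powr Suc]) (auto intro: G_pos)
  then have "Ck_on j {0..} F" by (rule Ck_on_cong) (auto simp: F_eq)
  then have "Ck_on j {0..} (\<lambda>r. - c * X r)"
    unfolding X_def N_def[abs_def] by (intro Ck_on_cmult Ck_on_diff Ck_on_radial_mean k)
  then show ?case by (intro Ck_on_SucI[OF G_deriv]) auto
qed

text \<open>Here \<open>- c X\<close> and \<open>- c X'\<close> are the first two derivatives of \<open>G\<close>.\<close>

lemma G_ode: "0 \<le> r \<Longrightarrow> 4 * r * (- c * X' r) + 4 * (k + 1) * (- c * X r) =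
    - 4 * c * (2 * r * (p * G r powr (p - 1) * (- c * X r)) + (k + 2) * G r powr p)"
proof -
  assume r: "0 \<le> r"
  have "4 * r * (- c * X' r) + 4 * (k + 1) * (- c * X r) = - 4 * c * (r * X' r + (k + 1) * X r)"
    by (simp add: algebra_simps)
  also have "\<dots> = - 4 * c * (2 * r * F' r + (k + 2) * F r)" using X_euler[OF r] by simp
  finally show ?thesis using r by (simp only: F_eq F'_eq)
qed

text \<open>Emden--Fowler variables: with \<open>\<rho> = e\<^sup>2\<^sup>s\<close> put \<open>w = \<rho> G\<^sup>p\<^sup>-\<^sup>1\<close> and \<open>z = k + 2 \<rho> G'/G\<close>. Then
  \<open>w' = (p - 1) w z\<close> and \<open>z' = k\<^sup>2 - z\<^sup>2 - \<mu> w z\<close> with \<open>\<mu> = 4 c p\<close>.\<close>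

definition \<mu> :: real where "\<mu> = 4 * c * p"

definition w :: "real \<Rightarrow> real" where "w s = exp (2 * s) * G (exp (2 * s)) powr (p - 1)"

definition z :: "real \<Rightarrow> real" where "z s = k + 2 * exp (2 * s) * (- c * X (exp (2 * s))) / G (exp (2 * s))"

lemma \<mu>: "0 < \<mu>"
  using c p(4) by (simp add: \<mu>_def)

lemma w_pos: "0 < w s"
  using G_pos[of "exp (2 * s)"] by (simp add: w_def)

text \<open>\<open>Y_pos\<close> and \<open>X_nonneg\<close> in the new variables, since z is (k G +
  2 \<rho> G') / G.\<close>

lemma z_bounds: "0 < z s" "z s \<le> k"
proof -
  let ?\<rho> = "exp (2 * s)"
  have g: "0 < G ?\<rho>" by (simp add: G_pos)
  have "z s = (k * G ?\<rho> - 2 * c * ?\<rho> * X ?\<rho>) / G ?\<rho>" using g by (simp add: z_def diff_divide_distrib)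
  then show "0 < z s" using Y_pos[of ?\<rho>] g by simp
  have "0 \<le> 2 * ?\<rho> * (c * X ?\<rho>) / G ?\<rho>" using g c X_nonneg[of ?\<rho>] by simp
  then show "z s \<le> k" by (simp add: z_def)
qed

lemma exp_deriv: "((\<lambda>s::real. exp (2 * s)) has_real_derivative 2 * exp (2 * s)) (at s)"
  by (auto intro!: derivative_eq_intros)

lemma w_deriv: "(w has_real_derivative (p - 1) * (w s * z s)) (at s)"
proof -
  let ?\<rho> = "exp (2 * s)"
  have g: "0 < G ?\<rho>" by (simp add: G_pos)
  have dG: "((\<lambda>s. G (exp (2 * s))) has_real_derivative - c * X ?\<rho> * (2 * ?\<rho>)) (at s)"
    by (rule DERIV_chain2[OF deriv_interior(1) exp_deriv]) simp
  have "((\<lambda>s. G (exp (2 * s)) powr (p - 1)) has_real_derivative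
      ((p - 1) * G ?\<rho> powr (p - 1 - 1)) * (- c * X ?\<rho> * (2 * ?\<rho>))) (at s)"
    by (rule DERIV_chain2[OF has_real_derivative_powr[OF g] dG])
  from DERIV_mult[OF exp_deriv this]
  have d: "(w has_real_derivative 2 * ?\<rho> * G ?\<rho> powr (p - 1) +
      ((p - 1) * G ?\<rho> powr (p - 1 - 1)) * (- c * X ?\<rho> * (2 * ?\<rho>)) * ?\<rho>) (at s)"
    unfolding w_def[abs_def] .
  have pw: "G ?\<rho> powr (p - 1 - 1) = G ?\<rho> powr (p - 1) / G ?\<rho>" using g by (simp add: powr_diff power2_eq_square)
  have wz: "(p - 1) * (w s * z s) = 2 * w s + (p - 1) * w s * (2 * ?\<rho> * (- c * X ?\<rho>) / G ?\<rho>)"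
  proof -
    have pk: "(p - 1) * k = 2" using p(2) k by simp
    have "(p - 1) * (w s * (k + e)) = ((p - 1) * k) * w s + (p - 1) * w s * e" for e by (simp add: algebra_simps)
    then show ?thesis unfolding z_def pk .
  qed
  have eq: "(p - 1) * (w s * z s) = 2 * ?\<rho> * G ?\<rho> powr (p - 1) +
      ((p - 1) * G ?\<rho> powr (p - 1 - 1)) * (- c * X ?\<rho> * (2 * ?\<rho>)) * ?\<rho>"
    unfolding wz pw unfolding w_def by (simp add: algebra_simps diff_divide_distrib)
  with d show ?thesis by simp
qed

lemma z_deriv: "(z has_real_derivative k\<^sup>2 - (z s)\<^sup>2 - \<mu> * (w s * z s)) (at s)"
proof -
  let ?\<rho> = "exp (2 * s)"
  have g: "0 < G ?\<rho>" by (simp add: G_pos)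
  define g0 g1 g2 q where gs: "g0 = G ?\<rho>" "g1 = - c * X ?\<rho>" "g2 = - c * X' ?\<rho>" "q = ?\<rho>"
  have dG: "((\<lambda>s. G (exp (2 * s))) has_real_derivative g1 * (2 * q)) (at s)"
    unfolding gs by (rule DERIV_chain2[OF deriv_interior(1) exp_deriv]) simp
  have dX: "((\<lambda>s. - c * X (exp (2 * s))) has_real_derivative g2 * (2 * q)) (at s)"
    unfolding gs by (rule DERIV_chain2[OF DERIV_cmult[OF deriv_interior(2)] exp_deriv]) simp
  have "((\<lambda>s. 2 * exp (2 * s)) has_real_derivative 4 * q) (at s)"
    unfolding gs by (auto intro!: derivative_eq_intros)
  from DERIV_divide[OF DERIV_mult[OF this dX] dG] g
  have d: "(z has_real_derivative ((4 * q * g1 + g2 * (2 * q) * (2 * q)) * g0 - 2 * q * g1 * (g1 * (2 * q))) / (g0 * g0)) (at s)"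
    unfolding z_def[abs_def] by (intro DERIV_add[OF DERIV_const, THEN DERIV_cong]) (auto simp: gs)
  \<comment> \<open>With z = k + y one has 2 \<rho> G' = y G. The numerator then becomes a multiple
    of G^2, and G cancels.\<close>
  define y where "y = z s - k"
  have y: "2 * q * g1 = y * g0" using g by (simp add: y_def z_def gs)
  have pw: "g0 powr p = g0 powr (p - 1) * g0" using g by (simp add: gs powr_diff)
  have "4 * q * g2 = - 4 * (k + 1) * g1 - 4 * c * (2 * q * (p * g0 powr (p - 1) * g1) + (k + 2) * g0 powr p)"
    unfolding gs using G_ode[of ?\<rho>] by (simp add: algebra_simps)
  then have "4 * q * g2 * q = (- 4 * (k + 1) * g1 - 4 * c * (2 * q * (p * g0 powr (p - 1) * g1) + (k + 2) * g0 powr p)) * q"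
    by simp
  also have "\<dots> = - 2 * (k + 1) * (2 * q * g1) - 4 * c * (2 * q * g1 * (p * g0 powr (p - 1)) + (k * p) * (g0 powr (p - 1) * g0)) * q"
    unfolding pw p(3) by (simp add: algebra_simps)
  also have "\<dots> = - 2 * (k + 1) * (y * g0) - 4 * c * (p * (y + k) * g0 powr (p - 1) * g0) * q"
    unfolding y by (simp add: algebra_simps)
  also have "\<dots> = (- 2 * (k + 1) * y - \<mu> * (w s * z s)) * g0"
    by (simp add: \<mu>_def w_def gs y_def algebra_simps)
  finally have e: "4 * q * g2 * q = (- 2 * (k + 1) * y - \<mu> * (w s * z s)) * g0" .
  have "(4 * q * g1 + g2 * (2 * q) * (2 * q)) * g0 - 2 * q * g1 * (g1 * (2 * q))
      = 2 * (2 * q * g1) * g0 + (4 * q * g2 * q) * g0 - (2 * q * g1) * (2 * q * g1)" by (simp add: algebra_simps)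
  also have "\<dots> = (k\<^sup>2 - (z s)\<^sup>2 - \<mu> * (w s * z s)) * (g0 * g0)"
    unfolding e y by (simp add: y_def algebra_simps power2_eq_square)
  finally show ?thesis using d g by (simp add: gs)
qed

text \<open>One computes (w z)' = w (k^2 + (p - 2) z^2 - \<mu> w z), which is negative once w z
  exceeds p k^2 / \<mu>; so w z never passes the larger of this value and its initial value.\<close>

lemma wz_bounded: obtains C where "0 < C" "\<And>s. 0 \<le> s \<Longrightarrow> w s * z s \<le> C"
proof -
  define C where "C = max (p * k\<^sup>2 / \<mu>) (w 0 * z 0)"
  have C: "p * k\<^sup>2 \<le> \<mu> * C" "w 0 * z 0 \<le> C" using \<mu> by (auto simp: C_def field_simps max_def)
  have "0 \<le> C - w s * z s" if s: "0 \<le> s" for s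
  proof (rule linear_differential_inequality(1)[where a = "\<lambda>s. \<mu> * w s" and f = "\<lambda>s. C - w s * z s", OF _ _ _ _ _ s])
    fix x :: real
    let ?d = "0 - ((p - 1) * (w x * z x) * z x + (k\<^sup>2 - (z x)\<^sup>2 - \<mu> * (w x * z x)) * w x)"
    show "((\<lambda>s. C - w s * z s) has_real_derivative ?d) (at x)"
      by (intro DERIV_diff DERIV_const DERIV_mult w_deriv z_deriv)
    have eq: "?d + \<mu> * w x * (C - w x * z x) = w x * (\<mu> * C - k\<^sup>2 - (p - 2) * (z x)\<^sup>2)"
      by (simp add: algebra_simps power2_eq_square)
    \<comment> \<open>As p may lie below 2, the coefficient is first raised to p - 1, which is
      positive.\<close>
    have le: "(p - 2) * (z x)\<^sup>2 \<le> (p - 1) * k\<^sup>2"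
    proof -
      have "(p - 2) * (z x)\<^sup>2 \<le> (p - 1) * (z x)\<^sup>2" by (intro mult_right_mono) auto
      also have "\<dots> \<le> (p - 1) * k\<^sup>2" using p(1) z_bounds[of x] by (intro mult_left_mono power_mono) auto
      finally show ?thesis .
    qed
    have "0 \<le> \<mu> * C - k\<^sup>2 - (p - 2) * (z x)\<^sup>2" using C(1) le by (simp add: left_diff_distrib)
    then show "0 \<le> ?d + \<mu> * w x * (C - w x * z x)" unfolding eq using w_pos[of x] by simp
  next
    have wz: "continuous_on {0..} w" "continuous_on {0..} z"
      by (rule DERIV_continuous_on[OF has_field_derivative_at_within], rule w_deriv z_deriv)+
    show "continuous_on {0..} (\<lambda>s. C - w s * z s)" by (intro continuous_intros wz)
    show "continuous_on {0..} (\<lambda>s. \<mu> * w s)" by (intro continuous_intros wz)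
  qed (use C in simp)
  then have "w s * z s \<le> C" if "0 \<le> s" for s using that by fastforce
  moreover have "0 < C" using C(2) w_pos[of 0] z_bounds[of 0] by (intro less_le_trans[OF _ C(2)]) simp
  ultimately show ?thesis using that[of C] by blast
qed

text \<open>Adding a/k^2 times z to w - a s cancels the term w z, because a \<mu> = k^2 (p - 1), and
  cancels the constant a as well: the sum J has derivative - (a/k^2) z^2. A lower bound for J then
  gives a limit, and z tends to 0.\<close>

lemma asymptotics: obtains l where "((\<lambda>s. w s - k / (2 * c * p) * s) \<longlongrightarrow> l) at_top"
proof -
  define a where "a = k / (2 * c * p)"
  have a: "0 < a" using k c p(4) by (simp add: a_def)
  have a_eq: "a * \<mu> = k\<^sup>2 * (p - 1)" using c p(4) k unfolding p(2) by (simp add: a_def \<mu>_def power2_eq_square)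
  obtain C where C: "0 < C" "\<And>s. 0 \<le> s \<Longrightarrow> w s * z s \<le> C" using wz_bounded by blast
  define J where "J s = w s + a / k\<^sup>2 * z s - a * s" for s
  have dJ: "(J has_real_derivative - (a / k\<^sup>2 * (z s)\<^sup>2)) (at s)" for s
  proof -
    have "(J has_real_derivative (p - 1) * (w s * z s) + a / k\<^sup>2 * (k\<^sup>2 - (z s)\<^sup>2 - \<mu> * (w s * z s)) - a) (at s)"
      unfolding J_def[abs_def] by (intro DERIV_diff DERIV_add DERIV_cmult w_deriv z_deriv) (auto intro!: derivative_eq_intros)
    moreover have "a / k\<^sup>2 * (\<mu> * (w s * z s)) = (a * \<mu>) / k\<^sup>2 * (w s * z s)" by simp
    then have "a / k\<^sup>2 * (\<mu> * (w s * z s)) = (p - 1) * (w s * z s)" unfolding a_eq using k by simp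
    moreover have "a / k\<^sup>2 * k\<^sup>2 = a" using k by simp
    ultimately show ?thesis by (simp only: right_diff_distrib) simp
  qed
  have anti: "J y \<le> J x" if "x \<le> y" for x y
    by (rule DERIV_nonpos_imp_nonincreasing[OF that]) (use dJ a in \<open>auto intro!: exI mult_nonneg_nonneg\<close>)
  \<comment> \<open>From w z \<le> C follows z^2 \<le> C z / w, and (p - 1) z / w is minus the
    derivative of 1/w. This D makes J - D/w nondecreasing, which bounds J from below.\<close>
  define D where "D = a * C / (k\<^sup>2 * (p - 1))"
  have D: "0 \<le> D" using a C(1) p(1) by (simp add: D_def)
  have lower: "J 0 - D / w 0 \<le> J s" if s: "0 \<le> s" for s
  proof -
    have "J 0 - D / w 0 \<le> J s - D / w s"
    proof (rule DERIV_nonneg_imp_nondecreasing[OF s], intro exI conjI)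
      fix x :: real assume x: "0 \<le> x" "x \<le> s"
      show "((\<lambda>s. J s - D / w s) has_real_derivative
          - (a / k\<^sup>2 * (z x)\<^sup>2) - (0 * w x - D * ((p - 1) * (w x * z x))) / (w x * w x)) (at x)"
        using w_pos[of x] by (intro DERIV_diff dJ DERIV_divide DERIV_const w_deriv) auto
      have "z x * (w x * z x) \<le> z x * C" using C(2)[OF x(1)] z_bounds[of x] by (intro mult_left_mono) auto
      then have "(z x)\<^sup>2 * w x \<le> C * z x" by (simp add: power2_eq_square mult_ac)
      then have "(z x)\<^sup>2 \<le> C * z x / w x" using w_pos[of x] by (simp add: field_simps)
      then have "a / k\<^sup>2 * (z x)\<^sup>2 \<le> a / k\<^sup>2 * (C * z x / w x)" using a by (intro mult_left_mono) auto
      also have "\<dots> = D * ((p - 1) * (w x * z x)) / (w x * w x)" using w_pos[of x] p(1) k by (simp add: D_def)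
      finally show "0 \<le> - (a / k\<^sup>2 * (z x)\<^sup>2) - (0 * w x - D * ((p - 1) * (w x * z x))) / (w x * w x)" by simp
    qed
    then show ?thesis using D w_pos[of s] by (smt (verit) divide_nonneg_pos)
  qed
  obtain l where l: "(J \<longlongrightarrow> l) at_top" using antimono_bounded_below_tendsto[of J, OF anti lower] by blast
  have "filterlim w at_top at_top"
  proof (rule filterlim_at_top_mono)
    show "\<forall>\<^sub>F s in at_top. (J 0 - D / w 0 - a / k\<^sup>2 * k) + a * s \<le> w s"
    proof (rule eventually_at_top_linorderI)
      fix s :: real assume "0 \<le> s"
      moreover have "a / k\<^sup>2 * z s \<le> a / k\<^sup>2 * k" using a z_bounds[of s] by (intro mult_left_mono) auto
      ultimately show "(J 0 - D / w 0 - a / k\<^sup>2 * k) + a * s \<le> w s" using lower[of s] by (simp add: J_def)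
    qed
    show "filterlim (\<lambda>s. (J 0 - D / w 0 - a / k\<^sup>2 * k) + a * s) at_top at_top"
      by (intro filterlim_tendsto_add_at_top[OF tendsto_const] filterlim_tendsto_pos_mult_at_top[OF tendsto_const a] filterlim_ident)
  qed
  then have "((\<lambda>s. C / w s) \<longlongrightarrow> 0) at_top" by (intro tendsto_divide_0[OF tendsto_const] filterlim_at_top_imp_at_infinity)
  then have "(z \<longlongrightarrow> 0) at_top"
  proof (rule Lim_null_comparison[rotated])
    show "\<forall>\<^sub>F s in at_top. norm (z s) \<le> C / w s"
    proof (rule eventually_at_top_linorderI)
      fix s :: real assume "0 \<le> s"
      then show "norm (z s) \<le> C / w s" using C(2)[of s] z_bounds[of s] w_pos[of s] by (simp add: field_simps)
    qed
  qed
  then have "((\<lambda>s. J s - a / k\<^sup>2 * z s) \<longlongrightarrow> l - a / k\<^sup>2 * 0) at_top" by (intro tendsto_diff l tendsto_mult tendsto_const)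
  then show ?thesis using that[of l] by (simp add: J_def a_def)
qed

end

text \<open>For uniqueness, an arbitrary C^2 radial function must be treated, without a smooth
  profile in |x|^2 at hand; so the Laplacian is computed from the restriction to one ray.\<close>

lemma laplacian_radial_line:
  fixes f :: "'a::euclidean_space \<Rightarrow> real"
  assumes f: "Ck 2 f" and rad: "\<And>x y. norm x = norm y \<Longrightarrow> f x = f y" and e: "e \<in> Basis" and s: "0 < s"
  shows "laplacian f (s *\<^sub>R e) = partial_deriv e (partial_deriv e f) (s *\<^sub>R e) +
    (real DIM('a) - 1) * partial_deriv e f (s *\<^sub>R e) / s"
proof -
  have df: "f differentiable (at x)" and ddf: "b \<in> Basis \<Longrightarrow> partial_deriv b f differentiable (at x)" for b x
    using f by (auto simp: numeral_2_eq_2)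
  define q' where "q' t = partial_deriv e f (t *\<^sub>R e)" for t
  have dq: "((\<lambda>t. f (t *\<^sub>R e)) has_real_derivative q' t) (at t)" for t
    using has_real_derivative_line[of f 0 t e] df by (simp add: q'_def)
  have dq': "(q' has_real_derivative partial_deriv e (partial_deriv e f) (t *\<^sub>R e)) (at t)" for t
    using has_real_derivative_line[of "partial_deriv e f" 0 t e] ddf[OF e] by (simp add: q'_def[abs_def])
  have "partial_deriv b (partial_deriv b f) (s *\<^sub>R e) = q' s / s" if b: "b \<in> Basis" "b \<noteq> e" for b
  proof -
    define y where "y t = sqrt (s\<^sup>2 + t\<^sup>2)" for t
    have y_pos: "0 < y t" for t using s by (simp add: y_def add_pos_nonneg)
    have dy: "(y has_real_derivative t / y t) (at t)" for t
    proof -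
      have "((\<lambda>t. s\<^sup>2 + t\<^sup>2) has_real_derivative 2 * t) (at t)" by (auto intro!: derivative_eq_intros)
      from DERIV_chain2[OF DERIV_real_sqrt this] s
      have "(y has_real_derivative inverse (y t) / 2 * (2 * t)) (at t)"
        unfolding y_def[abs_def] by (simp add: add_pos_nonneg)
      then show ?thesis by (simp add: field_simps)
    qed
    \<comment> \<open>Transversally to the ray, f depends on t through sqrt (s^2 + t^2) alone; its
      second t-derivative at 0 is therefore q'(s)/s.\<close>
    have eq: "f (s *\<^sub>R e + t *\<^sub>R b) = f (y t *\<^sub>R e)" for t
    proof (rule rad)
      have "(s *\<^sub>R e + t *\<^sub>R b) \<bullet> (s *\<^sub>R e + t *\<^sub>R b) = s\<^sup>2 + t\<^sup>2"
        using b e by (simp add: inner_simps inner_Basis power2_eq_square)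
      then have "norm (s *\<^sub>R e + t *\<^sub>R b) = y t" by (simp add: norm_eq_sqrt_inner y_def)
      then show "norm (s *\<^sub>R e + t *\<^sub>R b) = norm (y t *\<^sub>R e)" using e y_pos[of t] by simp
    qed
    have "partial_deriv b f (s *\<^sub>R e + t *\<^sub>R b) = t * (q' (y t) / y t)" for t
    proof (rule DERIV_unique)
      show "((\<lambda>t. f (s *\<^sub>R e + t *\<^sub>R b)) has_real_derivative partial_deriv b f (s *\<^sub>R e + t *\<^sub>R b)) (at t)"
        by (rule has_real_derivative_line[OF df])
      show "((\<lambda>t. f (s *\<^sub>R e + t *\<^sub>R b)) has_real_derivative t * (q' (y t) / y t)) (at t)"
        unfolding eq using DERIV_chain2[OF dq dy, of t] by (simp add: mult.commute)
    qed
    then have line: "(\<lambda>t. partial_deriv b f (s *\<^sub>R e + t *\<^sub>R b)) = (\<lambda>t. t * (q' (y t) / y t))" by blast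
    have "((\<lambda>t. t * (q' (y t) / y t)) has_real_derivative
        1 * (q' (y 0) / y 0) + (partial_deriv e (partial_deriv e f) (y 0 *\<^sub>R e) * (0 / y 0) * y 0 - q' (y 0) * (0 / y 0)) / (y 0 * y 0) * 0) (at 0)"
      using y_pos[of 0] by (intro DERIV_mult DERIV_ident DERIV_divide DERIV_chain2[OF dq' dy] dy) auto
    moreover have "y 0 = s" using s by (simp add: y_def)
    ultimately have "((\<lambda>t. t * (q' (y t) / y t)) has_real_derivative q' s / s) (at 0)" by simp
    moreover have "((\<lambda>t. t * (q' (y t) / y t)) has_real_derivative partial_deriv b (partial_deriv b f) (s *\<^sub>R e)) (at 0)"
      using has_real_derivative_line[of "partial_deriv b f" "s *\<^sub>R e" 0 b] ddf[OF b(1)] unfolding line by simp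
    ultimately show ?thesis by (rule DERIV_unique[rotated])
  qed
  then have "(\<Sum>b\<in>Basis - {e}. partial_deriv b (partial_deriv b f) (s *\<^sub>R e)) = (\<Sum>b\<in>Basis - {e}. q' s / s)"
    by (intro sum.cong) auto
  also have "\<dots> = (real DIM('a) - 1) * q' s / s" using e by (simp add: card_Diff_singleton of_nat_diff)
  finally show ?thesis unfolding laplacian_def using e by (simp add: sum.remove[of Basis e] q'_def)
qed

text \<open>Brings any radial solution into the form for which
  \<open>integral_equation_unique\<close> is proved. Here s is the distance and r = s^2, hence the
  square roots.\<close>

lemma (in soliton_ode) radial_integral_equation:
  assumes v: "\<And>s. (v has_real_derivative v' s) (at s)"
    and q: "\<And>s. (q has_real_derivative q' s) (at s)" "\<And>s. (q' has_real_derivative q'' s) (at s)"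
    and ode: "\<And>s. 0 < s \<Longrightarrow> q'' s + (2 * k + 1) * q' s / s = - 4 * c * (s * v' s + (k + 2) * v s)"
    and r: "0 \<le> r"
  shows "q (sqrt r) = q 0 - c * integral {0..r} (N (\<lambda>\<rho>. v (sqrt \<rho>)))"
proof -
  define F where "F \<rho> = v (sqrt \<rho>)" for \<rho>
  have cont: "continuous_on S v" "continuous_on S q" "continuous_on S q'" for S
    by (rule DERIV_continuous_on[OF has_field_derivative_at_within], rule v q)+
  have contF: "continuous_on {0..} F" unfolding F_def[abs_def]
    by (rule continuous_on_compose2[OF cont(1)[of UNIV]]) (auto intro: continuous_intros)
  define M where "M \<rho> = integral {0..\<rho>} (\<lambda>\<sigma>. \<sigma> powr k * F \<sigma>)" for \<rho>
  have contM: "continuous_on {0..} (\<lambda>\<sigma>. \<sigma> powr k * F \<sigma>)"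
    using k by (intro continuous_on_mult continuous_on_powr' continuous_intros contF) auto
  have dM: "(M has_real_derivative \<rho> powr k * F \<rho>) (at \<rho> within {0..})" if "0 \<le> \<rho>" for \<rho>
    unfolding M_def[abs_def] by (rule integral_has_real_derivative_atLeast[OF contM that])
  have M_mean: "M \<rho> = \<rho> powr (k + 1) * radial_mean k F \<rho>" if \<rho>: "0 < \<rho>" for \<rho>
  proof -
    have "((\<lambda>\<sigma>. \<sigma> powr k * F \<sigma>) has_integral M \<rho>) {0..\<rho>}"
      unfolding M_def by (rule integrable_integral, rule integrable_continuous_real, rule continuous_on_subset[OF contM]) auto
    from has_integral_stretch_real[OF this, of \<rho>] \<rho>
    have i: "((\<lambda>t. (\<rho> * t) powr k * F (\<rho> * t)) has_integral M \<rho> / \<rho>) ((\<lambda>x. x / \<rho>) ` {0..\<rho>})" by simp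
    have "(\<lambda>x. x / \<rho>) ` {0..\<rho>} = {0..1}"
      using \<rho> by (auto simp: image_iff intro!: bexI[of _ "\<rho> * _"])
    with i have "integral {0..1} (\<lambda>t. (\<rho> * t) powr k * F (\<rho> * t)) = M \<rho> / \<rho>" by (simp add: integral_unique)
    moreover have "integral {0..1} (\<lambda>t. (\<rho> * t) powr k * F (\<rho> * t)) = integral {0..1} (\<lambda>t. \<rho> powr k * (t powr k * F (t * \<rho>)))"
      using \<rho> by (intro Henstock_Kurzweil_Integration.integral_cong) (auto simp: powr_mult mult_ac)
    ultimately have "M \<rho> / \<rho> = \<rho> powr k * radial_mean k F \<rho>" by (simp add: radial_mean_def)
    then show ?thesis using \<rho> by (simp add: powr_add field_simps)
  qed
  \<comment> \<open>A first integral: the equation times s^(2 k + 1), integrated, with s v'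
    integrated by parts; \<open>M\<close> is the remaining ball integral. It is constant and
    vanishes at s = 0.\<close>
  define R where "R s = s powr (2 * k + 1) * q' s + 4 * c * (s powr (2 * k + 2) * v s) - 2 * c * k * M (s\<^sup>2)" for s
  have sq: "(s\<^sup>2) powr a = s powr (2 * a)" if "0 < s" for s a :: real
    using that by (simp add: powr_powr powr_numeral[symmetric] del: powr_numeral)
  have R: "R s = 0" if s: "0 < s" for s
  proof -
    have "R s = R 0"
    proof (rule DERIV_isconst2[OF s])
      have cM: "continuous_on {0..} M" using dM by (auto intro!: DERIV_continuous_on)
      have cM2: "continuous_on {0..s} (\<lambda>x. M (x\<^sup>2))"
        by (rule continuous_on_compose2[OF cM]) (auto intro!: continuous_intros)
      have cp: "continuous_on {0..s} (\<lambda>x. x powr a)" if "0 < a" for a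
        using that by (intro continuous_on_powr' continuous_on_id continuous_on_const) auto
      show "continuous_on {0..s} R" unfolding R_def[abs_def] using k
        by (intro continuous_on_add continuous_on_diff continuous_on_mult continuous_on_const cp cM2 cont) auto
      fix x assume x: "0 < x" "x < s"
      have dM1: "(M has_real_derivative (x\<^sup>2) powr k * F (x\<^sup>2)) (at (x\<^sup>2))"
        using dM[of "x\<^sup>2"] at_within_atLeast_interior[of "x\<^sup>2"] x by simp
      have dM2: "((\<lambda>x. M (x\<^sup>2)) has_real_derivative (x powr (2 * k) * v x) * (2 * x)) (at x)"
      proof -
        have "((\<lambda>x. x\<^sup>2) has_real_derivative 2 * x) (at x)" by (auto intro!: derivative_eq_intros)
        from DERIV_chain2[OF dM1 this] show ?thesis using x sq[OF x(1), of k] by (simp add: F_def)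
      qed
      have pw: "((\<lambda>x. x powr a) has_real_derivative a * x powr (a - 1)) (at x)" for a
        using x(1) by (rule has_real_derivative_powr)
      have "(R has_real_derivative
          ((2 * k + 1) * x powr (2 * k + 1 - 1)) * q' x + q'' x * x powr (2 * k + 1) +
          4 * c * (((2 * k + 2) * x powr (2 * k + 2 - 1)) * v x + v' x * x powr (2 * k + 2)) -
          2 * c * k * ((x powr (2 * k) * v x) * (2 * x))) (at x)"
        unfolding R_def[abs_def] by (intro DERIV_add DERIV_diff DERIV_cmult DERIV_mult pw q v dM2)
      moreover have "x powr (2 * k + 1) = x powr (2 * k) * x" "x powr (2 * k + 2) = x powr (2 * k) * x\<^sup>2"
        "x powr (2 * k + 2 - 1) = x powr (2 * k) * x"
        using x powr_add[of x "2 * k" 1] powr_add[of x "2 * k" 2] by (simp_all add: algebra_simps)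
      ultimately have "(R has_real_derivative
          x powr (2 * k) * (x * q'' x + (2 * k + 1) * q' x + 4 * c * x * (x * v' x + (k + 2) * v x))) (at x)"
        by (simp add: algebra_simps power2_eq_square)
      moreover have "x * q'' x + (2 * k + 1) * q' x = x * (q'' x + (2 * k + 1) * q' x / x)" using x(1) by (simp add: field_simps)
      then have "x * q'' x + (2 * k + 1) * q' x + 4 * c * x * (x * v' x + (k + 2) * v x) = 0"
        unfolding ode[OF x(1)] by (simp add: algebra_simps)
      ultimately show "(R has_real_derivative 0) (at x)" by simp
    qed (use s in auto)
    then show ?thesis using k by (simp add: R_def M_def)
  qed
  have q'_eq: "q' s = - 2 * c * s * N F (s\<^sup>2)" if s: "0 < s" for s
  proof -
    have pw: "s powr (2 * k + 1) = s powr (2 * k) * s" "s powr (2 * k + 2) = s powr (2 * k) * s\<^sup>2"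
        "(s\<^sup>2) powr (k + 1) = s powr (2 * k) * s\<^sup>2"
      using s powr_add[of s "2 * k" 1] powr_add[of s "2 * k" 2] sq[OF s, of "k + 1"] by (simp_all add: algebra_simps)
    have "0 = R s" using R[OF s] by simp
    also have "\<dots> = s powr (2 * k) * s * (q' s + 4 * c * s * v s - 2 * c * k * s * radial_mean k F (s\<^sup>2))"
    proof -
      have "M (s\<^sup>2) = s powr (2 * k) * s\<^sup>2 * radial_mean k F (s\<^sup>2)" using M_mean[of "s\<^sup>2"] s unfolding pw by simp
      then show ?thesis unfolding R_def pw by (simp add: algebra_simps power2_eq_square)
    qed
    finally have "q' s + 4 * c * s * v s - 2 * c * k * s * radial_mean k F (s\<^sup>2) = 0" using s by simp
    then show ?thesis using s by (simp add: N_def F_def algebra_simps)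
  qed
  have "((\<lambda>x. - c * N F x) has_integral q (sqrt r) - q (sqrt 0)) {0..r}"
  proof (rule fundamental_theorem_of_calculus_interior[OF r])
    show "continuous_on {0..r} (\<lambda>r. q (sqrt r))"
      by (rule continuous_on_compose2[OF cont(2)[of UNIV]]) (auto intro: continuous_intros)
    fix x assume "x \<in> {0<..<r}"
    then have x: "0 < x" by simp
    have "((\<lambda>r. q (sqrt r)) has_real_derivative q' (sqrt x) * (inverse (sqrt x) / 2)) (at x)"
      by (rule DERIV_chain2[OF q(1) DERIV_real_sqrt[OF x]])
    moreover have "q' (sqrt x) * (inverse (sqrt x) / 2) = - c * N F x" using q'_eq[of "sqrt x"] x by (simp add: field_simps)
    ultimately show "((\<lambda>r. q (sqrt r)) has_vector_derivative - c * N F x) (at x)"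
      by (simp only: has_real_derivative_iff_has_vector_derivative)
  qed
  moreover have "((\<lambda>x. - c * N F x) has_integral - c * integral {0..r} (N F)) {0..r}"
    by (intro has_integral_mult_right integrable_integral integrable_continuous_real
        continuous_on_subset[OF N_continuous[OF contF]]) auto
  ultimately have "q (sqrt r) - q (sqrt 0) = - c * integral {0..r} (N F)" by (rule has_integral_unique)
  then show ?thesis by (simp add: F_def[abs_def])
qed

text \<open>Supplies the local Lipschitz bound through which the soliton is controlled by its m-th
  power in the uniqueness proof.\<close>

lemma abs_powr_diff_le:
  fixes x y :: real
  assumes "0 < x" "x \<le> B" "0 < y" "y \<le> B" "1 \<le> p"
  shows "\<bar>x powr p - y powr p\<bar> \<le> p * B powr (p - 1) * \<bar>x - y\<bar>"
proof -
  have "norm (x powr p - y powr p) \<le> p * B powr (p - 1) * norm (x - y)"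
  proof (rule field_differentiable_bound[of "{0<..B}"])
    fix z assume z: "z \<in> {0<..B}"
    have "((\<lambda>x. x powr p) has_real_derivative p * z powr (p - 1)) (at z)"
      using z by (intro has_real_derivative_powr) auto
    then show "((\<lambda>x. x powr p) has_field_derivative p * z powr (p - 1)) (at z within {0<..B})"
      by (rule has_field_derivative_at_within)
    show "norm (p * z powr (p - 1)) \<le> p * B powr (p - 1)"
      using z assms(5) by (auto simp: abs_mult intro!: powr_mono2)
  qed (use assms in auto)
  then show ?thesis by simp
qed

section \<open>The solitons with parameters \<beta> and \<lambda> in dimension n\<close>

locale yamabe_soliton = soliton_solution k c G for k c :: real and G :: "real \<Rightarrow> real" +
  fixes dim :: "'n::finite itself"
  assumes dim_eq: "real CARD('n) = 2 * k + 2" and c_eq: "c = k / (k + 2) / (4 * (2 * k + 1))"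
begin

lemma exponent_eq: "yamabe_exponent CARD('n) = 1 / p"
  unfolding dim_eq p_def using k by (simp add: field_simps)

lemma rate_eq: "2 * \<beta> / (1 - 1 / p) = \<beta> * (k + 2)"
  unfolding p_def using k by (simp add: field_simps)

lemma coeff_eq: "(real CARD('n) - 1) / (1 / p) = 1 / (4 * c)"
  unfolding dim_eq p_def c_eq using k by (simp add: field_simps)

lemma profile_iff:
  fixes U :: "real^'n \<Rightarrow> real"
  shows "steady_soliton_profile \<beta> lam U \<longleftrightarrow>
    smooth U \<and> (\<forall>x. U x > 0) \<and> (\<forall>x y. norm x = norm y \<longrightarrow> U x = U y) \<and>
    (\<forall>x. 1 / (4 * c) * laplacian (\<lambda>y. U y powr (1 / p)) x
       + \<beta> * (\<Sum>b\<in>Basis. (x \<bullet> b) * partial_deriv b U x) + \<beta> * (k + 2) * U x = 0) \<and> U 0 = lam"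
  unfolding steady_soliton_profile_def Let_def exponent_eq rate_eq coeff_eq by simp

lemma soliton_ode_scaled: "0 < \<beta> \<Longrightarrow> soliton_ode k (c * \<beta>)"
  using k c by (simp add: soliton_ode_def)

lemma profile_integral_equation:
  fixes U :: "real^'n \<Rightarrow> real"
  assumes U: "steady_soliton_profile \<beta> lam U" and \<beta>: "0 < \<beta>" and e: "e \<in> Basis" and r: "0 \<le> r"
  shows "U (sqrt r *\<^sub>R e) powr (1 / p) = lam powr (1 / p) - c * \<beta> * integral {0..r} (N (\<lambda>\<rho>. U (sqrt \<rho> *\<^sub>R e)))"
proof -
  interpret s: soliton_ode k "c * \<beta>" by (rule soliton_ode_scaled[OF \<beta>])
  let ?f = "\<lambda>x. U x powr (1 / p)"
  have U': "Ck j U" "0 < U x" "norm x = norm y \<Longrightarrow> U x = U y" "U 0 = lam"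
    and pde: "1 / (4 * c) * laplacian ?f x + \<beta> * (\<Sum>b\<in>Basis. (x \<bullet> b) * partial_deriv b U x) + \<beta> * (k + 2) * U x = 0"
    for j x y using U unfolding profile_iff smooth_def by blast+
  have f: "Ck j ?f" for j by (rule Ck_compose[OF Ck_on_powr U'(1)]) (simp add: U'(2))
  have df: "?f differentiable (at x)" "partial_deriv e ?f differentiable (at x)" "U differentiable (at x)" for x
    using f[of 2] U'(1)[of 1] e by (auto simp: numeral_2_eq_2)
  have dl: "((\<lambda>t. h (t *\<^sub>R e)) has_real_derivative partial_deriv e h (t *\<^sub>R e)) (at t)"
    if "\<And>x. h differentiable (at x)" for t and h :: "real^'n \<Rightarrow> real"
    using has_real_derivative_line[of h 0 t e] that by simp
  have "?f (sqrt r *\<^sub>R e) = ?f (0 *\<^sub>R e) - c * \<beta> * integral {0..r} (s.N (\<lambda>\<rho>. U (sqrt \<rho> *\<^sub>R e)))"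
  proof (rule s.radial_integral_equation[OF dl[OF df(3)] dl[OF df(1)] dl[OF df(2)] _ r])
    fix s :: real assume s: "0 < s"
    have "(\<Sum>b\<in>Basis. ((s *\<^sub>R e) \<bullet> b) * partial_deriv b U (s *\<^sub>R e)) = (\<Sum>b\<in>Basis. if b = e then s * partial_deriv e U (s *\<^sub>R e) else 0)"
      using e by (intro sum.cong) (auto simp: inner_Basis)
    then have sum: "(\<Sum>b\<in>Basis. ((s *\<^sub>R e) \<bullet> b) * partial_deriv b U (s *\<^sub>R e)) = s * partial_deriv e U (s *\<^sub>R e)"
      using e by simp
    have "laplacian ?f (s *\<^sub>R e) = partial_deriv e (partial_deriv e ?f) (s *\<^sub>R e) + (2 * k + 1) * partial_deriv e ?f (s *\<^sub>R e) / s"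
      using laplacian_radial_line[OF f _ e s] U'(3) dim_eq by (smt (verit) DIM_cart DIM_real mult_1_right)
    moreover have "laplacian ?f (s *\<^sub>R e) = - 4 * (c * \<beta>) * (s * partial_deriv e U (s *\<^sub>R e) + (k + 2) * U (s *\<^sub>R e))"
      using pde[of "s *\<^sub>R e"] c unfolding sum by (simp add: field_simps)
    ultimately show "partial_deriv e (partial_deriv e ?f) (s *\<^sub>R e) + (2 * k + 1) * partial_deriv e ?f (s *\<^sub>R e) / s =
      - 4 * (c * \<beta>) * (s * partial_deriv e U (s *\<^sub>R e) + (k + 2) * U (s *\<^sub>R e))" by simp
  qed
  then show ?thesis by (simp add: U'(4))
qed

text \<open>The unknown of the integral equation is the m-th power g of the profile. As p > 1, the
  profile g^p is Lipschitz in g on bounded sets, which is the hypothesis of the uniqueness lemma;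
  radiality then leads from the ray to all x.\<close>

lemma profile_unique:
  fixes U V :: "real^'n \<Rightarrow> real"
  assumes U: "steady_soliton_profile \<beta> lam U" and V: "steady_soliton_profile \<beta> lam V" and \<beta>: "0 < \<beta>"
  shows "U = V"
proof
  fix x :: "real^'n"
  interpret s: soliton_ode k "c * \<beta>" by (rule soliton_ode_scaled[OF \<beta>])
  obtain e :: "real^'n" where e: "e \<in> Basis" using nonempty_Basis by blast
  have line: "continuous_on {0..} (\<lambda>\<rho>. W (sqrt \<rho> *\<^sub>R e))" "continuous_on {0..} (\<lambda>\<rho>. W (sqrt \<rho> *\<^sub>R e) powr (1 / p))" "0 < W y"
    if "steady_soliton_profile \<beta> lam W" for W :: "real^'n \<Rightarrow> real" and y
  proof -
    have W: "Ck 0 W" "0 < W y" for y using that unfolding profile_iff smooth_def by blast+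
    show "0 < W y" by (rule W)
    show *: "continuous_on {0..} (\<lambda>\<rho>. W (sqrt \<rho> *\<^sub>R e))"
      by (rule continuous_on_compose2[OF Ck_imp_continuous[OF W(1)]]) (auto intro!: continuous_intros)
    show "continuous_on {0..} (\<lambda>\<rho>. W (sqrt \<rho> *\<^sub>R e) powr (1 / p))"
      using W(2) by (intro continuous_on_powr * continuous_intros) (auto simp: less_imp_neq[symmetric])
  qed
  let ?g = "\<lambda>W \<rho>. W (sqrt \<rho> *\<^sub>R e) powr (1 / p)"
  have "?g U ((norm x)\<^sup>2) = ?g V ((norm x)\<^sup>2)"
  proof (rule s.integral_equation_unique[OF line(2)[OF U] line(1)[OF U] profile_integral_equation[OF U \<beta> e]
        line(2)[OF V] line(1)[OF V] profile_integral_equation[OF V \<beta> e]])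
    fix b :: real
    have bd: "\<exists>B. \<forall>r\<in>{0..b}. ?g W r \<le> B" if "steady_soliton_profile \<beta> lam W" for W :: "real^'n \<Rightarrow> real"
    proof -
      have "compact (?g W ` {0..b})"
        by (intro compact_continuous_image continuous_on_subset[OF line(2)[OF that]]) auto
      then have "bounded (?g W ` {0..b})" by (rule compact_imp_bounded)
      then obtain B where "\<forall>y\<in>?g W ` {0..b}. norm y \<le> B" unfolding bounded_iff by blast
      then show ?thesis by (intro exI[of _ B]) auto
    qed
    obtain B1 B2 where B: "\<forall>r\<in>{0..b}. ?g U r \<le> B1" "\<forall>r\<in>{0..b}. ?g V r \<le> B2" using bd[OF U] bd[OF V] by blast
    define B where "B = max B1 B2"
    have pp: "(y powr (1 / p)) powr p = y" if "0 < y" for y :: real using that p(4) by (simp add: powr_powr)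
    show "\<exists>C. \<forall>r. 0 \<le> r \<longrightarrow> r \<le> b \<longrightarrow> \<bar>U (sqrt r *\<^sub>R e) - V (sqrt r *\<^sub>R e)\<bar> \<le> C * \<bar>?g U r - ?g V r\<bar>"
    proof (intro exI allI impI)
      fix r assume r: "0 \<le> r" "r \<le> b"
      have "\<bar>?g U r powr p - ?g V r powr p\<bar> \<le> p * B powr (p - 1) * \<bar>?g U r - ?g V r\<bar>"
        using B r p(1) line(3)[OF U, of "sqrt r *\<^sub>R e"] line(3)[OF V, of "sqrt r *\<^sub>R e"]
        by (intro abs_powr_diff_le) (auto simp: B_def le_max_iff_disj)
      then show "\<bar>U (sqrt r *\<^sub>R e) - V (sqrt r *\<^sub>R e)\<bar> \<le> p * B powr (p - 1) * \<bar>?g U r - ?g V r\<bar>"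
        unfolding pp[OF line(3)[OF U]] pp[OF line(3)[OF V]] .
    qed
  qed simp_all
  then have "(U (norm x *\<^sub>R e) powr (1 / p)) powr p = (V (norm x *\<^sub>R e) powr (1 / p)) powr p" by simp
  then have eq: "U (norm x *\<^sub>R e) = V (norm x *\<^sub>R e)"
    using p(4) line(3)[OF U, of "norm x *\<^sub>R e"] line(3)[OF V, of "norm x *\<^sub>R e"] by (simp add: powr_powr)
  have "W x = W (norm x *\<^sub>R e)" if "steady_soliton_profile \<beta> lam W" for W :: "real^'n \<Rightarrow> real"
  proof -
    have "norm x = norm (norm x *\<^sub>R e)" using e by simp
    then show ?thesis using that unfolding profile_iff by blast
  qed
  from this[OF U] this[OF V] eq show "U x = V x" by simp
qed

text \<open>The soliton is lam F(\<sigma> |x|^2). The diffusion term scales like \<sigma> lam^m, the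
  remaining terms like \<beta> lam, and equating the two forces this \<sigma>.\<close>

definition \<sigma> :: "real \<Rightarrow> real \<Rightarrow> real" where "\<sigma> \<beta> lam = \<beta> * lam powr (1 - 1 / p)"

definition \<Phi> :: "real \<Rightarrow> real \<Rightarrow> real \<Rightarrow> real" where "\<Phi> \<beta> lam r = lam * F (\<sigma> \<beta> lam * r)"

definition \<Phi>' :: "real \<Rightarrow> real \<Rightarrow> real \<Rightarrow> real" where "\<Phi>' \<beta> lam r = lam * (F' (\<sigma> \<beta> lam * r) * \<sigma> \<beta> lam)"

definition \<Psi> :: "real \<Rightarrow> real \<Rightarrow> real \<Rightarrow> real" where "\<Psi> \<beta> lam r = lam powr (1 / p) * G (\<sigma> \<beta> lam * r)"

definition \<Psi>' :: "real \<Rightarrow> real \<Rightarrow> real \<Rightarrow> real" where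
  "\<Psi>' \<beta> lam r = lam powr (1 / p) * (- c * X (\<sigma> \<beta> lam * r) * \<sigma> \<beta> lam)"

definition \<Psi>'' :: "real \<Rightarrow> real \<Rightarrow> real \<Rightarrow> real" where
  "\<Psi>'' \<beta> lam r = lam powr (1 / p) * (- c * (X' (\<sigma> \<beta> lam * r) * \<sigma> \<beta> lam) * \<sigma> \<beta> lam)"

context
  fixes \<beta> lam :: real
  assumes \<beta>: "0 < \<beta>" and lam: "0 < lam"
begin

lemma \<sigma>_pos: "0 < \<sigma> \<beta> lam"
  using \<beta> lam by (simp add: \<sigma>_def)

lemma scale_deriv:
  assumes "\<And>r. 0 \<le> r \<Longrightarrow> (f has_real_derivative f' r) (at r within {0..})" "0 \<le> r"
  shows "((\<lambda>r. f (\<sigma> \<beta> lam * r)) has_real_derivative f' (\<sigma> \<beta> lam * r) * \<sigma> \<beta> lam) (at r within {0..})"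
proof -
  have "(f has_real_derivative f' (\<sigma> \<beta> lam * r)) (at (\<sigma> \<beta> lam * r) within (*) (\<sigma> \<beta> lam) ` {0..})"
    using assms(2) \<sigma>_pos by (intro DERIV_subset[OF assms(1)]) auto
  from DERIV_image_chain[OF this, of "\<sigma> \<beta> lam"] show ?thesis
    by (simp add: o_def)
qed

lemma \<Phi>_deriv: "0 \<le> r \<Longrightarrow> (\<Phi> \<beta> lam has_real_derivative \<Phi>' \<beta> lam r) (at r within {0..})"
  unfolding \<Phi>_def[abs_def] \<Phi>'_def by (intro DERIV_cmult scale_deriv F_deriv)

lemma \<Psi>_deriv:
  "0 \<le> r \<Longrightarrow> (\<Psi> \<beta> lam has_real_derivative \<Psi>' \<beta> lam r) (at r within {0..})"
  "0 \<le> r \<Longrightarrow> (\<Psi>' \<beta> lam has_real_derivative \<Psi>'' \<beta> lam r) (at r within {0..})"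
proof -
  assume r: "0 \<le> r"
  show "(\<Psi> \<beta> lam has_real_derivative \<Psi>' \<beta> lam r) (at r within {0..})"
    unfolding \<Psi>_def[abs_def] \<Psi>'_def by (intro DERIV_cmult scale_deriv[OF G_deriv] r)
  show "(\<Psi>' \<beta> lam has_real_derivative \<Psi>'' \<beta> lam r) (at r within {0..})"
    unfolding \<Psi>'_def[abs_def] \<Psi>''_def by (intro DERIV_cmult DERIV_cmult_right scale_deriv[OF X_deriv] r)
qed

lemma \<Phi>_pos: "0 \<le> r \<Longrightarrow> 0 < \<Phi> \<beta> lam r"
  using \<sigma>_pos lam F_eq[of "\<sigma> \<beta> lam * r"] G_pos[of "\<sigma> \<beta> lam * r"] by (simp add: \<Phi>_def)

lemma \<Phi>_powr: "0 \<le> r \<Longrightarrow> \<Phi> \<beta> lam r powr (1 / p) = \<Psi> \<beta> lam r"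
  using \<sigma>_pos lam F_eq[of "\<sigma> \<beta> lam * r"] G_pos[of "\<sigma> \<beta> lam * r"] p(4)
  by (simp add: \<Phi>_def \<Psi>_def powr_mult powr_powr)

lemma \<Phi>_Ck_on: "Ck_on j {0..} (\<Phi> \<beta> lam)"
proof -
  have "Ck_on j {0..} (\<lambda>r. G r powr p)" by (rule Ck_on_compose[OF Ck_on_powr G_Ck_on]) (auto intro: G_pos)
  then have "Ck_on j {0..} F" by (rule Ck_on_cong) (auto simp: F_eq)
  then have "Ck_on j {0..} (\<lambda>r. F (\<sigma> \<beta> lam * r))"
    by (rule Ck_on_compose[OF _ Ck_on_cmult[OF Ck_on_ident]]) (use \<sigma>_pos in auto)
  then show ?thesis unfolding \<Phi>_def[abs_def] by (rule Ck_on_cmult)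
qed

lemma \<Phi>_ode:
  assumes r: "0 \<le> r"
  shows "1 / (4 * c) * (4 * r * \<Psi>'' \<beta> lam r + 2 * (2 * k + 2) * \<Psi>' \<beta> lam r) =
    - \<beta> * (2 * r * \<Phi>' \<beta> lam r + (k + 2) * \<Phi> \<beta> lam r)"
proof -
  let ?s = "\<sigma> \<beta> lam" let ?r = "?s * r"
  have r': "0 \<le> ?r" using r \<sigma>_pos by simp
  have scale: "lam powr (1 / p) * ?s = \<beta> * lam"
    using lam by (simp add: \<sigma>_def powr_add[symmetric] mult.left_commute)
  have "4 * r * \<Psi>'' \<beta> lam r + 2 * (2 * k + 2) * \<Psi>' \<beta> lam r =
     (lam powr (1 / p) * ?s) * (4 * ?r * (- c * X' ?r) + 4 * (k + 1) * (- c * X ?r))"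
    by (simp add: \<Psi>''_def \<Psi>'_def algebra_simps)
  also have "\<dots> = (\<beta> * lam) * (- 4 * c * (2 * ?r * F' ?r + (k + 2) * F ?r))"
    unfolding scale G_ode[OF r'] F_eq[OF r'] F'_eq[OF r'] ..
  also have "\<dots> = - 4 * c * \<beta> * (2 * r * \<Phi>' \<beta> lam r + (k + 2) * \<Phi> \<beta> lam r)"
    by (simp add: \<Phi>_def \<Phi>'_def algebra_simps)
  finally show ?thesis using c by simp
qed

lemma profile_exists: "steady_soliton_profile \<beta> lam (\<lambda>x::real^'n. \<Phi> \<beta> lam (x \<bullet> x))"
  unfolding profile_iff
proof (intro conjI allI impI)
  show "smooth (\<lambda>x::real^'n. \<Phi> \<beta> lam (x \<bullet> x))"
    unfolding smooth_def using Ck_radial[OF \<Phi>_Ck_on, of 1 0, where 'a = "real^'n"] by simp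
  show "0 < \<Phi> \<beta> lam (x \<bullet> x)" for x :: "real^'n" by (rule \<Phi>_pos) simp
  show "\<Phi> \<beta> lam (x \<bullet> x) = \<Phi> \<beta> lam (y \<bullet> y)" if "norm x = norm y" for x y :: "real^'n"
    using that by (simp add: dot_square_norm)
  show "\<Phi> \<beta> lam (0 \<bullet> (0::real^'n)) = lam" by (simp add: \<Phi>_def F_eq G_0)
  fix x :: "real^'n"
  have "(\<lambda>y::real^'n. \<Phi> \<beta> lam (y \<bullet> y) powr (1 / p)) = (\<lambda>y. \<Psi> \<beta> lam (1 * (y \<bullet> y) + 0))"
    by (simp add: \<Phi>_powr)
  then have "laplacian (\<lambda>y::real^'n. \<Phi> \<beta> lam (y \<bullet> y) powr (1 / p)) x =
     4 * (x \<bullet> x) * \<Psi>'' \<beta> lam (x \<bullet> x) + 2 * (2 * k + 2) * \<Psi>' \<beta> lam (x \<bullet> x)"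
    using laplacian_radial(2)[OF \<Psi>_deriv, where x = x and \<alpha> = 1 and a = 0] dim_eq by simp
  then have lap: "1 / (4 * c) * laplacian (\<lambda>y::real^'n. \<Phi> \<beta> lam (y \<bullet> y) powr (1 / p)) x = - \<beta> * (2 * (x \<bullet> x) * \<Phi>' \<beta> lam (x \<bullet> x) + (k + 2) * \<Phi> \<beta> lam (x \<bullet> x))"
    using \<Phi>_ode[of "x \<bullet> x"] by (simp only: inner_ge_zero)
  have "((\<lambda>x. x \<bullet> x) has_derivative (\<lambda>h. 2 * (x \<bullet> h))) (at x)"
    by (auto intro!: derivative_eq_intros simp: inner_commute)
  from partial_deriv_eq[OF has_derivative_compose_real_within[OF \<Phi>_deriv _ this]]
  have "partial_deriv b (\<lambda>x::real^'n. \<Phi> \<beta> lam (x \<bullet> x)) x = \<Phi>' \<beta> lam (x \<bullet> x) * (2 * (x \<bullet> b))" for b by simp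
  then have "(\<Sum>b\<in>Basis. (x \<bullet> b) * partial_deriv b (\<lambda>x. \<Phi> \<beta> lam (x \<bullet> x)) x) =
      (\<Sum>b\<in>Basis. 2 * \<Phi>' \<beta> lam (x \<bullet> x) * ((x \<bullet> b) * (x \<bullet> b)))" by (simp add: mult_ac)
  also have "\<dots> = 2 * \<Phi>' \<beta> lam (x \<bullet> x) * (x \<bullet> x)" unfolding sum_distrib_left[symmetric] euclidean_inner[of x x] ..
  finally show "1 / (4 * c) * laplacian (\<lambda>y. \<Phi> \<beta> lam (y \<bullet> y) powr (1 / p)) x +
      \<beta> * (\<Sum>b\<in>Basis. (x \<bullet> b) * partial_deriv b (\<lambda>x. \<Phi> \<beta> lam (x \<bullet> x)) x) + \<beta> * (k + 2) * \<Phi> \<beta> lam (x \<bullet> x) = 0"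
    using lap by (simp add: algebra_simps)
qed

lemma steady_soliton_eq: "(steady_soliton \<beta> lam :: real^'n \<Rightarrow> real) = (\<lambda>x. \<Phi> \<beta> lam (x \<bullet> x))"
  unfolding steady_soliton_def using profile_exists profile_unique[OF _ profile_exists \<beta>] by (rule the_equality)

end

end

section \<open>Convergence of the rescaled solution\<close>

lemma lebesgue_scaling:
  fixes c :: real
  assumes "0 < c"
  shows "lebesgue = density (distr lebesgue lebesgue ((*\<^sub>R) c :: 'a::euclidean_space \<Rightarrow> 'a)) (\<lambda>_. ennreal (c ^ DIM('a)))"
proof -
  have eq: "(\<lambda>x::'a. 0 + (\<Sum>j\<in>Basis. (c * (x \<bullet> j)) *\<^sub>R j)) = (*\<^sub>R) c"
    unfolding scaleR_scaleR[symmetric] scaleR_sum_right[symmetric] euclidean_representation by simp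
  show ?thesis using lebesgue_affine_euclidean[of "\<lambda>_::'a. c" 0] assms unfolding eq by simp
qed

lemma lebesgue_integral_scaling:
  fixes f :: "'a::euclidean_space \<Rightarrow> real"
  assumes c: "0 < c" and f: "integrable lebesgue f"
  shows "integrable lebesgue (\<lambda>x. f (c *\<^sub>R x))"
    and "integral\<^sup>L lebesgue (\<lambda>x. f (c *\<^sub>R x)) = integral\<^sup>L lebesgue f / c ^ DIM('a)"
proof -
  let ?D = "distr lebesgue lebesgue ((*\<^sub>R) c :: 'a \<Rightarrow> 'a)"
  have m: "f \<in> borel_measurable lebesgue" using f by (rule borel_measurable_integrable)
  then have m': "f \<in> borel_measurable ?D" by simp
  have c': "c ^ DIM('a) \<noteq> 0" using c by simp
  have "integrable (density ?D (\<lambda>_. ennreal (c ^ DIM('a)))) f" using f lebesgue_scaling[OF c, where 'a = 'a] by simp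
  then have "integrable ?D (\<lambda>x. c ^ DIM('a) *\<^sub>R f x)"
    using c by (subst (asm) integrable_density[OF m']) auto
  then have "integrable ?D f" using c' by simp
  then show i: "integrable lebesgue (\<lambda>x. f (c *\<^sub>R x))" using m by (simp add: integrable_distr_eq)
  have "integral\<^sup>L lebesgue f = integral\<^sup>L (density ?D (\<lambda>_. ennreal (c ^ DIM('a)))) f"
    using lebesgue_scaling[OF c, where 'a = 'a] by simp
  also have "\<dots> = integral\<^sup>L ?D (\<lambda>x. c ^ DIM('a) *\<^sub>R f x)"
    using c by (subst integral_density[OF m']) auto
  also have "\<dots> = c ^ DIM('a) * integral\<^sup>L lebesgue (\<lambda>x. f (c *\<^sub>R x))"
    using m by (simp add: integral_distr)
  finally show "integral\<^sup>L lebesgue (\<lambda>x. f (c *\<^sub>R x)) = integral\<^sup>L lebesgue f / c ^ DIM('a)" using c' by (simp add: field_simps)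
qed

lemma locally_integrable_scaling:
  fixes f :: "'a::euclidean_space \<Rightarrow> real"
  assumes f: "f locally_integrable_on UNIV" and c: "0 < c"
  shows "(\<lambda>x. a * f (c *\<^sub>R x)) locally_integrable_on UNIV"
  unfolding locally_integrable_on_def
proof (intro allI impI)
  fix C :: "'a set" assume C: "compact C \<and> C \<subseteq> UNIV"
  have "compact ((*\<^sub>R) c ` C)" using C by (intro compact_scaling) auto
  then have "integrable lebesgue (\<lambda>x. indicat_real ((*\<^sub>R) c ` C) x * f x)"
    using f by (simp add: locally_integrable_on_def set_integrable_def)
  from lebesgue_integral_scaling(1)[OF c this]
  have "integrable lebesgue (\<lambda>x. indicat_real ((*\<^sub>R) c ` C) (c *\<^sub>R x) * f (c *\<^sub>R x))" .
  moreover have "indicat_real ((*\<^sub>R) c ` C) (c *\<^sub>R x) = indicat_real C x" for x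
    using c by (auto simp: indicator_def)
  ultimately have "integrable lebesgue (\<lambda>x. a * (indicat_real C x * f (c *\<^sub>R x)))" by simp
  then show "(\<lambda>x. a * f (c *\<^sub>R x)) absolutely_integrable_on C" by (simp add: set_integrable_def mult_ac)
qed

lemma locally_integrable_measurable:
  fixes f :: "'a::euclidean_space \<Rightarrow> real"
  assumes "f locally_integrable_on UNIV"
  shows "f \<in> borel_measurable lebesgue"
proof (rule borel_measurable_LIMSEQ_metric)
  show "(\<lambda>x. indicat_real (cball 0 (real j)) x * f x) \<in> borel_measurable lebesgue" for j
    by (rule borel_measurable_integrable) (use assms in \<open>simp add: locally_integrable_on_def set_integrable_def\<close>)
  show "(\<lambda>j. indicat_real (cball 0 (real j)) x * f x) \<longlonglongrightarrow> f x" for x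
  proof (rule tendsto_eventually)
    have "\<forall>\<^sub>F j in sequentially. norm x \<le> real j"
      using filterlim_real_sequentially unfolding filterlim_at_top by blast
    then show "\<forall>\<^sub>F j in sequentially. indicat_real (cball 0 (real j)) x * f x = f x"
      by eventually_elim (simp add: indicator_def)
  qed
qed

text \<open>Two limits agree almost everywhere on every ball. For continuous functions the set of
  disagreement is open as well as null, hence empty.\<close>

lemma L1loc_limit_unique:
  fixes U V :: "'a::euclidean_space \<Rightarrow> real"
  assumes U: "L1loc_tendsto f U F" and V: "L1loc_tendsto f V F" and F: "F \<noteq> bot"
    and cont: "continuous_on UNIV U" "continuous_on UNIV V"
  shows "U = V"
proof -
  have ball0: "{x \<in> ball 0 r. U x \<noteq> V x} = {}" for r
  proof (rule AE_lborel_notin_open)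
    have "open {x. U x \<noteq> V x}" using cont by (intro open_Collect_neq)
    then have "open (ball 0 r \<inter> {x. U x \<noteq> V x})" by (intro open_Int) auto
    then show "open {x \<in> ball 0 r. U x \<noteq> V x}" by (simp add: Int_def)
    let ?C = "cball (0::'a) r"
    have iUV: "integrable lebesgue (\<lambda>x. indicat_real ?C x * \<bar>U x - V x\<bar>)"
      by (intro integrable_continuous_on_compact continuous_intros continuous_on_subset[OF cont(1)] continuous_on_subset[OF cont(2)]) auto
    have iC: "integrable lebesgue (\<lambda>x. indicat_real ?C x * g x)" if "g locally_integrable_on UNIV" for g :: "'a \<Rightarrow> real"
      using that by (simp add: locally_integrable_on_def set_integrable_def)
    have le: "\<forall>\<^sub>F s in F. integral\<^sup>L lebesgue (\<lambda>x. indicat_real ?C x * \<bar>U x - V x\<bar>)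
       \<le> (LINT x:?C|lebesgue. \<bar>f s x - U x\<bar>) + (LINT x:?C|lebesgue. \<bar>f s x - V x\<bar>)"
      using U[unfolded L1loc_tendsto_def, THEN conjunct2, THEN conjunct1]
    proof eventually_elim
      case (elim s)
      have i: "integrable lebesgue (\<lambda>x. indicat_real ?C x * \<bar>f s x - W x\<bar>)" if "W locally_integrable_on UNIV" for W
      proof -
        have "integrable lebesgue (\<lambda>x. \<bar>indicat_real ?C x * f s x - indicat_real ?C x * W x\<bar>)"
          by (intro integrable_abs Bochner_Integration.integrable_diff iC elim that)
        then show ?thesis by (simp add: abs_mult right_diff_distrib[symmetric])
      qed
      have l: "U locally_integrable_on UNIV" "V locally_integrable_on UNIV" using U V by (auto simp: L1loc_tendsto_def)
      have "integral\<^sup>L lebesgue (\<lambda>x. indicat_real ?C x * \<bar>U x - V x\<bar>) \<le>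
        integral\<^sup>L lebesgue (\<lambda>x. indicat_real ?C x * \<bar>f s x - U x\<bar> + indicat_real ?C x * \<bar>f s x - V x\<bar>)"
        by (rule integral_mono[OF iUV Bochner_Integration.integrable_add[OF i[OF l(1)] i[OF l(2)]]]) (auto simp: indicator_def)
      then show ?case using i[OF l(1)] i[OF l(2)] by (simp add: set_lebesgue_integral_def)
    qed
    have "((\<lambda>s. (LINT x:?C|lebesgue. \<bar>f s x - U x\<bar>) + (LINT x:?C|lebesgue. \<bar>f s x - V x\<bar>)) \<longlongrightarrow> 0 + 0) F"
      using U V by (intro tendsto_add) (auto simp: L1loc_tendsto_def)
    from tendsto_lowerbound[OF this le F]
    have "integral\<^sup>L lebesgue (\<lambda>x. indicat_real ?C x * \<bar>U x - V x\<bar>) = 0"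
      by (intro antisym Bochner_Integration.integral_nonneg) auto
    then have "AE x in lebesgue. indicat_real ?C x * \<bar>U x - V x\<bar> = 0"
      by (subst (asm) integral_nonneg_eq_0_iff_AE[OF iUV]) auto
    then show "AE x in lborel. x \<notin> {x \<in> ball 0 r. U x \<noteq> V x}"
      unfolding AE_completion_iff by eventually_elim (auto simp: indicator_def)
  qed
  show ?thesis
  proof
    fix x show "U x = V x" using ball0[of "norm x + 1"] by auto
  qed
qed

lemma integrable_positive_part:
  fixes f g :: "'a::euclidean_space \<Rightarrow> real"
  assumes "f \<in> borel_measurable lebesgue" "integrable lebesgue g" "AE x in lebesgue. f x \<le> g x" "\<And>x. 0 \<le> g x"
  shows "integrable lebesgue (\<lambda>x. max 0 (f x))"
proof (rule Bochner_Integration.integrable_bound[OF assms(2)])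
  show "AE x in lebesgue. norm (max 0 (f x)) \<le> norm (g x)"
    using assms(3) by eventually_elim (use assms(4) in auto)
qed (use assms(1) in auto)

text \<open>The substitution y = e^(\<beta> t) x enlarges the ball with t, which is harmless since
  the stability constant does not depend on the radius; the Jacobian contributes e^(- n \<beta>
  t).\<close>

lemma rescaled_positive_part_bound:
  fixes u v :: "real^'n \<Rightarrow> real \<Rightarrow> real"
  assumes u: "fast_diffusion_solution m u u0" and v: "fast_diffusion_solution m v v0"
    and m: "0 < m" "m < 1" and n: "CARD('n) \<ge> 3" and t: "0 < t" and r: "0 < r"
    and f0: "integrable lebesgue (\<lambda>x. max 0 (u x 0 - v x 0))"
  shows "integral\<^sup>L lebesgue (\<lambda>x. max 0 (exp (\<gamma> * t) * u (exp (\<beta> * t) *\<^sub>R x) t - exp (\<gamma> * t) * v (exp (\<beta> * t) *\<^sub>R x) t) * indicat_real (cball 0 r) x)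
    \<le> exp ((\<gamma> - real CARD('n) * \<beta>) * t) * (2 powr ((real CARD('n) - 2) / 2) * integral\<^sup>L lebesgue (\<lambda>x. max 0 (u x 0 - v x 0)))"
    and "integrable lebesgue (\<lambda>x. max 0 (exp (\<gamma> * t) * u (exp (\<beta> * t) *\<^sub>R x) t - exp (\<gamma> * t) * v (exp (\<beta> * t) *\<^sub>R x) t) * indicat_real (cball 0 r) x)"
proof -
  define s where "s = exp (\<beta> * t)"
  have s: "0 < s" by (simp add: s_def)
  define f where "f x = max 0 (u x t - v x t) * indicat_real (cball 0 (s * r)) x" for x
  have "integrable lebesgue (\<lambda>x. max 0 (indicat_real (cball 0 (s * r)) x * u x t - indicat_real (cball 0 (s * r)) x * v x t))"
    using fast_diffusion_slice(1)[OF u, of t "s * r"] fast_diffusion_slice(1)[OF v, of t "s * r"] t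
    unfolding set_integrable_def by (intro integrable_max integrable_zero Bochner_Integration.integrable_diff) auto
  moreover have "max 0 (indicat_real (cball 0 (s * r)) x * u x t - indicat_real (cball 0 (s * r)) x * v x t) = f x" for x
    by (auto simp: f_def indicator_def)
  ultimately have fi: "integrable lebesgue f" by simp
  have eq: "(\<lambda>x. max 0 (exp (\<gamma> * t) * u (exp (\<beta> * t) *\<^sub>R x) t - exp (\<gamma> * t) * v (exp (\<beta> * t) *\<^sub>R x) t) * indicat_real (cball 0 r) x)
    = (\<lambda>x. exp (\<gamma> * t) * f (s *\<^sub>R x))"
  proof
    fix x :: "real^'n"
    have "max 0 (exp (\<gamma> * t) * a - exp (\<gamma> * t) * b) = exp (\<gamma> * t) * max 0 (a - b)" for a b
      using max_mult_distrib_left[of "exp (\<gamma> * t)" 0 "a - b"] by (simp add: right_diff_distrib)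
    moreover have "indicat_real (cball 0 (s * r)) (s *\<^sub>R x) = indicat_real (cball 0 r) x"
      using s by (auto simp: indicator_def)
    ultimately show "max 0 (exp (\<gamma> * t) * u (exp (\<beta> * t) *\<^sub>R x) t - exp (\<gamma> * t) * v (exp (\<beta> * t) *\<^sub>R x) t) * indicat_real (cball 0 r) x
      = exp (\<gamma> * t) * f (s *\<^sub>R x)" by (simp add: f_def s_def)
  qed
  have "integral\<^sup>L lebesgue f \<le> 2 powr ((real CARD('n) - 2) / 2) * integral\<^sup>L lebesgue (\<lambda>x. max 0 (u x 0 - v x 0))"
    unfolding f_def by (rule fast_diffusion_L1_stability[OF u v m n t _ f0]) (use s r in simp)
  then have "exp (\<gamma> * t) / s ^ CARD('n) * integral\<^sup>L lebesgue f \<le>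
     exp (\<gamma> * t) / s ^ CARD('n) * (2 powr ((real CARD('n) - 2) / 2) * integral\<^sup>L lebesgue (\<lambda>x. max 0 (u x 0 - v x 0)))"
    using s by (intro mult_left_mono) auto
  moreover have "integral\<^sup>L lebesgue (\<lambda>x. exp (\<gamma> * t) * f (s *\<^sub>R x)) = exp (\<gamma> * t) / s ^ CARD('n) * integral\<^sup>L lebesgue f"
    using lebesgue_integral_scaling(2)[OF s fi] by simp
  moreover have "exp (\<gamma> * t) / s ^ CARD('n) = exp ((\<gamma> - real CARD('n) * \<beta>) * t)"
    by (simp add: s_def exp_of_nat_mult[symmetric] exp_diff[symmetric] algebra_simps)
  ultimately show "integral\<^sup>L lebesgue (\<lambda>x. max 0 (exp (\<gamma> * t) * u (exp (\<beta> * t) *\<^sub>R x) t - exp (\<gamma> * t) * v (exp (\<beta> * t) *\<^sub>R x) t) * indicat_real (cball 0 r) x)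
    \<le> exp ((\<gamma> - real CARD('n) * \<beta>) * t) * (2 powr ((real CARD('n) - 2) / 2) * integral\<^sup>L lebesgue (\<lambda>x. max 0 (u x 0 - v x 0)))"
    unfolding eq by simp
  show "integrable lebesgue (\<lambda>x. max 0 (exp (\<gamma> * t) * u (exp (\<beta> * t) *\<^sub>R x) t - exp (\<gamma> * t) * v (exp (\<beta> * t) *\<^sub>R x) t) * indicat_real (cball 0 r) x)"
    unfolding eq using lebesgue_integral_scaling(1)[OF s fi] by simp
qed

section \<open>Travelling waves and the expansion of solitons at infinity\<close>

context yamabe_soliton
begin

lemma travelling_wave:
  assumes \<beta>: "0 < \<beta>" and lam: "0 < lam"
  shows "fast_diffusion_solution (1 / p)
    (\<lambda>(x::real^'n) t. exp (- (\<beta> * (k + 2)) * t) * \<Phi> \<beta> lam (exp (- 2 * \<beta> * t) * (x \<bullet> x))) (\<lambda>x. \<Phi> \<beta> lam (x \<bullet> x))"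
proof -
  define \<gamma> where "\<gamma> = \<beta> * (k + 2)"
  define V :: "(real^'n) \<times> real \<Rightarrow> real"
    where "V q = exp (- \<gamma> * snd q) * \<Phi> \<beta> lam (exp (- 2 * \<beta> * snd q) * (fst q \<bullet> fst q))" for q
  have Ck_exp: "Ck j (\<lambda>q::(real^'n) \<times> real. exp (a * snd q))" for a j
  proof (rule Ck_compose[of j UNIV exp])
    show "Ck j (\<lambda>q::(real^'n) \<times> real. a * snd q)"
      by (intro Ck_mult Ck_const Ck_bounded_linear bounded_linear_snd)
  qed (auto intro: Ck_on_exp)
  have Ck_sq: "Ck j (\<lambda>q::(real^'n) \<times> real. fst q \<bullet> fst q)" for j
  proof -
    have "bounded_linear (\<lambda>q::(real^'n) \<times> real. fst q \<bullet> b)" for b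
      by (rule bounded_linear_compose[OF bounded_linear_inner_left bounded_linear_fst])
    then have "Ck j (\<lambda>q::(real^'n) \<times> real. \<Sum>b\<in>Basis. (fst q \<bullet> b) * (fst q \<bullet> b))"
      by (intro Ck_sum Ck_mult Ck_bounded_linear)
    then show ?thesis unfolding euclidean_inner[symmetric] .
  qed
  have Ck_V: "Ck 2 V" unfolding V_def[abs_def]
    by (intro Ck_mult Ck_exp Ck_compose[OF \<Phi>_Ck_on[OF \<beta> lam]] Ck_sq) simp
  have V_pos: "0 < V q" for q unfolding V_def using \<Phi>_pos[OF \<beta> lam] by simp
  have "fast_diffusion_solution (1 / p) (\<lambda>x t. V (x, t)) (\<lambda>x. V (x, 0))"
  proof (rule classical_fast_diffusion_solution[OF Ck_V V_pos])
    fix x :: "real^'n" and t :: real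
    define \<alpha> where "\<alpha> = exp (- 2 * \<beta> * t)"
    define \<rho> where "\<rho> = \<alpha> * (x \<bullet> x)"
    have \<alpha>: "0 < \<alpha>" and \<rho>: "0 \<le> \<rho>" by (auto simp: \<alpha>_def \<rho>_def)
    define E where "E = exp (- \<gamma> * t) powr (1 / p)"
    \<comment> \<open>The scaling relation \<gamma> m + 2 \<beta> = \<gamma>: the diffusion term and
      the time derivative of the wave carry the same exponential factor.\<close>
    have E: "E * \<alpha> = exp (- \<gamma> * t)"
    proof -
      have "\<gamma> / p + 2 * \<beta> = \<gamma>" using k p(4) unfolding \<gamma>_def p_def by (simp add: field_simps)
      then have "exp (- \<gamma> * t) = exp (- (\<gamma> / p + 2 * \<beta>) * t)" by simp
      also have "\<dots> = exp (- \<gamma> * t / p + - 2 * \<beta> * t)" by (simp add: algebra_simps)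
      also have "\<dots> = E * \<alpha>" unfolding exp_add E_def \<alpha>_def by (simp add: powr_def)
      finally show ?thesis ..
    qed
    have d\<rho>: "((\<lambda>s. exp (- 2 * \<beta> * s) * (x \<bullet> x)) has_derivative (\<lambda>h. - 2 * \<beta> * \<rho> * h)) (at t)"
      unfolding \<rho>_def \<alpha>_def by (auto intro!: derivative_eq_intros simp: algebra_simps)
    have "((\<lambda>s. \<Phi> \<beta> lam (exp (- 2 * \<beta> * s) * (x \<bullet> x))) has_derivative (\<lambda>h. \<Phi>' \<beta> lam \<rho> * (- 2 * \<beta> * \<rho> * h))) (at t)"
      by (rule has_derivative_compose_real_within[OF _ _ d\<rho>, of _ _ "{0..}"])
        (use \<Phi>_deriv[OF \<beta> lam \<rho>] in \<open>simp_all add: \<rho>_def \<alpha>_def\<close>)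
    then have d\<Phi>: "((\<lambda>s. \<Phi> \<beta> lam (exp (- 2 * \<beta> * s) * (x \<bullet> x))) has_real_derivative \<Phi>' \<beta> lam \<rho> * (- 2 * \<beta> * \<rho>)) (at t)"
      by (rule has_derivative_imp_has_field_derivative) simp
    have "((\<lambda>s. exp (- \<gamma> * s)) has_real_derivative - \<gamma> * exp (- \<gamma> * t)) (at t)"
      by (auto intro!: derivative_eq_intros)
    from DERIV_mult[OF this d\<Phi>]
    have "((\<lambda>s. V (x, s)) has_real_derivative
        - \<gamma> * exp (- \<gamma> * t) * \<Phi> \<beta> lam \<rho> + \<Phi>' \<beta> lam \<rho> * (- 2 * \<beta> * \<rho>) * exp (- \<gamma> * t)) (at t)"
      by (simp add: V_def \<rho>_def \<alpha>_def)
    moreover have "V differentiable (at (x, t))" using Ck_V by (simp add: numeral_2_eq_2)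
    ultimately have "partial_deriv (0, 1) V (x, t) =
        - \<gamma> * exp (- \<gamma> * t) * \<Phi> \<beta> lam \<rho> + \<Phi>' \<beta> lam \<rho> * (- 2 * \<beta> * \<rho>) * exp (- \<gamma> * t)"
      using DERIV_unique partial_deriv_slice_snd by blast
    also have "\<dots> = exp (- \<gamma> * t) * (- \<beta> * (2 * \<rho> * \<Phi>' \<beta> lam \<rho> + (k + 2) * \<Phi> \<beta> lam \<rho>))"
      by (simp add: \<gamma>_def algebra_simps)
    also have "\<dots> = (E * \<alpha>) * (1 / (4 * c) * (4 * \<rho> * \<Psi>'' \<beta> lam \<rho> + 2 * (2 * k + 2) * \<Psi>' \<beta> lam \<rho>))"
      unfolding E \<Phi>_ode[OF \<beta> lam \<rho>] ..
    also have "\<dots> = 1 / (4 * c) * (4 * \<alpha>\<^sup>2 * (x \<bullet> x) * (E * \<Psi>'' \<beta> lam \<rho>) + 2 * \<alpha> * (2 * k + 2) * (E * \<Psi>' \<beta> lam \<rho>))"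
      by (simp add: \<rho>_def algebra_simps power2_eq_square)
    also have "4 * \<alpha>\<^sup>2 * (x \<bullet> x) * (E * \<Psi>'' \<beta> lam \<rho>) + 2 * \<alpha> * (2 * k + 2) * (E * \<Psi>' \<beta> lam \<rho>)
        = laplacian (\<lambda>y. V (y, t) powr (1 / p)) x"
    proof -
      have "V (y, t) powr (1 / p) = E * \<Psi> \<beta> lam (\<alpha> * (y \<bullet> y) + 0)" for y
        using \<Phi>_powr[OF \<beta> lam, of "\<alpha> * (y \<bullet> y)"] \<Phi>_pos[OF \<beta> lam, of "\<alpha> * (y \<bullet> y)"] \<alpha>
        by (simp add: V_def powr_mult E_def \<alpha>_def)
      moreover have "laplacian (\<lambda>y::real^'n. E * \<Psi> \<beta> lam (\<alpha> * (y \<bullet> y) + 0)) x =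
        4 * \<alpha>\<^sup>2 * (x \<bullet> x) * (E * \<Psi>'' \<beta> lam (\<alpha> * (x \<bullet> x) + 0)) + 2 * \<alpha> * DIM(real^'n) * (E * \<Psi>' \<beta> lam (\<alpha> * (x \<bullet> x) + 0))"
        by (rule laplacian_radial(2)[where S = "{0..}" and g = "\<lambda>r. E * \<Psi> \<beta> lam r" and g' = "\<lambda>r. E * \<Psi>' \<beta> lam r" and g'' = "\<lambda>r. E * \<Psi>'' \<beta> lam r"])
          (use \<alpha> in \<open>auto intro!: DERIV_cmult \<Psi>_deriv[OF \<beta> lam]\<close>)
      ultimately show ?thesis using dim_eq by (simp add: \<rho>_def)
    qed
    finally show "partial_deriv (0, 1) V (x, t) = (real CARD('n) - 1) / (1 / p) * laplacian (\<lambda>y. V (y, t) powr (1 / p)) x"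
      unfolding coeff_eq .
  qed
  then show ?thesis by (simp add: V_def \<gamma>_def)
qed

lemma growth_eq: "k / (2 * c * p) = (real CARD('n) - 2) * (real CARD('n) - 1)"
proof -
  have "c * p = (k / (k + 2) * ((k + 2) / k)) / (4 * (2 * k + 1))" by (simp add: c_eq p_def)
  also have "\<dots> = 1 / (4 * (2 * k + 1))" using k by simp
  finally have cp: "c * p = 1 / (4 * (2 * k + 1))" .
  have "k / (2 * c * p) = k / (c * p) / 2" by simp
  also have "\<dots> = 2 * k * (2 * k + 1)" unfolding cp by simp
  finally show ?thesis unfolding dim_eq by simp
qed

text \<open>With exp(2 s) = \<sigma> |x|^2, the variable w(s) equals \<beta> |x|^2 times the soliton
  to the power 1 - m. The shift s = ln |x| + ln \<sigma> / 2 produces the dependence on the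
  parameters, using 1 - m = 2/(k + 2).\<close>

lemma \<Phi>_asymptotics:
  assumes l: "((\<lambda>s. w s - a * s) \<longlongrightarrow> l) at_top" and a: "0 < a" and \<beta>: "0 < \<beta>" and lam: "0 < lam"
  shows "((\<lambda>x::real^'n. (norm x)\<^sup>2 * (\<beta> / a) * \<Phi> \<beta> lam (x \<bullet> x) powr (1 - 1 / p) - ln (norm x))
    \<longlongrightarrow> ln \<beta> / 2 + ln lam / (k + 2) + l / a) at_infinity"
proof -
  note \<sigma> = \<sigma>_pos[OF \<beta> lam]
  have "1 - 1 / p = 2 / (k + 2)" using k unfolding p_def by (simp add: field_simps)
  then have ln_\<sigma>: "ln (\<sigma> \<beta> lam) / 2 = ln \<beta> / 2 + ln lam / (k + 2)"
    using \<beta> lam by (simp add: \<sigma>_def ln_mult ln_powr)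
  define s where "s x = ln (norm x) + ln (\<sigma> \<beta> lam) / 2" for x :: "real^'n"
  have "filterlim s at_top at_infinity"
    unfolding s_def[abs_def]
    by (subst add.commute) (intro filterlim_tendsto_add_at_top[OF tendsto_const] filterlim_compose[OF ln_at_top] filterlim_norm_at_top)
  from filterlim_compose[OF l this]
  have "((\<lambda>x. (w (s x) - a * s x) / a + ln (\<sigma> \<beta> lam) / 2) \<longlongrightarrow> l / a + ln (\<sigma> \<beta> lam) / 2) at_infinity"
    using a by (intro tendsto_intros) auto
  then have lim: "((\<lambda>x. (w (s x) - a * s x) / a + ln (\<sigma> \<beta> lam) / 2) \<longlongrightarrow> ln \<beta> / 2 + ln lam / (k + 2) + l / a) at_infinity"
    unfolding ln_\<sigma> by (simp only: add_ac)
  have ev: "\<forall>\<^sub>F x in at_infinity. (w (s x) - a * s x) / a + ln (\<sigma> \<beta> lam) / 2 =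
      (norm x)\<^sup>2 * (\<beta> / a) * \<Phi> \<beta> lam (x \<bullet> x) powr (1 - 1 / p) - ln (norm x)"
  proof (rule eventually_mono[OF eventually_not_equal_at_infinity[of 0]])
    fix x :: "real^'n" assume x: "x \<noteq> 0"
    define \<rho> where "\<rho> = \<sigma> \<beta> lam * (x \<bullet> x)"
    have \<rho>: "0 < \<rho>" using x \<sigma> by (simp add: \<rho>_def)
    have "exp (2 * s x) = \<rho>"
      using x \<sigma> by (simp add: s_def \<rho>_def exp_add distrib_left exp_double dot_square_norm)
    then have w: "w (s x) = \<rho> * G \<rho> powr (p - 1)" by (simp add: w_def)
    have "\<Phi> \<beta> lam (x \<bullet> x) = lam * G \<rho> powr p" using \<rho> by (simp add: \<Phi>_def F_eq \<rho>_def)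
    then have "\<Phi> \<beta> lam (x \<bullet> x) powr (1 - 1 / p) = lam powr (1 - 1 / p) * G \<rho> powr (p * (1 - 1 / p))"
      using lam G_pos[of \<rho>] \<rho> by (simp add: powr_mult powr_powr)
    moreover have "p * (1 - 1 / p) = p - 1" using p(4) by (simp add: field_simps)
    ultimately have "(norm x)\<^sup>2 * \<beta> * \<Phi> \<beta> lam (x \<bullet> x) powr (1 - 1 / p) = w (s x)"
      unfolding w by (simp add: \<rho>_def \<sigma>_def dot_square_norm)
    then show "(w (s x) - a * s x) / a + ln (\<sigma> \<beta> lam) / 2 =
      (norm x)\<^sup>2 * (\<beta> / a) * \<Phi> \<beta> lam (x \<bullet> x) powr (1 - 1 / p) - ln (norm x)"
      using a by (simp add: s_def field_simps)
  qed
  show ?thesis using tendsto_cong[OF ev, THEN iffD1, OF lim] .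
qed

text \<open>Joint continuity in the parameter is what lets the two barriers close up in L^1 on
  compact sets.\<close>

lemma \<Phi>_jointly_continuous:
  "0 < \<beta> \<Longrightarrow> continuous_on (UNIV \<times> {0<..}) (\<lambda>(x::real^'n, lam). \<Phi> \<beta> lam (x \<bullet> x))"
  unfolding \<Phi>_def case_prod_beta \<sigma>_def
  by (intro continuous_intros continuous_on_compose2[OF F_continuous]) auto

lemma \<Phi>_sq_continuous: "0 < \<beta> \<Longrightarrow> 0 < lam \<Longrightarrow> continuous_on UNIV (\<lambda>x::real^'n. \<Phi> \<beta> lam (x \<bullet> x))"
  by (rule continuous_on_compose2[OF \<Phi>_Ck_on[of \<beta> lam 0, simplified]]) (auto intro!: continuous_intros)

end

section \<open>Sandwiching the rescaled solution between solitons\<close>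

context yamabe_soliton
begin

lemma convergence:
  fixes u :: "real^'n \<Rightarrow> real \<Rightarrow> real" and u0 \<phi> \<psi> :: "real^'n \<Rightarrow> real"
  assumes \<beta>: "0 < \<beta>" and sol: "fast_diffusion_solution (1 / p) u u0"
    and u0: "AE x in lebesgue. u0 x = \<phi> x + \<psi> x" and \<psi>: "integrable lebesgue \<psi>"
    and \<phi>: "\<forall>\<^sub>F x in at_infinity. 0 \<le> \<phi> x"
    and a: "0 < a" and l: "((\<lambda>s. w s - a * s) \<longlongrightarrow> l) at_top"
    and K: "((\<lambda>x. (norm x)\<^sup>2 * (\<beta> / a) * \<phi> x powr (1 - 1 / p) - ln (norm x)) \<longlongrightarrow> K) at_infinity"
    and lam: "0 < lam" "K = ln \<beta> / 2 + ln lam / (k + 2) + l / a"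
  shows "L1loc_tendsto (\<lambda>t x. exp (\<beta> * (k + 2) * t) * u (exp (\<beta> * t) *\<^sub>R x) t) (\<lambda>x. \<Phi> \<beta> lam (x \<bullet> x)) at_top"
proof -
  define \<gamma> where "\<gamma> = \<beta> * (k + 2)"
  define U where "U \<mu> x = \<Phi> \<beta> \<mu> (x \<bullet> x)" for \<mu> and x :: "real^'n"
  define v where "v \<mu> x t = exp (- \<gamma> * t) * \<Phi> \<beta> \<mu> (exp (- 2 * \<beta> * t) * (x \<bullet> x))" for \<mu> and x :: "real^'n" and t
  define C where "C u v = 2 powr ((real CARD('n) - 2) / 2) * integral\<^sup>L lebesgue (\<lambda>x. max 0 (u x 0 - v x (0::real)))"
    for u v :: "real^'n \<Rightarrow> real \<Rightarrow> real"
  have v: "fast_diffusion_solution (1 / p) (v \<mu>) (U \<mu>)" if "0 < \<mu>" for \<mu>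
    using travelling_wave[OF \<beta> that] by (simp add: v_def[abs_def] U_def[abs_def] \<gamma>_def)
  have v0: "v \<mu> x 0 = U \<mu> x" for \<mu> x by (simp add: v_def U_def)
  have v_scaled: "exp (\<gamma> * t) * v \<mu> (exp (\<beta> * t) *\<^sub>R x) t = U \<mu> x" for \<mu> x t
  proof -
    have "exp (- 2 * \<beta> * t) * ((exp (\<beta> * t) *\<^sub>R x) \<bullet> (exp (\<beta> * t) *\<^sub>R x)) =
        exp (- 2 * \<beta> * t) * exp (\<beta> * t) * exp (\<beta> * t) * (x \<bullet> x)" by simp
    also have "\<dots> = x \<bullet> x" unfolding exp_add[symmetric] by simp
    finally have "v \<mu> (exp (\<beta> * t) *\<^sub>R x) t = exp (- \<gamma> * t) * U \<mu> x" by (simp only: v_def U_def)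
    then show ?thesis by (simp add: mult.assoc[symmetric] exp_add[symmetric])
  qed
  have U_pos: "0 < U \<mu> x" if "0 < \<mu>" for \<mu> x using \<Phi>_pos[OF \<beta> that] by (simp add: U_def)
  have U_cont: "continuous_on S (U \<mu>)" if "0 < \<mu>" for \<mu> S
    using \<Phi>_sq_continuous[OF \<beta> that] continuous_on_subset by (auto simp: U_def[abs_def])
  have exponent: "0 < 1 / p" "1 / p < 1" "0 \<le> 1 - 1 / p" using p(1) by auto
  have n3: "CARD('n) \<ge> 3"
  proof -
    have "2 < real CARD('n)" using dim_eq k by simp
    then show ?thesis by linarith
  qed
  have sol_loc: "(\<lambda>x. u x t) locally_integrable_on UNIV" if "0 \<le> t" for t
    using sol that by (auto simp: fast_diffusion_solution_def L1loc_tendsto_def)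
  have u_init: "AE x in lebesgue. u x 0 = \<phi> x + \<psi> x" "AE x in lebesgue. 0 \<le> u x 0"
  proof -
    have "AE x in lebesgue. u x 0 = u0 x" using sol by (simp add: fast_diffusion_solution_def)
    then show "AE x in lebesgue. u x 0 = \<phi> x + \<psi> x" using u0 by eventually_elim simp
    show "AE x in lebesgue. 0 \<le> u x 0" by (rule fast_diffusion_slice(2)[OF sol]) simp
  qed
  have meas: "(\<lambda>x. u x 0) \<in> borel_measurable lebesgue" by (rule locally_integrable_measurable[OF sol_loc]) simp
  have measU: "U \<mu> \<in> borel_measurable lebesgue" if "0 < \<mu>" for \<mu>
    by (rule locally_integrable_measurable[OF continuous_locally_integrable[OF U_cont[OF that]]])
  define g where "g \<mu> x = (norm x)\<^sup>2 * (\<beta> / a) * U \<mu> x powr (1 - 1 / p) - ln (norm x)" for \<mu> and x :: "real^'n"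
  have g: "(g \<mu> \<longlongrightarrow> ln \<beta> / 2 + ln \<mu> / (k + 2) + l / a) at_infinity" if "0 < \<mu>" for \<mu>
    unfolding g_def[abs_def] U_def by (rule \<Phi>_asymptotics[OF l a \<beta> that])
  have cancel: "y < z" if "A * y < A * z" "0 \<le> A" for A y z :: real
    using that by (meson leI mult_left_mono not_le)
  have coeff: "0 \<le> (norm x)\<^sup>2 * (\<beta> / a)" for x :: "real^'n" using \<beta> a by simp
  \<comment> \<open>The constant of \<open>U \<mu>\<close> strictly exceeds K. The common term ln
    |x| cancels in the difference of the expansions, so \<phi> \<le> U \<mu> outside a ball; inside
    it, the positive part is at most u, which is integrable there.\<close>
  have upper: "integrable lebesgue (\<lambda>x. max 0 (u x 0 - v \<mu> x 0))" if \<mu>: "lam < \<mu>" for \<mu>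
  proof -
    have \<mu>0: "0 < \<mu>" using \<mu> lam(1) by simp
    have "K < ln \<beta> / 2 + ln \<mu> / (k + 2) + l / a" unfolding lam(2) using \<mu> lam(1) k by (simp add: divide_strict_right_mono)
    then have "\<forall>\<^sub>F x in at_infinity. 0 < g \<mu> x - ((norm x)\<^sup>2 * (\<beta> / a) * \<phi> x powr (1 - 1 / p) - ln (norm x))"
      by (intro order_tendstoD(1)[OF tendsto_diff[OF g[OF \<mu>0] K]]) simp
    then have "\<forall>\<^sub>F x in at_infinity. \<phi> x \<le> U \<mu> x"
    proof eventually_elim
      case (elim x)
      then have "(norm x)\<^sup>2 * (\<beta> / a) * \<phi> x powr (1 - 1 / p) < (norm x)\<^sup>2 * (\<beta> / a) * U \<mu> x powr (1 - 1 / p)"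
        by (simp add: g_def)
      from cancel[OF this coeff] show ?case
        using powr_mono2[OF exponent(3), of "U \<mu> x" "\<phi> x"] U_pos[OF \<mu>0, of x] by linarith
    qed
    then obtain R where R: "\<And>x. R \<le> norm x \<Longrightarrow> \<phi> x \<le> U \<mu> x" unfolding eventually_at_infinity by blast
    show ?thesis
    proof (rule integrable_positive_part)
      show "(\<lambda>x. u x 0 - v \<mu> x 0) \<in> borel_measurable lebesgue" unfolding v0 using meas measU[OF \<mu>0] by simp
      show "integrable lebesgue (\<lambda>x. \<bar>\<psi> x\<bar> + \<bar>indicat_real (cball 0 R) x * u x 0\<bar>)"
        using \<psi> fast_diffusion_slice(1)[OF sol, of 0 R] by (auto simp: set_integrable_def)
      show "AE x in lebesgue. u x 0 - v \<mu> x 0 \<le> \<bar>\<psi> x\<bar> + \<bar>indicat_real (cball 0 R) x * u x 0\<bar>"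
        using u_init(1)
      proof eventually_elim
        case (elim x)
        then show ?case using R[of x] U_pos[OF \<mu>0, of x] by (cases "norm x \<le> R") (auto simp: v0 indicator_def)
      qed
    qed auto
  qed
  \<comment> \<open>The mirror image: nonnegativity of \<phi> near infinity allows the power to be
    inverted, and inside the ball u \<ge> 0 bounds the positive part by
    \<open>U \<mu>\<close>.\<close>
  have lower: "integrable lebesgue (\<lambda>x. max 0 (v \<mu> x 0 - u x 0))" if \<mu>: "0 < \<mu>" "\<mu> < lam" for \<mu>
  proof -
    have "ln \<beta> / 2 + ln \<mu> / (k + 2) + l / a < K" unfolding lam(2) using \<mu> k by (simp add: divide_strict_right_mono)
    then have "\<forall>\<^sub>F x in at_infinity. 0 < ((norm x)\<^sup>2 * (\<beta> / a) * \<phi> x powr (1 - 1 / p) - ln (norm x)) - g \<mu> x"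
      by (intro order_tendstoD(1)[OF tendsto_diff[OF K g[OF \<mu>(1)]]]) simp
    then have "\<forall>\<^sub>F x in at_infinity. U \<mu> x \<le> \<phi> x"
      using \<phi>
    proof eventually_elim
      case (elim x)
      then have "(norm x)\<^sup>2 * (\<beta> / a) * U \<mu> x powr (1 - 1 / p) < (norm x)\<^sup>2 * (\<beta> / a) * \<phi> x powr (1 - 1 / p)"
        by (simp add: g_def)
      from cancel[OF this coeff] show ?case
        using powr_mono2[OF exponent(3), of "\<phi> x" "U \<mu> x"] elim by linarith
    qed
    then obtain R where R: "\<And>x. R \<le> norm x \<Longrightarrow> U \<mu> x \<le> \<phi> x" unfolding eventually_at_infinity by blast
    show ?thesis
    proof (rule integrable_positive_part)
      show "(\<lambda>x. v \<mu> x 0 - u x 0) \<in> borel_measurable lebesgue" unfolding v0 using meas measU[OF \<mu>(1)] by simp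
      have "integrable lebesgue (\<lambda>x. indicat_real (cball 0 R) x * U \<mu> x)"
        by (intro integrable_continuous_on_compact U_cont \<mu>) simp
      then show "integrable lebesgue (\<lambda>x. \<bar>\<psi> x\<bar> + \<bar>indicat_real (cball 0 R) x * U \<mu> x\<bar>)" using \<psi> by auto
      show "AE x in lebesgue. v \<mu> x 0 - u x 0 \<le> \<bar>\<psi> x\<bar> + \<bar>indicat_real (cball 0 R) x * U \<mu> x\<bar>"
        using u_init
      proof eventually_elim
        case (elim x)
        then show ?case using R[of x] by (cases "norm x \<le> R") (auto simp: v0 indicator_def)
      qed
    qed auto
  qed
  have decay: "((\<lambda>t. exp ((\<gamma> - real CARD('n) * \<beta>) * t) * c') \<longlongrightarrow> 0) at_top" for c'
  proof -
    have "\<gamma> - real CARD('n) * \<beta> < 0" unfolding dim_eq \<gamma>_def using \<beta> k by (simp add: algebra_simps)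
    then have "filterlim (\<lambda>t. (\<gamma> - real CARD('n) * \<beta>) * t) at_bot at_top"
      by (intro filterlim_tendsto_neg_mult_at_bot[OF tendsto_const _ filterlim_ident])
    then have "((\<lambda>t. exp ((\<gamma> - real CARD('n) * \<beta>) * t)) \<longlongrightarrow> 0) at_top" by (rule filterlim_compose[OF exp_at_bot])
    from tendsto_mult_left_zero[OF this] show ?thesis .
  qed
  define w' where "w' t x = exp (\<gamma> * t) * u (exp (\<beta> * t) *\<^sub>R x) t" for t x
  have w'_loc: "w' t locally_integrable_on UNIV" if "0 \<le> t" for t
    unfolding w'_def by (rule locally_integrable_scaling[OF sol_loc[OF that]]) simp
  have U_loc: "U \<mu> locally_integrable_on UNIV" if "0 < \<mu>" for \<mu>
    by (rule continuous_locally_integrable[OF U_cont[OF that]])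
  have "L1loc_tendsto w' (U lam) at_top"
    unfolding L1loc_tendsto_def
  proof (intro conjI allI impI)
    show "U lam locally_integrable_on UNIV" by (rule U_loc[OF lam(1)])
    show "\<forall>\<^sub>F t in at_top. w' t locally_integrable_on UNIV"
      using w'_loc by (rule eventually_at_top_linorderI)
    fix S :: "(real^'n) set" assume S: "compact S"
    then obtain r where r: "0 < r" "S \<subseteq> cball 0 r"
      using bounded_subset_ballD[OF compact_imp_bounded[OF S], of 0] ball_subset_cball by blast
    define d where "d \<mu> = integral\<^sup>L lebesgue (\<lambda>x. indicat_real S x * \<bar>U \<mu> x - U lam x\<bar>)" for \<mu>
    have d_int: "integrable lebesgue (\<lambda>x. indicat_real S x * \<bar>U \<mu> x - U lam x\<bar>)" if "0 < \<mu>" for \<mu>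
      by (intro integrable_continuous_on_compact continuous_intros U_cont that lam S)
    show "((\<lambda>t. LINT x:S|lebesgue. \<bar>w' t x - U lam x\<bar>) \<longlongrightarrow> 0) at_top"
    proof (rule tendstoI)
      fix e :: real assume e: "0 < e"
      have "((\<lambda>s. LINT x:S|lebesgue. \<bar>U s x - U lam x\<bar>) \<longlongrightarrow> 0) (at lam within {0<..})"
        by (rule L1_continuous_on_compact[where f = "\<lambda>x s. U s x"])
          (use \<Phi>_jointly_continuous[OF \<beta>] lam S in \<open>simp_all add: U_def\<close>)
      then have "\<forall>\<^sub>F s in at lam within {0<..}. d s < e / 4"
        using e by (intro order_tendstoD(2)) (auto simp: d_def set_lebesgue_integral_def)
      then obtain \<delta> where \<delta>: "0 < \<delta>" "\<And>s. 0 < s \<Longrightarrow> s \<noteq> lam \<Longrightarrow> dist s lam < \<delta> \<Longrightarrow> d s < e / 4"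
        unfolding eventually_at by auto
      \<comment> \<open>The alternative \<open>lam / 2\<close> keeps the lower parameter positive
        when \<delta> is large.\<close>
      define \<mu>1 where "\<mu>1 = max (lam / 2) (lam - \<delta> / 2)"
      define \<mu>2 where "\<mu>2 = lam + \<delta> / 2"
      have \<mu>: "0 < \<mu>1" "\<mu>1 < lam" "lam < \<mu>2" "0 < \<mu>2" "d \<mu>1 < e / 4" "d \<mu>2 < e / 4"
        using lam(1) \<delta>(1) \<delta>(2)[of \<mu>1] \<delta>(2)[of \<mu>2] by (auto simp: \<mu>1_def \<mu>2_def dist_real_def max_def split: if_splits)
      define P where "P t = integral\<^sup>L lebesgue (\<lambda>x. max 0 (w' t x - U \<mu>2 x) * indicat_real (cball 0 r) x)" for t
      define Q where "Q t = integral\<^sup>L lebesgue (\<lambda>x. max 0 (U \<mu>1 x - w' t x) * indicat_real (cball 0 r) x)" for t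
      have P: "P t \<le> exp ((\<gamma> - real CARD('n) * \<beta>) * t) * C u (v \<mu>2)"
        "integrable lebesgue (\<lambda>x. max 0 (w' t x - U \<mu>2 x) * indicat_real (cball 0 r) x)" if "0 < t" for t
        using rescaled_positive_part_bound[OF sol v[OF \<mu>(4)] exponent(1,2) n3 that r(1) upper[OF \<mu>(3)], of \<gamma> \<beta>]
        unfolding v_scaled by (simp_all add: P_def C_def w'_def)
      have Q: "Q t \<le> exp ((\<gamma> - real CARD('n) * \<beta>) * t) * C (v \<mu>1) u"
        "integrable lebesgue (\<lambda>x. max 0 (U \<mu>1 x - w' t x) * indicat_real (cball 0 r) x)" if "0 < t" for t
        using rescaled_positive_part_bound[OF v[OF \<mu>(1)] sol exponent(1,2) n3 that r(1) lower[OF \<mu>(1,2)], of \<gamma> \<beta>]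
        unfolding v_scaled by (simp_all add: Q_def C_def w'_def)
      have "\<forall>\<^sub>F t in at_top. exp ((\<gamma> - real CARD('n) * \<beta>) * t) * C u (v \<mu>2) < e / 4"
        "\<forall>\<^sub>F t in at_top. exp ((\<gamma> - real CARD('n) * \<beta>) * t) * C (v \<mu>1) u < e / 4"
        by (rule order_tendstoD(2)[OF decay], use e in simp)+
      then show "\<forall>\<^sub>F t in at_top. dist (LINT x:S|lebesgue. \<bar>w' t x - U lam x\<bar>) 0 < e"
        using eventually_gt_at_top[of 0]
      proof eventually_elim
        case (elim t)
        have i0: "integrable lebesgue (\<lambda>x. indicat_real S x * \<bar>w' t x - U lam x\<bar>)"
        proof -
          have "integrable lebesgue (\<lambda>x. indicat_real S x * w' t x)" "integrable lebesgue (\<lambda>x. indicat_real S x * U lam x)"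
            using w'_loc[of t] U_loc[OF lam(1)] elim S by (simp_all add: locally_integrable_on_def set_integrable_def)
          then have "integrable lebesgue (\<lambda>x. \<bar>indicat_real S x * w' t x - indicat_real S x * U lam x\<bar>)"
            by (intro integrable_abs Bochner_Integration.integrable_diff)
          then show ?thesis by (simp add: abs_mult right_diff_distrib[symmetric])
        qed
        have "integral\<^sup>L lebesgue (\<lambda>x. indicat_real S x * \<bar>w' t x - U lam x\<bar>) \<le> integral\<^sup>L lebesgue (\<lambda>x.
            max 0 (w' t x - U \<mu>2 x) * indicat_real (cball 0 r) x + max 0 (U \<mu>1 x - w' t x) * indicat_real (cball 0 r) x
            + (indicat_real S x * \<bar>U \<mu>1 x - U lam x\<bar> + indicat_real S x * \<bar>U \<mu>2 x - U lam x\<bar>))"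
        proof (rule integral_mono[OF i0])
          show "indicat_real S x * \<bar>w' t x - U lam x\<bar> \<le>
            max 0 (w' t x - U \<mu>2 x) * indicat_real (cball 0 r) x + max 0 (U \<mu>1 x - w' t x) * indicat_real (cball 0 r) x
            + (indicat_real S x * \<bar>U \<mu>1 x - U lam x\<bar> + indicat_real S x * \<bar>U \<mu>2 x - U lam x\<bar>)" for x
          proof (cases "x \<in> S")
            case True
            then have "x \<in> cball 0 r" using r by blast
            with True have ind: "indicat_real S x = 1" "indicat_real (cball 0 r) x = 1" by simp_all
            \<comment> \<open>A is the rescaled solution, B the limit, D and E the upper and lower
              barriers: beyond a barrier the excess is counted, between them the distances of the
              barriers from B suffice.\<close>
            have "\<bar>A - B\<bar> \<le> max 0 (A - D) * 1 + max 0 (E - A) * 1 + (1 * \<bar>E - B\<bar> + 1 * \<bar>D - B\<bar>)" for A B D E :: real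
              using max.cobounded1[of 0 "A - D"] max.cobounded2[of "A - D" 0] max.cobounded1[of 0 "E - A"] max.cobounded2[of "E - A" 0]
              by (simp del: max.cobounded1 max.cobounded2)
            then show ?thesis unfolding ind by simp
          qed simp
        qed (intro Bochner_Integration.integrable_add P Q d_int \<mu> elim)
        also have "\<dots> = P t + Q t + (d \<mu>1 + d \<mu>2)"
          using P(2)[of t] Q(2)[of t] d_int[OF \<mu>(1)] d_int[OF \<mu>(4)] elim by (simp add: P_def Q_def d_def)
        also have "\<dots> < e" using P(1)[of t] Q(1)[of t] elim \<mu>(5,6) by simp
        finally have "integral\<^sup>L lebesgue (\<lambda>x. indicat_real S x * \<bar>w' t x - U lam x\<bar>) < e" .
        moreover have "0 \<le> integral\<^sup>L lebesgue (\<lambda>x. indicat_real S x * \<bar>w' t x - U lam x\<bar>)"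
          by (intro Bochner_Integration.integral_nonneg) auto
        ultimately show ?case by (simp add: set_lebesgue_integral_def)
      qed
    qed
  qed
  then show ?thesis by (simp add: w'_def[abs_def] U_def[abs_def] \<gamma>_def)
qed

lemma \<Phi>_0: "\<Phi> \<beta> lam 0 = lam"
  by (simp add: \<Phi>_def F_eq G_0)

end

theorem theorem3p1:
  fixes n :: nat and m :: real
  assumes n_def: "n = CARD('n::finite)" and n_ge: "n \<ge> 3"
    and m_def: "m = (real n - 2) / (real n + 2)"
  shows "\<exists>\<kappa>::real. \<forall>(\<beta>::real) (\<gamma>::real) (K::real)
      (u :: real^'n \<Rightarrow> real \<Rightarrow> real) (u\<^sub>0 :: real^'n \<Rightarrow> real)
      (\<phi> :: real^'n \<Rightarrow> real) (\<psi> :: real^'n \<Rightarrow> real).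
    \<beta> > 0 \<and> \<gamma> = 2 * \<beta> / (1 - m) \<and>
    (AE x in lebesgue. 0 \<le> u\<^sub>0 x) \<and> u\<^sub>0 locally_integrable_on UNIV \<and>
    yamabe_flow_solution u u\<^sub>0 \<and>
    (AE x in lebesgue. u\<^sub>0 x = \<phi> x + \<psi> x) \<and> integrable lebesgue \<psi> \<and>
    (\<forall>\<^sub>F x in at_infinity. 0 \<le> \<phi> x) \<and>
    (\<exists>\<epsilon> :: real^'n \<Rightarrow> real. (\<epsilon> \<longlongrightarrow> 0) at_infinity \<and>
      (\<forall>\<^sub>F x in at_infinity. \<phi> x powr (1 - m) =
         1 / (norm x)\<^sup>2 * ((real n - 2) * (real n - 1) / \<beta>) * (ln (norm x) + K + \<epsilon> x)))
    \<longrightarrow>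
    (\<exists>lam>0. L1loc_tendsto (\<lambda>t x. exp (\<gamma> * t) * u (exp (\<beta> * t) *\<^sub>R x) t)
                 (steady_soliton \<beta> lam) at_top) \<and>
    (\<forall>lam>0. L1loc_tendsto (\<lambda>t x. exp (\<gamma> * t) * u (exp (\<beta> * t) *\<^sub>R x) t)
                 (steady_soliton \<beta> lam) at_top
       \<longrightarrow> K = 2 * ln lam / (real n + 2) + ln \<beta> / 2 + \<kappa>)"
proof -
  define k where "k = (real n - 2) / 2"
  \<comment> \<open>This is m / (4 (n - 1)), so that 1/(4 c) is the coefficient (n - 1)/m of the
    equation.\<close>
  define c where "c = k / (k + 2) / (4 * (2 * k + 1))"
  have k: "0 < k" using n_ge by (simp add: k_def)
  then have kc: "0 < k" "0 < c" by (simp_all add: c_def)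
  interpret soliton_ode k c by unfold_locales (fact kc)+
  obtain G where G: "continuous_on {0..} G" "\<And>r. 0 \<le> r \<Longrightarrow> G r = 1 - c * integral {0..r} (N (\<lambda>s. trunc (G s)))"
    using integral_equation_exists by blast
  interpret yamabe_soliton k c G "TYPE('n)"
    by unfold_locales (rule G(1), erule G(2), simp add: k_def n_def[symmetric] field_simps, rule c_def)
  define a where "a = (real n - 2) * (real n - 1)"
  have a: "0 < a" using n_ge by (simp add: a_def)
  have "\<exists>l. ((\<lambda>s. w s - k / (2 * c * p) * s) \<longlongrightarrow> l) at_top" by (rule asymptotics) (rule exI)
  then obtain l where "((\<lambda>s. w s - k / (2 * c * p) * s) \<longlongrightarrow> l) at_top" by (rule exE)
  then have l: "((\<lambda>s. w s - a * s) \<longlongrightarrow> l) at_top" unfolding growth_eq unfolding a_def n_def .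
  have m_eq: "m = 1 / p" using exponent_eq by (simp add: m_def n_def)
  have rate: "2 * x / (real n + 2) = x / (k + 2)" for x by (simp add: k_def field_simps)
  show ?thesis
  \<comment> \<open>The profile G and the constant l of its expansion were fixed from k and c, hence
    from n, before \<beta>, K and the solution are introduced; therefore l / a is a legitimate
    \<kappa>.\<close>
  proof (intro exI[of _ "l / a"] allI impI, elim conjE exE)
    fix \<beta> \<gamma> K :: real and u :: "real^'n \<Rightarrow> real \<Rightarrow> real" and u\<^sub>0 \<phi> \<psi> \<epsilon> :: "real^'n \<Rightarrow> real"
    assume \<beta>: "\<beta> > 0" and \<gamma>: "\<gamma> = 2 * \<beta> / (1 - m)" and flow: "yamabe_flow_solution u u\<^sub>0"
      and u\<^sub>0: "AE x in lebesgue. u\<^sub>0 x = \<phi> x + \<psi> x" and \<psi>: "integrable lebesgue \<psi>"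
      and \<phi>: "\<forall>\<^sub>F x in at_infinity. 0 \<le> \<phi> x" and \<epsilon>: "(\<epsilon> \<longlongrightarrow> 0) at_infinity"
      and expansion: "\<forall>\<^sub>F x in at_infinity. \<phi> x powr (1 - m) =
         1 / (norm x)\<^sup>2 * ((real n - 2) * (real n - 1) / \<beta>) * (ln (norm x) + K + \<epsilon> x)"
    have \<gamma>_eq: "\<gamma> = \<beta> * (k + 2)" using rate_eq[of \<beta>] by (simp add: \<gamma> m_eq)
    have sol: "fast_diffusion_solution (1 / p) u u\<^sub>0" using flow exponent_eq by (simp add: yamabe_flow_solution_def)
    have "((\<lambda>x. (norm x)\<^sup>2 * (\<beta> / a) * \<phi> x powr (1 - 1 / p) - ln (norm x)) \<longlongrightarrow> K) at_infinity"
    proof (rule tendsto_cong[THEN iffD1])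
      show "((\<lambda>x. K + \<epsilon> x) \<longlongrightarrow> K) at_infinity" using tendsto_add[OF tendsto_const \<epsilon>, of K] by simp
      show "\<forall>\<^sub>F x in at_infinity. K + \<epsilon> x = (norm x)\<^sup>2 * (\<beta> / a) * \<phi> x powr (1 - 1 / p) - ln (norm x)"
        using expansion eventually_not_equal_at_infinity[of 0]
      proof eventually_elim
        case (elim x)
        have eq: "\<phi> x powr (1 - 1 / p) = 1 / (norm x)\<^sup>2 * (a / \<beta>) * (ln (norm x) + K + \<epsilon> x)"
          using elim(1) unfolding a_def m_eq .
        show ?case unfolding eq using elim(2) \<beta> a by simp
      qed
    qed
    note limit = convergence[OF \<beta> sol u\<^sub>0 \<psi> \<phi> a l this]
    \<comment> \<open>The relation between K and \<lambda> solved for \<lambda>; every real K is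
      attained because ln maps (0, \<infinity>) onto the reals.\<close>
    define lam where "lam = exp ((K - ln \<beta> / 2 - l / a) * (k + 2))"
    have lam: "0 < lam" "K = ln \<beta> / 2 + ln lam / (k + 2) + l / a" using kc by (simp_all add: lam_def)
    have conv: "L1loc_tendsto (\<lambda>t x. exp (\<gamma> * t) * u (exp (\<beta> * t) *\<^sub>R x) t) (steady_soliton \<beta> lam) at_top"
      unfolding steady_soliton_eq[OF \<beta> lam(1)] \<gamma>_eq by (rule limit[OF lam])
    show "(\<exists>lam>0. L1loc_tendsto (\<lambda>t x. exp (\<gamma> * t) * u (exp (\<beta> * t) *\<^sub>R x) t)
                 (steady_soliton \<beta> lam) at_top) \<and>
      (\<forall>lam>0. L1loc_tendsto (\<lambda>t x. exp (\<gamma> * t) * u (exp (\<beta> * t) *\<^sub>R x) t)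
                 (steady_soliton \<beta> lam) at_top
       \<longrightarrow> K = 2 * ln lam / (real n + 2) + ln \<beta> / 2 + l / a)"
    proof (intro conjI allI impI exI[of _ lam] lam conv)
      \<comment> \<open>Any other admissible parameter has the same limit function, and the value of
        a soliton at the origin is its parameter.\<close>
      fix lam' assume lam': "0 < lam'"
        and conv': "L1loc_tendsto (\<lambda>t x. exp (\<gamma> * t) * u (exp (\<beta> * t) *\<^sub>R x) t) (steady_soliton \<beta> lam') at_top"
      have "(\<lambda>x::real^'n. \<Phi> \<beta> lam (x \<bullet> x)) = (\<lambda>x. \<Phi> \<beta> lam' (x \<bullet> x))"
        by (rule L1loc_limit_unique[OF conv[unfolded steady_soliton_eq[OF \<beta> lam(1)]] conv'[unfolded steady_soliton_eq[OF \<beta> lam']] _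
          \<Phi>_sq_continuous[OF \<beta> lam(1)] \<Phi>_sq_continuous[OF \<beta> lam']]) simp
      from fun_cong[OF this, of 0] have "lam = lam'" by (simp add: \<Phi>_0)
      then show "K = 2 * ln lam' / (real n + 2) + ln \<beta> / 2 + l / a" unfolding rate using lam(2) by simp
    qed
  qed
qed

end
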